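(* Let $M$ be a compact smooth manifold and let $f:M\to M$ be a $C^2$ partially hyperbolic diffeomorphism with splitting $TM=E^u\oplus E^c\oplus E^s$. If the pointwise bunching condition $$\sup_{p\in M}\frac{\|T^c_pf\|}{\boldsymbol{m}(T^u_pf)\,\boldsymbol{m}(T^c_pf)}<1$$ holds, then $E^u$ is continuously differentiable with respect to $E^c$.
   Context: $M$ carries a fixed Riemannian (or Finsler) metric. For a linear map $T:X\to Y$, $\|T\|$ is the operator norm and $\boldsymbol{m}(T)=\inf_{x\neq 0}|Tx|/|x|$ is the conorm. For a $Tf$-invariant subbundle $X\subset TM$, $T^Xf$ is the restriction of $Tf$ to $X$, and $T^X_pf:X_p\to X_{f(p)}$; $T^uf,T^cf,T^sf$ stand for $T^{E^u}f,T^{E^c}f,T^{E^s}f$. A $Tf$-invariant splitting $TM=R\oplus S$ is dominated if $\inf_p \boldsymbol{m}(T^R_pf)/\|T^S_pf\|>1$. The diffeomorphism $f$ is partially hyperbolic with splitting $TM=E^u\oplus E^c\oplus E^s$ if the splitting is $Tf$-invariant, both $E^u\oplus(E^c\oplus E^s)$ and $(E^u\oplus E^c)\oplus E^s$ are dominated splittings, $\inf_p\boldsymbol{m}(T^u_pf)>1$, and $\sup_p\|T^s_pf\|<1$. Differentiability of a bundle along a bundle: let $R\subset TM$ be a continuous subbundle of fiber dimension $d$, regarded as a section $\sigma:p\mapsto R_p$ of the Grassmann bundle $\pi:G=G(d,TM)\to M$ of $d$-planes in $TM$, and let $E\subset TM$ be a continuous subbundle. Then $R$ is continuously differentiable with respect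 to $E$ if there is a continuous map $H:E\to TG$ such that (a) for each $p\in M$, $H$ maps $E_p$ linearly into $T_{\sigma(p)}G$; (b) $T\pi\circ H=\mathrm{Id}_E$; (c) for every $C^1$ arc $\gamma$ in $M$ that is everywhere tangent to $E$, $\sigma\circ\gamma$ is differentiable and $(\sigma\circ\gamma)'(t)=H(\gamma'(t))$. *)

theory Defs
  imports "HOL-Analysis.Analysis"
begin

section \<open>Calculus on relatively open subsets of a linear subspace\<close>

text \<open>
  Manifolds are modelled on a linear subspace \<open>S\<close> of a normed space, because the Grassmann bundle
  has a dimension that is not the dimension of any type at hand. For \<open>X\<close> relatively open in \<open>S\<close>,
  a derivative at \<open>x\<close> within \<open>X\<close> is determined only on \<open>S\<close>, and it is only ever applied to
  vectors of \<open>S\<close>.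
\<close>

lemma frechet_derivative_relatively_open:
  fixes f :: "'a::real_normed_vector \<Rightarrow> 'b::real_normed_vector"
  assumes S: "subspace S" and X: "openin (top_of_set S) X" "x \<in> X" and v: "v \<in> S"
    and D: "(f has_derivative D) (at x within X)"
  shows "frechet_derivative f (at x within X) v = D v"
proof -
  let ?F = "frechet_derivative f (at x within X)"
  let ?l = "\<lambda>t::real. x + t *\<^sub>R v"
  have F: "(f has_derivative ?F) (at x within X)"
    using D frechet_derivative_works[of f "at x within X"] unfolding differentiable_def by blast
  obtain T where T: "open T" "X = S \<inter> T"
    using X(1) unfolding openin_open by blast
  define I where "I = ?l -` T"
  have "continuous_on UNIV ?l"
    by (intro continuous_intros)
  then have I: "open I" "0 \<in> I"
    using open_vimage[OF T(1), of ?l] T(2) X(2) unfolding I_def by auto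
  have "x \<in> S"
    using X(2) T(2) by blast
  then have "?l t \<in> S" for t
    using S v by (simp add: subspace_add subspace_scale)
  then have img: "?l ` I \<subseteq> X"
    using T(2) unfolding I_def by blast
  have l: "(?l has_derivative (\<lambda>t. t *\<^sub>R v)) (at 0 within I)"
    by (auto intro!: derivative_eq_intros)
  have chain: "((f \<circ> ?l) has_derivative (E \<circ> (\<lambda>t. t *\<^sub>R v))) (at 0)"
    if E: "(f has_derivative E) (at x within X)" for E
  proof -
    have "(f has_derivative E) (at (?l 0) within ?l ` I)"
      using has_derivative_subset[OF E img] by simp
    from diff_chain_within[OF l this] show ?thesis
      unfolding at_within_open[OF I(2,1)] .
  qed
  have "?F \<circ> (\<lambda>t. t *\<^sub>R v) = D \<circ> (\<lambda>t. t *\<^sub>R v)"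
    using has_derivative_unique[OF chain[OF F] chain[OF D]] .
  from fun_cong[OF this, of 1] show ?thesis
    by simp
qed

primrec Ck_on ::
  "nat \<Rightarrow> 'a set \<Rightarrow> 'a set \<Rightarrow> ('a::real_normed_vector \<Rightarrow> 'b::real_normed_vector) \<Rightarrow> bool"
  where
    "Ck_on 0 S X f \<longleftrightarrow> continuous_on X f"
  | "Ck_on (Suc k) S X f \<longleftrightarrow>
       (\<forall>x\<in>X. f differentiable (at x within X)) \<and>
       (\<forall>v\<in>S. Ck_on k S X (\<lambda>x. frechet_derivative f (at x within X) v))"


section \<open>Smooth manifolds\<close>

text \<open>
  A chart is a pair of its domain and its coordinate map. A manifold is given by its model space
  (a linear subspace) and a smooth atlas; its underlying set is the union of the chart domains.
\<close>

type_synonym ('m, 'b) chart = "'m set \<times> ('m \<Rightarrow> 'b)"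

record ('m, 'b) manifold =
  model :: "'b set"
  atlas :: "('m, 'b) chart set"

definition points :: "('m, 'b) manifold \<Rightarrow> 'm set" where
  "points M = (\<Union>c\<in>atlas M. fst c)"

definition mtopology :: "('m, 'b::real_normed_vector) manifold \<Rightarrow> 'm topology" where
  "mtopology M = topology_generated_by
     {{p \<in> fst c. snd c p \<in> W} | c W. c \<in> atlas M \<and> openin (top_of_set (model M)) W}"

definition chart_inv :: "('m, 'b) chart \<Rightarrow> 'b \<Rightarrow> 'm" where
  "chart_inv c = inv_into (fst c) (snd c)"

definition local_dom ::
  "('m, 'b) chart \<Rightarrow> ('n, 'c) chart \<Rightarrow> ('m \<Rightarrow> 'n) \<Rightarrow> 'b set" where
  "local_dom c c' f = snd c ` {p \<in> fst c. f p \<in> fst c'}"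

definition local_rep ::
  "('m, 'b) chart \<Rightarrow> ('n, 'c) chart \<Rightarrow> ('m \<Rightarrow> 'n) \<Rightarrow> 'b \<Rightarrow> 'c" where
  "local_rep c c' f = snd c' \<circ> f \<circ> chart_inv c"

definition smooth_manifold :: "('m, 'b::real_normed_vector) manifold \<Rightarrow> bool" where
  "smooth_manifold M \<longleftrightarrow>
     subspace (model M) \<and>
     (\<forall>c\<in>atlas M. inj_on (snd c) (fst c) \<and> snd c ` fst c \<subseteq> model M) \<and>
     (\<forall>c\<in>atlas M. \<forall>c'\<in>atlas M.
        openin (top_of_set (model M)) (local_dom c c' id) \<and>
        (\<forall>k. Ck_on k (model M) (local_dom c c' id) (local_rep c c' id))) \<and>
     Hausdorff_space (mtopology M) \<and> second_countable (mtopology M)"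

definition Ck_map ::
  "nat \<Rightarrow> ('m, 'b::real_normed_vector) manifold \<Rightarrow> ('n, 'c::real_normed_vector) manifold \<Rightarrow>
    ('m \<Rightarrow> 'n) \<Rightarrow> bool" where
  "Ck_map k M N f \<longleftrightarrow>
     f ` points M \<subseteq> points N \<and>
     (\<forall>c\<in>atlas M. \<forall>c'\<in>atlas N.
        openin (top_of_set (model M)) (local_dom c c' f) \<and>
        Ck_on k (model M) (local_dom c c' f) (local_rep c c' f))"

definition Ck_diffeo :: "nat \<Rightarrow> ('m, 'b::real_normed_vector) manifold \<Rightarrow> ('m \<Rightarrow> 'm) \<Rightarrow> bool" where
  "Ck_diffeo k M f \<longleftrightarrow>
     bij_betw f (points M) (points M) \<and> Ck_map k M M f \<and> Ck_map k M M (inv_into (points M) f)"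


section \<open>Tangent bundle and tangent maps\<close>

text \<open>
  A preferred chart is selected around every point \<open>p\<close>, and a tangent vector at \<open>p\<close> is given by
  its coordinates in that chart. Thus every tangent space is, as a vector space, the model space,
  and the tangent bundle consists of pairs \<open>(p, v)\<close>. Nothing identifies tangent spaces at
  different points canonically: the topology of the tangent bundle comes from its bundle charts.
\<close>

definition chart_at :: "('m, 'b) manifold \<Rightarrow> 'm \<Rightarrow> ('m, 'b) chart" where
  "chart_at M p = (SOME c. c \<in> atlas M \<and> p \<in> fst c)"

definition chart_diff ::
  "('m, 'b::real_normed_vector) manifold \<Rightarrow> ('m, 'b) chart \<Rightarrow> 'm \<Rightarrow> 'b \<Rightarrow> 'b" where
  "chart_diff M c p =
     frechet_derivative (local_rep (chart_at M p) c id)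
       (at (snd (chart_at M p) p) within local_dom (chart_at M p) c id)"

definition tangent_bundle ::
  "('m, 'b::real_normed_vector) manifold \<Rightarrow> ('m \<times> 'b, 'b \<times> 'b) manifold" where
  "tangent_bundle M =
     \<lparr>model = model M \<times> model M,
      atlas = (\<lambda>c. (fst c \<times> model M, \<lambda>(p, v). (snd c p, chart_diff M c p v))) ` atlas M\<rparr>"

definition tangent_map ::
  "('m, 'b::real_normed_vector) manifold \<Rightarrow> ('n, 'c::real_normed_vector) manifold \<Rightarrow>
    ('m \<Rightarrow> 'n) \<Rightarrow> 'm \<Rightarrow> 'b \<Rightarrow> 'c" where
  "tangent_map M N f p =
     frechet_derivative (local_rep (chart_at M p) (chart_at N (f p)) f)
       (at (snd (chart_at M p) p) within local_dom (chart_at M p) (chart_at N (f p)) f)"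

text \<open>\<open>\<gamma>\<close>, defined on the interval \<open>I\<close>, is differentiable at \<open>t\<close> with \<open>\<gamma>'(t) = v\<close> in the tangent
  space at \<open>\<gamma> t\<close>.\<close>

definition has_velocity ::
  "('m, 'b::real_normed_vector) manifold \<Rightarrow> (real \<Rightarrow> 'm) \<Rightarrow> 'b \<Rightarrow> real \<Rightarrow> real set \<Rightarrow> bool" where
  "has_velocity M \<gamma> v t I \<longleftrightarrow>
     \<gamma> t \<in> points M \<and>
     (\<forall>\<^sub>F s in at t within I. \<gamma> s \<in> fst (chart_at M (\<gamma> t))) \<and>
     ((snd (chart_at M (\<gamma> t)) \<circ> \<gamma>) has_vector_derivative v) (at t within I)"

definition C1_arc ::
  "('m, 'b::real_normed_vector) manifold \<Rightarrow> (real \<Rightarrow> 'm) \<Rightarrow> (real \<Rightarrow> 'b) \<Rightarrow> real \<Rightarrow> real \<Rightarrow> bool" where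
  "C1_arc M \<gamma> \<gamma>' a b \<longleftrightarrow>
     a < b \<and>
     (\<forall>t\<in>{a..b}. has_velocity M \<gamma> (\<gamma>' t) t {a..b}) \<and>
     continuous_map (top_of_set {a..b}) (mtopology (tangent_bundle M)) (\<lambda>t. (\<gamma> t, \<gamma>' t))"


section \<open>The Grassmann bundle\<close>

definition planes :: "nat \<Rightarrow> 'b::euclidean_space set \<Rightarrow> 'b set set" where
  "planes d S = {V. subspace V \<and> V \<subseteq> S \<and> dim V = d}"

definition ref_plane :: "nat \<Rightarrow> 'b::euclidean_space set \<Rightarrow> 'b set" where
  "ref_plane d S = (SOME V. V \<in> planes d S)"

text \<open>
  The linear maps from the reference plane \<open>V\<close> to its orthogonal complement in \<open>S\<close>, extended by
  \<open>0\<close> on the orthogonal complement of \<open>V\<close>. They form the model space of the Grassmannian of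
  \<open>d\<close>-planes in \<open>S\<close>.
\<close>

definition slopes :: "nat \<Rightarrow> 'b::euclidean_space set \<Rightarrow> ('b \<Rightarrow>\<^sub>L 'b) set" where
  "slopes d S =
     {A. (\<forall>x\<in>ref_plane d S. blinfun_apply A x \<in> S \<and>
            (\<forall>y\<in>ref_plane d S. blinfun_apply A x \<bullet> y = 0)) \<and>
         (\<forall>z. (\<forall>y\<in>ref_plane d S. z \<bullet> y = 0) \<longrightarrow> blinfun_apply A z = 0)}"

definition slope_graph :: "nat \<Rightarrow> 'b::euclidean_space set \<Rightarrow> ('b \<Rightarrow>\<^sub>L 'b) \<Rightarrow> 'b set" where
  "slope_graph d S A = (\<lambda>x. x + blinfun_apply A x) ` ref_plane d S"

text \<open>
  Each chart \<open>c\<close> of \<open>M\<close> and each linear automorphism \<open>B\<close> of the model space give a chart of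
  \<open>G(d, TM)\<close>: over the domain of \<open>c\<close>, a plane whose coordinate expression is the \<open>B\<close>-image of the
  graph of a slope \<open>A\<close> receives the coordinate \<open>A\<close>. These are the usual affine charts; every
  \<open>d\<close>-plane is \<open>B\<close> applied to the reference plane for some \<open>B\<close>.
\<close>

definition grassmann_chart ::
  "('m, 'b::euclidean_space) manifold \<Rightarrow> nat \<Rightarrow> ('m, 'b) chart \<Rightarrow> ('b \<Rightarrow> 'b) \<Rightarrow>
    ('m \<times> 'b set, 'b \<times> ('b \<Rightarrow>\<^sub>L 'b)) chart" where
  "grassmann_chart M d c B =
     ({(p, V). p \<in> fst c \<and> V \<in> planes d (model M) \<and>
         (\<exists>A\<in>slopes d (model M). chart_diff M c p ` V = B ` slope_graph d (model M) A)},
      \<lambda>(p, V). (snd c p,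
         THE A. A \<in> slopes d (model M) \<and> chart_diff M c p ` V = B ` slope_graph d (model M) A))"

definition grassmann_bundle ::
  "nat \<Rightarrow> ('m, 'b::euclidean_space) manifold \<Rightarrow> ('m \<times> 'b set, 'b \<times> ('b \<Rightarrow>\<^sub>L 'b)) manifold" where
  "grassmann_bundle d M =
     \<lparr>model = model M \<times> slopes d (model M),
      atlas = {grassmann_chart M d c B | c B.
                 c \<in> atlas M \<and> linear B \<and> bij_betw B (model M) (model M)}\<rparr>"


section \<open>Subbundles and differentiability along a subbundle\<close>

type_synonym ('m, 'b) subbundle = "'m \<Rightarrow> 'b set"

definition total_space :: "('m, 'b) manifold \<Rightarrow> ('m, 'b) subbundle \<Rightarrow> ('m \<times> 'b) set" where
  "total_space M E = {(p, v). p \<in> points M \<and> v \<in> E p}"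

definition plane_section :: "('m, 'b) subbundle \<Rightarrow> 'm \<Rightarrow> 'm \<times> 'b set" where
  "plane_section R p = (p, R p)"

definition continuous_subbundle ::
  "('m, 'b::euclidean_space) manifold \<Rightarrow> nat \<Rightarrow> ('m, 'b) subbundle \<Rightarrow> bool" where
  "continuous_subbundle M d R \<longleftrightarrow>
     continuous_map (mtopology M) (mtopology (grassmann_bundle d M)) (plane_section R)"

definition continuously_differentiable_wrt ::
  "('m, 'b::euclidean_space) manifold \<Rightarrow> ('m, 'b) subbundle \<Rightarrow> ('m, 'b) subbundle \<Rightarrow> bool" where
  "continuously_differentiable_wrt M R E \<longleftrightarrow>
     (\<exists>e. continuous_subbundle M e E) \<and>
     (\<exists>d. continuous_subbundle M d R \<and>
        (\<exists>H :: 'm \<times> 'b \<Rightarrow> ('m \<times> 'b set) \<times> ('b \<times> ('b \<Rightarrow>\<^sub>L 'b)).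
           continuous_map
             (subtopology (mtopology (tangent_bundle M)) (total_space M E))
             (mtopology (tangent_bundle (grassmann_bundle d M))) H \<and>
           (\<forall>p\<in>points M.
              (\<forall>v\<in>E p. fst (H (p, v)) = plane_section R p) \<and>
              (\<forall>v\<in>E p. \<forall>w\<in>E p. \<forall>a b :: real.
                 snd (H (p, a *\<^sub>R v + b *\<^sub>R w)) =
                 a *\<^sub>R snd (H (p, v)) + b *\<^sub>R snd (H (p, w)))) \<and>
           (\<forall>p\<in>points M. \<forall>v\<in>E p.
              tangent_map (grassmann_bundle d M) M fst (fst (H (p, v))) (snd (H (p, v))) = v) \<and>
           (\<forall>\<gamma> \<gamma>' a b.
              C1_arc M \<gamma> \<gamma>' a b \<and> (\<forall>t\<in>{a..b}. \<gamma>' t \<in> E (\<gamma> t)) \<longrightarrow>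
              (\<forall>t\<in>{a..b}.
                 has_velocity (grassmann_bundle d M) (plane_section R \<circ> \<gamma>)
                   (snd (H (\<gamma> t, \<gamma>' t))) t {a..b}))))"


section \<open>Finsler metrics, norms and conorms\<close>

text \<open>A Finsler metric is a continuous family of norms on the tangent spaces; this includes the
  norms of Riemannian metrics.\<close>

definition finsler_metric ::
  "('m, 'b::real_normed_vector) manifold \<Rightarrow> ('m \<Rightarrow> 'b \<Rightarrow> real) \<Rightarrow> bool" where
  "finsler_metric M N \<longleftrightarrow>
     (\<forall>p\<in>points M.
        (\<forall>v\<in>model M. 0 \<le> N p v \<and> (N p v = 0 \<longleftrightarrow> v = 0)) \<and>
        (\<forall>v\<in>model M. \<forall>a. N p (a *\<^sub>R v) = \<bar>a\<bar> * N p v) \<and>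
        (\<forall>v\<in>model M. \<forall>w\<in>model M. N p (v + w) \<le> N p v + N p w)) \<and>
     continuous_map (mtopology (tangent_bundle M)) euclideanreal (\<lambda>(p, v). N p v)"

text \<open>Norm and conorm of the restriction of \<open>T\<^sub>p f\<close> to the fibre \<open>X p\<close>. On a zero fibre they are
  \<open>0\<close> and \<open>\<infinity>\<close>, which is what the supremum and infimum over the empty set are in \<open>[0, \<infinity>]\<close>.\<close>

definition norm_on ::
  "('m, 'b::real_normed_vector) manifold \<Rightarrow> ('m \<Rightarrow> 'b \<Rightarrow> real) \<Rightarrow> ('m \<Rightarrow> 'm) \<Rightarrow>
    ('m, 'b) subbundle \<Rightarrow> 'm \<Rightarrow> ennreal" where
  "norm_on M N f X p = (SUP v\<in>X p - {0}. ennreal (N (f p) (tangent_map M M f p v) / N p v))"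

definition conorm_on ::
  "('m, 'b::real_normed_vector) manifold \<Rightarrow> ('m \<Rightarrow> 'b \<Rightarrow> real) \<Rightarrow> ('m \<Rightarrow> 'm) \<Rightarrow>
    ('m, 'b) subbundle \<Rightarrow> 'm \<Rightarrow> ennreal" where
  "conorm_on M N f X p = (INF v\<in>X p - {0}. ennreal (N (f p) (tangent_map M M f p v) / N p v))"


section \<open>Partial hyperbolicity\<close>

definition bundle_sum ::
  "('m, 'b::real_vector) subbundle \<Rightarrow> ('m, 'b) subbundle \<Rightarrow> ('m, 'b) subbundle" where
  "bundle_sum R S p = {v + w | v w. v \<in> R p \<and> w \<in> S p}"

definition splitting ::
  "('m, 'b::euclidean_space) manifold \<Rightarrow> ('m, 'b) subbundle \<Rightarrow> ('m, 'b) subbundle \<Rightarrow> bool" where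
  "splitting M R S \<longleftrightarrow>
     (\<exists>d. continuous_subbundle M d R) \<and> (\<exists>d. continuous_subbundle M d S) \<and>
     (\<forall>p\<in>points M. bundle_sum R S p = model M \<and> R p \<inter> S p = {0})"

definition invariant_bundle ::
  "('m, 'b::real_normed_vector) manifold \<Rightarrow> ('m \<Rightarrow> 'm) \<Rightarrow> ('m, 'b) subbundle \<Rightarrow> bool" where
  "invariant_bundle M f X \<longleftrightarrow> (\<forall>p\<in>points M. tangent_map M M f p ` X p = X (f p))"

definition dominated_splitting ::
  "('m, 'b::euclidean_space) manifold \<Rightarrow> ('m \<Rightarrow> 'b \<Rightarrow> real) \<Rightarrow> ('m \<Rightarrow> 'm) \<Rightarrow>
    ('m, 'b) subbundle \<Rightarrow> ('m, 'b) subbundle \<Rightarrow> bool" where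
  "dominated_splitting M N f R S \<longleftrightarrow>
     splitting M R S \<and> invariant_bundle M f R \<and> invariant_bundle M f S \<and>
     (INF p\<in>points M. conorm_on M N f R p / norm_on M N f S p) > 1"

text \<open>The two dominated splittings together force the sum of the three bundles to be direct.\<close>

definition partially_hyperbolic ::
  "('m, 'b::euclidean_space) manifold \<Rightarrow> ('m \<Rightarrow> 'b \<Rightarrow> real) \<Rightarrow> ('m \<Rightarrow> 'm) \<Rightarrow>
    ('m, 'b) subbundle \<Rightarrow> ('m, 'b) subbundle \<Rightarrow> ('m, 'b) subbundle \<Rightarrow> bool" where
  "partially_hyperbolic M N f Eu Ec Es \<longleftrightarrow>
     (\<forall>E\<in>{Eu, Ec, Es}. (\<exists>d. continuous_subbundle M d E) \<and> invariant_bundle M f E) \<and>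
     dominated_splitting M N f Eu (bundle_sum Ec Es) \<and>
     dominated_splitting M N f (bundle_sum Eu Ec) Es \<and>
     (INF p\<in>points M. conorm_on M N f Eu p) > 1 \<and>
     (SUP p\<in>points M. norm_on M N f Es p) < 1"

end

theory Submission
  imports Defs
begin

text \<open>
  Why the theorem holds. In a chart, a derivative of \<open>E\<^sup>u\<close> along \<open>E\<^sup>c\<close> at \<open>p\<close> is a bilinear map
  \<open>E\<^sup>c \<times> E\<^sup>u \<rightarrow> E\<^sup>c \<oplus> E\<^sup>s\<close>: it says how the plane \<open>E\<^sup>u\<close>, seen as a graph over \<open>E\<^sup>u p\<close>, tilts as the base
  point moves in a center direction. Differentiating the invariance of \<open>E\<^sup>u\<close> under \<open>f\<close> gives an affine
  equation for this bilinear map, whose inhomogeneous term is the second derivative of \<open>f\<close>. Its linear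
  part multiplies a bilinear map at \<open>p\<close> by at most \<open>\<parallel>T\<^sup>c\<^sup>sf\<parallel> / (m(T\<^sup>uf) m(T\<^sup>cf))\<close>, where \<open>T\<^sup>c\<^sup>sf\<close> is the
  restriction to \<open>E\<^sup>c \<oplus> E\<^sup>s\<close>: the value is mapped forward, both arguments are pulled back. In a norm
  adapted to the splitting \<open>\<parallel>T\<^sup>c\<^sup>sf\<parallel>\<close> is \<open>\<parallel>T\<^sup>cf\<parallel>\<close>, by the domination of \<open>E\<^sup>s\<close> (if \<open>E\<^sup>c \<noteq> 0\<close>), so bunching
  makes the linear part a contraction. The equation has one bounded solution; it is the limit of the iterates
  of zero, and it is continuous (\<open>K_facts\<close>, \<open>KK_continuous\<close>).

  That this solution really is the derivative is shown by the same contraction, applied to errors.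
  Let \<open>q\<close> be joined to \<open>p\<close> by a path of length \<open>w\<close> tangent to \<open>E\<^sup>c\<close>. One iterate of \<open>f\<close> multiplies the
  deviation of \<open>E\<^sup>u q\<close> from \<open>E\<^sup>u p\<close> by at most \<open>\<parallel>T\<^sup>c\<^sup>sf\<parallel> / m(T\<^sup>uf)\<close> and adds an error of order \<open>w\<close>, while \<open>w\<close>
  itself shrinks at most by the factor \<open>m(T\<^sup>cf)\<close>. Thus a bound for the deviation relative to \<open>w\<close>
  improves, and \<open>E\<^sup>u\<close> is Lipschitz along center paths (\<open>Eu_lipschitz_along_center\<close>). With the bilinear
  prediction subtracted, the added error is of smaller order than \<open>w\<close>, because the second derivative
  cancels. Hence the relative error at \<open>p\<close> is, in the limit \<open>w \<rightarrow> 0\<close>, at most \<open>\<theta> < 1\<close> times the one at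
  the preimage of \<open>p\<close>; being bounded, it vanishes (\<open>Eu_differentiable_along_center\<close>).

  Planes are compared through the inequality \<open>\<bar>P\<^sup>c\<^sup>s \<omega>\<bar> \<le> \<sigma> \<bar>P\<^sup>u \<omega>\<bar>\<close> for all vectors \<open>\<omega>\<close> of \<open>E\<^sup>u q\<close>, with the
  projections taken at \<open>p\<close>; no graph has to be parametrised, and invariance is applied to vectors.
  Only the last part needs coordinates of planes. There the derivative of the slope of \<open>E\<^sup>u\<close> in an
  affine chart of the Grassmann bundle is the bilinear map between two fixed projections
  (\<open>slope_velocity\<close>), and its compatibility with the transition maps (\<open>dslope_transition\<close>) makes it a
  continuous map into the tangent bundle of the Grassmann bundle (\<open>H_continuous\<close>).
\<close>

section \<open>Derivatives on relatively open subsets of a subspace\<close>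

definition oproj :: "'a::euclidean_space set => 'a \<Rightarrow>\<^sub>L 'a" where
  "oproj S = (SOME P. (\<forall>v. blinfun_apply P v \<in> S) \<and> (\<forall>v. \<forall>y\<in>S. (v - blinfun_apply P v) \<bullet> y = 0))"

lemma oproj_exists:
  assumes "subspace (S::'a::euclidean_space set)"
  shows "\<exists>P::'a \<Rightarrow>\<^sub>L 'a. (\<forall>v. blinfun_apply P v \<in> S) \<and> (\<forall>v. \<forall>y\<in>S. (v - blinfun_apply P v) \<bullet> y = 0)"
proof -
  obtain B where B: "B \<subseteq> S" "pairwise orthogonal B" "\<And>x. x \<in> B ==> norm x = 1"
    "independent B" "card B = dim S" "span B = S"
    using orthonormal_basis_subspace[OF assms] by metis
  have fin: "finite B" using B(4) independent_imp_finite by blast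
  define P where "P = (\<lambda>v. \<Sum>b\<in>B. (v \<bullet> b) *\<^sub>R b)"
  have bl: "bounded_linear P"
    unfolding P_def by (intro bounded_linear_intros)
  have PS: "P v \<in> S" for v
    unfolding P_def using B(1) assms by (auto intro!: subspace_sum subspace_scale)
  have ob: "(v - P v) \<bullet> b = 0" if "b \<in> B" for v b
  proof -
    have "P v \<bullet> b = (\<Sum>b'\<in>B. (v \<bullet> b') * (b' \<bullet> b))"
      unfolding P_def by (simp add: inner_sum_left)
    also have "\<dots> = (\<Sum>b'\<in>B. if b' = b then v \<bullet> b else 0)"
      using B(2) B(3) that
      by (intro sum.cong) (auto simp: pairwise_def orthogonal_def dot_square_norm)
    also have "\<dots> = v \<bullet> b" using that fin by simp
    finally show ?thesis by (simp add: inner_diff_left)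
  qed
  have "(v - P v) \<bullet> y = 0" if "y \<in> S" for v y
  proof -
    have "y \<in> span B" using that B(6) by simp
    then show ?thesis
    proof (induction rule: span_induct_alt)
      case (step c x y)
      then show ?case by (simp add: inner_add_right ob)
    qed simp
  qed
  then show ?thesis
    using PS bounded_linear_Blinfun_apply[OF bl] by (intro exI[of _ "Blinfun P"]) auto
qed

lemma
  assumes "subspace (S::'a::euclidean_space set)"
  shows oproj_mem [simp]: "blinfun_apply (oproj S) v \<in> S"
    and oproj_orth: "y \<in> S ==> (v - blinfun_apply (oproj S) v) \<bullet> y = 0"
  using someI_ex[OF oproj_exists[OF assms]] unfolding oproj_def by blast+

lemma oproj_id:
  assumes "subspace (S::'a::euclidean_space set)" "v \<in> S"
  shows "blinfun_apply (oproj S) v = v"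
proof -
  have "v - blinfun_apply (oproj S) v \<in> S"
    using assms by (simp add: subspace_diff)
  then have "(v - blinfun_apply (oproj S) v) \<bullet> (v - blinfun_apply (oproj S) v) = 0"
    using oproj_orth[OF assms(1)] by blast
  then show ?thesis by simp
qed

lemma oproj_zero:
  assumes "subspace (S::'a::euclidean_space set)" "\<forall>y\<in>S. v \<bullet> y = 0"
  shows "blinfun_apply (oproj S) v = 0"
proof -
  let ?w = "blinfun_apply (oproj S) v"
  have "(v - ?w) \<bullet> ?w = 0" "v \<bullet> ?w = 0"
    using oproj_orth[OF assms(1), of ?w v] assms by auto
  then show ?thesis by (simp add: inner_diff_left)
qed

text \<open>A derivative within \<open>S\<close> is determined on \<open>S\<close> only. Composed with the orthogonal projection onto
  \<open>S\<close> it is an operator on the whole space, so that \<open>der S F\<close> can be differentiated again.\<close>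

definition der ::
  "'a::euclidean_space set => ('a => 'c::real_normed_vector) => 'a => 'a \<Rightarrow>\<^sub>L 'c" where
  "der S F x = Blinfun (\<lambda>v. frechet_derivative F (at x within S) (blinfun_apply (oproj S) v))"

lemma at_within_openin:
  assumes "openin (top_of_set S) X" "x \<in> X"
  shows "at x within X = at x within S"
proof -
  obtain T where "open T" "X = S \<inter> T" using assms(1) unfolding openin_open by blast
  then show ?thesis using assms(2) by (intro at_within_nhd[of x T]) auto
qed

lemma at_within_eventually:
  assumes "\<forall>\<^sub>F s in at t within I. P s"
  shows "at t within {s \<in> I. P s} = at t within I"
proof -
  have "\<forall>\<^sub>F s in nhds t. s \<noteq> t --> s \<in> I --> P s"
    using assms unfolding eventually_at_filter .
  then have "eventually Q (at t within {s \<in> I. P s}) \<longleftrightarrow> eventually Q (at t within I)" for Q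
    unfolding eventually_at_filter by (intro eventually_subst) (auto elim: eventually_mono)
  then show ?thesis by (simp add: filter_eq_iff)
qed

lemma has_derivative_eq_on_subspace:
  assumes "(F has_derivative D) (at x within S)" "x \<in> S" "subspace S"
    and "\<And>v. v \<in> S ==> D' v = D v" and "bounded_linear D'"
  shows "(F has_derivative D') (at x within S)"
proof -
  have "((\<lambda>y. (F y - F x - D (y - x)) /\<^sub>R norm (y - x)) \<longlongrightarrow> 0) (at x within S)"
    using assms(1) unfolding has_derivative_at_within by auto
  moreover have "\<forall>\<^sub>F y in at x within S. (F y - F x - D (y - x)) /\<^sub>R norm (y - x)
      = (F y - F x - D' (y - x)) /\<^sub>R norm (y - x)"
    unfolding eventually_at_filter
    using assms by (auto intro!: always_eventually simp: subspace_diff subset_iff)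
  ultimately have "((\<lambda>y. (F y - F x - D' (y - x)) /\<^sub>R norm (y - x)) \<longlongrightarrow> 0) (at x within S)"
    using tendsto_cong by fast
  then show ?thesis using assms(5) unfolding has_derivative_at_within by auto
qed

lemma der_apply:
  assumes "F differentiable (at x within S)"
  shows "blinfun_apply (der S F x) v
    = frechet_derivative F (at x within S) (blinfun_apply (oproj S) v)"
proof -
  have "bounded_linear (frechet_derivative F (at x within S))"
    using assms frechet_derivative_works has_derivative_bounded_linear by blast
  from bounded_linear_compose[OF this blinfun.bounded_linear_right[of "oproj S"]]
  show ?thesis unfolding der_def by (simp add: bounded_linear_Blinfun_apply)
qed

lemma has_derivative_der:
  fixes F :: "'a::euclidean_space => 'c::real_normed_vector"
  assumes "F differentiable (at x within S)" "x \<in> S" "subspace S"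
  shows "(F has_derivative blinfun_apply (der S F x)) (at x within S)"
  by (rule has_derivative_eq_on_subspace[of F "frechet_derivative F (at x within S)" x S])
    (use assms in \<open>auto simp: der_apply oproj_id blinfun.bounded_linear_right
      intro: frechet_derivative_works[THEN iffD1]\<close>)

lemma der_eqI:
  fixes F :: "'a::euclidean_space => 'c::real_normed_vector"
  assumes "subspace S" "x \<in> S" "(F has_derivative D) (at x within S)"
  shows "blinfun_apply (der S F x) v = D (blinfun_apply (oproj S) v)"
proof -
  have "F differentiable (at x within S)" using assms(3) differentiableI by blast
  then show ?thesis
    using frechet_derivative_relatively_open[of S S x "blinfun_apply (oproj S) v" F D] assms
    by (simp add: der_apply)
qed

lemma der_oproj:
  fixes F :: "'a::euclidean_space => 'c::real_normed_vector"
  assumes "F differentiable (at x within S)" "subspace S"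
  shows "blinfun_apply (der S F x) (blinfun_apply (oproj S) v) = blinfun_apply (der S F x) v"
  using assms by (simp add: der_apply oproj_id)

lemma has_derivative_cong_openin:
  assumes "openin (top_of_set S) X" "x \<in> X" "\<And>y. y \<in> X ==> F y = G y"
    and "(F has_derivative D) (at x within S)"
  shows "(G has_derivative D) (at x within S)"
proof -
  have "(F has_derivative D) (at x within X)"
    using assms(4) at_within_openin[OF assms(1,2)] by simp
  then have "(G has_derivative D) (at x within X)"
    using has_derivative_transform[of x X G F D] assms(2,3) by simp
  then show ?thesis using at_within_openin[OF assms(1,2)] by simp
qed

text \<open>The embedding \<open>y \<mapsto> (v \<mapsto> (v \<bullet> i) y)\<close>; these recover an operator from its values on a basis, and
  so reduce statements on operator-valued functions to their values.\<close>

definition elementary :: "'b::euclidean_space => 'c::real_normed_vector \<Rightarrow>\<^sub>L 'b \<Rightarrow>\<^sub>L 'c" where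
  "elementary i = Blinfun (\<lambda>y. blinfun_scaleR_left y o\<^sub>L blinfun_inner_left i)"

lemma elementary_apply: "blinfun_apply (blinfun_apply (elementary i) y) v = (v \<bullet> i) *\<^sub>R y"
  unfolding elementary_def
  by (subst bounded_linear_Blinfun_apply) (auto intro!: bounded_linear_intros)

lemma blinfun_elementary_sum:
  "G = (\<Sum>i\<in>Basis. blinfun_apply (elementary i) (blinfun_apply G i))"
proof (rule blinfun_eqI)
  fix v :: 'a
  have "blinfun_apply G v = blinfun_apply G (\<Sum>i\<in>Basis. (v \<bullet> i) *\<^sub>R i)"
    by (simp add: euclidean_representation)
  then show "blinfun_apply G v =
      blinfun_apply (\<Sum>i\<in>Basis. blinfun_apply (elementary i) (blinfun_apply G i)) v"
    by (simp add: blinfun.sum_left elementary_apply blinfun.sum_right blinfun.scaleR_right)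
qed

lemma differentiable_blinfun_pointwise:
  fixes G :: "'a::real_normed_vector => 'b::euclidean_space \<Rightarrow>\<^sub>L 'c::real_normed_vector"
  assumes "\<And>i. i \<in> Basis ==> (\<lambda>x. blinfun_apply (G x) i) differentiable F"
  shows "G differentiable F"
proof -
  have "(\<lambda>x. \<Sum>i\<in>Basis. blinfun_apply (elementary i) (blinfun_apply (G x) i)) differentiable F"
  proof (intro differentiable_sum ballI)
    fix i :: 'b
    assume "i \<in> Basis"
    then obtain D where "((\<lambda>x. blinfun_apply (G x) i) has_derivative D) F"
      using assms unfolding differentiable_def by blast
    from bounded_linear.has_derivative[OF blinfun.bounded_linear_right this]
    show "(\<lambda>x. blinfun_apply (elementary i) (blinfun_apply (G x) i)) differentiable F"
      by (rule differentiableI)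
  qed auto
  then show ?thesis by (simp only: blinfun_elementary_sum[symmetric])
qed

lemma der_range:
  fixes F :: "'a::euclidean_space => 'c::euclidean_space"
  assumes "subspace S" "subspace T" "openin (top_of_set S) X" "x \<in> X" "F ` X \<subseteq> T"
    and "F differentiable (at x within S)"
  shows "blinfun_apply (der S F x) v \<in> T"
proof -
  have x: "x \<in> S" using assms(3,4) openin_imp_subset by blast
  have "(F has_derivative der S F x) (at x within S)"
    using has_derivative_der assms(1,6) x by blast
  then have "((\<lambda>y. oproj T (F y)) has_derivative (\<lambda>v. oproj T (der S F x v))) (at x within S)"
    by (rule bounded_linear.has_derivative[OF blinfun.bounded_linear_right])
  moreover have "oproj T (F y) = F y" if "y \<in> X" for y
    using assms(2,5) that by (intro oproj_id) blast+
  ultimately have "(F has_derivative (\<lambda>v. oproj T (der S F x v))) (at x within S)"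
    using has_derivative_cong_openin[OF assms(3,4), of "\<lambda>y. oproj T (F y)" F] by blast
  from der_eqI[OF assms(1) x this] show ?thesis
    using oproj_mem[OF assms(2)] by metis
qed

lemma der_chain:
  fixes F :: "'a::euclidean_space => 'b::euclidean_space" and G :: "'b => 'c::real_normed_vector"
  assumes "subspace S" "subspace T" "openin (top_of_set S) X" "x \<in> X" "F ` X \<subseteq> T"
    and "F differentiable (at x within S)" "G differentiable (at (F x) within T)"
    and "\<And>y. y \<in> X ==> H y = G (F y)"
  shows "H differentiable (at x within S)" "der S H x = der T G (F x) o\<^sub>L der S F x"
proof -
  have xS: "x \<in> S" and FxT: "F x \<in> T" using assms(3,4,5) openin_imp_subset by blast+
  have F: "(F has_derivative der S F x) (at x within X)"
    using has_derivative_der assms(1,6) xS at_within_openin[OF assms(3,4)] by metis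
  have G: "(G has_derivative der T G (F x)) (at (F x) within F ` X)"
    using has_derivative_subset[OF has_derivative_der[OF assms(7) FxT assms(2)] assms(5)] .
  have "((\<lambda>y. G (F y)) has_derivative (\<lambda>v. der T G (F x) (der S F x v))) (at x within S)"
    using diff_chain_within[OF F G] at_within_openin[OF assms(3,4)] by (simp add: o_def)
  then have D: "(H has_derivative (\<lambda>v. der T G (F x) (der S F x v))) (at x within S)"
    by (rule has_derivative_cong_openin[OF assms(3,4), rotated]) (simp add: assms(8))
  then show "H differentiable (at x within S)" by (rule differentiableI)
  show "der S H x = der T G (F x) o\<^sub>L der S F x"
    using der_eqI[OF assms(1) xS D] der_oproj[OF assms(6,1)] by (intro blinfun_eqI) simp
qed

definition twice_diff ::
  "'a::euclidean_space set => 'a set => ('a => 'c::real_normed_vector) => bool" where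
  "twice_diff S X F \<longleftrightarrow> openin (top_of_set S) X \<and>
     (\<forall>x\<in>X. F differentiable (at x within S)) \<and>
     (\<forall>x\<in>X. der S F differentiable (at x within S)) \<and>
     continuous_on X (der S (der S F))"

text \<open>The class \<open>Ck_on 2\<close> speaks of the derivative one vector at a time; on a finite-dimensional space
  this suffices for the derivative as an operator.\<close>

lemma twice_diff_Ck_on:
  fixes F :: "'a::euclidean_space => 'c::euclidean_space"
  assumes S: "subspace S" and X: "openin (top_of_set S) X" and F: "Ck_on 2 S X F"
  shows "twice_diff S X F"
proof -
  have eq: "Ck_on 2 S X F \<longleftrightarrow> (\<forall>x\<in>X. F differentiable (at x within X)) \<and>
     (\<forall>v\<in>S. (\<forall>x\<in>X. (\<lambda>x. frechet_derivative F (at x within X) v) differentiable (at x within X)) \<and>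
      (\<forall>w\<in>S. continuous_on X (\<lambda>x. frechet_derivative
         (\<lambda>x. frechet_derivative F (at x within X) v) (at x within X) w)))"
    by (simp add: numeral_2_eq_2)
  have XS: "X \<subseteq> S" using X openin_imp_subset by blast
  have at: "at x within X = at x within S" if "x \<in> X" for x
    using at_within_openin[OF X that] .
  define G where "G v = (\<lambda>x. frechet_derivative F (at x within X) v)" for v
  have d1: "F differentiable (at x within S)" if "x \<in> X" for x
    using F at that unfolding eq by metis
  have ev: "blinfun_apply (der S F x) v = G (oproj S v) x" if "x \<in> X" for x v
    using der_apply[OF d1[OF that]] at[OF that] unfolding G_def by simp
  have G1: "G (oproj S v) differentiable (at x within S)" if "x \<in> X" for x v
    using F at that oproj_mem[OF S] unfolding eq G_def by metis
  have e1: "(\<lambda>x. blinfun_apply (der S F x) v) differentiable (at x within S)" if x: "x \<in> X" for x v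
  proof -
    obtain D where "(G (oproj S v) has_derivative D) (at x within S)"
      using G1[OF x] unfolding differentiable_def by blast
    then have "((\<lambda>x. blinfun_apply (der S F x) v) has_derivative D) (at x within S)"
      by (rule has_derivative_cong_openin[OF X x, rotated]) (simp add: ev)
    then show ?thesis by (rule differentiableI)
  qed
  have d2: "der S F differentiable (at x within S)" if "x \<in> X" for x
    by (rule differentiable_blinfun_pointwise) (use e1 that in blast)
  have c2: "continuous_on X (\<lambda>x. blinfun_apply (blinfun_apply (der S (der S F) x) w) v)" for v w
  proof -
    have "blinfun_apply (blinfun_apply (der S (der S F) x) w) v
      = frechet_derivative (G (oproj S v)) (at x within X) (oproj S w)" if x: "x \<in> X" for x
    proof -
      have "(der S F has_derivative der S (der S F) x) (at x within S)"
        using has_derivative_der[OF d2[OF x] _ S] XS x by blast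
      then have "((\<lambda>y. blinfun_apply (der S F y) v) has_derivative
          (\<lambda>w. blinfun_apply (blinfun_apply (der S (der S F) x) w) v)) (at x within S)"
        by (rule bounded_linear.has_derivative[OF blinfun.bounded_linear_left])
      then have "(G (oproj S v) has_derivative
          (\<lambda>w. blinfun_apply (blinfun_apply (der S (der S F) x) w) v)) (at x within S)"
        by (rule has_derivative_cong_openin[OF X x, rotated]) (simp add: ev)
      from frechet_derivative_relatively_open[of S S x "oproj S w", OF S _ _ _ this] XS x
      have "frechet_derivative (G (oproj S v)) (at x within X) (oproj S w)
        = blinfun_apply (blinfun_apply (der S (der S F) x) (oproj S w)) v"
        using S at[OF x] by auto
      then show ?thesis using der_oproj[OF d2[OF x] S] by simp
    qed
    moreover have "continuous_on X (\<lambda>x. frechet_derivative (G (oproj S v)) (at x within X) (oproj S w))"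
      using F oproj_mem[OF S] unfolding eq G_def by metis
    ultimately show ?thesis by (simp cong: continuous_on_cong)
  qed
  have "continuous_on X (der S (der S F))"
    by (intro continuous_on_blinfun_componentwise c2)
  then show ?thesis unfolding twice_diff_def using X d1 d2 by blast
qed

lemma twice_diff_continuous_der:
  assumes "twice_diff S X F"
  shows "continuous_on X F" "continuous_on X (der S F)"
proof -
  have "openin (top_of_set S) X" using assms unfolding twice_diff_def by blast
  then have at: "at x within X = at x within S" if "x \<in> X" for x
    using at_within_openin that by blast
  show "continuous_on X F"
    using assms at differentiable_imp_continuous_within
    unfolding twice_diff_def continuous_on_eq_continuous_within by fastforce
  show "continuous_on X (der S F)"
    using assms at differentiable_imp_continuous_within
    unfolding twice_diff_def continuous_on_eq_continuous_within by fastforce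
qed

text \<open>The second-order chain rule.\<close>

lemma der2_chain:
  fixes F :: "'a::euclidean_space => 'b::euclidean_space"
    and G :: "'b => 'c::real_normed_vector"
  assumes S: "subspace S" "subspace T" and X: "openin (top_of_set S) X" "x \<in> X" "F ` X \<subseteq> Y"
    and F: "twice_diff S X F" and G: "twice_diff T Y G"
    and H: "\<And>y. y \<in> X ==> H y = G (F y)"
  shows "blinfun_apply (der S (der S H) x) v =
    (blinfun_apply (der T (der T G) (F x)) (blinfun_apply (der S F x) v) o\<^sub>L der S F x)
    + (der T G (F x) o\<^sub>L blinfun_apply (der S (der S F) x) v)"
proof -
  have XS: "X \<subseteq> S" and YT: "Y \<subseteq> T"
    using X(1) G openin_imp_subset unfolding twice_diff_def by blast+
  then have xS: "x \<in> S" using X by blast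
  have dF: "F differentiable (at y within S)" "der S F differentiable (at y within S)"
    and dG: "G differentiable (at (F y) within T)" "der T G differentiable (at (F y) within T)"
    if "y \<in> X" for y
    using F G X(3) that unfolding twice_diff_def by blast+
  have FT: "F ` X \<subseteq> T" using X(3) YT by blast
  have eqH: "der S H y = der T G (F y) o\<^sub>L der S F y" if "y \<in> X" for y
    using der_chain(2)[OF S X(1) that FT dF(1)[OF that] dG(1)[OF that] H] .
  have GF: "(\<lambda>y. der T G (F y)) differentiable (at x within S)"
    "der S (\<lambda>y. der T G (F y)) x = der T (der T G) (F x) o\<^sub>L der S F x"
    using der_chain[OF S X(1,2) FT dF(1)[OF X(2)] dG(2)[OF X(2)], of "\<lambda>y. der T G (F y)"]
    by auto
  have "((\<lambda>y. der T G (F y)) has_derivative der T (der T G) (F x) o\<^sub>L der S F x) (at x within S)"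
    using has_derivative_der[OF GF(1) xS S(1)] unfolding GF(2) .
  from bounded_bilinear.FDERIV[OF bounded_bilinear_blinfun_compose this
      has_derivative_der[OF dF(2)[OF X(2)] xS S(1)]]
  have "((\<lambda>y. der T G (F y) o\<^sub>L der S F y) has_derivative
     (\<lambda>v. (der T G (F x) o\<^sub>L blinfun_apply (der S (der S F) x) v)
       + (blinfun_apply (der T (der T G) (F x)) (blinfun_apply (der S F x) v) o\<^sub>L der S F x)))
     (at x within S)" by simp
  then have "(der S H has_derivative
     (\<lambda>v. (der T G (F x) o\<^sub>L blinfun_apply (der S (der S F) x) v)
       + (blinfun_apply (der T (der T G) (F x)) (blinfun_apply (der S F x) v) o\<^sub>L der S F x)))
     (at x within S)"
    by (rule has_derivative_cong_openin[OF X(1,2), rotated]) (simp add: eqH)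
  from der_eqI[OF S(1) xS this] show ?thesis
    using der_oproj[OF dF(1)[OF X(2)] S(1)] der_oproj[OF dF(2)[OF X(2)] S(1)]
    by (simp add: add.commute)
qed

lemma has_vector_derivative_compose_within:
  assumes "(x has_vector_derivative \<xi>) (at t within I)" "\<forall>\<^sub>F s in at t within I. x s \<in> S"
    and "(F has_derivative D) (at (x t) within S)"
  shows "((\<lambda>s. F (x s)) has_vector_derivative D \<xi>) (at t within I)"
proof -
  let ?J = "{s \<in> I. x s \<in> S}"
  have J: "at t within ?J = at t within I" by (rule at_within_eventually[OF assms(2)])
  have "(x has_vector_derivative \<xi>) (at t within ?J)" using assms(1) J by simp
  moreover have "(F has_derivative D) (at (x t) within x ` ?J)"
    by (rule has_derivative_subset[OF assms(3)]) auto
  ultimately have "((F \<circ> x) has_vector_derivative D \<xi>) (at t within ?J)"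
    by (rule vector_derivative_diff_chain_within)
  then show ?thesis using J by (simp add: o_def)
qed


section \<open>Filters and compactness\<close>

lemma filterlim_nhdsin_generated:
  assumes "y \<in> \<Union>\<U>" "\<And>U. U \<in> \<U> ==> y \<in> U ==> eventually (\<lambda>x. g x \<in> U) F"
  shows "filterlim g (nhdsin (topology_generated_by \<U>) y) F"
proof -
  have ev: "eventually (\<lambda>x. g x \<in> V) F" if "generate_topology_on \<U> V" "y \<in> V" for V
    using that
  proof (induction rule: generate_topology_on.induct)
    case (Int a b)
    then show ?case by (auto intro: eventually_conj)
  next
    case (UN K)
    then obtain k where "k \<in> K" "y \<in> k" by blast
    then show ?case using UN.IH[of k] by (auto elim: eventually_mono)
  qed (use assms(2) in auto)
  show ?thesis
    unfolding filterlim_iff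
  proof safe
    fix P
    assume "eventually P (nhdsin (topology_generated_by \<U>) y)"
    then obtain V where "generate_topology_on \<U> V" "y \<in> V" "\<forall>x\<in>V. P x"
      using assms(1) unfolding eventually_nhdsin openin_topology_generated_by_iff by auto
    with ev[of V] show "\<forall>\<^sub>F x in F. P (g x)" by (auto elim: eventually_mono)
  qed
qed

text \<open>The tube lemma for filters.\<close>

lemma eventually_tube:
  fixes K :: "'b::topological_space set"
  assumes "compact K" "\<And>y. y \<in> K ==> \<forall>\<^sub>F z in F \<times>\<^sub>F nhds y. P (fst z) (snd z)"
  shows "\<forall>\<^sub>F x in F. \<forall>y\<in>K. P x y"
proof -
  have "\<exists>U Q. open U \<and> y \<in> U \<and> eventually Q F \<and> (\<forall>x y'. Q x --> y' \<in> U --> P x y')" if "y \<in> K" for y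
  proof -
    from assms(2)[OF that] obtain Q R where Q: "eventually Q F" "eventually R (nhds y)"
      "\<And>x y'. Q x ==> R y' ==> P x y'"
      unfolding eventually_prod_filter by auto
    then show ?thesis unfolding eventually_nhds by metis
  qed
  then obtain U Q where U: "\<And>y. y \<in> K ==> open (U y) \<and> y \<in> U y \<and> eventually (Q y) F \<and>
      (\<forall>x y'. Q y x --> y' \<in> U y --> P x y')" by metis
  obtain C where C: "C \<subseteq> K" "finite C" "K \<subseteq> (\<Union>c\<in>C. U c)"
    by (rule compactE_image[OF assms(1), of K U]) (use U in blast)+
  have "\<forall>\<^sub>F x in F. \<forall>c\<in>C. Q c x"
    using C U by (auto intro!: eventually_ball_finite)
  then show ?thesis
    by (rule eventually_mono) (use C U in \<open>fastforce\<close>)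
qed

text \<open>Compactness, in the form in which it produces uniform constants.\<close>

lemma compactin_uniform:
  fixes Q :: "real => 'm => bool"
  assumes K: "compactin X K"
    and loc: "\<And>p. p \<in> K ==> \<exists>\<delta>>0. \<forall>\<^sub>F q in nhdsin X p. q \<in> K --> Q \<delta> q"
    and mono: "\<And>\<delta> \<delta>' p. p \<in> K ==> Q \<delta> p ==> 0 < \<delta>' ==> \<delta>' \<le> \<delta> ==> Q \<delta>' p"
  shows "\<exists>\<delta>>0. \<forall>p\<in>K. Q \<delta> p"
proof -
  have sub: "K \<subseteq> topspace X" using K by (rule compactin_subset_topspace)
  have "\<exists>\<delta> U. \<delta> > 0 \<and> openin X U \<and> p \<in> U \<and> (\<forall>q\<in>U. q \<in> K --> Q \<delta> q)" if p: "p \<in> K" for p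
  proof -
    obtain \<delta> where "\<delta> > 0" "\<forall>\<^sub>F q in nhdsin X p. q \<in> K --> Q \<delta> q" using loc[OF p] by blast
    then show ?thesis using sub p unfolding eventually_nhdsin by blast
  qed
  then obtain d U where dU: "\<And>p. p \<in> K ==> d p > 0 \<and> openin X (U p) \<and> p \<in> U p \<and>
      (\<forall>q\<in>U p. q \<in> K --> Q (d p) q)" by metis
  have "\<exists>\<F>. finite \<F> \<and> \<F> \<subseteq> U ` K \<and> K \<subseteq> \<Union>\<F>"
  proof -
    have "(\<forall>V\<in>U ` K. openin X V)" "K \<subseteq> \<Union>(U ` K)" using dU by blast+
    then show ?thesis using K unfolding compactin_def by blast
  qed
  then obtain C where C: "C \<subseteq> K" "finite C" "K \<subseteq> (\<Union>c\<in>C. U c)"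
    by (metis finite_subset_image)
  show ?thesis
  proof (cases "C = {}")
    case True
    then have "K = {}" using C by auto
    then show ?thesis by (auto intro: exI[of _ 1])
  next
    case False
    define e where "e = Min (d ` C)"
    have e: "e > 0" "\<And>c. c \<in> C ==> e \<le> d c"
      unfolding e_def using C False dU by (auto simp: subset_iff)
    have "Q e p" if p: "p \<in> K" for p
    proof -
      obtain c where "c \<in> C" "p \<in> U c" using C p by blast
      then show ?thesis using mono[OF p _ e(1) e(2)] dU C p by blast
    qed
    then show ?thesis using e(1) by blast
  qed
qed

section \<open>Calculus in the charts of a manifold\<close>

lemma filterlim_continuous_map:
  assumes "continuous_map X Y h" "x \<in> topspace X"
  shows "filterlim h (nhdsin Y (h x)) (nhdsin X x)"
  unfolding filterlim_iff
proof safe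
  fix P
  assume "eventually P (nhdsin Y (h x))"
  moreover have "h x \<in> topspace Y"
    using assms continuous_map_image_subset_topspace by fastforce
  ultimately obtain V where V: "openin Y V" "h x \<in> V" "\<forall>y\<in>V. P y"
    unfolding eventually_nhdsin by blast
  then have "openin X {z \<in> topspace X. h z \<in> V}" "x \<in> {z \<in> topspace X. h z \<in> V}"
    using assms openin_continuous_map_preimage by auto
  then show "\<forall>\<^sub>F z in nhdsin X x. P (h z)"
    unfolding eventually_nhdsin using V(3) by blast
qed

lemma eventually_nhdsinI:
  "openin X U ==> x \<in> U ==> (\<And>y. y \<in> U ==> P y) ==> eventually P (nhdsin X x)"
  unfolding eventually_nhdsin by blast

lemma mtopology_chart:
  assumes "C \<in> atlas N" "P \<in> fst C" "snd C ` fst C \<subseteq> model N"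
  shows "\<forall>\<^sub>F x in nhdsin (mtopology N) P. x \<in> fst C"
    and "(snd C \<longlongrightarrow> snd C P) (nhdsin (mtopology N) P)"
proof -
  have ev: "\<forall>\<^sub>F x in nhdsin (mtopology N) P. x \<in> fst C \<and> snd C x \<in> O'"
    if "open O'" "snd C P \<in> O'" for O'
  proof (rule eventually_nhdsinI)
    show "openin (mtopology N) {x \<in> fst C. snd C x \<in> model N \<inter> O'}"
      unfolding mtopology_def
      by (rule topology_generated_by_Basis) (use assms(1) openin_open_Int[OF that(1)] in blast)
  qed (use that assms in auto)
  show "\<forall>\<^sub>F x in nhdsin (mtopology N) P. x \<in> fst C"
    using ev[of UNIV] by simp
  show "(snd C \<longlongrightarrow> snd C P) (nhdsin (mtopology N) P)"
  proof (rule topological_tendstoI)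
    fix O' assume "open O'" "snd C P \<in> O'"
    from ev[OF this] show "\<forall>\<^sub>F x in nhdsin (mtopology N) P. snd C x \<in> O'"
      by eventually_elim blast
  qed
qed

locale smooth_mfd =
  fixes M :: "('m, 'b::euclidean_space) manifold"
  assumes M: "smooth_manifold M"
begin

abbreviation S where "S \<equiv> model M"

abbreviation "TMtop \<equiv> mtopology (tangent_bundle M)"
abbreviation "gchart d \<equiv> grassmann_chart M d"
abbreviation "Gr d \<equiv> grassmann_bundle d M"

definition nh :: "'m => 'm filter" where
  "nh p = nhdsin (mtopology M) p"

text \<open>The first and second derivative of \<open>g\<close> at the point \<open>p\<close>, as operators on the coordinate space, in
  the charts \<open>c\<close> around \<open>p\<close> and \<open>c'\<close> around \<open>g p\<close>. With \<open>g = id\<close> they describe the change of charts.\<close>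

definition D :: "('m => 'm) => ('m, 'b) chart => ('m, 'b) chart => 'm => 'b \<Rightarrow>\<^sub>L 'b" where
  "D g c c' p = der S (local_rep c c' g) (snd c p)"

definition D2 :: "('m => 'm) => ('m, 'b) chart => ('m, 'b) chart => 'm => 'b \<Rightarrow>\<^sub>L 'b \<Rightarrow>\<^sub>L 'b" where
  "D2 g c c' p = der S (der S (local_rep c c' g)) (snd c p)"

abbreviation C2 :: "('m => 'm) => bool" where
  "C2 g \<equiv> Ck_map 2 M M g"

lemma sub: "subspace S"
  and inj_chart: "c \<in> atlas M ==> inj_on (snd c) (fst c)"
  and chart_image: "c \<in> atlas M ==> snd c ` fst c \<subseteq> S"
  and Hausdorff: "Hausdorff_space (mtopology M)"
  using M unfolding smooth_manifold_def by blast+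

lemma oproj_S [simp]: "blinfun_apply (oproj S) v \<in> S" "v \<in> S ==> blinfun_apply (oproj S) v = v"
  using sub oproj_mem oproj_id by blast+

lemma S_closed_under [simp]:
  "0 \<in> S" "v \<in> S ==> a *\<^sub>R v \<in> S" "v \<in> S ==> - v \<in> S"
  "v \<in> S ==> w \<in> S ==> v + w \<in> S" "v \<in> S ==> w \<in> S ==> v - w \<in> S"
  using sub by (simp_all add: subspace_0 subspace_scale subspace_neg subspace_add subspace_diff)

lemma chart_S [simp]: "c \<in> atlas M ==> p \<in> fst c ==> snd c p \<in> S"
  using chart_image by blast

lemma mem_points: "c \<in> atlas M ==> p \<in> fst c ==> p \<in> points M"
  unfolding points_def by blast

lemma chart_at: "p \<in> points M ==> chart_at M p \<in> atlas M" "p \<in> points M ==> p \<in> fst (chart_at M p)"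
proof -
  have "p \<in> points M ==> chart_at M p \<in> atlas M \<and> p \<in> fst (chart_at M p)"
    unfolding points_def chart_at_def by (rule someI_ex) blast
  then show "p \<in> points M ==> chart_at M p \<in> atlas M" "p \<in> points M ==> p \<in> fst (chart_at M p)"
    by blast+
qed

lemma local_rep_at:
  "c \<in> atlas M ==> p \<in> fst c ==> local_rep c c' g (snd c p) = snd c' (g p)"
  using inj_chart unfolding local_rep_def chart_inv_def by (simp add: inv_into_f_f)

lemma local_dom_at:
  assumes "c \<in> atlas M" "p \<in> fst c"
  shows "snd c p \<in> local_dom c c' g \<longleftrightarrow> g p \<in> fst c'"
  using inj_onD[OF inj_chart[OF assms(1)]] assms(2) unfolding local_dom_def by blast

lemma local_domI: "p \<in> fst c ==> g p \<in> fst c' ==> snd c p \<in> local_dom c c' g"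
  unfolding local_dom_def by blast

lemma C2_id: "C2 id"
  using M unfolding smooth_manifold_def Ck_map_def by auto

lemma C2_points: "C2 g ==> p \<in> points M ==> g p \<in> points M"
  unfolding Ck_map_def by blast

lemma twice_diff_local_rep:
  assumes "C2 g" "c \<in> atlas M" "c' \<in> atlas M"
  shows "twice_diff S (local_dom c c' g) (local_rep c c' g)"
  using assms twice_diff_Ck_on[OF sub] unfolding Ck_map_def by blast

lemma openin_local_dom:
  assumes "C2 g" "c \<in> atlas M" "c' \<in> atlas M"
  shows "openin (top_of_set S) (local_dom c c' g)"
  using assms unfolding Ck_map_def by blast

lemma openin_chart:
  assumes "c \<in> atlas M" "openin (top_of_set S) W"
  shows "openin (mtopology M) {p \<in> fst c. snd c p \<in> W}"
  unfolding mtopology_def by (rule topology_generated_by_Basis) (use assms in blast)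

lemma openin_chart_dom:
  assumes "c \<in> atlas M"
  shows "openin (mtopology M) (fst c)"
proof -
  have "fst c = {p \<in> fst c. snd c p \<in> S}" using assms by auto
  moreover have "openin (top_of_set S) S" by simp
  ultimately show ?thesis using openin_chart[OF assms] by metis
qed

lemma topspace_M: "topspace (mtopology M) = points M"
proof
  show "topspace (mtopology M) \<subseteq> points M"
    unfolding mtopology_def points_def by auto
  show "points M \<subseteq> topspace (mtopology M)"
    using openin_chart_dom openin_subset unfolding points_def by blast
qed

lemma eventually_nh:
  "eventually P (nh p) \<longleftrightarrow> p \<notin> points M \<or> (\<exists>U. openin (mtopology M) U \<and> p \<in> U \<and> (\<forall>q\<in>U. P q))"
  unfolding nh_def eventually_nhdsin topspace_M ..

lemma eventually_nhI:
  "openin (mtopology M) U ==> p \<in> U ==> (\<And>q. q \<in> U ==> P q) ==> eventually P (nh p)"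
  unfolding eventually_nh by blast

lemma eventually_nh_self: "eventually P (nh p) ==> p \<in> points M ==> P p"
  unfolding eventually_nh by blast

lemma
  assumes "c \<in> atlas M" "p \<in> fst c"
  shows eventually_chart: "\<forall>\<^sub>F q in nh p. q \<in> fst c"
    and tendsto_chart: "(snd c \<longlongrightarrow> snd c p) (nh p)"
  using mtopology_chart[OF assms chart_image[OF assms(1)]] unfolding nh_def by blast+

lemma tendsto_coord:
  assumes "c \<in> atlas M" "p \<in> fst c" "openin (top_of_set S) X" "snd c p \<in> X" "continuous_on X \<Phi>"
    and "\<forall>\<^sub>F x in F. h x \<in> fst c" "((\<lambda>x. snd c (h x)) \<longlongrightarrow> snd c p) F"
  shows "\<forall>\<^sub>F x in F. snd c (h x) \<in> X" "((\<lambda>x. \<Phi> (snd c (h x))) \<longlongrightarrow> \<Phi> (snd c p)) F"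
proof -
  obtain O' where O: "open O'" "X = S \<inter> O'" using assms(3) unfolding openin_open by blast
  have "\<forall>\<^sub>F x in F. snd c (h x) \<in> O'"
    using topological_tendstoD[OF assms(7) O(1)] O assms(4) by blast
  then show ev: "\<forall>\<^sub>F x in F. snd c (h x) \<in> X"
    using assms(6) by eventually_elim (use O(2) assms(1) in auto)
  show "((\<lambda>x. \<Phi> (snd c (h x))) \<longlongrightarrow> \<Phi> (snd c p)) F"
    by (rule continuous_on_tendsto_compose[OF assms(5,7,4) ev])
qed

lemma filterlim_nh_iff:
  assumes "c \<in> atlas M" "p \<in> fst c"
  shows "filterlim h (nh p) F \<longleftrightarrow> (\<forall>\<^sub>F x in F. h x \<in> fst c) \<and> ((\<lambda>x. snd c (h x)) \<longlongrightarrow> snd c p) F"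
proof
  assume h: "filterlim h (nh p) F"
  show "(\<forall>\<^sub>F x in F. h x \<in> fst c) \<and> ((\<lambda>x. snd c (h x)) \<longlongrightarrow> snd c p) F"
    using eventually_compose_filterlim[OF eventually_chart[OF assms] h]
      filterlim_compose[OF tendsto_chart[OF assms] h] by blast
next
  assume h: "(\<forall>\<^sub>F x in F. h x \<in> fst c) \<and> ((\<lambda>x. snd c (h x)) \<longlongrightarrow> snd c p) F"
  show "filterlim h (nh p) F"
    unfolding nh_def mtopology_def
  proof (rule filterlim_nhdsin_generated)
    show "p \<in> \<Union>{{p \<in> fst c. snd c p \<in> W} |c W. c \<in> atlas M \<and> openin (top_of_set S) W}"
    proof
      show "p \<in> {p \<in> fst c. snd c p \<in> S}" using assms by simp
      have "openin (top_of_set S) S" by simp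
      then show "{p \<in> fst c. snd c p \<in> S} \<in>
          {{p \<in> fst c. snd c p \<in> W} |c W. c \<in> atlas M \<and> openin (top_of_set S) W}"
        using assms(1) by blast
    qed
    fix U
    assume "U \<in> {{p \<in> fst c. snd c p \<in> W} |c W. c \<in> atlas M \<and> openin (top_of_set S) W}" "p \<in> U"
    then obtain c' W where c': "c' \<in> atlas M" "openin (top_of_set S) W" "p \<in> fst c'" "snd c' p \<in> W"
      "U = {p \<in> fst c'. snd c' p \<in> W}" by blast
    let ?X = "local_dom c c' id" and ?F = "local_rep c c' id"
    have X: "openin (top_of_set S) ?X" "snd c p \<in> ?X"
      using openin_local_dom[OF C2_id] assms c' by (auto intro: local_domI)
    have cont: "continuous_on ?X ?F"
      using twice_diff_continuous_der(1)[OF twice_diff_local_rep[OF C2_id]] assms c' by blast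
    note t = tendsto_coord[OF assms X cont, of h F]
    have ev: "\<forall>\<^sub>F x in F. snd c (h x) \<in> ?X" "((\<lambda>x. ?F (snd c (h x))) \<longlongrightarrow> ?F (snd c p)) F"
      using t h by blast+
    obtain O' where O: "open O'" "W = S \<inter> O'" using c'(2) unfolding openin_open by blast
    have "\<forall>\<^sub>F x in F. ?F (snd c (h x)) \<in> O'"
      using topological_tendstoD[OF ev(2) O(1)] O c' assms by (simp add: local_rep_at)
    then show "\<forall>\<^sub>F x in F. h x \<in> U"
      using ev(1) conjunct1[OF h]
      by eventually_elim (use O c' assms in \<open>auto simp: local_rep_at local_dom_at\<close>)
  qed
qed

lemma
  assumes "C2 g" "c \<in> atlas M" "c' \<in> atlas M" "p \<in> fst c" "g p \<in> fst c'"
  shows D_tendsto: "(D g c c' \<longlongrightarrow> D g c c' p) (nh p)"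
    and D2_tendsto: "(D2 g c c' \<longlongrightarrow> D2 g c c' p) (nh p)"
    and rep_tendsto: "((\<lambda>q. snd c' (g q)) \<longlongrightarrow> snd c' (g p)) (nh p)"
    and eventually_g_chart: "\<forall>\<^sub>F q in nh p. g q \<in> fst c'"
proof -
  let ?X = "local_dom c c' g" and ?F = "local_rep c c' g"
  have X: "openin (top_of_set S) ?X" "snd c p \<in> ?X"
    using openin_local_dom[OF assms(1)] assms by (auto intro: local_domI)
  note td = twice_diff_local_rep[OF assms(1,2,3)]
  note ch = eventually_chart[OF assms(2,4)] tendsto_chart[OF assms(2,4)]
  show "(D g c c' \<longlongrightarrow> D g c c' p) (nh p)"
    using tendsto_coord(2)[OF assms(2,4) X twice_diff_continuous_der(2)[OF td] ch]
    unfolding D_def[abs_def] .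
  show "(D2 g c c' \<longlongrightarrow> D2 g c c' p) (nh p)"
    using tendsto_coord(2)[OF assms(2,4) X _ ch] td unfolding D2_def[abs_def] twice_diff_def by blast
  note r = tendsto_coord[OF assms(2,4) X twice_diff_continuous_der(1)[OF td] ch]
  show "((\<lambda>q. snd c' (g q)) \<longlongrightarrow> snd c' (g p)) (nh p)"
  proof (rule tendsto_cong[THEN iffD1])
    show "((\<lambda>q. ?F (snd c q)) \<longlongrightarrow> snd c' (g p)) (nh p)" using r(2) assms by (simp add: local_rep_at)
    show "\<forall>\<^sub>F q in nh p. ?F (snd c q) = snd c' (g q)"
      using ch(1) by eventually_elim (use assms in \<open>simp add: local_rep_at\<close>)
  qed
  show "\<forall>\<^sub>F q in nh p. g q \<in> fst c'"
    using r(1) ch(1) by eventually_elim (use local_dom_at[OF assms(2)] in blast)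
qed

lemma filterlim_C2:
  assumes "C2 g" "p \<in> points M"
  shows "filterlim g (nh (g p)) (nh p)"
proof -
  have c: "chart_at M p \<in> atlas M" "p \<in> fst (chart_at M p)"
    "chart_at M (g p) \<in> atlas M" "g p \<in> fst (chart_at M (g p))"
    using chart_at C2_points assms by blast+
  show ?thesis
    using filterlim_nh_iff[OF c(3,4)] rep_tendsto[OF assms(1) c(1,3,2,4)]
      eventually_g_chart[OF assms(1) c(1,3,2,4)] by blast
qed

lemma local_rep_diff:
  assumes "C2 g" "c \<in> atlas M" "c' \<in> atlas M" "p \<in> fst c" "g p \<in> fst c'"
  shows "local_rep c c' g differentiable (at (snd c p) within S)"
    "der S (local_rep c c' g) differentiable (at (snd c p) within S)"
  using twice_diff_local_rep[OF assms(1,2,3)] local_dom_at[OF assms(2,4), of c' g] assms(5)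
  unfolding twice_diff_def by blast+

lemma
  assumes "C2 g" "c \<in> atlas M" "c' \<in> atlas M" "p \<in> fst c" "g p \<in> fst c'"
  shows D_oproj: "D g c c' p (oproj S v) = D g c c' p v"
    and D_S: "D g c c' p v \<in> S"
proof -
  show "D g c c' p (oproj S v) = D g c c' p v"
    using der_oproj[OF local_rep_diff(1)[OF assms] sub] unfolding D_def .
  have "local_rep c c' g ` local_dom c c' g \<subseteq> S"
    using assms(2,3) unfolding local_dom_def by (auto simp: local_rep_at)
  then show "D g c c' p v \<in> S"
    using der_range[OF sub sub openin_local_dom[OF assms(1,2,3)] _ _ local_rep_diff(1)[OF assms]]
      local_dom_at[OF assms(2,4)] assms(5) unfolding D_def by blast
qed

lemma
  assumes g: "C2 g" and h: "C2 h" and k: "C2 k" and khg: "\<And>q. q \<in> points M ==> k q = h (g q)"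
    and c: "c \<in> atlas M" "c' \<in> atlas M" "c'' \<in> atlas M" "p \<in> fst c" "g p \<in> fst c'" "h (g p) \<in> fst c''"
  shows D_chain: "D k c c'' p = D h c' c'' (g p) o\<^sub>L D g c c' p"
    and D2_chain: "D2 k c c'' p v =
      (D2 h c' c'' (g p) (D g c c' p v) o\<^sub>L D g c c' p) + (D h c' c'' (g p) o\<^sub>L D2 g c c' p v)"
proof -
  let ?F = "local_rep c c' g" and ?G = "local_rep c' c'' h" and ?H = "local_rep c c'' k"
  let ?Y = "local_dom c' c'' h"
  define X where "X = {x \<in> local_dom c c' g. ?F x \<in> ?Y}"
  note tF = twice_diff_local_rep[OF g c(1,2)] and tG = twice_diff_local_rep[OF h c(2,3)]
  have FS: "?F ` local_dom c c' g \<subseteq> S"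
    using c unfolding local_dom_def by (auto simp: local_rep_at)
  have "openin (top_of_set (local_dom c c' g)) (local_dom c c' g \<inter> ?F -` ?Y)"
    using FS by (intro continuous_openin_preimage[OF twice_diff_continuous_der(1)[OF tF] _
      openin_local_dom[OF h c(2,3)]]) auto
  moreover have "local_dom c c' g \<inter> ?F -` ?Y = X" unfolding X_def by blast
  ultimately have X: "openin (top_of_set S) X"
    using openin_local_dom[OF g c(1,2)] openin_trans by metis
  have pX: "snd c p \<in> X"
    using c unfolding X_def by (auto simp: local_rep_at intro: local_domI)
  have FX: "?F ` X \<subseteq> ?Y" unfolding X_def by blast
  have H: "?H y = ?G (?F y)" if "y \<in> X" for y
  proof -
    obtain q where q: "y = snd c q" "q \<in> fst c" "g q \<in> fst c'" using \<open>y \<in> X\<close>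
      unfolding X_def local_dom_def by blast
    then show ?thesis using c khg[of q] mem_points by (simp add: local_rep_at)
  qed
  have Fp: "?F (snd c p) = snd c' (g p)" using c by (simp add: local_rep_at)
  have tF': "twice_diff S X ?F"
  proof -
    have "X \<subseteq> local_dom c c' g" unfolding X_def by blast
    then show ?thesis
      using tF X continuous_on_subset[of "local_dom c c' g" "der S (der S ?F)" X]
      unfolding twice_diff_def by auto
  qed
  have FXS: "?F ` X \<subseteq> S" using FS unfolding X_def by blast
  show "D k c c'' p = D h c' c'' (g p) o\<^sub>L D g c c' p"
    using der_chain(2)[where G = ?G and H = ?H, OF sub sub X pX FXS local_rep_diff(1)[OF g c(1,2,4,5)] _ H]
      local_rep_diff(1)[OF h c(2,3,5,6)] unfolding D_def Fp by simp
  show "D2 k c c'' p v =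
      (D2 h c' c'' (g p) (D g c c' p v) o\<^sub>L D g c c' p) + (D h c' c'' (g p) o\<^sub>L D2 g c c' p v)"
    using der2_chain[where H = ?H, OF sub sub X pX FX tF' tG H] unfolding D_def D2_def Fp by simp
qed

lemma D_id_same:
  assumes "c \<in> atlas M" "p \<in> fst c"
  shows "D id c c p = oproj S"
proof (rule blinfun_eqI)
  fix v
  have p: "snd c p \<in> local_dom c c id" using assms by (simp add: local_domI)
  have "((\<lambda>x. x) has_derivative (\<lambda>x. x)) (at (snd c p) within S)" by simp
  then have "(local_rep c c id has_derivative (\<lambda>x. x)) (at (snd c p) within S)"
    by (rule has_derivative_cong_openin[OF openin_local_dom[OF C2_id assms(1,1)] p, rotated])
      (use assms in \<open>auto simp: local_dom_def local_rep_at\<close>)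
  from der_eqI[OF sub _ this] show "D id c c p v = oproj S v"
    using assms unfolding D_def by simp
qed

lemma D_inverse:
  assumes "C2 g" "C2 h" "\<And>q. q \<in> points M ==> h (g q) = q"
    and "c \<in> atlas M" "c' \<in> atlas M" "p \<in> fst c" "g p \<in> fst c'" "v \<in> S"
  shows "D h c' c (g p) (D g c c' p v) = v"
proof -
  have "h (g p) = p" using assms mem_points by blast
  then have "D id c c p = D h c' c (g p) o\<^sub>L D g c c' p"
    using D_chain[OF assms(1,2) C2_id _ assms(4,5,4,6,7)] assms by simp
  then have "D h c' c (g p) (D g c c' p v) = D id c c p v" by simp
  then show ?thesis using D_id_same[OF assms(4,6)] assms(8) by simp
qed

lemma D_id_inverse:
  assumes "c \<in> atlas M" "c' \<in> atlas M" "p \<in> fst c" "p \<in> fst c'" "v \<in> S"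
  shows "D id c' c p (D id c c' p v) = v"
  using D_inverse[OF C2_id C2_id, of c c' p v] assms by simp

lemma D_id_chain:
  assumes "c \<in> atlas M" "c' \<in> atlas M" "c'' \<in> atlas M" "p \<in> fst c" "p \<in> fst c'" "p \<in> fst c''"
  shows "D id c' c'' p (D id c c' p v) = D id c c'' p v"
  using D_chain[OF C2_id C2_id C2_id _ assms(1,2,3,4)] assms by simp

lemma chart_diff_eq:
  assumes "c \<in> atlas M" "p \<in> fst c" "v \<in> S"
  shows "chart_diff M c p v = D id (chart_at M p) c p v"
proof -
  have p: "p \<in> points M" using assms mem_points by blast
  note ca = chart_at[OF p]
  have "snd (chart_at M p) p \<in> local_dom (chart_at M p) c id"
    using ca assms by (simp add: local_domI)
  from at_within_openin[OF openin_local_dom[OF C2_id ca(1) assms(1)] this]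
  show ?thesis
    unfolding chart_diff_def D_def
    using der_apply[OF local_rep_diff(1)[OF C2_id ca(1) assms(1) ca(2)]] assms by simp
qed

lemma tangent_map_eq:
  assumes "C2 g" "p \<in> points M" "v \<in> S"
  shows "tangent_map M M g p v = D g (chart_at M p) (chart_at M (g p)) p v"
proof -
  have gp: "g p \<in> points M" using C2_points assms by blast
  note ca = chart_at[OF assms(2)] and cb = chart_at[OF gp]
  have "snd (chart_at M p) p \<in> local_dom (chart_at M p) (chart_at M (g p)) g"
    using ca cb by (simp add: local_domI)
  from at_within_openin[OF openin_local_dom[OF assms(1) ca(1) cb(1)] this]
  show ?thesis
    unfolding tangent_map_def D_def
    using der_apply[OF local_rep_diff(1)[OF assms(1) ca(1) cb(1) ca(2) cb(2)]] assms by simp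
qed

lemma
  assumes "C2 g" "c \<in> atlas M" "c' \<in> atlas M" "\<gamma> t \<in> fst c" "g (\<gamma> t) \<in> fst c'" "t \<in> I"
    and "\<forall>\<^sub>F s in at t within I. \<gamma> s \<in> fst c"
    and "((\<lambda>s. snd c (\<gamma> s)) has_vector_derivative \<xi>) (at t within I)"
  shows curve_rep: "((\<lambda>s. snd c' (g (\<gamma> s))) has_vector_derivative D g c c' (\<gamma> t) \<xi>) (at t within I)"
    and curve_D: "((\<lambda>s. D g c c' (\<gamma> s)) has_vector_derivative D2 g c c' (\<gamma> t) \<xi>) (at t within I)"
proof -
  let ?J = "{s \<in> I. \<gamma> s \<in> fst c}"
  have J: "at t within ?J = at t within I" by (rule at_within_eventually[OF assms(7)])
  have tJ: "t \<in> ?J" using assms by simp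
  have ev: "\<forall>\<^sub>F s in at t within I. snd c (\<gamma> s) \<in> S"
    using assms(7) by eventually_elim (use assms in simp)
  have S: "snd c (\<gamma> t) \<in> S" using assms by simp
  note ld = local_rep_diff[OF assms(1-5)]
  have "((\<lambda>s. local_rep c c' g (snd c (\<gamma> s))) has_vector_derivative D g c c' (\<gamma> t) \<xi>) (at t within I)"
    unfolding D_def
    by (rule has_vector_derivative_compose_within[OF assms(8) ev has_derivative_der[OF ld(1) S sub]])
  then have "((\<lambda>s. local_rep c c' g (snd c (\<gamma> s))) has_vector_derivative D g c c' (\<gamma> t) \<xi>) (at t within ?J)"
    using J by simp
  then have "((\<lambda>s. snd c' (g (\<gamma> s))) has_vector_derivative D g c c' (\<gamma> t) \<xi>) (at t within ?J)"
    by (rule has_vector_derivative_transform[OF tJ, rotated]) (use assms in \<open>auto simp: local_rep_at\<close>)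
  then show "((\<lambda>s. snd c' (g (\<gamma> s))) has_vector_derivative D g c c' (\<gamma> t) \<xi>) (at t within I)"
    using J by simp
  show "((\<lambda>s. D g c c' (\<gamma> s)) has_vector_derivative D2 g c c' (\<gamma> t) \<xi>) (at t within I)"
    unfolding D_def D2_def
    by (rule has_vector_derivative_compose_within[OF assms(8) ev has_derivative_der[OF ld(2) S sub]])
qed

lemma
  assumes "has_velocity M \<gamma> v t I" "t \<in> I" "v \<in> S"
  shows velocity_points: "\<gamma> t \<in> points M"
    and velocity_lim: "filterlim \<gamma> (nh (\<gamma> t)) (at t within I)"
    and velocity_chart: "c \<in> atlas M ==> \<gamma> t \<in> fst c ==>
      ((\<lambda>s. snd c (\<gamma> s)) has_vector_derivative chart_diff M c (\<gamma> t) v) (at t within I)"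
proof -
  let ?c = "chart_at M (\<gamma> t)"
  from assms show p: "\<gamma> t \<in> points M" unfolding has_velocity_def by blast
  note ca = chart_at[OF p]
  have ev: "\<forall>\<^sub>F s in at t within I. \<gamma> s \<in> fst ?c"
    and d: "((\<lambda>s. snd ?c (\<gamma> s)) has_vector_derivative v) (at t within I)"
    using assms unfolding has_velocity_def by (auto simp: o_def)
  have "((\<lambda>s. snd ?c (\<gamma> s)) \<longlongrightarrow> snd ?c (\<gamma> t)) (at t within I)"
    using has_vector_derivative_continuous[OF d] by (simp add: continuous_within)
  then show "filterlim \<gamma> (nh (\<gamma> t)) (at t within I)"
    using filterlim_nh_iff[OF ca] ev by blast
  show "((\<lambda>s. snd c (\<gamma> s)) has_vector_derivative chart_diff M c (\<gamma> t) v) (at t within I)"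
    if "c \<in> atlas M" "\<gamma> t \<in> fst c"
    using curve_rep[OF C2_id ca(1) that(1) ca(2) _ assms(2) ev d] that assms(3)
    by (simp add: chart_diff_eq)
qed

lemma velocity_image:
  assumes "C2 g" "has_velocity M \<gamma> v t I" "t \<in> I" "v \<in> S"
  shows "has_velocity M (\<lambda>s. g (\<gamma> s)) (tangent_map M M g (\<gamma> t) v) t I"
proof -
  note p = velocity_points[OF assms(2-4)] and lim = velocity_lim[OF assms(2-4)]
  have gp: "g (\<gamma> t) \<in> points M" using C2_points[OF assms(1) p] .
  note ca = chart_at[OF p] and cb = chart_at[OF gp]
  have ev: "\<forall>\<^sub>F s in at t within I. \<gamma> s \<in> fst (chart_at M (\<gamma> t))"
    using lim filterlim_nh_iff[OF ca] by blast
  have "((\<lambda>s. snd (chart_at M (\<gamma> t)) (\<gamma> s)) has_vector_derivative v) (at t within I)"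
    using assms(2) unfolding has_velocity_def by (simp add: o_def)
  note d = curve_rep[OF assms(1) ca(1) cb(1) ca(2) cb(2) assms(3) ev this]
  have "\<forall>\<^sub>F s in at t within I. g (\<gamma> s) \<in> fst (chart_at M (g (\<gamma> t)))"
    using filterlim_compose[OF filterlim_C2[OF assms(1) p] lim] filterlim_nh_iff[OF cb, of "\<lambda>s. g (\<gamma> s)"]
    by blast
  then show ?thesis
    unfolding has_velocity_def using d gp tangent_map_eq[OF assms(1) p assms(4)] by (simp add: o_def)
qed

text \<open>The mean value inequality on a ball of \<open>S\<close> on which the second derivative is bounded.\<close>

lemma D_lipschitz:
  assumes "C2 g" "c \<in> atlas M" "c' \<in> atlas M" "p0 \<in> fst c" "g p0 \<in> fst c'"
  shows "\<exists>C>0. \<exists>r>0. \<forall>p\<in>fst c. \<forall>q\<in>fst c. dist (snd c p0) (snd c p) < r --> dist (snd c p0) (snd c q) < r -->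
    norm (D g c c' q - D g c c' p) \<le> C * norm (snd c q - snd c p)"
proof -
  let ?X = "local_dom c c' g" and ?F = "local_rep c c' g" and ?x = "snd c p0"
  note td = twice_diff_local_rep[OF assms(1,2,3)]
  have x: "?x \<in> ?X" using local_dom_at assms by blast
  obtain O' where O: "open O'" "?X = S \<inter> O'" using td unfolding twice_diff_def openin_open by blast
  obtain r1 where r1: "r1 > 0" "ball ?x r1 \<subseteq> O'" using O x openE by blast
  have "continuous (at ?x within ?X) (der S (der S ?F))"
    using td x unfolding twice_diff_def continuous_on_eq_continuous_within by blast
  then obtain r2 where r2: "r2 > 0"
    "\<And>y. y \<in> ?X ==> dist y ?x < r2 ==> dist (der S (der S ?F) y) (der S (der S ?F) ?x) < 1"
    unfolding continuous_within_eps_delta using zero_less_one by blast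
  define r where "r = min r1 r2"
  define C where "C = norm (der S (der S ?F) ?x) + 1"
  let ?B = "S \<inter> ball ?x r"
  have B: "y \<in> ?X" "norm (der S (der S ?F) y) \<le> C" if "y \<in> ?B" for y
  proof -
    show "y \<in> ?X" using that r1 O unfolding r_def by auto
    then have "dist (der S (der S ?F) y) (der S (der S ?F) ?x) < 1"
      using r2(2) that unfolding r_def by (auto simp: dist_commute)
    then show "norm (der S (der S ?F) y) \<le> C"
      unfolding C_def dist_norm using norm_triangle_sub[of "der S (der S ?F) y" "der S (der S ?F) ?x"] by linarith
  qed
  have conv: "convex ?B" by (simp add: convex_Int subspace_imp_convex[OF sub])
  have bound: "norm (der S ?F y - der S ?F x) \<le> C * norm (y - x)" if "x \<in> ?B" "y \<in> ?B" for x y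
  proof (rule differentiable_bound[OF conv _ _ that(2,1)])
    fix z assume z: "z \<in> ?B"
    have "der S ?F differentiable (at z within S)" using td B(1)[OF z] unfolding twice_diff_def by blast
    from has_derivative_der[OF this _ sub] z
    show "(der S ?F has_derivative der S (der S ?F) z) (at z within ?B)"
      using has_derivative_subset by blast
    show "onorm (der S (der S ?F) z) \<le> C" using B(2)[OF z] by (simp add: norm_blinfun.rep_eq)
  qed
  have "C > 0" unfolding C_def by (simp add: add_nonneg_pos)
  moreover have "r > 0" unfolding r_def using r1 r2 by simp
  moreover have "norm (D g c c' q - D g c c' p) \<le> C * norm (snd c q - snd c p)"
    if "p \<in> fst c" "q \<in> fst c" "dist ?x (snd c p) < r" "dist ?x (snd c q) < r" for p q
    unfolding D_def using bound[of "snd c p" "snd c q"] that assms by simp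
  ultimately show ?thesis by blast
qed

lemma chart_diff_trans:
  assumes "c \<in> atlas M" "c' \<in> atlas M" "p \<in> fst c" "p \<in> fst c'" "v \<in> S"
  shows "chart_diff M c' p v = D id c c' p (chart_diff M c p v)"
  using assms chart_at mem_points D_id_chain by (simp add: chart_diff_eq)

text \<open>Convergence in the tangent bundle can be tested in a single chart.\<close>

lemma filterlim_tangent_bundle:
  assumes "c \<in> atlas M" "p \<in> fst c" "v \<in> S" "filterlim P (nh p) F" "\<forall>\<^sub>F x in F. V x \<in> S"
    and "((\<lambda>x. chart_diff M c (P x) (V x)) \<longlongrightarrow> chart_diff M c p v) F"
  shows "filterlim (\<lambda>x. (P x, V x)) (nhdsin TMtop (p, v)) F"
  unfolding mtopology_def[of "tangent_bundle M"]
proof (rule filterlim_nhdsin_generated)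
  let ?T = "tangent_bundle M"
  let ?\<G> = "{{x \<in> fst C. snd C x \<in> W} |C W. C \<in> atlas ?T \<and> openin (top_of_set (model ?T)) W}"
  have chS: "chart_diff M c' q w \<in> S" if "c' \<in> atlas M" "q \<in> fst c'" "w \<in> S" for c' q w
    using that chart_at mem_points by (simp add: chart_diff_eq D_S[OF C2_id])
  show "(p, v) \<in> \<Union>?\<G>"
  proof
    let ?C = "(fst c \<times> S, \<lambda>(q, w). (snd c q, chart_diff M c q w))"
    show "(p, v) \<in> {x \<in> fst ?C. snd ?C x \<in> S \<times> S}" using assms chS by simp
    show "{x \<in> fst ?C. snd ?C x \<in> S \<times> S} \<in> ?\<G>"
      using assms(1) unfolding tangent_bundle_def
      by (intro CollectI exI[of _ ?C] exI[of _ "S \<times> S"]) auto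
  qed
  fix U assume "U \<in> ?\<G>" "(p, v) \<in> U"
  then obtain c' W where c': "c' \<in> atlas M" "openin (top_of_set (S \<times> S)) W" "p \<in> fst c'"
    "(snd c' p, chart_diff M c' p v) \<in> W"
    "U = {x \<in> fst c' \<times> S. (\<lambda>(p, v). (snd c' p, chart_diff M c' p v)) x \<in> W}"
    unfolding tangent_bundle_def by auto
  obtain O' where O: "open O'" "W = (S \<times> S) \<inter> O'" using c'(2) unfolding openin_open by blast
  have ev: "\<forall>\<^sub>F x in F. P x \<in> fst c" "\<forall>\<^sub>F x in F. P x \<in> fst c'"
    and l: "((\<lambda>x. snd c' (P x)) \<longlongrightarrow> snd c' p) F"
    using assms(4) filterlim_nh_iff[OF assms(1,2)] filterlim_nh_iff[OF c'(1,3)] by blast+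
  have DD: "((\<lambda>x. D id c c' (P x)) \<longlongrightarrow> D id c c' p) F"
    by (rule filterlim_compose[OF D_tendsto[OF C2_id assms(1) c'(1) assms(2)] assms(4)]) (use c' in simp)
  have "((\<lambda>x. D id c c' (P x) (chart_diff M c (P x) (V x))) \<longlongrightarrow> D id c c' p (chart_diff M c p v)) F"
    by (intro tendsto_intros DD assms(6))
  moreover have "\<forall>\<^sub>F x in F. D id c c' (P x) (chart_diff M c (P x) (V x)) = chart_diff M c' (P x) (V x)"
    using ev assms(5) by eventually_elim (rule chart_diff_trans[OF assms(1) c'(1), symmetric])
  ultimately have "((\<lambda>x. chart_diff M c' (P x) (V x)) \<longlongrightarrow> chart_diff M c' p v) F"
    unfolding chart_diff_trans[OF assms(1) c'(1) assms(2) c'(3) assms(3)]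
    by (rule Lim_transform_eventually)
  then have "((\<lambda>x. (snd c' (P x), chart_diff M c' (P x) (V x))) \<longlongrightarrow> (snd c' p, chart_diff M c' p v)) F"
    using l by (intro tendsto_intros)
  then have "\<forall>\<^sub>F x in F. (snd c' (P x), chart_diff M c' (P x) (V x)) \<in> O'"
    using topological_tendstoD O c'(4) by blast
  then show "\<forall>\<^sub>F x in F. (P x, V x) \<in> U"
    using ev(2) assms(5) by eventually_elim (use c' O chS in auto)
qed

lemma tangent_bundle_lims:
  assumes "c \<in> atlas M" "p \<in> fst c" "v \<in> S"
  shows "filterlim fst (nh p) (nhdsin TMtop (p, v))"
    and "((\<lambda>(q, w). chart_diff M c q w) \<longlongrightarrow> chart_diff M c p v)
      (nhdsin TMtop (p, v))"
    and "\<forall>\<^sub>F x in nhdsin TMtop (p, v). snd x \<in> S"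
proof -
  let ?T = "TMtop"
  let ?C = "\<lambda>(q, w). (snd c q, chart_diff M c q w)"
  have chS: "chart_diff M c q w \<in> S" if "q \<in> fst c" "w \<in> S" for q w
    using that assms chart_at mem_points by (simp add: chart_diff_eq D_S[OF C2_id])
  have C: "(fst c \<times> S, ?C) \<in> atlas (tangent_bundle M)" "(p, v) \<in> fst (fst c \<times> S, ?C)"
    "snd (fst c \<times> S, ?C) ` fst (fst c \<times> S, ?C) \<subseteq> model (tangent_bundle M)"
    using assms chS unfolding tangent_bundle_def by auto
  have e: "\<forall>\<^sub>F x in nhdsin ?T (p, v). x \<in> fst c \<times> S"
    and t: "(?C \<longlongrightarrow> ?C (p, v)) (nhdsin ?T (p, v))"
    using mtopology_chart[OF C] by simp_all
  have "((\<lambda>x. snd c (fst x)) \<longlongrightarrow> snd c p) (nhdsin ?T (p, v))"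
    using tendsto_fst[OF t] by (simp add: case_prod_unfold)
  moreover have "\<forall>\<^sub>F x in nhdsin ?T (p, v). fst x \<in> fst c"
    using e by eventually_elim auto
  ultimately show "filterlim fst (nh p) (nhdsin ?T (p, v))"
    using filterlim_nh_iff[OF assms(1,2)] by blast
  show "((\<lambda>(q, w). chart_diff M c q w) \<longlongrightarrow> chart_diff M c p v) (nhdsin ?T (p, v))"
    using tendsto_snd[OF t] by (simp add: case_prod_unfold)
  show "\<forall>\<^sub>F x in nhdsin ?T (p, v). snd x \<in> S"
    using e by eventually_elim auto
qed

end

section \<open>Continuous subbundles\<close>

text \<open>Bases of the two planes are completed to bases of \<open>S\<close>.\<close>

lemma linear_automorphism_onto_plane:
  fixes S V W :: "'b::euclidean_space set"
  assumes "subspace S" "V \<subseteq> S" "W \<subseteq> S" "subspace V" "subspace W" "dim V = dim W"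
  obtains B B' where "linear B" "linear B'" "B ` S \<subseteq> S" "B' ` S \<subseteq> S" "B ` V = W"
    "\<And>x. x \<in> S ==> B' (B x) = x" "\<And>x. x \<in> S ==> B (B' x) = x"
proof -
  have ext: "\<exists>b e. b \<subseteq> e \<and> independent e \<and> span b = U \<and> span e = S \<and> finite e \<and> card b = dim U \<and> card e = dim S"
    if U: "U \<subseteq> S" "subspace U" for U
  proof -
    obtain b where b: "b \<subseteq> U" "independent b" "U \<subseteq> span b" "card b = dim U"
      using basis_exists by blast
    then have sb: "span b = U" using U(2) span_minimal by blast
    obtain e where e: "b \<subseteq> e" "e \<subseteq> S" "independent e" "S \<subseteq> span e"
      by (rule maximal_independent_subset_extend[of b S]) (use b U in auto)
    then have "span e = S" using assms(1) span_minimal by blast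
    moreover have "card e = dim S" using e basis_card_eq_dim by blast
    ultimately show ?thesis
      using b sb e independent_imp_finite[OF e(3)] by (intro exI[of _ b] exI[of _ e]) simp
  qed
  obtain b1 e1 where V: "b1 \<subseteq> e1" "independent e1" "span b1 = V" "span e1 = S" "finite e1"
    "card b1 = dim V" "card e1 = dim S" using ext[OF assms(2,4)] by blast
  obtain b2 e2 where W: "b2 \<subseteq> e2" "independent e2" "span b2 = W" "span e2 = S" "finite e2"
    "card b2 = dim W" "card e2 = dim S" using ext[OF assms(3,5)] by blast
  obtain h1 where h1: "bij_betw h1 b1 b2"
    using finite_same_card_bij[of b1 b2] V W assms(6) finite_subset by metis
  obtain h2 where h2: "bij_betw h2 (e1 - b1) (e2 - b2)"
    using finite_same_card_bij[of "e1 - b1" "e2 - b2"] V W assms(6)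
    by (metis card_Diff_subset finite_Diff finite_subset)
  define h where "h x = (if x \<in> b1 then h1 x else h2 x)" for x
  have hb: "bij_betw h b1 b2" "bij_betw h (e1 - b1) (e2 - b2)"
    using h1 h2 by (auto simp: h_def intro: bij_betw_cong[THEN iffD1])
  then have he: "bij_betw h e1 e2"
    using bij_betw_combine[OF hb] V(1) W(1) by (simp add: Un_absorb1)
  obtain B where B: "linear B" "\<And>x. x \<in> e1 ==> B x = h x"
    using linear_independent_extend[OF V(2)] by blast
  obtain B' where B': "linear B'" "\<And>x. x \<in> e2 ==> B' x = inv_into e1 h x"
    using linear_independent_extend[OF W(2)] by blast
  have Bb: "B ` b1 = b2" "B ` e1 = e2"
  proof -
    have "B ` b1 = h ` b1" "B ` e1 = h ` e1" using B(2) V(1) by (auto intro!: image_cong)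
    then show "B ` b1 = b2" "B ` e1 = e2" using hb(1) he by (simp_all add: bij_betw_def)
  qed
  have "B' ` e2 = inv_into e1 h ` e2" using B'(2) by (intro image_cong) auto
  then have "B' ` e2 = e1"
    using bij_betw_inv_into[OF he] by (simp add: bij_betw_def)
  show ?thesis
  proof (rule that[OF B(1) B'(1)])
    show "B ` S \<subseteq> S" using linear_span_image[OF B(1), of e1] Bb V W by simp
    show "B' ` S \<subseteq> S" using linear_span_image[OF B'(1), of e2] \<open>B' ` e2 = e1\<close> V W by simp
    show "B ` V = W" using linear_span_image[OF B(1), of b1] Bb V W by simp
    have "(B' \<circ> B) x = id x" if "x \<in> e1" for x
      using that B B' he bij_betw_inv_into_left[OF he] by (auto simp: bij_betw_def)
    then show "B' (B x) = x" if "x \<in> S" for x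
      using linear_eq_on[OF linear_compose[OF B(1) B'(1)] linear_id, of x e1] V that by simp
    have "(B \<circ> B') x = id x" if "x \<in> e2" for x
      using that B B' he bij_betw_inv_into_right[OF he] inv_into_into[of x h e1]
      by (auto simp: bij_betw_def)
    then show "B (B' x) = x" if "x \<in> S" for x
      using linear_eq_on[OF linear_compose[OF B'(1) B(1)] linear_id, of x e2] W that by simp
  qed
qed

context
  fixes d :: nat and S :: "'b::euclidean_space set"
  assumes S: "subspace S" and ne: "planes d S \<noteq> {}"
begin

lemma ref_plane: "subspace (ref_plane d S)" "ref_plane d S \<subseteq> S" "dim (ref_plane d S) = d"
  using someI_ex[of "\<lambda>V. V \<in> planes d S"] ne unfolding ref_plane_def planes_def by auto

lemma slopes_iff:
  "A \<in> slopes d S \<longleftrightarrow> (\<forall>x. blinfun_apply A (oproj (ref_plane d S) x) = blinfun_apply A x \<and>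
     blinfun_apply A x \<in> S \<and> oproj (ref_plane d S) (blinfun_apply A x) = 0)" (is "_ \<longleftrightarrow> ?R")
proof
  let ?V = "ref_plane d S"
  assume A: "A \<in> slopes d S"
  have 1: "A (oproj ?V x) = A x" for x
  proof -
    have "A (x - oproj ?V x) = 0"
      using A oproj_orth[OF ref_plane(1)] unfolding slopes_def by blast
    then show ?thesis by (simp add: blinfun.diff_right)
  qed
  have "A x \<in> S \<and> oproj ?V (A x) = 0" for x
    using A oproj_mem[OF ref_plane(1), of x] oproj_zero[OF ref_plane(1), of "A (oproj ?V x)"]
    unfolding slopes_def 1[of x, symmetric] by blast
  then show ?R using 1 by blast
next
  let ?V = "ref_plane d S"
  assume R: ?R
  have "A x \<bullet> y = 0" if "y \<in> ?V" for x y
    using oproj_orth[OF ref_plane(1) that, of "A x"] R by simp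
  moreover have "A z = 0" if "\<forall>y\<in>?V. z \<bullet> y = 0" for z
    using oproj_zero[OF ref_plane(1) that] R by (metis blinfun.zero_right)
  ultimately show "A \<in> slopes d S" using R unfolding slopes_def by blast
qed

lemma slope_graph_iff:
  assumes "A \<in> slopes d S"
  shows "w \<in> slope_graph d S A \<longleftrightarrow> w - oproj (ref_plane d S) w = A (oproj (ref_plane d S) w)"
proof
  let ?P = "oproj (ref_plane d S)"
  have A: "?P (A x) = 0" "A (?P x) = A x" for x using assms unfolding slopes_iff by blast+
  show "w - ?P w = A (?P w)" if "w \<in> slope_graph d S A"
  proof -
    obtain x where x: "x \<in> ref_plane d S" "w = x + A x" using \<open>w \<in> _\<close> unfolding slope_graph_def by blast
    then have "?P w = x" using oproj_id[OF ref_plane(1) x(1)] A(1) by (simp add: blinfun.add_right)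
    then show ?thesis using x by simp
  qed
  show "w \<in> slope_graph d S A" if "w - ?P w = A (?P w)"
  proof -
    have "w = ?P w + A (?P w)" using that by (simp add: algebra_simps)
    then show ?thesis unfolding slope_graph_def using oproj_mem[OF ref_plane(1)] by (intro image_eqI) auto
  qed
qed

lemma slope_graph_inj:
  assumes "A \<in> slopes d S" "A' \<in> slopes d S" "slope_graph d S A = slope_graph d S A'"
  shows "A = A'"
proof (rule blinfun_eqI)
  fix x
  let ?P = "oproj (ref_plane d S)"
  have A: "?P (A x) = 0" "A (?P x) = A x" for x using assms(1) unfolding slopes_iff by blast+
  have A': "A' (?P x) = A' x" for x using assms(2) unfolding slopes_iff by blast+
  let ?w = "?P x + A (?P x)"
  have "?w \<in> slope_graph d S A"
    unfolding slope_graph_def using oproj_mem[OF ref_plane(1)] by blast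
  then have "?w - ?P ?w = A' (?P ?w)"
    using slope_graph_iff[OF assms(2)] assms(3) by blast
  moreover have "?P ?w = ?P x"
    using A oproj_id[OF ref_plane(1) oproj_mem[OF ref_plane(1)]] by (simp add: blinfun.add_right)
  ultimately have "A (?P x) = A' (?P x)" by simp
  then show "A x = A' x" unfolding A(2) A' .
qed

lemma slope_graph_subset: "A \<in> slopes d S ==> slope_graph d S A \<subseteq> S"
  using ref_plane(2) S unfolding slope_graph_def slopes_iff by (auto intro: subspace_add)

lemma zero_slope: "0 \<in> slopes d S" "slope_graph d S 0 = ref_plane d S"
  using S unfolding slopes_def slope_graph_def by (auto simp: subspace_0)

lemma subspace_slopes: "subspace (slopes d S)"
  unfolding subspace_def
proof safe
  show "0 \<in> slopes d S" by (rule zero_slope)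
  fix A A' and a :: real
  assume A: "A \<in> slopes d S"
  then show "a *\<^sub>R A \<in> slopes d S"
    using S unfolding slopes_iff by (simp add: blinfun.scaleR_left blinfun.scaleR_right subspace_scale)
  assume "A' \<in> slopes d S"
  with A show "A + A' \<in> slopes d S"
    using S unfolding slopes_iff by (simp add: blinfun.add_left blinfun.add_right subspace_add)
qed

end

context smooth_mfd
begin

text \<open>Fibres at different points are compared in the coordinates of a chart.\<close>

definition EE :: "('m, 'b) subbundle => ('m, 'b) chart => 'm => 'b set" where
  "EE E c p = chart_diff M c p ` E p"

lemma topspace_grassmann:
  "topspace (mtopology (Gr d)) \<subseteq> (\<Union>C\<in>atlas (Gr d). fst C)"
  unfolding mtopology_def by auto

lemma subbundle_planes:
  assumes "continuous_subbundle M d E" "p \<in> points M"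
  shows "E p \<in> planes d S"
proof -
  have "(p, E p) \<in> topspace (mtopology (Gr d))"
    using assms continuous_map_image_subset_topspace topspace_M
    unfolding continuous_subbundle_def plane_section_def by fastforce
  then show ?thesis
    using topspace_grassmann[of d] by (auto simp: grassmann_bundle_def grassmann_chart_def)
qed

lemma chart_diff_S: "c \<in> atlas M ==> p \<in> fst c ==> v \<in> S ==> chart_diff M c p v \<in> S"
  using chart_at mem_points by (simp add: chart_diff_eq D_S[OF C2_id])

lemma D_chart_diff:
  assumes "C2 g" "c \<in> atlas M" "c' \<in> atlas M" "p \<in> fst c" "g p \<in> fst c'" "v \<in> S"
  shows "D g c c' p (chart_diff M c p v) = chart_diff M c' (g p) (tangent_map M M g p v)"
proof -
  have p: "p \<in> points M" "g p \<in> points M" using assms mem_points C2_points by blast+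
  note ca = chart_at[OF p(1)] and cb = chart_at[OF p(2)]
  have "D g c c' p (D id (chart_at M p) c p v) = D g (chart_at M p) c' p v"
    using D_chain[OF C2_id assms(1,1) _ ca(1) assms(2,3) ca(2), of] assms by simp
  moreover have "D id (chart_at M (g p)) c' (g p) (D g (chart_at M p) (chart_at M (g p)) p v)
      = D g (chart_at M p) c' p v"
    using D_chain[OF assms(1) C2_id assms(1) _ ca(1) cb(1) assms(3) ca(2) cb(2)] assms by simp
  ultimately show ?thesis
    using assms p tangent_map_eq[OF assms(1) p(1) assms(6)]
    by (simp add: chart_diff_eq D_S[OF assms(1) ca(1) cb(1) ca(2) cb(2)])
qed

lemma chart_diff_inverse:
  assumes "c \<in> atlas M" "p \<in> fst c"
  shows "v \<in> S ==> D id c (chart_at M p) p (chart_diff M c p v) = v"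
    and "\<xi> \<in> S ==> chart_diff M c p (D id c (chart_at M p) p \<xi>) = \<xi>"
  using assms chart_at[of p] mem_points
  by (simp_all add: chart_diff_eq D_id_inverse D_S[OF C2_id])

lemma
  assumes "c \<in> atlas M" "p \<in> fst c" "E p \<subseteq> S" "subspace (E p)"
  shows EE_S: "EE E c p \<subseteq> S" and subspace_EE: "subspace (EE E c p)" and dim_EE: "dim (EE E c p) = dim (E p)"
proof -
  let ?D = "D id (chart_at M p) c p"
  have e: "EE E c p = ?D ` E p"
    unfolding EE_def using assms by (intro image_cong refl chart_diff_eq) auto
  have l: "linear ?D" by (simp add: blinfun.bounded_linear_right bounded_linear.linear)
  have inj: "inj_on ?D (E p)"
  proof (rule inj_on_inverseI)
    fix v assume "v \<in> E p"
    then show "D id c (chart_at M p) p (?D v) = v"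
      using assms chart_at[of p] mem_points by (intro D_id_inverse) auto
  qed
  show "EE E c p \<subseteq> S" unfolding EE_def using assms chart_diff_S by blast
  show "subspace (EE E c p)" unfolding e using linear_subspace_image[OF l assms(4)] .
  show "dim (EE E c p) = dim (E p)"
    unfolding e using dim_image_eq[OF l, of "E p"] inj span_eq_iff[THEN iffD2, OF assms(4)] by simp
qed

text \<open>The coordinate of the plane \<open>E p\<close> in the affine chart of the Grassmannian.\<close>

definition slope :: "nat => ('m, 'b) subbundle => ('m, 'b) chart => ('b => 'b) => 'm => 'b \<Rightarrow>\<^sub>L 'b" where
  "slope d E c B p = snd (snd (gchart d c B) (p, E p))"

lemma grassmann_chart_value:
  assumes ne: "planes d S \<noteq> {}" and B: "bij_betw B S S"
    and A: "A \<in> slopes d S" "chart_diff M c p ` V = B ` slope_graph d S A"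
  shows "snd (gchart d c B) (p, V) = (snd c p, A)"
proof -
  have "A' = A" if "A' \<in> slopes d S" "chart_diff M c p ` V = B ` slope_graph d S A'" for A'
  proof -
    have "slope_graph d S A' = slope_graph d S A"
      using that A B slope_graph_subset[OF sub ne]
      by (metis bij_betw_def inj_on_image_eq_iff)
    then show ?thesis using slope_graph_inj[OF sub ne] that A by blast
  qed
  then show ?thesis
    unfolding grassmann_chart_def using A by (auto intro!: the_equality)
qed

lemma grassmann_chart_model:
  assumes B: "bij_betw B S S" and c: "c \<in> atlas M"
  shows "snd (gchart d c B) ` fst (gchart d c B) \<subseteq> model (Gr d)"
proof (rule image_subsetI)
  fix x assume x: "x \<in> fst (gchart d c B)"
  obtain p V where pV: "x = (p, V)" by fastforce
  obtain A where A: "p \<in> fst c" "V \<in> planes d S" "A \<in> slopes d S" "chart_diff M c p ` V = B ` slope_graph d S A"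
    using x unfolding pV grassmann_chart_def by auto
  then have "planes d S \<noteq> {}" by blast
  from grassmann_chart_value[OF this B A(3,4)]
  show "snd (gchart d c B) x \<in> model (Gr d)"
    using c A unfolding pV grassmann_bundle_def by simp
qed

lemma grassmann_atlas:
  "c \<in> atlas M ==> linear B ==> bij_betw B S S ==>
    gchart d c B \<in> atlas (Gr d)"
  unfolding grassmann_bundle_def by (simp del: split_paired_Ex) blast

lemma slope_local:
  assumes E: "continuous_subbundle M d E" and c: "c \<in> atlas M" and B: "linear B" "bij_betw B S S"
    and p: "p \<in> points M" "(p, E p) \<in> fst (gchart d c B)"
  shows "p \<in> fst c" "slope d E c B p \<in> slopes d S"
    and "EE E c p = B ` slope_graph d S (slope d E c B p)"
    and "\<forall>\<^sub>F q in nh p. (q, E q) \<in> fst (gchart d c B)"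
    and "(slope d E c B \<longlongrightarrow> slope d E c B p) (nh p)"
proof -
  let ?C = "gchart d c B" and ?G = "Gr d"
  obtain A where A: "p \<in> fst c" "A \<in> slopes d S" "chart_diff M c p ` E p = B ` slope_graph d S A"
    using p unfolding grassmann_chart_def by auto
  have "slope d E c B p = A"
    using grassmann_chart_value[OF _ B(2) A(2,3)] subbundle_planes[OF E p(1)] unfolding slope_def by fastforce
  then show "p \<in> fst c" "slope d E c B p \<in> slopes d S"
    "EE E c p = B ` slope_graph d S (slope d E c B p)"
    using A unfolding EE_def by auto
  have C: "?C \<in> atlas ?G" using grassmann_atlas c B by blast
  note mc = mtopology_chart[OF C p(2) grassmann_chart_model[OF B(2) c]]
  have lim: "filterlim (plane_section E) (nhdsin (mtopology ?G) (p, E p)) (nh p)"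
    using filterlim_continuous_map[OF E[unfolded continuous_subbundle_def]] p(1) topspace_M
    unfolding nh_def plane_section_def by metis
  show "\<forall>\<^sub>F q in nh p. (q, E q) \<in> fst ?C"
    using eventually_compose_filterlim[OF mc(1) lim] unfolding plane_section_def .
  show "(slope d E c B \<longlongrightarrow> slope d E c B p) (nh p)"
    using tendsto_snd[OF filterlim_compose[OF mc(2) lim]]
    unfolding plane_section_def slope_def[abs_def] by simp
qed

lemma exists_grassmann_chart:
  assumes E: "continuous_subbundle M d E" and c: "c \<in> atlas M" "p \<in> fst c"
  obtains B B' where "linear B" "linear B'" "B ` S \<subseteq> S" "B' ` S \<subseteq> S"
    "\<And>x. x \<in> S ==> B' (B x) = x" "\<And>x. x \<in> S ==> B (B' x) = x" "bij_betw B S S"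
    "(p, E p) \<in> fst (gchart d c B)"
proof -
  have p: "p \<in> points M" using c mem_points by blast
  note pl = subbundle_planes[OF E p]
  then have ne: "planes d S \<noteq> {}" and Ep: "E p \<subseteq> S" "subspace (E p)" "dim (E p) = d"
    unfolding planes_def by auto
  note EE = EE_S[where E = E, OF c Ep(1,2)] subspace_EE[where E = E, OF c Ep(1,2)]
    dim_EE[where E = E, OF c Ep(1,2)]
  obtain B B' where B: "linear B" "linear B'" "B ` S \<subseteq> S" "B' ` S \<subseteq> S" "B ` ref_plane d S = EE E c p"
    "\<And>x. x \<in> S ==> B' (B x) = x" "\<And>x. x \<in> S ==> B (B' x) = x"
    using linear_automorphism_onto_plane[OF sub ref_plane(2)[OF sub ne] EE(1) ref_plane(1)[OF sub ne] EE(2)]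
      EE(3) Ep(3) ref_plane(3)[OF sub ne] by metis
  have bij: "bij_betw B S S"
    using B by (intro bij_betw_byWitness[of S B']) auto
  have "(p, E p) \<in> fst (gchart d c B)"
  proof -
    have "chart_diff M c p ` E p = B ` slope_graph d S 0"
      using B(5) zero_slope(2)[OF sub ne] unfolding EE_def by simp
    then show ?thesis
      unfolding grassmann_chart_def using c pl zero_slope(1)[OF sub ne] by auto
  qed
  then show ?thesis using that B bij by blast
qed

text \<open>The total space of a continuous subbundle is closed: in a chart of the Grassmann bundle,
  membership in the fibre is the vanishing of the function \<open>\<Phi>\<close>, which depends continuously on the slope.\<close>

lemma subbundle_closed:
  assumes E: "continuous_subbundle M d E" and c: "c \<in> atlas M" "p \<in> fst c" and "\<xi> \<notin> EE E c p"
    and "filterlim P (nh p) F" "(X \<longlongrightarrow> \<xi>) F"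
  shows "\<forall>\<^sub>F x in F. X x \<notin> EE E c (P x)"
proof (cases "\<xi> \<in> S")
  case False
  have "open (- S)" using closed_subspace[OF sub] by (simp add: open_closed)
  then have "\<forall>\<^sub>F x in F. X x \<in> - S" using topological_tendstoD[OF assms(6)] False by blast
  moreover have "\<forall>\<^sub>F x in F. P x \<in> fst c" using filterlim_nh_iff[OF c] assms(5) by blast
  ultimately show ?thesis
  proof eventually_elim
    case (elim x)
    then have "P x \<in> points M" using c mem_points by blast
    from subbundle_planes[OF E this] have "EE E c (P x) \<subseteq> S"
      using EE_S[where E = E, OF c(1) elim(2)] unfolding planes_def by blast
    then show ?case using elim by blast
  qed
next
  case True
  have p: "p \<in> points M" using c mem_points by blast
  have ne: "planes d S \<noteq> {}" using subbundle_planes[OF E p] by blast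
  obtain B B' where B: "linear B" "linear B'" "B ` S \<subseteq> S" "B' ` S \<subseteq> S"
    "\<And>x. x \<in> S ==> B' (B x) = x" "\<And>x. x \<in> S ==> B (B' x) = x" "bij_betw B S S"
    and pB: "(p, E p) \<in> fst (gchart d c B)"
    using exists_grassmann_chart[OF E c] by blast
  let ?P = "oproj (ref_plane d S)" and ?A = "slope d E c B"
  define \<Phi> where "\<Phi> q x = (B' x - ?P (B' x)) - ?A q (?P (B' x))" for q x
  note sl = slope_local[OF E c(1) B(1,7) p pB]
  have iff: "\<Phi> q x = 0" if "q \<in> points M" "(q, E q) \<in> fst (gchart d c B)" "x \<in> EE E c q" for q x
  proof -
    note sl = slope_local[OF E c(1) B(1,7) that(1,2)]
    obtain w where w: "w \<in> slope_graph d S (?A q)" "x = B w" using \<open>x \<in> EE E c q\<close> sl(3) by blast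
    then have "B' x = w" using slope_graph_subset[OF sub ne sl(2)] B by blast
    then show ?thesis using slope_graph_iff[OF sub ne sl(2)] w unfolding \<Phi>_def by simp
  qed
  have "\<Phi> p \<xi> \<noteq> 0"
  proof
    assume "\<Phi> p \<xi> = 0"
    then have "B' \<xi> \<in> slope_graph d S (?A p)"
      using slope_graph_iff[OF sub ne sl(2)] unfolding \<Phi>_def by simp
    then have "B (B' \<xi>) \<in> EE E c p" using sl(3) by blast
    then show False using B True assms(4) by simp
  qed
  have bB': "bounded_linear B'" using B(2) linear_conv_bounded_linear by blast
  have "((\<lambda>x. \<Phi> (P x) (X x)) \<longlongrightarrow> \<Phi> p \<xi>) F"
    unfolding \<Phi>_def
    by (intro tendsto_intros bounded_linear.tendsto[OF bB'] assms(6) filterlim_compose[OF sl(5) assms(5)])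
  then have "\<forall>\<^sub>F x in F. \<Phi> (P x) (X x) \<noteq> 0"
    using \<open>\<Phi> p \<xi> \<noteq> 0\<close> tendsto_imp_eventually_ne by blast
  moreover have "\<forall>\<^sub>F x in F. P x \<in> fst c" using filterlim_nh_iff[OF c] assms(5) by blast
  moreover have "\<forall>\<^sub>F x in F. (P x, E (P x)) \<in> fst (gchart d c B)"
    using eventually_compose_filterlim[OF sl(4) assms(5)] .
  ultimately show ?thesis
    by eventually_elim (use iff c mem_points in blast)
qed

end

section \<open>Projections of a splitting\<close>

context smooth_mfd
begin

definition subb :: "('m, 'b) subbundle => bool" where
  "subb E \<longleftrightarrow> (\<exists>d. continuous_subbundle M d E)"

lemma subb_fibre: "subb E ==> p \<in> points M ==> E p \<subseteq> S \<and> subspace (E p)"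
  using subbundle_planes unfolding subb_def planes_def by blast

lemma subb_EE:
  assumes "subb E" "c \<in> atlas M" "p \<in> fst c"
  shows "EE E c p \<subseteq> S" "subspace (EE E c p)"
  using EE_S[where E = E, OF assms(2,3)] subspace_EE[where E = E, OF assms(2,3)]
    subb_fibre[OF assms(1) mem_points[OF assms(2,3)]] by blast+

lemma subb_closed:
  assumes "subb E" "c \<in> atlas M" "p \<in> fst c" "\<xi> \<notin> EE E c p"
    and "filterlim P (nh p) F" "(X \<longlongrightarrow> \<xi>) F"
  shows "\<forall>\<^sub>F x in F. X x \<notin> EE E c (P x)"
  using subbundle_closed assms unfolding subb_def by blast

lemma chart_diff_linear:
  assumes "c \<in> atlas M" "p \<in> fst c" "v \<in> S" "w \<in> S"
  shows "chart_diff M c p (v + w) = chart_diff M c p v + chart_diff M c p w"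
  using assms by (simp add: chart_diff_eq blinfun.add_right)

lemma EE_bundle_sum:
  assumes "c \<in> atlas M" "p \<in> fst c" "R p \<subseteq> S" "T p \<subseteq> S"
  shows "EE (bundle_sum R T) c p = {a + b |a b. a \<in> EE R c p \<and> b \<in> EE T c p}" (is "?l = ?r")
proof
  show "?l \<subseteq> ?r"
  proof
    fix x assume "x \<in> ?l"
    then obtain v w where "v \<in> R p" "w \<in> T p" "x = chart_diff M c p (v + w)"
      unfolding EE_def bundle_sum_def by blast
    then have "x = chart_diff M c p v + chart_diff M c p w" "chart_diff M c p v \<in> EE R c p"
      "chart_diff M c p w \<in> EE T c p"
      using chart_diff_linear assms unfolding EE_def by blast+
    then show "x \<in> ?r" by blast
  qed
  show "?r \<subseteq> ?l"
  proof
    fix x assume "x \<in> ?r"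
    then obtain v w where vw: "v \<in> R p" "w \<in> T p" "x = chart_diff M c p v + chart_diff M c p w"
      unfolding EE_def by blast
    then have "x = chart_diff M c p (v + w)" using chart_diff_linear assms by (metis subsetD)
    then show "x \<in> ?l" using vw(1,2) unfolding EE_def bundle_sum_def by blast
  qed
qed

text \<open>The projection onto \<open>R\<close> along \<open>T\<close>, in the coordinates of the chart \<open>c\<close>.\<close>

definition proj :: "('m, 'b) subbundle => ('m, 'b) subbundle => ('m, 'b) chart => 'm => 'b \<Rightarrow>\<^sub>L 'b" where
  "proj R T c p = Blinfun (\<lambda>\<xi>. THE a. a \<in> EE R c p \<and> oproj S \<xi> - a \<in> EE T c p)"

context
  fixes R T :: "('m, 'b) subbundle"
  assumes split: "splitting M R T"
begin

lemma split_subb: "subb R" "subb T"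
  using split unfolding splitting_def subb_def by blast+

lemma split_unique:
  assumes c: "c \<in> atlas M" "p \<in> fst c"
    and "a \<in> EE R c p" "a' \<in> EE R c p" "x - a \<in> EE T c p" "x - a' \<in> EE T c p"
  shows "a = a'"
proof -
  have p: "p \<in> points M" using c mem_points by blast
  have "a - a' \<in> EE R c p" using subb_EE(2)[OF split_subb(1) c] assms subspace_diff by blast
  moreover have "(x - a') - (x - a) \<in> EE T c p"
    using subb_EE(2)[OF split_subb(2) c] assms subspace_diff by blast
  then have "a - a' \<in> EE T c p" by simp
  ultimately obtain r t where rt: "r \<in> R p" "t \<in> T p" "a - a' = chart_diff M c p r"
    "a - a' = chart_diff M c p t" unfolding EE_def by blast
  then have rS: "r \<in> S" "t \<in> S" using subb_fibre split_subb p by blast+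
  have "r = t" using chart_diff_inverse(1)[OF c] rt rS by metis
  then have "r = 0" using split p rt unfolding splitting_def by blast
  then have "a - a' = 0" using rt(3) c by (simp add: chart_diff_eq)
  then show ?thesis by simp
qed

lemma split_exists:
  assumes c: "c \<in> atlas M" "p \<in> fst c"
  shows "\<exists>a. a \<in> EE R c p \<and> oproj S \<xi> - a \<in> EE T c p"
proof -
  have p: "p \<in> points M" using c mem_points by blast
  let ?x = "oproj S \<xi>"
  have "D id c (chart_at M p) p ?x \<in> bundle_sum R T p"
    using split p D_S[OF C2_id c(1) chart_at(1)[OF p] c(2)] chart_at(2)[OF p]
    unfolding splitting_def by simp
  then obtain r t where rt: "r \<in> R p" "t \<in> T p" "D id c (chart_at M p) p ?x = r + t"
    unfolding bundle_sum_def by blast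
  have S: "r \<in> S" "t \<in> S" using rt subb_fibre split_subb p by blast+
  have "?x = chart_diff M c p (r + t)" using chart_diff_inverse(2)[OF c, of ?x] rt(3) by simp
  also have "\<dots> = chart_diff M c p r + chart_diff M c p t" by (rule chart_diff_linear[OF c S])
  finally have "?x - chart_diff M c p r = chart_diff M c p t" by simp
  then show ?thesis using rt unfolding EE_def by (intro exI[of _ "chart_diff M c p r"]) auto
qed

context
  fixes c p
  assumes c: "c \<in> atlas M" "p \<in> fst c"
begin

lemma proj_aux:
  defines "h \<equiv> \<lambda>\<xi>. THE a. a \<in> EE R c p \<and> oproj S \<xi> - a \<in> EE T c p"
  shows "h \<xi> \<in> EE R c p" "oproj S \<xi> - h \<xi> \<in> EE T c p" "blinfun_apply (proj R T c p) = h"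
proof -
  have h: "h \<xi> \<in> EE R c p \<and> oproj S \<xi> - h \<xi> \<in> EE T c p" for \<xi>
    unfolding h_def by (rule theI') (use split_exists[OF c] split_unique[OF c] in blast)
  then show "h \<xi> \<in> EE R c p" "oproj S \<xi> - h \<xi> \<in> EE T c p" by blast+
  note sR = subb_EE(2)[OF split_subb(1) c] and sT = subb_EE(2)[OF split_subb(2) c]
  have "linear h"
  proof
    fix x y and a :: real
    have "(oproj S x - h x) + (oproj S y - h y) \<in> EE T c p" using h sT subspace_add by blast
    then have "oproj S (x + y) - (h x + h y) \<in> EE T c p" by (simp add: blinfun.add_right algebra_simps)
    moreover have "h x + h y \<in> EE R c p" using h sR subspace_add by blast
    ultimately show "h (x + y) = h x + h y" using h split_unique[OF c] by blast
    have "a *\<^sub>R (oproj S x - h x) \<in> EE T c p" using h sT subspace_scale by blast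
    then have "oproj S (a *\<^sub>R x) - a *\<^sub>R h x \<in> EE T c p"
      by (simp add: blinfun.scaleR_right scaleR_diff_right)
    moreover have "a *\<^sub>R h x \<in> EE R c p" using h sR subspace_scale by blast
    ultimately show "h (a *\<^sub>R x) = a *\<^sub>R h x" using h split_unique[OF c] by blast
  qed
  then have "bounded_linear h" using linear_conv_bounded_linear by blast
  then show "blinfun_apply (proj R T c p) = h"
    unfolding proj_def h_def by (rule bounded_linear_Blinfun_apply)
qed

lemma proj_mem: "proj R T c p \<xi> \<in> EE R c p" "oproj S \<xi> - proj R T c p \<xi> \<in> EE T c p"
  using proj_aux by metis+

lemma proj_eqI: "a \<in> EE R c p ==> oproj S \<xi> - a \<in> EE T c p ==> proj R T c p \<xi> = a"
  using split_unique[OF c] proj_mem by blast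

lemma proj_oproj: "proj R T c p (oproj S \<xi>) = proj R T c p \<xi>"
  using proj_mem[of \<xi>] by (intro proj_eqI) auto

lemma proj_id: "a \<in> EE R c p ==> proj R T c p a = a"
  using subb_EE[OF split_subb(1) c] subspace_0[OF subb_EE(2)[OF split_subb(2) c]]
  by (intro proj_eqI) (auto simp: subset_iff)

lemma proj_zero: "b \<in> EE T c p ==> proj R T c p b = 0"
  using subb_EE[OF split_subb(2) c] subspace_0[OF subb_EE(2)[OF split_subb(1) c]]
  by (intro proj_eqI) (auto simp: subset_iff)

end

text \<open>A map that preserves both bundles of the splitting commutes with the projections.\<close>

lemma proj_D:
  assumes g: "C2 g" and c: "c \<in> atlas M" "c' \<in> atlas M" "p \<in> fst c" "g p \<in> fst c'"
    and R: "\<And>\<xi>. \<xi> \<in> EE R c p ==> D g c c' p \<xi> \<in> EE R c' (g p)"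
    and T: "\<And>\<xi>. \<xi> \<in> EE T c p ==> D g c c' p \<xi> \<in> EE T c' (g p)"
  shows "proj R T c' (g p) (D g c c' p \<xi>) = D g c c' p (proj R T c p \<xi>)"
proof (rule proj_eqI[OF c(2,4)])
  show "D g c c' p (proj R T c p \<xi>) \<in> EE R c' (g p)" using R proj_mem[OF c(1,3)] by blast
  have "D g c c' p (oproj S \<xi> - proj R T c p \<xi>) \<in> EE T c' (g p)" using T proj_mem[OF c(1,3)] by blast
  then show "oproj S (D g c c' p \<xi>) - D g c c' p (proj R T c p \<xi>) \<in> EE T c' (g p)"
    using D_S[OF g c] by (simp add: blinfun.diff_right D_oproj[OF g c])
qed

text \<open>The projections depend continuously on the point because both bundles are closed and the
  unit sphere is compact.\<close>

lemma proj_tendsto: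
  assumes c: "c \<in> atlas M" "p \<in> fst c"
  shows "(proj R T c \<longlongrightarrow> proj R T c p) (nh p)"
proof (rule tendsto_componentwise1)
  fix \<xi> :: 'b
  let ?P = "\<lambda>q. proj R T c q \<xi>" and ?x = "oproj S \<xi>"
  have ev: "\<forall>\<^sub>F q in nh p. q \<in> fst c" by (rule eventually_chart[OF c])
  have fst_lim: "filterlim fst (nh p) (nh p \<times>\<^sub>F G)" for G :: "'x filter" by (rule filterlim_fst)
  have tube: "\<forall>\<^sub>F q in nh p. \<forall>y\<in>K. \<not> (fst y \<in> EE R c q \<and> snd y - fst y \<in> EE T c q)"
    if K: "compact K" "\<And>y. y \<in> K ==> \<not> (fst y \<in> EE R c p \<and> snd y - fst y \<in> EE T c p)"
    for K :: "('b \<times> 'b) set"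
  proof (rule eventually_tube[OF K(1)])
    fix y assume "y \<in> K"
    have s: "(snd \<longlongrightarrow> y) (nh p \<times>\<^sub>F nhds y)" by (rule filterlim_snd)
    from K(2)[OF \<open>y \<in> K\<close>] show "\<forall>\<^sub>F z in nh p \<times>\<^sub>F nhds y.
        \<not> (fst (snd z) \<in> EE R c (fst z) \<and> snd (snd z) - fst (snd z) \<in> EE T c (fst z))"
    proof (cases "fst y \<in> EE R c p")
      case False
      from subb_closed[OF split_subb(1) c this fst_lim tendsto_fst[OF s]]
      show ?thesis by eventually_elim blast
    next
      case True
      then have "snd y - fst y \<notin> EE T c p" using K(2)[OF \<open>y \<in> K\<close>] by blast
      from subb_closed[OF split_subb(2) c this fst_lim tendsto_diff[OF tendsto_snd[OF s] tendsto_fst[OF s]]]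
      show ?thesis by eventually_elim blast
    qed
  qed
  define \<delta> where "\<delta> = 1 / (norm (proj R T c p) + 1)"
  have n1: "norm (proj R T c p) + 1 > 0" by (simp add: add_nonneg_pos)
  then have d: "\<delta> > 0" unfolding \<delta>_def by simp
  have "\<forall>\<^sub>F q in nh p. \<forall>y\<in>sphere (0::'b) 1 \<times> (cball 0 \<delta> \<inter> S).
      \<not> (fst y \<in> EE R c q \<and> snd y - fst y \<in> EE T c q)"
  proof (rule tube)
    show "compact (sphere (0::'b) 1 \<times> (cball 0 \<delta> \<inter> S))"
      by (intro compact_Times compact_sphere compact_Int_closed compact_cball closed_subspace sub)
    fix y :: "'b \<times> 'b" assume y: "y \<in> sphere 0 1 \<times> (cball 0 \<delta> \<inter> S)"
    show "\<not> (fst y \<in> EE R c p \<and> snd y - fst y \<in> EE T c p)"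
    proof
      assume "fst y \<in> EE R c p \<and> snd y - fst y \<in> EE T c p"
      then have "proj R T c p (snd y) = fst y" using y by (intro proj_eqI[OF c]) auto
      then have "1 \<le> norm (proj R T c p) * norm (snd y)"
        using norm_blinfun[of "proj R T c p" "snd y"] y by auto
      also have "\<dots> \<le> norm (proj R T c p) * \<delta>" using y by (intro mult_left_mono) auto
      also have "\<dots> < 1" unfolding \<delta>_def using n1 by (simp add: field_simps)
      finally show False by simp
    qed
  qed
  then have bound: "\<forall>\<^sub>F q in nh p. norm (?P q) * \<delta> \<le> norm ?x"
    using ev
  proof eventually_elim
    case (elim q)
    note m = proj_mem[OF c(1) elim(2), of \<xi>]
    show ?case
    proof (rule ccontr)
      assume neg: "\<not> norm (?P q) * \<delta> \<le> norm ?x"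
      then have n0: "norm (?P q) > 0" using d by (cases "?P q = 0") auto
      let ?y = "(inverse (norm (?P q)) *\<^sub>R ?P q, inverse (norm (?P q)) *\<^sub>R ?x)"
      have "?y \<in> sphere 0 1 \<times> (cball 0 \<delta> \<inter> S)"
        using neg n0 by (auto simp: field_simps)
      moreover have "fst ?y \<in> EE R c q"
        using m subspace_scale[OF subb_EE(2)[OF split_subb(1) c(1) elim(2)]] by simp
      moreover have "snd ?y - fst ?y \<in> EE T c q"
        using m subspace_scale[OF subb_EE(2)[OF split_subb(2) c(1) elim(2)], of "?x - ?P q"]
        by (simp add: scaleR_diff_right)
      ultimately show False using elim(1) by blast
    qed
  qed
  show "(?P \<longlongrightarrow> ?P p) (nh p)"
  proof (rule tendstoI)
    fix e :: real assume e: "e > 0"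
    let ?K = "(cball 0 (norm ?x / \<delta>) - ball (?P p) e) \<times> {?x}"
    have "\<forall>\<^sub>F q in nh p. \<forall>y\<in>?K. \<not> (fst y \<in> EE R c q \<and> snd y - fst y \<in> EE T c q)"
    proof (rule tube)
      show "compact ?K" by (intro compact_Times compact_diff compact_cball open_ball) auto
      fix y assume y: "y \<in> ?K"
      show "\<not> (fst y \<in> EE R c p \<and> snd y - fst y \<in> EE T c p)"
        using y e proj_eqI[OF c, of "fst y" \<xi>] by auto
    qed
    then show "\<forall>\<^sub>F q in nh p. dist (?P q) (?P p) < e"
      using ev bound
    proof eventually_elim
      case (elim q)
      note m = proj_mem[OF c(1) elim(2), of \<xi>]
      have "(?P q, ?x) \<notin> ?K" using elim(1) m by auto
      then show ?case using elim(3) d by (auto simp: field_simps dist_commute)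
    qed
  qed
qed

end

end


locale center_bunched = smooth_mfd M
  for M :: "('m, 'b::euclidean_space) manifold" +
  fixes N :: "'m => 'b => real"
    and f :: "'m => 'm"
    and Eu Ec Es :: "('m, 'b) subbundle"
  assumes compactM: "compact_space (mtopology M)"
    and finsler: "finsler_metric M N"
    and diffeo: "Ck_diffeo 2 M f"
    and ph: "partially_hyperbolic M N f Eu Ec Es"
    and bunched: "(SUP p\<in>points M.
            norm_on M N f Ec p / (conorm_on M N f Eu p * conorm_on M N f Ec p)) < 1"
begin

definition finv :: "'m => 'm" where
  "finv = inv_into (points M) f"

abbreviation "Tf \<equiv> tangent_map M M f"
abbreviation "Tfinv \<equiv> tangent_map M M finv"

lemma C2_f: "C2 f" and C2_finv: "C2 finv"
  using diffeo unfolding Ck_diffeo_def finv_def by blast+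

lemma f_finv [simp]: "p \<in> points M ==> f (finv p) = p"
  and finv_f [simp]: "p \<in> points M ==> finv (f p) = p"
  using diffeo unfolding Ck_diffeo_def finv_def
  by (auto simp: bij_betw_inv_into_right bij_betw_inv_into_left)

lemma f_points [simp]: "p \<in> points M ==> f p \<in> points M"
  and finv_points [simp]: "p \<in> points M ==> finv p \<in> points M"
  using C2_points C2_f C2_finv by blast+

abbreviation Ecs where "Ecs \<equiv> bundle_sum Ec Es"
abbreviation Euc where "Euc \<equiv> bundle_sum Eu Ec"

lemma splittings: "splitting M Eu Ecs" "splitting M Euc Es"
  and invariant: "invariant_bundle M f Eu" "invariant_bundle M f Ec" "invariant_bundle M f Es"
    "invariant_bundle M f Ecs" "invariant_bundle M f Euc"
  and subbs: "subb Eu" "subb Ec" "subb Es"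
  using ph unfolding partially_hyperbolic_def dominated_splitting_def subb_def by blast+

lemma splitting_swap: "splitting M Es Euc"
proof -
  have "bundle_sum Es Euc p = bundle_sum Euc Es p" for p
    unfolding bundle_sum_def[of Es] bundle_sum_def[of Euc] using add.commute by blast
  then show ?thesis using splittings(2) unfolding splitting_def by (simp add: inf_commute)
qed

lemma subbs_sum: "subb Ecs" "subb Euc"
  using split_subb splittings by blast+

lemma fibre_S: "p \<in> points M ==> E p \<subseteq> S" if "E \<in> {Eu, Ec, Es}" for E
  using subb_fibre subbs that by blast

lemma D_f_EE:
  assumes c: "c \<in> atlas M" "c' \<in> atlas M" "p \<in> fst c" "f p \<in> fst c'"
    and inv: "invariant_bundle M f E" and sub: "subb E"
  shows "D f c c' p ` EE E c p = EE E c' (f p)"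
proof -
  have p: "p \<in> points M" using c mem_points by blast
  have "D f c c' p ` EE E c p = (\<lambda>v. chart_diff M c' (f p) (Tf p v)) ` E p"
    unfolding EE_def image_image
    using subb_fibre[OF sub p] by (intro image_cong refl D_chart_diff[OF C2_f c]) blast
  also have "\<dots> = chart_diff M c' (f p) ` Tf p ` E p" by (simp add: image_image)
  also have "\<dots> = EE E c' (f p)" using inv p unfolding invariant_bundle_def EE_def by simp
  finally show ?thesis .
qed

lemma D_finv_f:
  assumes "c \<in> atlas M" "c' \<in> atlas M" "p \<in> fst c" "f p \<in> fst c'" "v \<in> S"
  shows "D finv c' c (f p) (D f c c' p v) = v"
  using D_inverse[OF C2_f C2_finv _ assms] by simp

lemma D_f_finv:
  assumes "c \<in> atlas M" "c' \<in> atlas M" "p \<in> fst c" "f p \<in> fst c'" "v \<in> S"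
  shows "D f c c' p (D finv c' c (f p) v) = v"
proof -
  have "p \<in> points M" using assms mem_points by blast
  then show ?thesis using D_inverse[OF C2_finv C2_f, of c' c "f p" v] assms by simp
qed

lemma D_finv_EE:
  assumes c: "c \<in> atlas M" "c' \<in> atlas M" "p \<in> fst c" "f p \<in> fst c'"
    and inv: "invariant_bundle M f E" and sub: "subb E" and "\<xi> \<in> EE E c' (f p)"
  shows "D finv c' c (f p) \<xi> \<in> EE E c p"
proof -
  obtain \<eta> where \<eta>: "\<eta> \<in> EE E c p" "\<xi> = D f c c' p \<eta>" using D_f_EE[OF c inv sub] assms(7) by blast
  then have "\<eta> \<in> S" using subb_EE[OF sub c(1,3)] by blast
  then show ?thesis using D_finv_f[OF c] \<eta> by simp
qed

definition Pu :: "('m, 'b) chart => 'm => 'b \<Rightarrow>\<^sub>L 'b" where "Pu = proj Eu Ecs"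
definition Ps :: "('m, 'b) chart => 'm => 'b \<Rightarrow>\<^sub>L 'b" where "Ps = proj Es Euc"
definition Pcs :: "('m, 'b) chart => 'm => 'b \<Rightarrow>\<^sub>L 'b" where "Pcs c p = oproj S - Pu c p"
definition Pc :: "('m, 'b) chart => 'm => 'b \<Rightarrow>\<^sub>L 'b" where "Pc c p = Pcs c p - Ps c p"

lemmas P_defs = Pu_def Ps_def Pcs_def Pc_def

context
  fixes c p
  assumes c: "c \<in> atlas M" "p \<in> fst c"
begin

lemma EE_Ecs: "EE Ecs c p = {a + b |a b. a \<in> EE Ec c p \<and> b \<in> EE Es c p}"
  and EE_Euc: "EE Euc c p = {a + b |a b. a \<in> EE Eu c p \<and> b \<in> EE Ec c p}"
  using EE_bundle_sum[where p = p, OF c] fibre_S mem_points[OF c] by auto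

lemma Pu_mem: "Pu c p \<xi> \<in> EE Eu c p" and Ps_mem: "Ps c p \<xi> \<in> EE Es c p"
  and Pcs_mem: "Pcs c p \<xi> \<in> EE Ecs c p"
  using proj_mem[OF splittings(1) c] proj_mem[OF splitting_swap c]
  unfolding P_defs by (simp_all add: blinfun.diff_left)

lemma EE_subsets: "EE Ec c p \<subseteq> EE Ecs c p" "EE Es c p \<subseteq> EE Ecs c p"
  "EE Eu c p \<subseteq> EE Euc c p" "EE Ec c p \<subseteq> EE Euc c p"
  using subspace_0[OF subb_EE(2)[OF _ c]] subbs unfolding EE_Ecs EE_Euc
  by (auto; metis add_0 add.right_neutral)+

lemma Pc_mem: "Pc c p \<xi> \<in> EE Ec c p"
proof -
  obtain a b where ab: "a \<in> EE Ec c p" "b \<in> EE Es c p" "Pcs c p \<xi> = a + b"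
    using Pcs_mem[of \<xi>] unfolding EE_Ecs by blast
  have "oproj S \<xi> - b = Pu c p \<xi> + a"
    using ab(3) unfolding Pcs_def by (simp add: blinfun.diff_left algebra_simps)
  then have "oproj S \<xi> - b \<in> EE Euc c p" using Pu_mem[of \<xi>] ab(1) unfolding EE_Euc by auto
  then have "Ps c p \<xi> = b" unfolding Ps_def using ab(2) by (intro proj_eqI[OF splitting_swap c])
  then have "Pc c p \<xi> = a" using ab(3) unfolding Pc_def by (simp add: blinfun.diff_left)
  then show ?thesis using ab(1) by simp
qed

lemma P_S [simp]: "Pu c p \<xi> \<in> S" "Ps c p \<xi> \<in> S" "Pc c p \<xi> \<in> S" "Pcs c p \<xi> \<in> S"
  using Pu_mem Ps_mem Pc_mem Pcs_mem subb_EE(1)[OF _ c] subbs subbs_sum by blast+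

lemma P_decomp: "\<xi> \<in> S ==> Pu c p \<xi> + Pcs c p \<xi> = \<xi>" "Pc c p \<xi> + Ps c p \<xi> = Pcs c p \<xi>"
  unfolding Pcs_def Pc_def by (simp_all add: blinfun.diff_left)

lemma P_oproj: "Pu c p (oproj S \<xi>) = Pu c p \<xi>" "Ps c p (oproj S \<xi>) = Ps c p \<xi>"
  "Pc c p (oproj S \<xi>) = Pc c p \<xi>" "Pcs c p (oproj S \<xi>) = Pcs c p \<xi>"
  using proj_oproj[OF splittings(1) c] proj_oproj[OF splitting_swap c]
  unfolding P_defs by (simp_all add: blinfun.diff_left)

lemma P_Eu: "\<xi> \<in> EE Eu c p ==> Pu c p \<xi> = \<xi>" "\<xi> \<in> EE Eu c p ==> Pcs c p \<xi> = 0"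
  "\<xi> \<in> EE Eu c p ==> Ps c p \<xi> = 0" "\<xi> \<in> EE Eu c p ==> Pc c p \<xi> = 0"
proof -
  assume \<xi>: "\<xi> \<in> EE Eu c p"
  then have S: "\<xi> \<in> S" using subb_EE[OF subbs(1) c] by blast
  show 1: "Pu c p \<xi> = \<xi>" unfolding Pu_def by (rule proj_id[OF splittings(1) c \<xi>])
  then show 2: "Pcs c p \<xi> = 0" unfolding Pcs_def using S by (simp add: blinfun.diff_left)
  show 3: "Ps c p \<xi> = 0" unfolding Ps_def using \<xi> EE_subsets by (intro proj_zero[OF splitting_swap c]) blast
  show "Pc c p \<xi> = 0" unfolding Pc_def using 2 3 by (simp add: blinfun.diff_left)
qed

lemma P_Ecs: "\<xi> \<in> EE Ecs c p ==> Pu c p \<xi> = 0" "\<xi> \<in> EE Ecs c p ==> Pcs c p \<xi> = \<xi>"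
proof -
  assume \<xi>: "\<xi> \<in> EE Ecs c p"
  then have S: "\<xi> \<in> S" using subb_EE[OF subbs_sum(1) c] by blast
  show 1: "Pu c p \<xi> = 0" unfolding Pu_def by (rule proj_zero[OF splittings(1) c \<xi>])
  then show "Pcs c p \<xi> = \<xi>" unfolding Pcs_def using S by (simp add: blinfun.diff_left)
qed

lemma P_Ec: "\<xi> \<in> EE Ec c p ==> Ps c p \<xi> = 0" "\<xi> \<in> EE Ec c p ==> Pc c p \<xi> = \<xi>"
proof -
  assume \<xi>: "\<xi> \<in> EE Ec c p"
  show 1: "Ps c p \<xi> = 0" unfolding Ps_def using \<xi> EE_subsets by (intro proj_zero[OF splitting_swap c]) blast
  show "Pc c p \<xi> = \<xi>" unfolding Pc_def using \<xi> EE_subsets P_Ecs 1 by (auto simp: blinfun.diff_left)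
qed

lemma P_Es: "\<xi> \<in> EE Es c p ==> Ps c p \<xi> = \<xi>"
  unfolding Ps_def by (rule proj_id[OF splitting_swap c])

lemma P_comp: "Pu c p (Pu c p \<xi>) = Pu c p \<xi>" "Pcs c p (Pu c p \<xi>) = 0" "Pu c p (Pcs c p \<xi>) = 0"
  "Pcs c p (Pcs c p \<xi>) = Pcs c p \<xi>" "Ps c p (Pu c p \<xi>) = 0" "Pc c p (Pu c p \<xi>) = 0"
  "Pc c p (Pc c p \<xi>) = Pc c p \<xi>" "Ps c p (Pc c p \<xi>) = 0" "Pu c p (Pc c p \<xi>) = 0"
  using P_Eu[OF Pu_mem] P_Ecs[OF Pcs_mem] P_Ec[OF Pc_mem] P_Ecs(1)[OF subsetD[OF EE_subsets(1) Pc_mem]]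
  by simp_all

lemma Ps_Pcs: "Ps c p (Pcs c p \<xi>) = Ps c p \<xi>" "Pc c p (Pcs c p \<xi>) = Pc c p \<xi>"
proof -
  have "Ps c p (Pcs c p \<xi>) = Ps c p (oproj S \<xi>) - Ps c p (Pu c p \<xi>)"
    unfolding Pcs_def by (simp add: blinfun.diff_left blinfun.diff_right)
  then show 1: "Ps c p (Pcs c p \<xi>) = Ps c p \<xi>" by (simp add: P_oproj P_comp)
  show "Pc c p (Pcs c p \<xi>) = Pc c p \<xi>"
    unfolding Pc_def by (simp add: blinfun.diff_left P_comp 1)
qed

end

lemma P_tendsto:
  assumes "c \<in> atlas M" "p \<in> fst c"
  shows "(Pu c \<longlongrightarrow> Pu c p) (nh p)" "(Ps c \<longlongrightarrow> Ps c p) (nh p)"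
    "(Pcs c \<longlongrightarrow> Pcs c p) (nh p)" "(Pc c \<longlongrightarrow> Pc c p) (nh p)"
proof -
  show 1: "(Pu c \<longlongrightarrow> Pu c p) (nh p)" "(Ps c \<longlongrightarrow> Ps c p) (nh p)"
    unfolding Pu_def Ps_def using proj_tendsto splittings(1) splitting_swap assms by blast+
  then show 2: "(Pcs c \<longlongrightarrow> Pcs c p) (nh p)"
    unfolding Pcs_def[abs_def] by (intro tendsto_intros)
  show "(Pc c \<longlongrightarrow> Pc c p) (nh p)"
    unfolding Pc_def[abs_def] by (intro tendsto_intros 1 2)
qed

lemma P_f:
  assumes c: "c \<in> atlas M" "c' \<in> atlas M" "p \<in> fst c" "f p \<in> fst c'"
  shows "Pu c' (f p) (D f c c' p \<xi>) = D f c c' p (Pu c p \<xi>)"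
    "Ps c' (f p) (D f c c' p \<xi>) = D f c c' p (Ps c p \<xi>)"
    "Pcs c' (f p) (D f c c' p \<xi>) = D f c c' p (Pcs c p \<xi>)"
    "Pc c' (f p) (D f c c' p \<xi>) = D f c c' p (Pc c p \<xi>)"
proof -
  show 1: "Pu c' (f p) (D f c c' p \<xi>) = D f c c' p (Pu c p \<xi>)"
    unfolding Pu_def by (rule proj_D[OF splittings(1) C2_f c])
      (use D_f_EE[OF c] invariant subbs subbs_sum in blast)+
  show 2: "Ps c' (f p) (D f c c' p \<xi>) = D f c c' p (Ps c p \<xi>)"
    unfolding Ps_def by (rule proj_D[OF splitting_swap C2_f c])
      (use D_f_EE[OF c] invariant subbs subbs_sum in blast)+
  show 3: "Pcs c' (f p) (D f c c' p \<xi>) = D f c c' p (Pcs c p \<xi>)"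
    unfolding Pcs_def using D_S[OF C2_f c] 1
    by (simp add: blinfun.diff_left blinfun.diff_right D_oproj[OF C2_f c])
  show "Pc c' (f p) (D f c c' p \<xi>) = D f c c' p (Pc c p \<xi>)"
    unfolding Pc_def using 2 3 by (simp add: blinfun.diff_left blinfun.diff_right)
qed

lemma P_id:
  assumes c: "c \<in> atlas M" "c' \<in> atlas M" "p \<in> fst c" "p \<in> fst c'"
  shows "Pu c' p (D id c c' p \<xi>) = D id c c' p (Pu c p \<xi>)"
    "Pcs c' p (D id c c' p \<xi>) = D id c c' p (Pcs c p \<xi>)"
    "Pc c' p (D id c c' p \<xi>) = D id c c' p (Pc c p \<xi>)"
proof -
  have E: "D id c c' p \<xi> \<in> EE E c' p" if "\<xi> \<in> EE E c p" "E \<in> {Eu, Ec, Es, Ecs, Euc}" for E \<xi>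
  proof -
    obtain v where v: "v \<in> E p" "\<xi> = chart_diff M c p v" using \<open>\<xi> \<in> EE E c p\<close> unfolding EE_def by blast
    then have "v \<in> S" using subb_fibre[OF _ mem_points[OF c(1,3)]] that subbs subbs_sum by blast
    then have "D id c c' p \<xi> = chart_diff M c' p v"
      using chart_diff_trans[OF c] v by simp
    then show ?thesis using v unfolding EE_def by blast
  qed
  show 1: "Pu c' p (D id c c' p \<xi>) = D id c c' p (Pu c p \<xi>)"
    unfolding Pu_def using proj_D[OF splittings(1) C2_id c(1-3)] c(4) E by simp
  have 2: "Ps c' p (D id c c' p \<xi>) = D id c c' p (Ps c p \<xi>)"
    unfolding Ps_def using proj_D[OF splitting_swap C2_id c(1-3)] c(4) E by simp
  show 3: "Pcs c' p (D id c c' p \<xi>) = D id c c' p (Pcs c p \<xi>)"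
    unfolding Pcs_def using D_S[OF C2_id c(1-3)] c(4) 1
    by (simp add: blinfun.diff_left blinfun.diff_right D_oproj[OF C2_id c(1-3)])
  show "Pc c' p (D id c c' p \<xi>) = D id c c' p (Pc c p \<xi>)"
    unfolding Pc_def using 2 3 by (simp add: blinfun.diff_left blinfun.diff_right)
qed

end

section \<open>The adapted norm and the rates of expansion\<close>

lemma nhdsin_euclidean: "nhdsin euclidean x = nhds x"
  by (simp add: filter_eq_iff eventually_nhdsin eventually_nhds)

text \<open>How the rates of expansion are separated at a point by constants with some room to spare.
  The three sets are those of the ratios \<open>\<bar>Tf v\<bar> / \<bar>v\<bar>\<close> for \<open>v\<close> in \<open>E\<^sup>c\<close>, \<open>E\<^sup>u\<close> and \<open>E\<^sup>s\<close>.\<close>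

lemma separating_rates:
  fixes Xc Xu Xs :: "real set"
  assumes lo: "0 < lo" "\<And>x. x \<in> Xc \<union> Xu \<union> Xs ==> lo \<le> x \<and> x \<le> hi"
    and e: "1 < e" "e^2 / \<rho>1 \<le> \<kappa>" "e^3 * \<rho> \<le> \<theta>" and pos: "0 < \<rho>1" "0 < \<rho>"
    and h1: "\<And>x y. x \<in> Xc \<union> Xs ==> y \<in> Xu ==> \<rho>1 * x \<le> y"
    and h2: "\<And>x y. x \<in> Xs ==> y \<in> Xc ==> x \<le> y"
    and h3: "\<And>x z y. x \<in> Xc ==> z \<in> Xc ==> y \<in> Xu ==> x \<le> \<rho> * y * z"
  shows "\<exists>\<alpha> \<mu> m. 0 < \<alpha> \<and> 0 < \<mu> \<and> 0 < m \<and> \<alpha> \<le> \<kappa> * \<mu> \<and> \<alpha> \<le> \<theta> * \<mu> * m \<and>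
    (\<forall>x\<in>Xc \<union> Xs. x < \<alpha>) \<and> (\<forall>y\<in>Xu. \<mu> < y) \<and> (\<forall>x\<in>Xc. m < x)"
proof -
  \<comment> \<open>extreme elements \<open>b\<close>, \<open>a\<close>, \<open>b'\<close> are added so that no set is empty\<close>
  define h where "h = max lo hi"
  define b where "b = max (\<rho>1 * h) (h / (\<rho> * lo))"
  define l where "l = min lo b"
  define a where "a = min (l / \<rho>1) (\<rho> * l * lo)"
  define b' where "b' = max lo (h / (\<rho> * l))"
  have h: "0 < h" "x \<in> Xc \<union> Xs ==> x \<le> h" for x unfolding h_def using lo by fastforce+
  have "0 < b" unfolding b_def using h pos lo(1) by (simp add: less_max_iff_disj)
  then have l: "0 < l" "l \<le> lo" "l \<le> b" unfolding l_def using lo(1) by auto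
  have a: "0 < a" "\<rho>1 * a \<le> l" "a \<le> \<rho> * l * lo"
  proof -
    have "a \<le> l / \<rho>1" unfolding a_def by simp
    then show "\<rho>1 * a \<le> l" using pos by (simp add: field_simps)
  qed (use pos l lo(1) in \<open>simp_all add: a_def\<close>)
  have bb: "\<rho>1 * h \<le> b" "h \<le> \<rho> * b * lo" "h \<le> \<rho> * l * b'"
  proof -
    have "h / (\<rho> * lo) \<le> b" "h / (\<rho> * l) \<le> b'" unfolding b_def b'_def by simp_all
    then show "h \<le> \<rho> * b * lo" "h \<le> \<rho> * l * b'" using pos l lo(1) by (simp_all add: field_simps)
  qed (simp add: b_def)
  let ?X = "insert a (Xc \<union> Xs)" and ?Y = "insert b Xu" and ?Z = "insert b' Xc"
  have Y: "l \<le> y" if "y \<in> ?Y" for y using that lo(2)[of y] l by auto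
  have Z: "lo \<le> z" if "z \<in> ?Z" for z using that lo(2)[of z] unfolding b'_def by auto
  have key1: "\<rho>1 * x \<le> y" if x: "x \<in> ?X" and y: "y \<in> ?Y" for x y
  proof (cases "x = a \<or> y = b")
    case True
    have "x = a ==> \<rho>1 * x \<le> y" using a(2) Y[OF y] by simp
    moreover have "\<rho>1 * x \<le> y" if "x \<noteq> a" "y = b"
    proof -
      have "\<rho>1 * x \<le> \<rho>1 * h" using h(2)[of x] x that pos by (intro mult_left_mono) auto
      then show ?thesis using bb(1) that by simp
    qed
    ultimately show ?thesis using True by blast
  qed (use h1 x y in blast)
  have key2: "x \<le> \<rho> * y * z" if x: "x \<in> ?X" and y: "y \<in> ?Y" and z: "z \<in> ?Z" for x y z
  proof -
    have mono: "\<rho> * y0 * z0 \<le> \<rho> * y * z" if "0 \<le> y0" "y0 \<le> y" "0 \<le> z0" "z0 \<le> z" for y0 z0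
      using that pos by (intro mult_mono mult_nonneg_nonneg) auto
    consider "x = a" | "x \<noteq> a" "z = b'" | "x \<noteq> a" "y = b" "z \<in> Xc" | "x \<in> Xc \<union> Xs" "y \<in> Xu" "z \<in> Xc"
      using x y z by blast
    then show ?thesis
    proof cases
      case 1 show ?thesis using mono[of l lo] a(3) 1 l lo(1) Y[OF y] Z[OF z] by simp
    next
      case 2
      have "0 \<le> b'" unfolding b'_def using lo(1) by simp
      then show ?thesis using mono[of l b'] bb(3) h(2)[of x] x 2 l Y[OF y] by simp
    next
      case 3 show ?thesis using mono[of b lo] bb(2) h(2)[of x] x 3 l(1,3) lo(1) Z[OF z] by simp
    next
      case 4
      then show ?thesis using h2[of x z] h3[of x z y] h3[of z z y] by (metis UnE order_trans)
    qed
  qed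
  define A where "A = Sup ?X"
  define U where "U = Inf ?Y"
  define m0 where "m0 = Inf ?Z"
  have A: "x \<le> A" if "x \<in> ?X" for x
    unfolding A_def by (rule cSup_upper[OF that bdd_aboveI[of _ "max a h"]]) (use h(2) in fastforce)
  have U: "U \<le> y" "l \<le> U" if "y \<in> ?Y" for y
    unfolding U_def by (rule cInf_lower[OF that bdd_belowI[OF Y]], assumption, rule cInf_greatest[OF _ Y]) auto
  have m0: "m0 \<le> z" "lo \<le> m0" if "z \<in> ?Z" for z
    unfolding m0_def by (rule cInf_lower[OF that bdd_belowI[OF Z]], assumption, rule cInf_greatest[OF _ Z]) auto
  have p: "0 < A" "0 < U" "0 < m0" using A[of a] a(1) U(2)[of b] l(1) m0(2)[of b'] lo(1) by force+
  have AU: "A \<le> U / \<rho>1"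
    unfolding A_def
  proof (rule cSup_least)
    fix x assume x: "x \<in> ?X"
    have "\<rho>1 * x \<le> U" unfolding U_def by (rule cInf_greatest) (use key1[OF x] in auto)
    then show "x \<le> U / \<rho>1" using pos by (simp add: field_simps)
  qed simp
  have AUm: "A \<le> \<rho> * U * m0"
    unfolding A_def
  proof (rule cSup_least)
    fix x assume x: "x \<in> ?X"
    have "x / (\<rho> * m0) \<le> U"
      unfolding U_def
    proof (rule cInf_greatest)
      fix y assume y: "y \<in> ?Y"
      have y0: "0 < y" using Y[OF y] l by linarith
      have "x / (\<rho> * y) \<le> m0"
        unfolding m0_def by (rule cInf_greatest) (use key2[OF x y] y0 pos in \<open>auto simp: field_simps\<close>)
      then show "x / (\<rho> * m0) \<le> y" using y0 p pos by (simp add: field_simps)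
    qed simp
    then show "x \<le> \<rho> * U * m0" using p pos by (simp add: field_simps)
  qed simp
  define \<alpha> where "\<alpha> = e * A"
  define \<mu> where "\<mu> = U / e"
  define m where "m = m0 / e"
  have al: "0 < \<alpha>" "A < \<alpha>" and mu: "0 < \<mu>" "\<mu> < U" and m: "0 < m" "m < m0"
    unfolding \<alpha>_def \<mu>_def m_def using p e(1) by (auto simp: field_simps)
  have "\<alpha> \<le> e * (U / \<rho>1)" unfolding \<alpha>_def using AU e(1) by (intro mult_left_mono) auto
  also have "\<dots> = (e^2 / \<rho>1) * \<mu>" unfolding \<mu>_def using e(1) by (simp add: power2_eq_square)
  also have "\<dots> \<le> \<kappa> * \<mu>" using e(2) mu by (intro mult_right_mono) auto
  finally have k: "\<alpha> \<le> \<kappa> * \<mu>" .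
  have "\<alpha> \<le> e * (\<rho> * U * m0)" unfolding \<alpha>_def using AUm e(1) by simp
  also have "\<dots> = (e^3 * \<rho>) * (\<mu> * m)" unfolding \<mu>_def m_def using e(1) by (simp add: power3_eq_cube)
  also have "\<dots> \<le> \<theta> * (\<mu> * m)" using e(3) mu m by (intro mult_right_mono) auto
  finally have t: "\<alpha> \<le> \<theta> * \<mu> * m" by (simp add: mult.assoc)
  have "\<forall>x\<in>Xc \<union> Xs. x < \<alpha>" "\<forall>y\<in>Xu. \<mu> < y" "\<forall>x\<in>Xc. m < x"
    using A al U(1) mu m0(1) m by fastforce+
  then show ?thesis using al(1) mu(1) m(1) k t by blast
qed

lemma divide_antimono_ennreal:
  fixes a b c :: ennreal
  assumes "b \<le> c"
  shows "a / c \<le> a / b"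
proof -
  have "inverse c \<le> inverse b"
  proof (cases b rule: ennreal_cases)
    case b: (real x)
    show ?thesis
    proof (cases c rule: ennreal_cases)
      case (real y)
      show ?thesis
      proof (cases "x = 0")
        case False
        then show ?thesis
          using b real assms by (auto simp: inverse_ennreal ennreal_le_iff le_imp_inverse_le)
      qed (use b in simp)
    qed simp
  qed (use assms in \<open>simp add: top_unique\<close>)
  then show ?thesis unfolding divide_ennreal_def by (rule mult_left_mono) simp
qed

context center_bunched
begin

text \<open>The Finsler norm in the coordinates of a chart, and the adapted norm: the maximum of the norms of
  the three components. In the adapted norm all projections have norm at most one, and the norm of
  \<open>Tf\<close> on \<open>E\<^sup>c \<oplus> E\<^sup>s\<close> is the larger of the norms on the two summands.\<close>

definition Nc :: "('m, 'b) chart => 'm => 'b => real" where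
  "Nc c p \<xi> = N p (D id c (chart_at M p) p \<xi>)"

definition nrm :: "('m, 'b) chart => 'm => 'b => real" where
  "nrm c p \<xi> = max (Nc c p (Pu c p \<xi>)) (max (Nc c p (Pc c p \<xi>)) (Nc c p (Ps c p \<xi>)))"

lemma N_facts:
  assumes "p \<in> points M" "v \<in> S" "w \<in> S"
  shows "0 \<le> N p v" "N p v = 0 \<longleftrightarrow> v = 0" "N p (a *\<^sub>R v) = \<bar>a\<bar> * N p v" "N p (v + w) \<le> N p v + N p w"
  using finsler assms unfolding finsler_metric_def by blast+

lemma Nc_chart_diff: "c \<in> atlas M ==> p \<in> fst c ==> v \<in> S ==> Nc c p (chart_diff M c p v) = N p v"
  unfolding Nc_def by (simp add: chart_diff_inverse)

context
  fixes c p
  assumes c: "c \<in> atlas M" "p \<in> fst c"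
begin

lemma Nc_facts:
  assumes "\<xi> \<in> S" "\<eta> \<in> S"
  shows "0 \<le> Nc c p \<xi>" "Nc c p \<xi> = 0 \<longleftrightarrow> \<xi> = 0" "Nc c p (a *\<^sub>R \<xi>) = \<bar>a\<bar> * Nc c p \<xi>"
    "Nc c p (\<xi> + \<eta>) \<le> Nc c p \<xi> + Nc c p \<eta>"
proof -
  have p: "p \<in> points M" using mem_points[OF c] .
  note ca = chart_at[OF p]
  have DS: "D id c (chart_at M p) p \<xi> \<in> S" for \<xi> using D_S[OF C2_id c(1) ca(1) c(2)] ca by simp
  note n = N_facts[OF p DS DS]
  show "0 \<le> Nc c p \<xi>" "Nc c p (a *\<^sub>R \<xi>) = \<bar>a\<bar> * Nc c p \<xi>" "Nc c p (\<xi> + \<eta>) \<le> Nc c p \<xi> + Nc c p \<eta>"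
    unfolding Nc_def using n by (simp_all add: blinfun.add_right blinfun.scaleR_right)
  have "D id c (chart_at M p) p \<xi> = 0 \<longleftrightarrow> \<xi> = 0"
    using D_id_inverse[OF c(1) ca(1) c(2) ca(2) assms(1)] by (metis blinfun.zero_right)
  then show "Nc c p \<xi> = 0 \<longleftrightarrow> \<xi> = 0" unfolding Nc_def using n(2) by simp
qed

lemma Nc_zero [simp]: "Nc c p 0 = 0"
  using Nc_facts(2)[of 0 0] by simp

lemma nrm_nonneg [simp]: "0 \<le> nrm c p \<xi>"
  unfolding nrm_def using Nc_facts(1)[OF P_S(1)[OF c], of 0] by (simp add: le_max_iff_disj)

lemma nrm_eq_0: "\<xi> \<in> S ==> nrm c p \<xi> = 0 \<longleftrightarrow> \<xi> = 0"
proof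
  assume S: "\<xi> \<in> S" and "nrm c p \<xi> = 0"
  then have "Nc c p (Pu c p \<xi>) \<le> 0" "Nc c p (Pc c p \<xi>) \<le> 0" "Nc c p (Ps c p \<xi>) \<le> 0"
    unfolding nrm_def by auto
  then have "Pu c p \<xi> = 0" "Pc c p \<xi> = 0" "Ps c p \<xi> = 0"
    using Nc_facts(1,2)[OF P_S(1)[OF c] P_S(1)[OF c]] Nc_facts(1,2)[OF P_S(2)[OF c] P_S(1)[OF c]]
      Nc_facts(1,2)[OF P_S(3)[OF c] P_S(1)[OF c]] by (meson order_antisym)+
  then show "\<xi> = 0" using P_decomp[OF c] S by (metis add_0)
qed (simp add: nrm_def)

lemma nrm_scale: "nrm c p (a *\<^sub>R \<xi>) = \<bar>a\<bar> * nrm c p \<xi>"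
  unfolding nrm_def
  using Nc_facts(3)[OF P_S(1)[OF c] S_closed_under(1)] Nc_facts(3)[OF P_S(2)[OF c] S_closed_under(1)]
    Nc_facts(3)[OF P_S(3)[OF c] S_closed_under(1)]
  by (simp add: blinfun.scaleR_right max_mult_distrib_left)

lemma nrm_triangle: "nrm c p (\<xi> + \<eta>) \<le> nrm c p \<xi> + nrm c p \<eta>"
proof -
  have "Nc c p (Q (\<xi> + \<eta>)) \<le> nrm c p \<xi> + nrm c p \<eta>"
    if "Q \<in> {Pu c p, Pc c p, Ps c p}" for Q :: "'b \<Rightarrow>\<^sub>L 'b"
  proof -
    have "Nc c p (Q (\<xi> + \<eta>)) \<le> Nc c p (Q \<xi>) + Nc c p (Q \<eta>)"
      using that Nc_facts(4) P_S[OF c] by (auto simp: blinfun.add_right)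
    moreover have "Nc c p (Q \<xi>) \<le> nrm c p \<xi>" "Nc c p (Q \<eta>) \<le> nrm c p \<eta>"
      using that unfolding nrm_def by auto
    ultimately show ?thesis by linarith
  qed
  then show ?thesis unfolding nrm_def[of c p "\<xi> + \<eta>"] by simp
qed

lemma nrm_minus: "nrm c p (- \<xi>) = nrm c p \<xi>"
  using nrm_scale[of "-1" \<xi>] by simp

lemma nrm_triangle_diff: "nrm c p \<xi> \<le> nrm c p \<eta> + nrm c p (\<xi> - \<eta>)"
  using nrm_triangle[of \<eta> "\<xi> - \<eta>"] by simp

lemma nrm_diff: "nrm c p (\<xi> - \<eta>) \<le> nrm c p \<xi> + nrm c p \<eta>"
  using nrm_triangle[of \<xi> "- \<eta>"] by (simp add: nrm_minus)

lemma nrm_0 [simp]: "nrm c p 0 = 0" using nrm_eq_0 by simp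

lemma nrm_P: "nrm c p (Pu c p \<xi>) = Nc c p (Pu c p \<xi>)" "nrm c p (Pc c p \<xi>) = Nc c p (Pc c p \<xi>)"
  "nrm c p (Pcs c p \<xi>) = max (Nc c p (Pc c p \<xi>)) (Nc c p (Ps c p \<xi>))"
proof -
  have "0 \<le> Nc c p (Pu c p \<xi>)" "0 \<le> Nc c p (Pc c p \<xi>)" "0 \<le> Nc c p (Ps c p \<xi>)"
    using Nc_facts(1)[OF P_S(1)[OF c] S_closed_under(1)] Nc_facts(1)[OF P_S(2)[OF c] S_closed_under(1)]
      Nc_facts(1)[OF P_S(3)[OF c] S_closed_under(1)] by auto
  then show "nrm c p (Pu c p \<xi>) = Nc c p (Pu c p \<xi>)" "nrm c p (Pc c p \<xi>) = Nc c p (Pc c p \<xi>)"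
    "nrm c p (Pcs c p \<xi>) = max (Nc c p (Pc c p \<xi>)) (Nc c p (Ps c p \<xi>))"
    unfolding nrm_def
    by (simp_all add: P_comp[OF c] Ps_Pcs[OF c] max_absorb1 max_absorb2 le_max_iff_disj)
qed

lemma nrm_Eu: "\<xi> \<in> EE Eu c p ==> nrm c p \<xi> = Nc c p \<xi>"
  and nrm_Ec: "\<xi> \<in> EE Ec c p ==> nrm c p \<xi> = Nc c p \<xi>"
  using nrm_P(1,2)[of \<xi>] P_Eu(1)[OF c] P_Ec(2)[OF c] by simp_all

lemma nrm_Es: "\<xi> \<in> EE Es c p ==> nrm c p \<xi> = Nc c p \<xi>"
  using nrm_P(3)[of \<xi>] P_Es[OF c] P_Ecs(2)[OF c] EE_subsets(2)[OF c]
    P_decomp(2)[OF c, of \<xi>] Nc_facts(1)[OF P_S(2)[OF c] S_closed_under(1), of \<xi>] by (simp add: subset_iff)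

lemma nrm_max: "nrm c p \<xi> = max (nrm c p (Pu c p \<xi>)) (nrm c p (Pcs c p \<xi>))"
  unfolding nrm_P nrm_def[of c p \<xi>] by simp

lemma nrm_P_le: "nrm c p (Pu c p \<xi>) \<le> nrm c p \<xi>" "nrm c p (Pcs c p \<xi>) \<le> nrm c p \<xi>"
  "nrm c p (Pc c p \<xi>) \<le> nrm c p \<xi>"
  using nrm_max[of \<xi>] by (auto simp: nrm_P nrm_def[of c p \<xi>])

end

lemma Nc_tendsto:
  assumes c: "c \<in> atlas M" "p \<in> fst c" and P: "filterlim P (nh p) F"
    and X: "(X \<longlongrightarrow> \<xi>) F" "\<forall>\<^sub>F x in F. X x \<in> S" "\<xi> \<in> S"
  shows "((\<lambda>x. Nc c (P x) (X x)) \<longlongrightarrow> Nc c p \<xi>) F"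
proof -
  let ?v = "\<lambda>q \<xi>. D id c (chart_at M q) q \<xi>" and ?T = "TMtop"
  have p: "p \<in> points M" using mem_points[OF c] .
  have ev: "\<forall>\<^sub>F x in F. P x \<in> fst c" using filterlim_nh_iff[OF c] P by blast
  have vS: "?v q \<xi> \<in> S" if "q \<in> fst c" for q \<xi>
    using D_S[OF C2_id c(1) _ that] chart_at[OF mem_points[OF c(1) that]] by simp
  have cont: "continuous_map ?T euclideanreal (\<lambda>(p, v). N p v)"
    using finsler unfolding finsler_metric_def by blast
  have N: "((\<lambda>(p, v). N p v) \<longlongrightarrow> N p (?v p \<xi>)) (nhdsin ?T (p, ?v p \<xi>))"
  proof (cases "(p, ?v p \<xi>) \<in> topspace ?T")
    case True
    from filterlim_continuous_map[OF cont this] show ?thesis by (simp add: nhdsin_euclidean)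
  qed (simp add: nhdsin_degenerate)
  have "\<forall>\<^sub>F x in F. X x = chart_diff M c (P x) (?v (P x) (X x))"
    using ev X(2) by eventually_elim (simp add: chart_diff_inverse c)
  then have "((\<lambda>x. chart_diff M c (P x) (?v (P x) (X x))) \<longlongrightarrow> chart_diff M c p (?v p \<xi>)) F"
    using Lim_transform_eventually[OF X(1)] chart_diff_inverse(2)[OF c X(3)] by simp
  moreover have "\<forall>\<^sub>F x in F. ?v (P x) (X x) \<in> S" using ev by eventually_elim (rule vS)
  ultimately have "filterlim (\<lambda>x. (P x, ?v (P x) (X x))) (nhdsin ?T (p, ?v p \<xi>)) F"
    using filterlim_tangent_bundle[OF c vS[OF c(2)] P, of "\<lambda>x. ?v (P x) (X x)"] by blast
  from filterlim_compose[OF N this] show ?thesis unfolding Nc_def by simp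
qed

lemma nrm_tendsto:
  assumes c: "c \<in> atlas M" "p \<in> fst c" and P: "filterlim P (nh p) F" and X: "(X \<longlongrightarrow> \<xi>) F"
  shows "((\<lambda>x. nrm c (P x) (X x)) \<longlongrightarrow> nrm c p \<xi>) F"
proof -
  have ev: "\<forall>\<^sub>F x in F. P x \<in> fst c" using filterlim_nh_iff[OF c] P by blast
  have "((\<lambda>x. Nc c (P x) (Q c (P x) (X x))) \<longlongrightarrow> Nc c p (Q c p \<xi>)) F"
    if Q: "(Q c \<longlongrightarrow> Q c p) (nh p)" "\<And>q \<xi>. q \<in> fst c ==> blinfun_apply (Q c q) \<xi> \<in> S" for Q
  proof (rule Nc_tendsto[OF c P])
    show "((\<lambda>x. Q c (P x) (X x)) \<longlongrightarrow> Q c p \<xi>) F"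
      by (intro tendsto_intros X filterlim_compose[OF Q(1) P])
    show "\<forall>\<^sub>F x in F. Q c (P x) (X x) \<in> S" using ev by eventually_elim (rule Q(2))
  qed (rule Q(2)[OF c(2)])
  note t = this
  show ?thesis unfolding nrm_def
    by (intro tendsto_max t P_tendsto[OF c]) (use P_S c in auto)
qed

text \<open>The adapted norm is bounded above and away from zero on the unit sphere of \<open>S\<close>, which is compact,
  and this persists at nearby points.\<close>

lemma nrm_equiv:
  assumes c: "c \<in> atlas M" "p \<in> fst c"
  shows "\<exists>C>0. \<forall>\<^sub>F q in nh p. \<forall>\<xi>\<in>S. norm \<xi> \<le> C * nrm c q \<xi> \<and> nrm c q \<xi> \<le> C * norm \<xi>"
proof (cases "S \<inter> sphere 0 1 = {}")
  case True
  have z: "\<xi> = 0" if "\<xi> \<in> S" for \<xi>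
  proof (rule ccontr)
    assume "\<xi> \<noteq> 0"
    then have "inverse (norm \<xi>) *\<^sub>R \<xi> \<in> S \<inter> sphere 0 1" using that by simp
    then show False using True by blast
  qed
  have "\<forall>\<^sub>F q in nh p. \<forall>\<xi>\<in>S. norm \<xi> \<le> 1 * nrm c q \<xi> \<and> nrm c q \<xi> \<le> 1 * norm \<xi>"
    using eventually_chart[OF c]
  proof eventually_elim
    case (elim q)
    show ?case
    proof
      fix \<xi> assume "\<xi> \<in> S"
      then have "\<xi> = 0" by (rule z)
      then show "norm \<xi> \<le> 1 * nrm c q \<xi> \<and> nrm c q \<xi> \<le> 1 * norm \<xi>" using c(1) elim by simp
    qed
  qed
  then show ?thesis by (intro exI[of _ 1]) simp
next
  case False
  let ?K = "S \<inter> sphere 0 1"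
  have K: "compact ?K" by (intro closed_Int_compact closed_subspace sub compact_sphere)
  have "continuous_on ?K (nrm c p)"
    unfolding continuous_on_def
    by (intro ballI nrm_tendsto[OF c] tendsto_ident_at) (simp add: filterlim_nh_iff[OF c] c)
  from continuous_attains_inf[OF K False this] continuous_attains_sup[OF K False this]
  obtain x y where x: "x \<in> ?K" "\<And>z. z \<in> ?K ==> nrm c p x \<le> nrm c p z"
    and y: "y \<in> ?K" "\<And>z. z \<in> ?K ==> nrm c p z \<le> nrm c p y" by metis
  define a where "a = nrm c p x / 2"
  define b where "b = nrm c p y + 1"
  have "x \<noteq> 0" using x(1) by auto
  then have "nrm c p x \<noteq> 0" using nrm_eq_0[OF c, of x] x(1) by blast
  then have a: "0 < a" "a < nrm c p x" unfolding a_def using nrm_nonneg[OF c, of x] by auto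
  have b: "0 < b" unfolding b_def using nrm_nonneg[OF c, of y] by linarith
  have "\<forall>\<^sub>F q in nh p. \<forall>\<xi>\<in>?K. a < nrm c q \<xi> \<and> nrm c q \<xi> < b"
  proof (rule eventually_tube[OF K])
    fix \<xi> assume \<xi>: "\<xi> \<in> ?K"
    have t: "((\<lambda>z. nrm c (fst z) (snd z)) \<longlongrightarrow> nrm c p \<xi>) (nh p \<times>\<^sub>F nhds \<xi>)"
      by (rule nrm_tendsto[OF c filterlim_fst filterlim_snd])
    have "a < nrm c p \<xi>" "nrm c p \<xi> < b" using x(2)[OF \<xi>] y(2)[OF \<xi>] a unfolding b_def by auto
    then show "\<forall>\<^sub>F z in nh p \<times>\<^sub>F nhds \<xi>. a < nrm c (fst z) (snd z) \<and> nrm c (fst z) (snd z) < b"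
      using order_tendstoD[OF t] by (simp add: eventually_conj)
  qed
  then have "\<forall>\<^sub>F q in nh p. \<forall>\<xi>\<in>S. norm \<xi> \<le> max (1 / a) b * nrm c q \<xi> \<and> nrm c q \<xi> \<le> max (1 / a) b * norm \<xi>"
    using eventually_chart[OF c]
  proof eventually_elim
    case (elim q)
    note cq = c(1) elim(2)
    show ?case
    proof
      fix \<xi> assume \<xi>: "\<xi> \<in> S"
      show "norm \<xi> \<le> max (1 / a) b * nrm c q \<xi> \<and> nrm c q \<xi> \<le> max (1 / a) b * norm \<xi>"
      proof (cases "\<xi> = 0")
        case False
        then have "inverse (norm \<xi>) *\<^sub>R \<xi> \<in> ?K" using \<xi> by simp
        with elim(1) have "a < nrm c q (inverse (norm \<xi>) *\<^sub>R \<xi>)" "nrm c q (inverse (norm \<xi>) *\<^sub>R \<xi>) < b" by blast+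
        then have 1: "a * norm \<xi> < nrm c q \<xi>" "nrm c q \<xi> < b * norm \<xi>"
          unfolding nrm_scale[OF cq] using False by (auto simp: field_simps)
        have "norm \<xi> \<le> (1 / a) * nrm c q \<xi>" using 1(1) a(1) by (simp add: field_simps)
        also have "\<dots> \<le> max (1 / a) b * nrm c q \<xi>" by (intro mult_right_mono nrm_nonneg[OF cq]) simp
        finally have 2: "norm \<xi> \<le> max (1 / a) b * nrm c q \<xi>" .
        have "b * norm \<xi> \<le> max (1 / a) b * norm \<xi>" by (intro mult_right_mono) auto
        then show ?thesis using 1 2 by linarith
      qed (simp add: cq)
    qed
  qed
  moreover have "max (1 / a) b > 0" using b by simp
  ultimately show ?thesis by blast
qed


lemma nrm_oproj: "c \<in> atlas M ==> p \<in> fst c ==> nrm c p (oproj S \<xi>) = nrm c p \<xi>"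
  unfolding nrm_def by (simp add: P_oproj)

lemma nrm_norm_constant:
  assumes c: "c \<in> atlas M" "p \<in> fst c"
  shows "\<exists>C>0. (\<forall>x\<in>S. norm x \<le> C * nrm c p x) \<and> (\<forall>x. nrm c p x \<le> C * norm x)"
proof -
  obtain C where C: "C > 0" "\<forall>\<xi>\<in>S. norm \<xi> \<le> C * nrm c p \<xi> \<and> nrm c p \<xi> \<le> C * norm \<xi>"
    using nrm_equiv[OF c] eventually_nh_self[OF _ mem_points[OF c]] by blast
  let ?C = "C * (norm (oproj S) + 1)"
  have C': "C \<le> ?C" using C(1) by (simp add: algebra_simps)
  have "nrm c p x \<le> ?C * norm x" for x
  proof -
    have "nrm c p x = nrm c p (oproj S x)" using nrm_oproj[OF c] by simp
    also have "\<dots> \<le> C * norm (oproj S x)" using C(2) by simp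
    also have "\<dots> \<le> C * (norm (oproj S) * norm x)" using C(1) norm_blinfun[of "oproj S" x] by simp
    also have "\<dots> \<le> ?C * norm x" using C(1) by (simp add: algebra_simps)
    finally show ?thesis .
  qed
  moreover have "norm x \<le> ?C * nrm c p x" if "x \<in> S" for x
    using C(2) that mult_right_mono[OF C' nrm_nonneg[OF c, of x]] by fastforce
  moreover have "?C > 0" using C(1) C' by linarith
  ultimately show ?thesis by blast
qed

text \<open>A strict inequality on the unit vectors of one fibre persists in the nearby fibres, since the total
  space of the subbundle is closed and the unit sphere is compact.\<close>

lemma strict_inequality_persists:
  assumes E: "subb E" and c: "c \<in> atlas M" "p \<in> fst c" and P: "filterlim P (nh p) G"
    and pos: "\<And>\<xi>. \<xi> \<in> EE E c p ==> norm \<xi> = 1 ==> 0 < k \<xi>"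
    and cont: "\<And>\<xi>. \<xi> \<in> S ==> ((\<lambda>z. h (fst z) (oproj S (snd z))) \<longlongrightarrow> k \<xi>) (G \<times>\<^sub>F nhds \<xi>)"
  shows "\<forall>\<^sub>F x in G. \<forall>\<xi>\<in>EE E c (P x). norm \<xi> = 1 --> 0 < (h x \<xi> :: real)"
proof -
  have "\<forall>\<^sub>F x in G. \<forall>\<xi>\<in>sphere 0 1 \<inter> S. \<xi> \<in> EE E c (P x) --> 0 < h x (oproj S \<xi>)"
  proof (rule eventually_tube)
    show "compact (sphere 0 1 \<inter> S)" by (intro compact_Int_closed compact_sphere closed_subspace sub)
    fix \<xi> assume \<xi>: "\<xi> \<in> sphere 0 1 \<inter> S"
    show "\<forall>\<^sub>F z in G \<times>\<^sub>F nhds \<xi>. snd z \<in> EE E c (P (fst z)) --> 0 < h (fst z) (oproj S (snd z))"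
    proof (cases "\<xi> \<in> EE E c p")
      case True
      then have "0 < k \<xi>" using pos \<xi> by simp
      from order_tendstoD(1)[OF cont this] \<xi> show ?thesis by (auto elim: eventually_mono)
    next
      case False
      from subb_closed[OF E c this filterlim_compose[OF P filterlim_fst] filterlim_snd]
      show ?thesis by eventually_elim blast
    qed
  qed
  then show ?thesis
    using eventually_compose_filterlim[OF eventually_chart[OF c] P]
  proof eventually_elim
    case (elim x)
    have "EE E c (P x) \<subseteq> S" using subb_EE[OF E c(1) elim(2)] by blast
    then show ?case using elim(1) by (auto simp: subset_iff)
  qed
qed

lemma tangent_map_S:
  assumes "p \<in> points M" "v \<in> S"
  shows "Tf p v \<in> S"
  using tangent_map_eq[OF C2_f assms] D_S[OF C2_f] chart_at assms by simp

lemma tangent_map_scale: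
  assumes "p \<in> points M" "v \<in> S"
  shows "Tf p (a *\<^sub>R v) = a *\<^sub>R Tf p v"
  using tangent_map_eq[OF C2_f assms(1)] assms by (simp add: blinfun.scaleR_right)

lemma Nc_D_f:
  assumes c: "c \<in> atlas M" "c' \<in> atlas M" "p \<in> fst c" "f p \<in> fst c'" and "v \<in> S"
  shows "Nc c' (f p) (D f c c' p (chart_diff M c p v)) = N (f p) (Tf p v)"
  using D_chart_diff[OF C2_f c assms(5)] Nc_chart_diff c tangent_map_S[OF mem_points[OF c(1,3)] assms(5)]
  by simp

text \<open>The factor \<open>s\<close>, which is \<open>1\<close> or \<open>-1\<close> in the applications, serves lower and upper bounds at once. By
  homogeneity it suffices to consider unit vectors, where the strict inequality persists.\<close>

lemma ratio_inequality_persists: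
  assumes E: "subb E" and p: "p \<in> points M"
    and pos: "\<And>v. v \<in> E p ==> v \<noteq> 0 ==> 0 < s * (N (f p) (Tf p v) - a * N p v)"
  shows "\<forall>\<^sub>F q in nh p. \<forall>v\<in>E q. 0 \<le> s * (N (f q) (Tf q v) - a * N q v)"
proof -
  let ?c = "chart_at M p" and ?c' = "chart_at M (f p)"
  have fp: "f p \<in> points M" using p by simp
  note c = chart_at[OF p] and c' = chart_at[OF fp]
  define h where "h q \<xi> = s * (Nc ?c' (f q) (D f ?c ?c' q \<xi>) - a * Nc ?c q \<xi>)" for q \<xi>
  have ev: "\<forall>\<^sub>F q in nh p. q \<in> fst ?c" "\<forall>\<^sub>F q in nh p. f q \<in> fst ?c'"
    using eventually_chart[OF c] eventually_g_chart[OF C2_f c(1) c'(1) c(2) c'(2)] by blast+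
  have hv: "h q (chart_diff M ?c q v) = s * (N (f q) (Tf q v) - a * N q v)"
    if "q \<in> fst ?c" "f q \<in> fst ?c'" "v \<in> S" for q v
    unfolding h_def using that Nc_D_f[OF c(1) c'(1)] Nc_chart_diff[OF c(1)] by simp
  have "\<forall>\<^sub>F q in nh p. \<forall>\<xi>\<in>EE E ?c q. norm \<xi> = 1 --> 0 < h q \<xi>"
  proof (rule strict_inequality_persists[where h = h and k = "h p", OF E c filterlim_ident])
    fix \<xi> assume \<xi>: "\<xi> \<in> EE E ?c p" "norm \<xi> = 1"
    then obtain v where v: "v \<in> E p" "\<xi> = chart_diff M ?c p v" unfolding EE_def by blast
    have vS: "v \<in> S" using v subb_fibre[OF E p] by blast
    have "v \<noteq> 0" using v(2) \<xi>(2) c by (auto simp: chart_diff_eq)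
    then show "0 < h p \<xi>" using pos[OF v(1)] hv[OF c(2) c'(2) vS] v(2) by simp
  next
    fix \<xi> assume \<xi>: "\<xi> \<in> S"
    let ?F = "nh p \<times>\<^sub>F nhds \<xi>"
    have f1: "filterlim fst (nh p) ?F" by (rule filterlim_fst)
    have f2: "((\<lambda>z. oproj S (snd z)) \<longlongrightarrow> \<xi>) ?F"
    proof -
      have "(snd \<longlongrightarrow> \<xi>) ?F" by (rule filterlim_snd)
      from blinfun.tendsto[OF tendsto_const this, of "oproj S"] show ?thesis using \<xi> by simp
    qed
    have f3: "filterlim (\<lambda>z. f (fst z)) (nh (f p)) ?F"
      using filterlim_compose[OF filterlim_C2[OF C2_f p] f1] .
    have e: "\<forall>\<^sub>F z in ?F. fst z \<in> fst ?c \<and> f (fst z) \<in> fst ?c'"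
      using eventually_compose_filterlim[OF ev(1) f1] eventually_compose_filterlim[OF ev(2) f1]
      by eventually_elim blast
    have DS: "D f ?c ?c' q \<eta> \<in> S" if "q \<in> fst ?c" "f q \<in> fst ?c'" for q \<eta>
      using D_S[OF C2_f c(1) c'(1) that] .
    have t1: "((\<lambda>z. Nc ?c (fst z) (oproj S (snd z))) \<longlongrightarrow> Nc ?c p \<xi>) ?F"
      by (rule Nc_tendsto[OF c f1 f2]) (use \<xi> in auto)
    have t2: "((\<lambda>z. Nc ?c' (f (fst z)) (D f ?c ?c' (fst z) (oproj S (snd z)))) \<longlongrightarrow> Nc ?c' (f p) (D f ?c ?c' p \<xi>)) ?F"
    proof (rule Nc_tendsto[OF c' f3])
      show "((\<lambda>z. D f ?c ?c' (fst z) (oproj S (snd z))) \<longlongrightarrow> D f ?c ?c' p \<xi>) ?F"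
        by (intro blinfun.tendsto f2 filterlim_compose[OF D_tendsto[OF C2_f c(1) c'(1) c(2) c'(2)] f1])
      show "\<forall>\<^sub>F z in ?F. D f ?c ?c' (fst z) (oproj S (snd z)) \<in> S"
        using e by eventually_elim (simp add: DS)
    qed (use DS c c' in simp)
    show "((\<lambda>z. h (fst z) (oproj S (snd z))) \<longlongrightarrow> h p \<xi>) ?F"
      unfolding h_def by (intro tendsto_intros t1 t2)
  qed
  then show ?thesis
    using ev
  proof eventually_elim
    case (elim q)
    have q: "q \<in> points M" using elim c mem_points by blast
    note fq = chart_at[OF f_points[OF q]]
    show ?case
    proof
      fix v assume v: "v \<in> E q"
      then have vS: "v \<in> S" using subb_fibre[OF E q] by blast
      let ?\<xi> = "chart_diff M ?c q v"
      show "0 \<le> s * (N (f q) (Tf q v) - a * N q v)"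
      proof (cases "?\<xi> = 0")
        case True
        then have "v = 0" using chart_diff_inverse(1)[OF c(1) elim(2) vS] by simp
        then show ?thesis
          using N_facts(2)[OF q S_closed_under(1) S_closed_under(1)] tangent_map_scale[OF q S_closed_under(1), of 0]
            N_facts(2)[OF f_points[OF q] S_closed_under(1) S_closed_under(1)] by simp
      next
        case False
        let ?b = "inverse (norm ?\<xi>)"
        have b: "?b > 0" using False by simp
        have e: "?b *\<^sub>R ?\<xi> = chart_diff M ?c q (?b *\<^sub>R v)"
          using c elim vS by (simp add: chart_diff_eq blinfun.scaleR_right)
        have "?b *\<^sub>R v \<in> E q" using subb_fibre[OF E q] v subspace_scale by blast
        then have "?b *\<^sub>R ?\<xi> \<in> EE E ?c q" unfolding e EE_def by blast
        moreover have "norm (?b *\<^sub>R ?\<xi>) = 1" using False by simp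
        ultimately have "0 < h q (?b *\<^sub>R ?\<xi>)" using elim(1) by blast
        also have "\<dots> = s * (N (f q) (Tf q (?b *\<^sub>R v)) - a * N q (?b *\<^sub>R v))"
          unfolding e using elim(2,3) vS by (intro hv) auto
        also have "\<dots> = ?b * (s * (N (f q) (Tf q v) - a * N q v))"
          using N_facts(3)[OF q vS vS] N_facts(3)[OF f_points[OF q] tangent_map_S[OF q vS] tangent_map_S[OF q vS]] b
          by (simp add: tangent_map_scale[OF q vS] algebra_simps)
        finally have "0 < ?b * (s * (N (f q) (Tf q v) - a * N q v))" .
        then have "0 < s * (N (f q) (Tf q v) - a * N q v)"
          using b zero_less_mult_pos by blast
        then show ?thesis by simp
      qed
    qed
  qed
qed


definition ratio :: "'m => 'b => real" where
  "ratio p v = N (f p) (Tf p v) / N p v"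

definition rate :: "'m => real => real => real => bool" where
  "rate p \<alpha> \<mu> m \<longleftrightarrow>
     (\<forall>v\<in>Eu p. \<mu> * N p v \<le> N (f p) (Tf p v)) \<and>
     (\<forall>v\<in>Ec p \<union> Es p. N (f p) (Tf p v) \<le> \<alpha> * N p v) \<and>
     (\<forall>v\<in>Ec p. m * N p v \<le> N (f p) (Tf p v))"

lemma tangent_map_nz:
  assumes "p \<in> points M" "v \<in> S" "v \<noteq> 0"
  shows "Tf p v \<noteq> 0"
proof
  note c = chart_at[OF assms(1)] and c' = chart_at[OF f_points[OF assms(1)]]
  assume "Tf p v = 0"
  then have "D f (chart_at M p) (chart_at M (f p)) p v = 0"
    using tangent_map_eq[OF C2_f assms(1,2)] by simp
  then show False using D_finv_f[OF c(1) c'(1) c(2) c'(2) assms(2)] assms(3) by simp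
qed

lemma N_pos: "p \<in> points M ==> v \<in> S ==> v \<noteq> 0 ==> 0 < N p v"
  using N_facts(1,2)[of p v v] by simp

lemma ratio_pos: "p \<in> points M ==> v \<in> S ==> v \<noteq> 0 ==> 0 < ratio p v"
  unfolding ratio_def by (intro divide_pos_pos N_pos tangent_map_nz tangent_map_S f_points)

lemma conorm_le: "v \<in> X p ==> v \<noteq> 0 ==> conorm_on M N f X p \<le> ennreal (ratio p v)"
  unfolding conorm_on_def ratio_def by (rule INF_lower) simp

lemma norm_ge: "v \<in> X p ==> v \<noteq> 0 ==> ennreal (ratio p v) \<le> norm_on M N f X p"
  unfolding norm_on_def ratio_def by (rule SUP_upper) simp

text \<open>The infimum in the definition of domination, unfolded to pairs of vectors, with a constant strictly
  between one and the infimum.\<close>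

lemma domination_ratio:
  assumes "dominated_splitting M N f R T" and sub: "subb R" "subb T"
  shows "\<exists>\<rho>>1. \<forall>p\<in>points M. \<forall>u z. u \<in> R p --> u \<noteq> 0 --> z \<in> T p --> z \<noteq> 0 --> \<rho> * ratio p z \<le> ratio p u"
proof -
  let ?I = "INF p\<in>points M. conorm_on M N f R p / norm_on M N f T p"
  have "1 < ?I" using assms(1) unfolding dominated_splitting_def by blast
  then obtain r where r: "1 < r" "r < ?I" using dense by blast
  then obtain \<rho> where \<rho>: "r = ennreal \<rho>" "0 \<le> \<rho>" by (cases r rule: ennreal_cases) auto
  then have "1 < \<rho>" using r(1) by (simp add: ennreal_less_iff flip: ennreal_1)
  moreover have "\<rho> * ratio p z \<le> ratio p u"
    if p: "p \<in> points M" and u: "u \<in> R p" "u \<noteq> 0" and z: "z \<in> T p" "z \<noteq> 0" for p u z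
  proof -
    have S: "u \<in> S" "z \<in> S" using subb_fibre[OF _ p] sub u z by blast+
    have rp: "0 < ratio p u" "0 < ratio p z" using ratio_pos[OF p] S u z by blast+
    have "ennreal \<rho> \<le> conorm_on M N f R p / norm_on M N f T p"
      using r(2) \<rho>(1) INF_lower[OF p, of "\<lambda>p. conorm_on M N f R p / norm_on M N f T p"] by simp
    also have "\<dots> \<le> ennreal (ratio p u) / norm_on M N f T p"
      by (intro divide_right_mono_ennreal conorm_le u)
    also have "\<dots> \<le> ennreal (ratio p u) / ennreal (ratio p z)"
      by (intro divide_antimono_ennreal norm_ge z)
    also have "\<dots> = ennreal (ratio p u / ratio p z)" using rp by (simp add: divide_ennreal)
    finally have "\<rho> \<le> ratio p u / ratio p z" using rp by (simp add: ennreal_le_iff)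
    then show ?thesis using rp by (simp add: field_simps)
  qed
  ultimately show ?thesis by blast
qed

lemma bunching_ratio:
  "\<exists>\<rho>. 0 < \<rho> \<and> \<rho> < 1 \<and> (\<forall>p\<in>points M. \<forall>x z u. x \<in> Ec p --> x \<noteq> 0 --> z \<in> Ec p --> z \<noteq> 0 -->
     u \<in> Eu p --> u \<noteq> 0 --> ratio p x \<le> \<rho> * ratio p u * ratio p z)"
proof -
  let ?h = "\<lambda>p. norm_on M N f Ec p / (conorm_on M N f Eu p * conorm_on M N f Ec p)"
  let ?I = "SUP p\<in>points M. ?h p"
  obtain r where r: "?I < r" "r < 1" using dense[OF bunched] by blast
  then obtain \<rho> where \<rho>: "r = ennreal \<rho>" "0 \<le> \<rho>" by (cases r rule: ennreal_cases) auto
  have "\<rho> < 1" using r(2) \<rho> by (simp add: ennreal_less_iff flip: ennreal_1)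
  moreover have "0 < \<rho>" using r(1) \<rho> by (metis ennreal_0 less_eq_real_def not_less_zero)
  moreover have "ratio p x \<le> \<rho> * ratio p u * ratio p z"
    if p: "p \<in> points M" and x: "x \<in> Ec p" "x \<noteq> 0" and z: "z \<in> Ec p" "z \<noteq> 0"
      and u: "u \<in> Eu p" "u \<noteq> 0" for p x z u
  proof -
    have S: "x \<in> S" "z \<in> S" "u \<in> S" using subb_fibre[OF _ p] subbs x u z by blast+
    have rp: "0 < ratio p x" "0 < ratio p z" "0 < ratio p u" using ratio_pos[OF p] S x u z by blast+
    have "ennreal (ratio p x / (ratio p u * ratio p z))
        = ennreal (ratio p x) / (ennreal (ratio p u) * ennreal (ratio p z))"
      using rp by (simp add: divide_ennreal ennreal_mult[symmetric])
    also have "\<dots> \<le> norm_on M N f Ec p / (ennreal (ratio p u) * ennreal (ratio p z))"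
      by (intro divide_right_mono_ennreal norm_ge x)
    also have "\<dots> \<le> ?h p"
      by (intro divide_antimono_ennreal mult_mono conorm_le u z) auto
    also have "\<dots> \<le> ennreal \<rho>" using SUP_upper[OF p, of ?h] r(1) \<rho>(1) by simp
    finally have "ratio p x / (ratio p u * ratio p z) \<le> \<rho>" using \<rho>(2) by (simp add: ennreal_le_iff)
    then show ?thesis using rp by (simp add: field_simps)
  qed
  ultimately show ?thesis by blast
qed

lemma ratio_bounds:
  assumes p: "p \<in> points M"
  shows "\<exists>lo>0. \<exists>hi. \<forall>v\<in>Eu p \<union> Ec p \<union> Es p. v \<noteq> 0 --> lo \<le> ratio p v \<and> ratio p v \<le> hi"
proof -
  let ?c = "chart_at M p" and ?c' = "chart_at M (f p)"
  note c = chart_at[OF p] and c' = chart_at[OF f_points[OF p]]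
  note cc = c(1) c'(1) c(2) c'(2)
  obtain C1 where C1: "C1 > 0" "\<And>\<xi>. \<xi> \<in> S ==> norm \<xi> \<le> C1 * nrm ?c p \<xi>" "\<And>\<xi>. nrm ?c p \<xi> \<le> C1 * norm \<xi>"
    using nrm_norm_constant[OF c] by blast
  obtain C2 where C2: "C2 > 0" "\<And>\<xi>. \<xi> \<in> S ==> norm \<xi> \<le> C2 * nrm ?c' (f p) \<xi>" "\<And>\<xi>. nrm ?c' (f p) \<xi> \<le> C2 * norm \<xi>"
    using nrm_norm_constant[OF c'] by blast
  define k where "k = norm (D f ?c ?c' p)"
  define k' where "k' = norm (D finv ?c' ?c (f p)) + 1"
  have k': "k' > 0" unfolding k'_def by (simp add: add_nonneg_pos)
  have "1 / (C1 * k' * C2) \<le> ratio p v \<and> ratio p v \<le> C2 * k * C1"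
    if v: "v \<in> E p" "v \<noteq> 0" and E: "E \<in> {Eu, Ec, Es}" for v E
  proof -
    have E': "invariant_bundle M f E" "subb E" using E invariant subbs by blast+
    have vS: "v \<in> S" using subb_fibre[OF E'(2) p] v by blast
    define \<xi> where "\<xi> = chart_diff M ?c p v"
    define \<eta> where "\<eta> = D f ?c ?c' p \<xi>"
    have \<xi>: "\<xi> \<in> EE E ?c p" unfolding \<xi>_def EE_def using v by blast
    have \<eta>: "\<eta> \<in> EE E ?c' (f p)" using D_f_EE[OF cc E'] \<xi> unfolding \<eta>_def by blast
    have S: "\<xi> \<in> S" "\<eta> \<in> S" using subb_EE(1)[OF E'(2) c] subb_EE(1)[OF E'(2) c'] \<xi> \<eta> by blast+
    have "nrm ?c p \<xi> = Nc ?c p \<xi>" "nrm ?c' (f p) \<eta> = Nc ?c' (f p) \<eta>"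
      using E \<xi> \<eta> nrm_Eu[OF c] nrm_Eu[OF c'] nrm_Ec[OF c] nrm_Ec[OF c'] nrm_Es[OF c] nrm_Es[OF c'] by auto
    then have N: "nrm ?c p \<xi> = N p v" "nrm ?c' (f p) \<eta> = N (f p) (Tf p v)"
      unfolding \<eta>_def \<xi>_def Nc_D_f[OF cc vS] Nc_chart_diff[OF c vS] by simp_all
    have Np: "0 < N p v" by (rule N_pos[OF p vS v(2)])
    have "norm \<eta> \<le> k * norm \<xi>" unfolding \<eta>_def k_def by (rule norm_blinfun)
    also have "\<dots> \<le> k * (C1 * N p v)" using C1(2)[OF S(1)] unfolding N k_def by (intro mult_left_mono) auto
    finally have "N (f p) (Tf p v) \<le> C2 * (k * (C1 * N p v))"
      using order_trans[OF C2(3)[of \<eta>] mult_left_mono] C2(1) unfolding N by simp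
    moreover have "norm \<xi> \<le> k' * (C2 * N (f p) (Tf p v))"
    proof -
      have "norm \<xi> \<le> (k' - 1) * norm \<eta>"
        using norm_blinfun[of "D finv ?c' ?c (f p)" \<eta>] D_finv_f[OF cc S(1)] unfolding k'_def \<eta>_def by simp
      also have "\<dots> \<le> k' * norm \<eta>" by (intro mult_right_mono) auto
      finally show ?thesis using order_trans[OF _ mult_left_mono[OF C2(2)[OF S(2)]]] k' unfolding N by simp
    qed
    then have "N p v \<le> C1 * (k' * (C2 * N (f p) (Tf p v)))"
      using order_trans[OF C1(3)[of \<xi>] mult_left_mono] C1(1) unfolding N by simp
    ultimately show ?thesis unfolding ratio_def using Np C1(1) C2(1) k' by (simp add: field_simps)
  qed
  moreover have "1 / (C1 * k' * C2) > 0" using C1(1) C2(1) k' by simp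
  ultimately show ?thesis by (intro exI[of _ "1 / (C1 * k' * C2)"] conjI exI[of _ "C2 * k * C1"]) auto
qed

text \<open>Domination and bunching at \<open>p\<close> leave room for three constants that separate the rates of \<open>Tf\<close> on
  the bundles strictly, hence on a neighbourhood of \<open>p\<close>. The fourth root leaves a factor \<open>e\<close> to spare for
  each of the constants.\<close>

lemma rates:
  obtains \<kappa> \<theta> where "0 < \<kappa>" "\<kappa> < 1" "0 < \<theta>" "\<theta> < 1"
    "\<And>p. p \<in> points M ==> \<exists>\<alpha> \<mu> m. 0 < \<alpha> \<and> 0 < \<mu> \<and> 0 < m \<and> \<alpha> \<le> \<kappa> * \<mu> \<and> \<alpha> \<le> \<theta> * \<mu> * m \<and>
       (\<forall>\<^sub>F q in nh p. rate q \<alpha> \<mu> m)"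
proof -
  have ds: "dominated_splitting M N f Eu Ecs" "dominated_splitting M N f Euc Es"
    using ph unfolding partially_hyperbolic_def by blast+
  obtain \<rho>1 where \<rho>1: "\<rho>1 > 1" "\<And>p u z. p \<in> points M ==> u \<in> Eu p ==> u \<noteq> 0 ==> z \<in> Ecs p ==> z \<noteq> 0 ==>
      \<rho>1 * ratio p z \<le> ratio p u" using domination_ratio[OF ds(1) subbs(1) subbs_sum(1)] by blast
  obtain \<rho>2 where \<rho>2: "\<rho>2 > 1" "\<And>p u z. p \<in> points M ==> u \<in> Euc p ==> u \<noteq> 0 ==> z \<in> Es p ==> z \<noteq> 0 ==>
      \<rho>2 * ratio p z \<le> ratio p u" using domination_ratio[OF ds(2) subbs_sum(2) subbs(3)] by blast
  obtain \<rho> where \<rho>: "0 < \<rho>" "\<rho> < 1" "\<And>p x z u. p \<in> points M ==> x \<in> Ec p ==> x \<noteq> 0 ==> z \<in> Ec p ==> z \<noteq> 0 ==>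
     u \<in> Eu p ==> u \<noteq> 0 ==> ratio p x \<le> \<rho> * ratio p u * ratio p z" using bunching_ratio by blast
  define e where "e = root 4 (min \<rho>1 (1 / \<rho>))"
  have mn: "1 < min \<rho>1 (1 / \<rho>)" using \<rho>1(1) \<rho>(1,2) by simp
  have e1: "1 < e" unfolding e_def using real_root_less_mono[of 4 1 "min \<rho>1 (1 / \<rho>)"] mn by simp
  have e4: "e ^ 4 = min \<rho>1 (1 / \<rho>)" unfolding e_def using mn by (intro real_root_pow_pos2) linarith+
  have e23: "e^2 < e^4" "e^3 < e^4" using e1 by (simp_all add: power_strict_increasing)
  have k: "e^2 / \<rho>1 < 1" using e23 e4 \<rho>1(1) by (simp add: field_simps)
  have "e^3 * \<rho> < (1 / \<rho>) * \<rho>" using e23(2) e4 \<rho>(1) by (intro mult_strict_right_mono) auto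
  then have t: "e^3 * \<rho> < 1" using \<rho>(1) by simp
  show ?thesis
  proof (rule that[of "e^2 / \<rho>1" "e^3 * \<rho>"])
    show pos: "0 < e^2 / \<rho>1" "0 < e^3 * \<rho>" using e1 \<rho>1(1) \<rho>(1) by auto
    fix p assume p: "p \<in> points M"
    obtain lo hi where lo: "0 < lo" "\<forall>v\<in>Eu p \<union> Ec p \<union> Es p. v \<noteq> 0 --> lo \<le> ratio p v \<and> ratio p v \<le> hi"
      using ratio_bounds[OF p] by blast
    define X where "X E = ratio p ` (E p - {0})" for E :: "('m, 'b) subbundle"
    have fib: "E p \<subseteq> S" "0 \<in> E p" if "E \<in> {Eu, Ec, Es}" for E
      using subb_fibre[OF _ p] subbs that subspace_0 by blast+
    have inc: "Ec p \<subseteq> Ecs p" "Es p \<subseteq> Ecs p" "Ec p \<subseteq> Euc p"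
      using fib(2)[of Ec] fib(2)[of Es] fib(2)[of Eu] unfolding bundle_sum_def
      by (force intro: exI[of _ 0])+
    have "\<exists>\<alpha> \<mu> m. 0 < \<alpha> \<and> 0 < \<mu> \<and> 0 < m \<and> \<alpha> \<le> e^2 / \<rho>1 * \<mu> \<and> \<alpha> \<le> e^3 * \<rho> * \<mu> * m \<and>
      (\<forall>x\<in>X Ec \<union> X Es. x < \<alpha>) \<and> (\<forall>y\<in>X Eu. \<mu> < y) \<and> (\<forall>x\<in>X Ec. m < x)"
    proof (rule separating_rates[OF lo(1)])
      show "lo \<le> x \<and> x \<le> hi" if "x \<in> X Ec \<union> X Eu \<union> X Es" for x
        using that lo(2) unfolding X_def by blast
      show "\<rho>1 * x \<le> y" if "x \<in> X Ec \<union> X Es" "y \<in> X Eu" for x y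
        using that \<rho>1(2)[OF p] inc unfolding X_def by blast
      show "x \<le> y" if "x \<in> X Es" "y \<in> X Ec" for x y
      proof -
        obtain s v where sv: "s \<in> Es p" "s \<noteq> 0" "x = ratio p s" "v \<in> Ec p" "v \<noteq> 0" "y = ratio p v"
          using \<open>x \<in> X Es\<close> \<open>y \<in> X Ec\<close> unfolding X_def by blast
        then have "\<rho>2 * x \<le> y" "0 < x" using \<rho>2(2)[OF p, of v s] inc ratio_pos[OF p] fib(1) by blast+
        moreover have "1 * x \<le> \<rho>2 * x" using \<open>0 < x\<close> \<rho>2(1) by (intro mult_right_mono) auto
        ultimately show ?thesis by linarith
      qed
      show "x \<le> \<rho> * y * z" if "x \<in> X Ec" "z \<in> X Ec" "y \<in> X Eu" for x z y
        using that \<rho>(3)[OF p] unfolding X_def by blast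
    qed (use e1 \<rho>1 \<rho> pos in auto)
    then obtain \<alpha> \<mu> m where r: "0 < \<alpha>" "0 < \<mu>" "0 < m" "\<alpha> \<le> e^2 / \<rho>1 * \<mu>" "\<alpha> \<le> e^3 * \<rho> * \<mu> * m"
      "\<And>x. x \<in> X Ec \<union> X Es ==> x < \<alpha>" "\<And>y. y \<in> X Eu ==> \<mu> < y" "\<And>x. x \<in> X Ec ==> m < x" by blast
    have N: "0 < N p v" if "v \<in> E p" "v \<noteq> 0" "E \<in> {Eu, Ec, Es}" for v E
      using N_pos[OF p] fib(1) that by blast
    have rt: "ratio p v \<in> X E" if "v \<in> E p" "v \<noteq> 0" for v E using that unfolding X_def by blast
    have 1: "\<forall>\<^sub>F q in nh p. \<forall>v\<in>Eu q. 0 \<le> 1 * (N (f q) (Tf q v) - \<mu> * N q v)"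
    proof (rule ratio_inequality_persists[OF subbs(1) p])
      fix v assume v: "v \<in> Eu p" "v \<noteq> 0"
      from r(7)[OF rt[where E = Eu, OF v]] N[where E = Eu, OF v] show "0 < 1 * (N (f p) (Tf p v) - \<mu> * N p v)"
        unfolding ratio_def by (simp add: field_simps)
    qed
    have 2: "\<forall>\<^sub>F q in nh p. \<forall>v\<in>Ec q. 0 \<le> 1 * (N (f q) (Tf q v) - m * N q v)"
    proof (rule ratio_inequality_persists[OF subbs(2) p])
      fix v assume v: "v \<in> Ec p" "v \<noteq> 0"
      from r(8)[OF rt[where E = Ec, OF v]] N[where E = Ec, OF v] show "0 < 1 * (N (f p) (Tf p v) - m * N p v)"
        unfolding ratio_def by (simp add: field_simps)
    qed
    have 3: "\<forall>\<^sub>F q in nh p. \<forall>v\<in>E q. 0 \<le> - 1 * (N (f q) (Tf q v) - \<alpha> * N q v)"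
      if E: "E = Ec \<or> E = Es" for E
    proof (rule ratio_inequality_persists[OF _ p])
      show "subb E" using E subbs by blast
      fix v assume v: "v \<in> E p" "v \<noteq> 0"
      from r(6)[of "ratio p v"] rt[where E = E, OF v] E N[where E = E, OF v]
      show "0 < - 1 * (N (f p) (Tf p v) - \<alpha> * N p v)"
        unfolding ratio_def by (auto simp: field_simps)
    qed
    have "\<forall>\<^sub>F q in nh p. rate q \<alpha> \<mu> m"
      using 1 2 3[of Ec, OF disjI1[OF refl]] 3[of Es, OF disjI2[OF refl]]
      by eventually_elim (auto simp: rate_def)
    then show "\<exists>\<alpha> \<mu> m. 0 < \<alpha> \<and> 0 < \<mu> \<and> 0 < m \<and> \<alpha> \<le> e^2 / \<rho>1 * \<mu> \<and> \<alpha> \<le> e^3 * \<rho> * \<mu> * m \<and>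
       (\<forall>\<^sub>F q in nh p. rate q \<alpha> \<mu> m)" using r by blast
  qed (use k t in auto)
qed

text \<open>The rates in the coordinates of arbitrary charts and in the adapted norm.\<close>

lemma rate_chart:
  assumes c: "c \<in> atlas M" "c' \<in> atlas M" "p \<in> fst c" "f p \<in> fst c'" and r: "rate p \<alpha> \<mu> m" and "0 < \<alpha>"
  shows "\<mu> * nrm c p (Pu c p \<xi>) \<le> nrm c' (f p) (D f c c' p (Pu c p \<xi>))"
    and "nrm c' (f p) (D f c c' p (Pcs c p \<xi>)) \<le> \<alpha> * nrm c p (Pcs c p \<xi>)"
    and "m * nrm c p (Pc c p \<xi>) \<le> nrm c' (f p) (D f c c' p (Pc c p \<xi>))"
proof -
  have p: "p \<in> points M" using c mem_points by blast
  have key: "\<exists>v. v \<in> E p \<and> Nc c p \<eta> = N p v \<and> Nc c' (f p) (D f c c' p \<eta>) = N (f p) (Tf p v)"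
    if "\<eta> \<in> EE E c p" "subb E" for \<eta> E
  proof -
    obtain v where v: "v \<in> E p" "\<eta> = chart_diff M c p v"
      using \<open>\<eta> \<in> EE E c p\<close> unfolding EE_def by blast
    then have "v \<in> S" using subb_fibre[OF that(2) p] by blast
    then show ?thesis using v Nc_D_f[OF c] Nc_chart_diff[OF c(1,3)] by blast
  qed
  note c1 = c(1,3) and c2 = c(2,4)
  have "nrm c' (f p) (D f c c' p (Pu c p \<xi>)) = Nc c' (f p) (D f c c' p (Pu c p \<xi>))"
    using nrm_P(1)[OF c2, of "D f c c' p \<xi>"] P_f(1)[OF c] by simp
  then show "\<mu> * nrm c p (Pu c p \<xi>) \<le> nrm c' (f p) (D f c c' p (Pu c p \<xi>))"
    using key[OF Pu_mem[OF c1] subbs(1), of \<xi>] r nrm_P(1)[OF c1] unfolding rate_def by auto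
  have "nrm c' (f p) (D f c c' p (Pc c p \<xi>)) = Nc c' (f p) (D f c c' p (Pc c p \<xi>))"
    using nrm_P(2)[OF c2, of "D f c c' p \<xi>"] P_f(4)[OF c] by simp
  then show "m * nrm c p (Pc c p \<xi>) \<le> nrm c' (f p) (D f c c' p (Pc c p \<xi>))"
    using key[OF Pc_mem[OF c1] subbs(2), of \<xi>] r nrm_P(2)[OF c1] unfolding rate_def by auto
  have "nrm c' (f p) (D f c c' p (Pcs c p \<xi>)) =
      max (Nc c' (f p) (D f c c' p (Pc c p \<xi>))) (Nc c' (f p) (D f c c' p (Ps c p \<xi>)))"
    using nrm_P(3)[OF c2, of "D f c c' p \<xi>"] P_f[OF c] by simp
  also have "\<dots> \<le> max (\<alpha> * Nc c p (Pc c p \<xi>)) (\<alpha> * Nc c p (Ps c p \<xi>))"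
    using key[OF Pc_mem[OF c1] subbs(2), of \<xi>] key[OF Ps_mem[OF c1] subbs(3), of \<xi>] r
    unfolding rate_def by (intro max.mono) auto
  also have "\<dots> = \<alpha> * nrm c p (Pcs c p \<xi>)"
    unfolding nrm_P(3)[OF c1] using \<open>0 < \<alpha>\<close> by (simp add: max_mult_distrib_left)
  finally show "nrm c' (f p) (D f c c' p (Pcs c p \<xi>)) \<le> \<alpha> * nrm c p (Pcs c p \<xi>)" .
qed

end

section \<open>Compact cores of charts and uniform constants\<close>

context smooth_mfd
begin

lemma eventually_nh_chart:
  assumes c: "c \<in> atlas M" "p \<in> fst c" and "eventually P (nh p)"
  shows "\<exists>r>0. \<forall>q\<in>fst c. dist (snd c q) (snd c p) < r --> P q"
proof -
  let ?F = "inf (filtercomap (snd c) (nhds (snd c p))) (principal (fst c))"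
  have "filterlim (\<lambda>q. q) (nh p) ?F"
    unfolding filterlim_nh_iff[OF c]
    by (auto simp: eventually_inf_principal intro: filterlim_mono[OF filterlim_filtercomap])
  then have "eventually P ?F" using assms(3) unfolding filterlim_iff by blast
  then obtain Q where Q: "eventually Q (nhds (snd c p))" "\<And>q. q \<in> fst c ==> Q (snd c q) ==> P q"
    unfolding eventually_inf_principal eventually_filtercomap by blast
  then show ?thesis unfolding eventually_nhds_metric by blast
qed

lemma openin_iff_eventually:
  assumes "U \<subseteq> points M" "\<And>p. p \<in> U ==> \<forall>\<^sub>F q in nh p. q \<in> U"
  shows "openin (mtopology M) U"
proof (rule openin_subopen[THEN iffD2], rule ballI)
  fix p assume p: "p \<in> U"
  then show "\<exists>T. openin (mtopology M) T \<and> p \<in> T \<and> T \<subseteq> U"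
    using assms(2)[OF p] assms(1) unfolding eventually_nh by blast
qed

lemma continuous_map_C2:
  assumes "C2 g"
  shows "continuous_map (mtopology M) (mtopology M) g"
  unfolding continuous_map
proof (intro conjI allI impI)
  show "g ` topspace (mtopology M) \<subseteq> topspace (mtopology M)" using C2_points[OF assms] topspace_M by auto
  fix U assume U: "openin (mtopology M) U"
  show "openin (mtopology M) {p \<in> topspace (mtopology M). g p \<in> U}"
  proof (rule openin_iff_eventually)
    fix p assume p: "p \<in> {p \<in> topspace (mtopology M). g p \<in> U}"
    then have pt: "p \<in> points M" using topspace_M by auto
    have "\<forall>\<^sub>F q in nh (g p). q \<in> U" by (rule eventually_nhI[OF U]) (use p in auto)
    from eventually_compose_filterlim[OF this filterlim_C2[OF assms pt]]
    have "\<forall>\<^sub>F q in nh p. g q \<in> U" .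
    moreover have "\<forall>\<^sub>F q in nh p. q \<in> topspace (mtopology M)"
      by (rule eventually_nhI[OF openin_topspace]) (use p in auto)
    ultimately show "\<forall>\<^sub>F q in nh p. q \<in> {p \<in> topspace (mtopology M). g p \<in> U}"
      by eventually_elim blast
  qed (auto simp: topspace_M)
qed

text \<open>Small closed balls of the coordinate space are images of compact sets under the inverse chart.\<close>

lemma compactin_chart_cball:
  assumes c: "c \<in> atlas M" "p \<in> fst c"
  shows "\<exists>r0>0. \<forall>r\<le>r0. compactin (mtopology M) {q \<in> fst c. dist (snd c q) (snd c p) \<le> r}"
proof -
  let ?X = "snd c ` fst c"
  have "openin (top_of_set S) ?X" using openin_local_dom[OF C2_id c(1) c(1)] by (simp add: local_dom_def)
  then obtain O' where O: "open O'" "?X = S \<inter> O'" unfolding openin_open by blast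
  then obtain e where e: "e > 0" "ball (snd c p) e \<subseteq> O'" using c openE by blast
  have inv: "chart_inv c (snd c q) = q" if "q \<in> fst c" for q
    using inj_chart[OF c(1)] that unfolding chart_inv_def by (simp add: inv_into_f_f)
  have cm: "continuous_map (top_of_set ?X) (mtopology M) (chart_inv c)"
    unfolding continuous_map
  proof (intro conjI allI impI)
    show "chart_inv c ` topspace (top_of_set ?X) \<subseteq> topspace (mtopology M)"
      using inv mem_points[OF c(1)] topspace_M by auto
    fix U assume U: "openin (mtopology M) U"
    show "openin (top_of_set ?X) {x \<in> topspace (top_of_set ?X). chart_inv c x \<in> U}"
      unfolding openin_euclidean_subtopology_iff
    proof (intro conjI ballI)
      fix x assume x: "x \<in> {x \<in> topspace (top_of_set ?X). chart_inv c x \<in> U}"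
      then obtain q where q: "q \<in> fst c" "x = snd c q" "q \<in> U" using inv by auto
      have "\<forall>\<^sub>F q' in nh q. q' \<in> U" by (rule eventually_nhI[OF U q(3)])
      then obtain r where "r > 0" "\<forall>q'\<in>fst c. dist (snd c q') (snd c q) < r --> q' \<in> U"
        using eventually_nh_chart[OF c(1) q(1)] by blast
      then show "\<exists>e>0. \<forall>x'\<in>?X. dist x' x < e --> x' \<in> {x \<in> topspace (top_of_set ?X). chart_inv c x \<in> U}"
        using inv q(2) by auto
    qed auto
  qed
  have "compactin (mtopology M) {q \<in> fst c. dist (snd c q) (snd c p) \<le> r}" if r: "r \<le> e / 2" for r
  proof -
    let ?K = "S \<inter> cball (snd c p) r"
    have KX: "?K \<subseteq> ?X" unfolding O(2) using r e by fastforce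
    have "compact ?K" by (intro closed_Int_compact closed_subspace sub compact_cball)
    then have "compactin (top_of_set ?X) ?K" using KX by (simp add: compactin_subtopology)
    from image_compactin[OF this cm] have "compactin (mtopology M) (chart_inv c ` ?K)" .
    moreover have "chart_inv c ` ?K = {q \<in> fst c. dist (snd c q) (snd c p) \<le> r}"
    proof
      show "chart_inv c ` ?K \<subseteq> {q \<in> fst c. dist (snd c q) (snd c p) \<le> r}"
        using KX inv by (fastforce simp: dist_commute)
      show "{q \<in> fst c. dist (snd c q) (snd c p) \<le> r} \<subseteq> chart_inv c ` ?K"
      proof
        fix q assume "q \<in> {q \<in> fst c. dist (snd c q) (snd c p) \<le> r}"
        then show "q \<in> chart_inv c ` ?K"
          using inv c by (intro image_eqI[of _ _ "snd c q"]) (auto simp: dist_commute)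
      qed
    qed
    ultimately show ?thesis by simp
  qed
  then show ?thesis using e(1) by (intro exI[of _ "e / 2"]) auto
qed

lemma eventually_chart_ball:
  assumes "c \<in> atlas M" "p \<in> fst c" "r > 0"
  shows "\<forall>\<^sub>F q in nh p. q \<in> fst c \<and> dist (snd c q) (snd c p) < r"
  using eventually_chart[OF assms(1,2)] tendstoD[OF tendsto_chart[OF assms(1,2)] assms(3)]
  by eventually_elim blast

text \<open>A finite family of charts, each with a compact core in its domain, whose cores cover \<open>M\<close>
  with their interiors.\<close>

definition good_cover :: "'m set => ('m => 'm set) => ('m => 'm) => bool" where
  "good_cover I core idx \<longleftrightarrow> finite I \<and> I \<subseteq> points M \<and>
     (\<forall>i\<in>I. compactin (mtopology M) (core i) \<and> core i \<subseteq> fst (chart_at M i)) \<and>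
     (\<forall>p\<in>points M. idx p \<in> I \<and> (\<forall>\<^sub>F q in nh p. q \<in> core (idx p)))"

lemma good_cover_exists:
  assumes "compact_space (mtopology M)"
  shows "\<exists>I core idx. good_cover I core idx"
proof -
  have "\<exists>r. \<forall>p\<in>points M. r p > 0 \<and>
      compactin (mtopology M) {q \<in> fst (chart_at M p). dist (snd (chart_at M p) q) (snd (chart_at M p) p) \<le> r p}"
  proof (intro bchoice ballI)
    fix p assume "p \<in> points M"
    from compactin_chart_cball[OF chart_at[OF this]]
    show "\<exists>r>0. compactin (mtopology M)
        {q \<in> fst (chart_at M p). dist (snd (chart_at M p) q) (snd (chart_at M p) p) \<le> r}" by blast
  qed
  then obtain r where r: "\<And>p. p \<in> points M ==> r p > 0"
      "\<And>p. p \<in> points M ==>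
      compactin (mtopology M) {q \<in> fst (chart_at M p). dist (snd (chart_at M p) q) (snd (chart_at M p) p) \<le> r p}"
    by blast
  define core where "core p = {q \<in> fst (chart_at M p). dist (snd (chart_at M p) q) (snd (chart_at M p) p) \<le> r p}" for p
  define U where "U p = {q \<in> fst (chart_at M p). snd (chart_at M p) q \<in> S \<inter> ball (snd (chart_at M p) p) (r p)}" for p
  have U: "openin (mtopology M) (U p)" "p \<in> U p" "U p \<subseteq> core p" if "p \<in> points M" for p
  proof -
    note c = chart_at[OF that]
    show "openin (mtopology M) (U p)"
      unfolding U_def using openin_open_Int[of "ball (snd (chart_at M p) p) (r p)" S] by (intro openin_chart[OF c(1)]) auto
    show "p \<in> U p" "U p \<subseteq> core p" unfolding U_def core_def using c r[OF that] by (auto simp: dist_commute)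
  qed
  have "compactin (mtopology M) (points M)" using assms topspace_M unfolding compact_space_def by simp
  moreover have "\<forall>V\<in>U ` points M. openin (mtopology M) V" "points M \<subseteq> \<Union>(U ` points M)" using U by blast+
  ultimately have "\<exists>\<F>. finite \<F> \<and> \<F> \<subseteq> U ` points M \<and> points M \<subseteq> \<Union>\<F>" unfolding compactin_def by blast
  then obtain I where I: "I \<subseteq> points M" "finite I" "points M \<subseteq> \<Union>(U ` I)" by (metis finite_subset_image)
  then have "\<exists>i. i \<in> I \<and> p \<in> U i" if "p \<in> points M" for p using that by blast
  then obtain idx where idx: "\<And>p. p \<in> points M ==> idx p \<in> I \<and> p \<in> U (idx p)" by metis
  have "good_cover I core idx"
    unfolding good_cover_def
  proof (intro conjI ballI)
    fix i assume "i \<in> I"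
    then show "compactin (mtopology M) (core i)" using r I(1) unfolding core_def by blast
    show "core i \<subseteq> fst (chart_at M i)" unfolding core_def by blast
  next
    fix p assume p: "p \<in> points M"
    then show "idx p \<in> I" using idx by blast
    then have ip: "idx p \<in> points M" using I by blast
    show "\<forall>\<^sub>F q in nh p. q \<in> core (idx p)"
      by (rule eventually_nhI[OF U(1)[OF ip]]) (use idx[OF p] U(3)[OF ip] in auto)
  qed (use I in auto)
  then show ?thesis by blast
qed

end

context center_bunched
begin

text \<open>A good cover is fixed. The core of the chart \<open>cs p\<close> is a neighbourhood of \<open>p\<close>, and \<open>cs\<close> takes finitely
  many values.\<close>

definition cover where
  "cover = (SOME x. good_cover (fst x) (fst (snd x)) (snd (snd x)))"

definition I0 :: "'m set" where "I0 = fst cover"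
definition core :: "'m => 'm set" where "core = fst (snd cover)"
definition idx :: "'m => 'm" where "idx = snd (snd cover)"
definition cs :: "'m => ('m, 'b) chart" where "cs p = chart_at M (idx p)"

lemma good_cover: "good_cover I0 core idx"
proof -
  have "\<exists>x. good_cover (fst x) (fst (snd x)) (snd (snd x))"
    using good_cover_exists[OF compactM] by auto
  from someI_ex[OF this] show ?thesis unfolding I0_def core_def idx_def cover_def .
qed

lemma cover_facts:
  shows "finite I0" "i \<in> I0 ==> i \<in> points M"
    and "i \<in> I0 ==> compactin (mtopology M) (core i)" "i \<in> I0 ==> core i \<subseteq> fst (chart_at M i)"
    and "p \<in> points M ==> idx p \<in> I0" "p \<in> points M ==> \<forall>\<^sub>F q in nh p. q \<in> core (idx p)"
    and "p \<in> points M ==> p \<in> core (idx p)"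
    and "p \<in> points M ==> cs p \<in> atlas M" "p \<in> points M ==> p \<in> fst (cs p)"
proof -
  show 1: "finite I0" "i \<in> I0 ==> i \<in> points M"
    "i \<in> I0 ==> compactin (mtopology M) (core i)" "i \<in> I0 ==> core i \<subseteq> fst (chart_at M i)"
    "p \<in> points M ==> idx p \<in> I0" "p \<in> points M ==> \<forall>\<^sub>F q in nh p. q \<in> core (idx p)" for i p
    using good_cover unfolding good_cover_def by blast+
  show 2: "p \<in> points M ==> p \<in> core (idx p)" using 1(6) eventually_nh_self by blast
  show "p \<in> points M ==> cs p \<in> atlas M" "p \<in> points M ==> p \<in> fst (cs p)"
    unfolding cs_def using 1(2,4,5) 2 chart_at(1) by blast+
qed

text \<open>Local constants for a single iterate of \<open>f\<close>, in any pair of charts, become uniform for the finitely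
  many pairs of selected charts.\<close>

lemma uniform_on_cores:
  fixes Q :: "real => ('m, 'b) chart => ('m, 'b) chart => 'm => bool"
  assumes loc: "\<And>p c c'. p \<in> points M ==> c \<in> atlas M ==> c' \<in> atlas M ==> p \<in> fst c ==> f p \<in> fst c' ==>
      \<exists>\<delta>>0. \<forall>\<^sub>F q in nh p. Q \<delta> c c' q"
    and mono: "\<And>\<delta> \<delta>' c c' p. Q \<delta> c c' p ==> 0 < \<delta>' ==> \<delta>' \<le> \<delta> ==> Q \<delta>' c c' p"
  shows "\<exists>\<delta>>0. \<forall>i\<in>I0. \<forall>j\<in>I0. \<forall>p\<in>core i. f p \<in> core j --> Q \<delta> (chart_at M i) (chart_at M j) p"
proof (cases "I0 = {}")
  case True
  show ?thesis by (rule exI[of _ 1]) (simp add: True)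
next
  case False
  have "\<exists>\<delta>>0. \<forall>p\<in>core i. f p \<in> core j --> Q \<delta> (chart_at M i) (chart_at M j) p"
    if i: "i \<in> I0" and j: "j \<in> I0" for i j
  proof -
    let ?K = "core i \<inter> {p \<in> topspace (mtopology M). f p \<in> core j}"
    have "closedin (mtopology M) (core j)"
      using compactin_imp_closedin[OF Hausdorff cover_facts(3)[OF j]] .
    then have "closedin (mtopology M) {p \<in> topspace (mtopology M). f p \<in> core j}"
      using closedin_continuous_map_preimage[OF continuous_map_C2[OF C2_f]] by blast
    then have K: "compactin (mtopology M) ?K"
      using compact_Int_closedin[OF cover_facts(3)[OF i]] by blast
    have "\<exists>\<delta>>0. \<forall>p\<in>?K. Q \<delta> (chart_at M i) (chart_at M j) p"
    proof (rule compactin_uniform[OF K])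
      fix p assume p: "p \<in> ?K"
      then have "p \<in> points M" "p \<in> fst (chart_at M i)" "f p \<in> fst (chart_at M j)"
        using cover_facts(4) i j topspace_M by auto
      from loc[OF this(1) chart_at(1)[OF cover_facts(2)[OF i]] chart_at(1)[OF cover_facts(2)[OF j]] this(2,3)]
      obtain \<delta> where "\<delta> > 0" "\<forall>\<^sub>F q in nh p. Q \<delta> (chart_at M i) (chart_at M j) q" by blast
      then show "\<exists>\<delta>>0. \<forall>\<^sub>F q in nhdsin (mtopology M) p. q \<in> ?K --> Q \<delta> (chart_at M i) (chart_at M j) q"
        unfolding nh_def by (intro exI[of _ \<delta>] conjI) (auto elim: eventually_mono)
    qed (rule mono)
    moreover have "core i \<subseteq> topspace (mtopology M)"
      using cover_facts(3)[OF i] by (rule compactin_subset_topspace)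
    ultimately show ?thesis by blast
  qed
  then obtain d where d: "\<And>i j. i \<in> I0 ==> j \<in> I0 ==> d i j > 0 \<and>
      (\<forall>p\<in>core i. f p \<in> core j --> Q (d i j) (chart_at M i) (chart_at M j) p)" by metis
  define \<delta> where "\<delta> = Min ((\<lambda>(i, j). d i j) ` (I0 \<times> I0))"
  have fin: "finite ((\<lambda>(i, j). d i j) ` (I0 \<times> I0))" using cover_facts(1) by simp
  have "\<delta> > 0" unfolding \<delta>_def using fin False d by (subst Min_gr_iff) auto
  moreover have "\<delta> \<le> d i j" if "i \<in> I0" "j \<in> I0" for i j
    unfolding \<delta>_def using fin that by (intro Min_le) auto
  ultimately show ?thesis using d mono by (intro exI[of _ \<delta>]) blast
qed

lemma uniform_on_M:
  fixes Q :: "real => 'm => bool"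
  assumes loc: "\<And>p. p \<in> points M ==> \<exists>\<delta>>0. \<forall>\<^sub>F q in nh p. Q \<delta> q"
    and mono: "\<And>\<delta> \<delta>' p. Q \<delta> p ==> 0 < \<delta>' ==> \<delta>' \<le> \<delta> ==> Q \<delta>' p"
  shows "\<exists>\<delta>>0. \<forall>p\<in>points M. Q \<delta> p"
proof -
  have "compactin (mtopology M) (points M)" using compactM topspace_M unfolding compact_space_def by simp
  then show ?thesis
  proof (rule compactin_uniform)
    fix p assume "p \<in> points M"
    then obtain \<delta> where "\<delta> > 0" "\<forall>\<^sub>F q in nh p. Q \<delta> q" using loc by blast
    then show "\<exists>\<delta>>0. \<forall>\<^sub>F q in nhdsin (mtopology M) p. q \<in> points M --> Q \<delta> q"
      unfolding nh_def by (intro exI[of _ \<delta>] conjI) (auto elim: eventually_mono)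
  qed (rule mono)
qed

end


section \<open>Paths tangent to the center bundle\<close>

context center_bunched
begin

text \<open>Paths tangent to \<open>E\<^sup>c\<close>, parametrised by the unit interval; the bound \<open>w\<close> on the speed then bounds
  the length.\<close>

definition is_cpath :: "(real => 'm) => (real => 'b) => real => bool" where
  "is_cpath \<gamma> \<gamma>' w \<longleftrightarrow>
     (\<forall>t\<in>{0..1}. has_velocity M \<gamma> (\<gamma>' t) t {0..1} \<and> \<gamma>' t \<in> Ec (\<gamma> t) \<and> N (\<gamma> t) (\<gamma>' t) \<le> w)"

definition cpath :: "real => 'm => 'm => bool" where
  "cpath w p q \<longleftrightarrow> (\<exists>\<gamma> \<gamma>'. is_cpath \<gamma> \<gamma>' w \<and> \<gamma> 0 = p \<and> \<gamma> 1 = q)"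

lemma is_cpathD:
  assumes "is_cpath \<gamma> \<gamma>' w" "t \<in> {0..1}"
  shows "\<gamma> t \<in> points M" "\<gamma>' t \<in> S" "filterlim \<gamma> (nh (\<gamma> t)) (at t within {0..1})"
    and "c \<in> atlas M ==> \<gamma> t \<in> fst c ==>
      ((\<lambda>s. snd c (\<gamma> s)) has_vector_derivative chart_diff M c (\<gamma> t) (\<gamma>' t)) (at t within {0..1})"
    and "c \<in> atlas M ==> \<gamma> t \<in> fst c ==> nrm c (\<gamma> t) (chart_diff M c (\<gamma> t) (\<gamma>' t)) \<le> w"
proof -
  have v: "has_velocity M \<gamma> (\<gamma>' t) t {0..1}" "\<gamma>' t \<in> Ec (\<gamma> t)" "N (\<gamma> t) (\<gamma>' t) \<le> w"
    using assms unfolding is_cpath_def by blast+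
  show p: "\<gamma> t \<in> points M" using v(1) unfolding has_velocity_def by blast
  show S: "\<gamma>' t \<in> S" using subb_fibre[OF subbs(2) p] v(2) by blast
  show "filterlim \<gamma> (nh (\<gamma> t)) (at t within {0..1})" by (rule velocity_lim[OF v(1) assms(2) S])
  show "c \<in> atlas M ==> \<gamma> t \<in> fst c ==>
      ((\<lambda>s. snd c (\<gamma> s)) has_vector_derivative chart_diff M c (\<gamma> t) (\<gamma>' t)) (at t within {0..1})"
    by (rule velocity_chart[OF v(1) assms(2) S])
  show "nrm c (\<gamma> t) (chart_diff M c (\<gamma> t) (\<gamma>' t)) \<le> w" if c: "c \<in> atlas M" "\<gamma> t \<in> fst c"
  proof -
    have "chart_diff M c (\<gamma> t) (\<gamma>' t) \<in> EE Ec c (\<gamma> t)" using v(2) unfolding EE_def by blast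
    then show ?thesis using nrm_Ec[OF c] Nc_chart_diff[OF c S] v(3) by simp
  qed
qed

lemma tangent_finv:
  assumes p: "p \<in> points M" and "invariant_bundle M f E" "subb E" "v \<in> E (f p)"
  shows "Tfinv (f p) v \<in> E p" "Tf p (Tfinv (f p) v) = v"
proof -
  note c = chart_at[OF p] and c' = chart_at[OF f_points[OF p]]
  obtain u where u: "u \<in> E p" "v = Tf p u"
    using assms(2,4) p unfolding invariant_bundle_def by blast
  have uS: "u \<in> S" using subb_fibre[OF assms(3) p] u by blast
  have vS: "v \<in> S" using tangent_map_S[OF p uS] u by simp
  have "Tfinv (f p) v = u"
    using tangent_map_eq[OF C2_finv f_points[OF p] vS] tangent_map_eq[OF C2_f p uS] u(2)
      D_finv_f[OF c(1) c'(1) c(2) c'(2) uS] p by simp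
  then show "Tfinv (f p) v \<in> E p" "Tf p (Tfinv (f p) v) = v"
    using u by simp_all
qed

text \<open>Pulling a center path back by \<open>f\<close> multiplies its speed by at most \<open>1 / m\<close>.\<close>

lemma cpath_finv:
  assumes \<gamma>: "is_cpath \<gamma> \<gamma>' w" and m: "m > 0" and r: "\<And>t. t \<in> {0..1} ==> rate (finv (\<gamma> t)) \<alpha> \<mu> m"
  shows "cpath (w / m) (finv (\<gamma> 0)) (finv (\<gamma> 1))"
proof -
  define \<eta>' where "\<eta>' t = Tfinv (\<gamma> t) (\<gamma>' t)" for t
  have "is_cpath (\<lambda>t. finv (\<gamma> t)) \<eta>' (w / m)"
    unfolding is_cpath_def
  proof (intro ballI conjI)
    fix t :: real assume t: "t \<in> {0..1}"
    note d = is_cpathD[OF \<gamma> t]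
    have v: "has_velocity M \<gamma> (\<gamma>' t) t {0..1}" "\<gamma>' t \<in> Ec (\<gamma> t)" "N (\<gamma> t) (\<gamma>' t) \<le> w"
      using \<gamma> t unfolding is_cpath_def by blast+
    show "has_velocity M (\<lambda>t. finv (\<gamma> t)) (\<eta>' t) t {0..1}"
      unfolding \<eta>'_def by (rule velocity_image[OF C2_finv v(1) t d(2)])
    have ff: "f (finv (\<gamma> t)) = \<gamma> t" using d(1) by simp
    note tf = tangent_finv[OF finv_points[OF d(1)] invariant(2) subbs(2), of "\<gamma>' t", unfolded ff, OF v(2)]
    show "\<eta>' t \<in> Ec (finv (\<gamma> t))" using tf(1) unfolding \<eta>'_def .
    have "m * N (finv (\<gamma> t)) (\<eta>' t) \<le> N (\<gamma> t) (\<gamma>' t)"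
      using r[OF t] tf ff unfolding rate_def \<eta>'_def by metis
    then have "m * N (finv (\<gamma> t)) (\<eta>' t) \<le> w" using v(3) by linarith
    then show "N (finv (\<gamma> t)) (\<eta>' t) \<le> w / m" using m by (simp add: field_simps)
  qed
  then show ?thesis unfolding cpath_def by blast
qed

text \<open>A short center path stays near its initial point: as long as it stays in a ball of the chart, its
  coordinates move by at most a multiple of \<open>w\<close>, which is less than the radius of the ball.\<close>

lemma cpath_confined:
  assumes c: "c \<in> atlas M" "p0 \<in> fst c" and P: "eventually P (nh p0)"
  shows "\<exists>\<delta>>0. \<forall>\<^sub>F p in nh p0. \<forall>w \<gamma> \<gamma>'. is_cpath \<gamma> \<gamma>' w --> w \<le> \<delta> --> \<gamma> 0 = p -->
    (\<forall>t\<in>{0..1}. P (\<gamma> t) \<and> \<gamma> t \<in> fst c \<and> norm (snd c (\<gamma> t) - snd c p) \<le> w / \<delta>)"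
proof -
  obtain C where C: "C > 0" "\<forall>\<^sub>F q in nh p0. \<forall>\<xi>\<in>S. norm \<xi> \<le> C * nrm c q \<xi> \<and> nrm c q \<xi> \<le> C * norm \<xi>"
    using nrm_equiv[OF c] by blast
  obtain r1 where r1: "r1 > 0" "\<And>q. q \<in> fst c ==> dist (snd c q) (snd c p0) < r1 ==>
      P q \<and> (\<forall>\<xi>\<in>S. norm \<xi> \<le> C * nrm c q \<xi>)"
    using eventually_nh_chart[OF c eventually_conj[OF P C(2)]] by blast
  obtain r0 where r0: "r0 > 0"
    "\<And>r. r \<le> r0 ==> compactin (mtopology M) {q \<in> fst c. dist (snd c q) (snd c p0) \<le> r}"
    using compactin_chart_cball[OF c] by blast
  define r where "r = min r0 (r1 / 2)"
  define K where "K = {q \<in> fst c. dist (snd c q) (snd c p0) \<le> r}"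
  have r: "r > 0" "r < r1" unfolding r_def using r0(1) r1(1) by auto
  have clK: "closedin (mtopology M) K"
    unfolding K_def by (rule compactin_imp_closedin[OF Hausdorff r0(2)]) (simp add: r_def)
  have KP: "q \<in> fst c" "P q" "\<xi> \<in> S ==> norm \<xi> \<le> C * nrm c q \<xi>" if "q \<in> K" for q \<xi>
    using that r1(2)[of q] r unfolding K_def by auto
  define \<delta> where "\<delta> = min (r / (4 * C)) (1 / C)"
  have \<delta>: "\<delta> > 0" "C * \<delta> \<le> r / 4" "C \<le> 1 / \<delta>"
  proof -
    show "\<delta> > 0" unfolding \<delta>_def using r C(1) by simp
    have "\<delta> \<le> r / (4 * C)" "\<delta> \<le> 1 / C" unfolding \<delta>_def by auto
    then show "C * \<delta> \<le> r / 4" "C \<le> 1 / \<delta>" using C(1) \<open>\<delta> > 0\<close> by (auto simp: field_simps)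
  qed
  have "\<forall>\<^sub>F p in nh p0. p \<in> fst c \<and> dist (snd c p) (snd c p0) < r / 4"
    using eventually_chart_ball[OF c, of "r / 4"] r by simp
  then have "\<forall>\<^sub>F p in nh p0. \<forall>w \<gamma> \<gamma>'. is_cpath \<gamma> \<gamma>' w --> w \<le> \<delta> --> \<gamma> 0 = p -->
    (\<forall>t\<in>{0..1}. P (\<gamma> t) \<and> \<gamma> t \<in> fst c \<and> norm (snd c (\<gamma> t) - snd c p) \<le> w / \<delta>)"
  proof eventually_elim
    case (elim p)
    show ?case
    proof (intro allI impI)
      fix w \<gamma> \<gamma>' assume \<gamma>: "is_cpath \<gamma> \<gamma>' w" and w: "w \<le> \<delta>" and \<gamma>0: "\<gamma> 0 = p"
      note d = is_cpathD[OF \<gamma>]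
      have w0: "0 \<le> w"
        using nrm_nonneg[of c p] d(5)[of 0 c] \<gamma>0 elim c(1) by (smt (verit) atLeastAtMost_iff)
      have move: "norm (snd c (\<gamma> \<tau>) - snd c p) \<le> C * w"
        if \<tau>: "\<tau> \<in> {0..1}" and in_K: "\<And>t. t \<in> {0..\<tau>} ==> \<gamma> t \<in> K" for \<tau>
      proof -
        have "norm (snd c (\<gamma> \<tau>) - snd c (\<gamma> 0)) \<le> (C * w) * norm (\<tau> - 0)"
        proof (rule differentiable_bound[of "{0..\<tau>}" "\<lambda>t. snd c (\<gamma> t)" "\<lambda>t h. h *\<^sub>R chart_diff M c (\<gamma> t) (\<gamma>' t)"])
          fix t assume t: "t \<in> {0..\<tau>}"
          then have t1: "t \<in> {0..1}" using \<tau> by auto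
          note K = KP[OF in_K[OF t]]
          from d(4)[OF t1 c(1) K(1)]
          show "((\<lambda>t. snd c (\<gamma> t)) has_derivative (\<lambda>h. h *\<^sub>R chart_diff M c (\<gamma> t) (\<gamma>' t))) (at t within {0..\<tau>})"
            unfolding has_vector_derivative_def by (rule has_derivative_subset) (use \<tau> in auto)
          have "norm (chart_diff M c (\<gamma> t) (\<gamma>' t)) \<le> C * nrm c (\<gamma> t) (chart_diff M c (\<gamma> t) (\<gamma>' t))"
            by (rule K(3)[OF chart_diff_S[OF c(1) K(1) d(2)[OF t1]]])
          also have "\<dots> \<le> C * w" using d(5)[OF t1 c(1) K(1)] C(1) by simp
          finally show "onorm (\<lambda>h. h *\<^sub>R chart_diff M c (\<gamma> t) (\<gamma>' t)) \<le> C * w"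
            using onorm_scaleR_left[OF bounded_linear_ident, of "chart_diff M c (\<gamma> t) (\<gamma>' t)"]
              onorm_id_le[where 'a = real] mult_right_mono[of "onorm (\<lambda>h::real. h)" 1 "norm (chart_diff M c (\<gamma> t) (\<gamma>' t))"]
            by simp
        qed (use \<tau> in auto)
        also have "\<dots> \<le> C * w" using \<tau> C(1) w0 by (simp add: mult_left_le)
        finally show ?thesis using \<gamma>0 by simp
      qed
      define good where "good t \<longleftrightarrow> (\<forall>s\<in>{0..t}. \<gamma> s \<in> K)" for t
      \<comment> \<open>continuity propagates \<open>good\<close> past every point up to which it holds\<close>
      have "0 \<le> (0::real) \<and> 1 \<le> (1::real) \<and> good 0 --> good 1"
      proof (rule Bolzano[of 0 1 "\<lambda>a b. 0 \<le> a \<and> b \<le> 1 \<and> good a --> good b"])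
        fix \<tau> :: real assume "0 \<le> \<tau>" "\<tau> \<le> 1"
        then have \<tau>: "\<tau> \<in> {0..1}" by simp
        have near: "\<exists>e>0. \<forall>s\<in>{0..1}. \<bar>s - \<tau>\<bar> < e --> Q (\<gamma> s)" if "\<forall>\<^sub>F q in nh (\<gamma> \<tau>). Q q" "Q (\<gamma> \<tau>)" for Q
          using eventually_compose_filterlim[OF that(1) d(3)[OF \<tau>]] that(2)
          unfolding eventually_at dist_real_def by metis
        show "\<exists>e>0. \<forall>a b. a \<le> \<tau> \<and> \<tau> \<le> b \<and> b - a < e --> (0 \<le> a \<and> b \<le> 1 \<and> good a --> good b)"
        proof (cases "good \<tau>")
          case True
          then have \<tau>K: "\<gamma> \<tau> \<in> K" and mv: "norm (snd c (\<gamma> \<tau>) - snd c p) \<le> C * w"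
            using move[OF \<tau>] \<tau> unfolding good_def by auto
          have "C * w \<le> C * \<delta>" using w C(1) by simp
          then have "dist (snd c (\<gamma> \<tau>)) (snd c p) \<le> r / 4" using mv \<delta>(2) by (simp add: dist_norm)
          then have dr: "dist (snd c (\<gamma> \<tau>)) (snd c p0) < r"
            using elim r dist_triangle[of "snd c (\<gamma> \<tau>)" "snd c p0" "snd c p"] by linarith
          have "\<forall>\<^sub>F q in nh (\<gamma> \<tau>). q \<in> fst c \<and> dist (snd c q) (snd c (\<gamma> \<tau>)) < r - dist (snd c (\<gamma> \<tau>)) (snd c p0)"
            using dr by (intro eventually_chart_ball[OF c(1) KP(1)[OF \<tau>K]]) simp
          then have "\<forall>\<^sub>F q in nh (\<gamma> \<tau>). q \<in> K"
          proof eventually_elim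
            case (elim q)
            then show ?case unfolding K_def
              using dist_triangle[of "snd c q" "snd c p0" "snd c (\<gamma> \<tau>)"] by auto
          qed
          from near[OF this \<tau>K] obtain e where e: "e > 0" "\<forall>s\<in>{0..1}. \<bar>s - \<tau>\<bar> < e --> \<gamma> s \<in> K" by blast
          have "good b" if "a \<le> \<tau>" "\<tau> \<le> b" "b - a < e" "b \<le> 1" for a b
            unfolding good_def
          proof
            fix s assume "s \<in> {0..b}"
            then show "\<gamma> s \<in> K" using True e(2) that unfolding good_def by (cases "s \<le> \<tau>") auto
          qed
          then show ?thesis using e(1) by blast
        next
          case False
          then obtain s where s: "s \<in> {0..\<tau>}" "\<gamma> s \<notin> K" unfolding good_def by blast
          have "\<exists>e>0. \<forall>a\<in>{0..\<tau>}. \<tau> - a < e --> \<not> good a"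
          proof (cases "s = \<tau>")
            case True
            have "openin (mtopology M) (points M - K)" using clK topspace_M by (simp add: closedin_def)
            then have "\<forall>\<^sub>F q in nh (\<gamma> \<tau>). q \<notin> K" by (rule eventually_nhI) (use s True d(1)[OF \<tau>] in auto)
            from near[OF this] s(2) True obtain e where e: "e > 0" "\<forall>s\<in>{0..1}. \<bar>s - \<tau>\<bar> < e --> \<gamma> s \<notin> K" by blast
            have "\<not> good a" if "a \<in> {0..\<tau>}" "\<tau> - a < e" for a
            proof -
              have "\<gamma> a \<notin> K" using e(2) \<tau> that by auto
              then show ?thesis unfolding good_def using that(1) by auto
            qed
            then show ?thesis using e(1) by blast
          next
            case False
            then show ?thesis using s unfolding good_def by (intro exI[of _ "\<tau> - s"]) auto
          qed
          then show ?thesis by fastforce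
        qed
      qed (use \<gamma>0 in auto)
      moreover have "good 0" unfolding good_def using \<gamma>0 elim r unfolding K_def by simp
      ultimately have all_K: "\<gamma> t \<in> K" if "t \<in> {0..1}" for t using that unfolding good_def by simp
      show "\<forall>t\<in>{0..1}. P (\<gamma> t) \<and> \<gamma> t \<in> fst c \<and> norm (snd c (\<gamma> t) - snd c p) \<le> w / \<delta>"
      proof
        fix t :: real assume t: "t \<in> {0..1}"
        have "norm (snd c (\<gamma> t) - snd c p) \<le> C * w" by (rule move[OF t]) (use all_K t in auto)
        also have "\<dots> \<le> w / \<delta>" using \<delta>(3) w0 mult_right_mono[of C "1 / \<delta>" w] by simp
        finally show "P (\<gamma> t) \<and> \<gamma> t \<in> fst c \<and> norm (snd c (\<gamma> t) - snd c p) \<le> w / \<delta>"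
          using KP[OF all_K[OF t]] by blast
      qed
    qed
  qed
  then show ?thesis using \<delta>(1) by blast
qed

end

section \<open>The unstable bundle is Lipschitz along center paths\<close>

context center_bunched
begin

text \<open>The plane \<open>E\<^sup>u q\<close>, translated to \<open>p\<close> in the chart \<open>c\<close>, lies in the cone of width \<open>\<sigma>\<close> around
  \<open>E\<^sup>u p\<close>. The smallest \<open>\<sigma>\<close> measures the distance of the two planes.\<close>

definition cone :: "real => ('m, 'b) chart => 'm => 'm => bool" where
  "cone \<sigma> c p q \<longleftrightarrow> (\<forall>\<omega>\<in>EE Eu c q. nrm c p (Pcs c p \<omega>) \<le> \<sigma> * nrm c p (Pu c p \<omega>))"

lemma cpath_nonneg:
  assumes "cpath w p q" shows "0 \<le> w" "p \<in> points M" "q \<in> points M"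
proof -
  obtain \<gamma> \<gamma>' where \<gamma>: "is_cpath \<gamma> \<gamma>' w" "\<gamma> 0 = p" "\<gamma> 1 = q" using assms unfolding cpath_def by blast
  note d0 = is_cpathD[OF \<gamma>(1), of 0] and d1 = is_cpathD[OF \<gamma>(1), of 1]
  show p: "p \<in> points M" "q \<in> points M" using d0(1) d1(1) \<gamma> by simp_all
  show "0 \<le> w" using d0(5)[OF _ chart_at] nrm_nonneg[OF chart_at] p \<gamma>(2) by (meson atLeastAtMost_iff order_refl order_trans zero_le_one)
qed

text \<open>The start of the iteration: by continuity the planes at nearby points lie in a cone of width one
  around each other.\<close>

lemma cone_nearby:
  assumes c: "c \<in> atlas M" "p \<in> fst c"
  shows "\<forall>\<^sub>F z in nh p \<times>\<^sub>F nh p. cone 1 c (fst z) (snd z)"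
proof -
  let ?G = "nh p \<times>\<^sub>F nh p"
  have f1: "filterlim fst (nh p) ?G" and f2: "filterlim snd (nh p) ?G"
    by (rule filterlim_fst filterlim_snd)+
  have "\<forall>\<^sub>F z in ?G. \<forall>\<xi>\<in>EE Eu c (snd z). norm \<xi> = 1 -->
      0 < nrm c (fst z) (Pu c (fst z) \<xi>) - nrm c (fst z) (Pcs c (fst z) \<xi>)"
  proof (rule strict_inequality_persists[where k = "\<lambda>\<xi>. nrm c p (Pu c p \<xi>) - nrm c p (Pcs c p \<xi>)", OF subbs(1) c f2])
    fix \<xi> assume \<xi>: "\<xi> \<in> EE Eu c p" "norm \<xi> = 1"
    have "\<xi> \<in> S" using \<xi> subb_EE[OF subbs(1) c] by blast
    moreover have "\<xi> \<noteq> 0" using \<xi> by auto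
    ultimately have "nrm c p \<xi> \<noteq> 0" using nrm_eq_0[OF c] by blast
    then show "0 < nrm c p (Pu c p \<xi>) - nrm c p (Pcs c p \<xi>)"
      using P_Eu[OF c \<xi>(1)] nrm_nonneg[OF c, of \<xi>] nrm_0[OF c] by simp
  next
    fix \<xi> assume \<xi>: "\<xi> \<in> S"
    let ?H = "?G \<times>\<^sub>F nhds \<xi>"
    have g: "filterlim (\<lambda>z. fst (fst z)) (nh p) ?H" using filterlim_compose[OF f1 filterlim_fst] .
    have s: "(snd \<longlongrightarrow> \<xi>) ?H" by (rule filterlim_snd)
    have o: "((\<lambda>z. oproj S (snd z)) \<longlongrightarrow> \<xi>) ?H"
      using blinfun.tendsto[OF tendsto_const s, of "oproj S"] \<xi> by simp
    show "((\<lambda>z. nrm c (fst (fst z)) (Pu c (fst (fst z)) (oproj S (snd z))) - nrm c (fst (fst z)) (Pcs c (fst (fst z)) (oproj S (snd z))))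
        \<longlongrightarrow> nrm c p (Pu c p \<xi>) - nrm c p (Pcs c p \<xi>)) ?H"
      by (intro tendsto_diff nrm_tendsto[OF c g] blinfun.tendsto o
          filterlim_compose[OF P_tendsto(1)[OF c] g] filterlim_compose[OF P_tendsto(3)[OF c] g])
  qed
  then show ?thesis
    using eventually_compose_filterlim[OF eventually_chart[OF c] f1]
      eventually_compose_filterlim[OF eventually_chart[OF c] f2]
  proof eventually_elim
    case (elim z)
    note c1 = c(1) elim(2) and c2 = c(1) elim(3)
    show ?case
      unfolding cone_def
    proof
      fix \<omega> assume \<omega>: "\<omega> \<in> EE Eu c (snd z)"
      show "nrm c (fst z) (Pcs c (fst z) \<omega>) \<le> 1 * nrm c (fst z) (Pu c (fst z) \<omega>)"
      proof (cases "\<omega> = 0")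
        case False
        let ?b = "inverse (norm \<omega>)"
        have b: "?b > 0" using False by simp
        have "?b *\<^sub>R \<omega> \<in> EE Eu c (snd z)" using subspace_scale[OF subb_EE(2)[OF subbs(1) c2] \<omega>] .
        moreover have "norm (?b *\<^sub>R \<omega>) = 1" using False by simp
        ultimately have "nrm c (fst z) (Pcs c (fst z) (?b *\<^sub>R \<omega>)) < nrm c (fst z) (Pu c (fst z) (?b *\<^sub>R \<omega>))"
          using elim(1) by fastforce
        then have "?b * nrm c (fst z) (Pcs c (fst z) \<omega>) < ?b * nrm c (fst z) (Pu c (fst z) \<omega>)"
          using b by (simp add: blinfun.scaleR_right nrm_scale[OF c1])
        then show ?thesis using b by simp
      qed (simp add: c1)
    qed
  qed
qed

lemma D_lipschitz_nrm:
  assumes c: "c \<in> atlas M" "c' \<in> atlas M" "p0 \<in> fst c" "f p0 \<in> fst c'"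
  shows "\<exists>C>0. \<exists>r>0. \<forall>\<^sub>F p in nh p0. \<forall>q\<in>fst c. dist (snd c q) (snd c p0) < r --> f q \<in> fst c' -->
    (\<forall>\<omega>\<in>S. nrm c' (f p) ((D f c c' q - D f c c' p) \<omega>) \<le> C * norm (snd c q - snd c p) * nrm c p \<omega>)"
proof -
  have p0: "p0 \<in> points M" using c mem_points by blast
  obtain C1 r where C1: "C1 > 0" "r > 0" "\<And>p q. p \<in> fst c ==> q \<in> fst c ==> dist (snd c p0) (snd c p) < r ==>
      dist (snd c p0) (snd c q) < r ==> norm (D f c c' q - D f c c' p) \<le> C1 * norm (snd c q - snd c p)"
    using D_lipschitz[OF C2_f c] by blast
  obtain C2 where C2: "C2 > 0" "\<forall>\<^sub>F q in nh p0. \<forall>\<xi>\<in>S. norm \<xi> \<le> C2 * nrm c q \<xi> \<and> nrm c q \<xi> \<le> C2 * norm \<xi>"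
    using nrm_equiv[OF c(1,3)] by blast
  obtain C3 where C3: "C3 > 0" "\<forall>\<^sub>F q in nh (f p0). \<forall>\<xi>\<in>S. norm \<xi> \<le> C3 * nrm c' q \<xi> \<and> nrm c' q \<xi> \<le> C3 * norm \<xi>"
    using nrm_equiv[OF c(2,4)] by blast
  have "\<forall>\<^sub>F p in nh p0. \<forall>q\<in>fst c. dist (snd c q) (snd c p0) < r --> f q \<in> fst c' -->
    (\<forall>\<omega>\<in>S. nrm c' (f p) ((D f c c' q - D f c c' p) \<omega>) \<le> (C3 * C1 * C2) * norm (snd c q - snd c p) * nrm c p \<omega>)"
    using C2(2) eventually_compose_filterlim[OF C3(2) filterlim_C2[OF C2_f p0]]
      eventually_chart_ball[OF c(1,3) C1(2)] eventually_g_chart[OF C2_f c]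
  proof eventually_elim
    case (elim p)
    show ?case
    proof (intro ballI impI)
      fix q \<omega> assume q: "q \<in> fst c" "dist (snd c q) (snd c p0) < r" "f q \<in> fst c'" and \<omega>: "\<omega> \<in> S"
      let ?T = "D f c c' q - D f c c' p"
      have TS: "?T \<omega> \<in> S"
        using D_S[OF C2_f c(1,2) q(1,3)] D_S[OF C2_f c(1,2)] elim by (simp add: blinfun.diff_left)
      have T: "norm ?T \<le> C1 * norm (snd c q - snd c p)"
        using C1(3)[of p q] q elim by (simp add: dist_commute)
      have "nrm c' (f p) (?T \<omega>) \<le> C3 * norm (?T \<omega>)" using elim(2) TS by blast
      also have "\<dots> \<le> C3 * (norm ?T * norm \<omega>)" using C3(1) norm_blinfun[of ?T \<omega>] by simp
      also have "\<dots> \<le> C3 * ((C1 * norm (snd c q - snd c p)) * (C2 * nrm c p \<omega>))"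
      proof -
        have "norm \<omega> \<le> C2 * nrm c p \<omega>" using elim(1) \<omega> by blast
        then have "norm ?T * norm \<omega> \<le> (C1 * norm (snd c q - snd c p)) * (C2 * nrm c p \<omega>)"
          using C1(1) by (intro mult_mono T) auto
        then show ?thesis using C3(1) by simp
      qed
      finally show "nrm c' (f p) (?T \<omega>) \<le> (C3 * C1 * C2) * norm (snd c q - snd c p) * nrm c p \<omega>"
        by (simp add: mult_ac)
    qed
  qed
  moreover have "C3 * C1 * C2 > 0" using C1(1) C2(1) C3(1) by simp
  ultimately show ?thesis using C1(2) by blast
qed

lemma D2_bound_nrm:
  assumes c: "c \<in> atlas M" "c' \<in> atlas M" "p0 \<in> fst c" "f p0 \<in> fst c'"
  shows "\<exists>C>0. \<forall>\<^sub>F p in nh p0. \<forall>\<xi>\<in>S. \<forall>\<eta>\<in>S.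
    nrm c' (f p) (D2 f c c' p \<xi> \<eta>) \<le> C * nrm c p \<xi> * nrm c p \<eta>"
proof -
  have p0: "p0 \<in> points M" using c mem_points by blast
  obtain C2 where C2: "C2 > 0" "\<forall>\<^sub>F q in nh p0. \<forall>\<xi>\<in>S. norm \<xi> \<le> C2 * nrm c q \<xi> \<and> nrm c q \<xi> \<le> C2 * norm \<xi>"
    using nrm_equiv[OF c(1,3)] by blast
  obtain C3 where C3: "C3 > 0" "\<forall>\<^sub>F q in nh (f p0). \<forall>\<xi>\<in>S. norm \<xi> \<le> C3 * nrm c' q \<xi> \<and> nrm c' q \<xi> \<le> C3 * norm \<xi>"
    using nrm_equiv[OF c(2,4)] by blast
  define B where "B = norm (D2 f c c' p0) + 1"
  define P where "P = norm (oproj S) + 1"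
  have B: "B > 0" "P > 0" unfolding B_def P_def by (simp_all add: add_nonneg_pos)
  have "\<forall>\<^sub>F p in nh p0. norm (D2 f c c' p) < B"
    unfolding B_def by (intro order_tendstoD(2)[OF tendsto_norm[OF D2_tendsto[OF C2_f c]]]) simp
  then have "\<forall>\<^sub>F p in nh p0. \<forall>\<xi>\<in>S. \<forall>\<eta>\<in>S.
    nrm c' (f p) (D2 f c c' p \<xi> \<eta>) \<le> (C3 * P * B * C2 * C2) * nrm c p \<xi> * nrm c p \<eta>"
    using C2(2) eventually_compose_filterlim[OF C3(2) filterlim_C2[OF C2_f p0]] eventually_g_chart[OF C2_f c]
  proof eventually_elim
    case (elim p)
    show ?case
    proof (intro ballI)
      fix \<xi> \<eta> assume S: "\<xi> \<in> S" "\<eta> \<in> S"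
      let ?b = "D2 f c c' p \<xi> \<eta>"
      have n: "norm \<xi> \<le> C2 * nrm c p \<xi>" "norm \<eta> \<le> C2 * nrm c p \<eta>" using elim(2) S by blast+
      have "norm ?b \<le> norm (D2 f c c' p \<xi>) * norm \<eta>" by (rule norm_blinfun)
      also have "\<dots> \<le> (norm (D2 f c c' p) * norm \<xi>) * norm \<eta>" by (intro mult_right_mono norm_blinfun) simp
      also have "\<dots> \<le> (B * (C2 * nrm c p \<xi>)) * (C2 * nrm c p \<eta>)"
        by (rule mult_mono[OF mult_mono[OF less_imp_le[OF elim(1)] n(1)] n(2)])
          (use B(1) C2(1) order_trans[OF norm_ge_zero n(1)] in auto)
      finally have nb: "norm ?b \<le> (B * (C2 * nrm c p \<xi>)) * (C2 * nrm c p \<eta>)" .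
      have "nrm c' (f p) ?b = nrm c' (f p) (oproj S ?b)" using nrm_oproj[OF c(2) elim(4)] by simp
      also have "\<dots> \<le> C3 * norm (oproj S ?b)" using elim(3) by simp
      also have "\<dots> \<le> C3 * (P * norm ?b)"
      proof -
        have "norm (oproj S ?b) \<le> norm (oproj S) * norm ?b" by (rule norm_blinfun)
        also have "\<dots> \<le> P * norm ?b" unfolding P_def by (intro mult_right_mono) auto
        finally show ?thesis using C3(1) by simp
      qed
      also have "\<dots> \<le> C3 * (P * ((B * (C2 * nrm c p \<xi>)) * (C2 * nrm c p \<eta>)))"
        using C3(1) B(2) nb by simp
      finally show "nrm c' (f p) ?b \<le> (C3 * P * B * C2 * C2) * nrm c p \<xi> * nrm c p \<eta>" by (simp add: mult_ac)
    qed
  qed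
  moreover have "C3 * P * B * C2 * C2 > 0" using C2(1) C3(1) B by simp
  ultimately show ?thesis by blast
qed

text \<open>What one iterate of \<open>f\<close> needs at \<open>p\<close>, with a single constant \<open>\<delta>\<close>: a bound on the second derivative,
  and for the endpoint \<open>q\<close> of a center path of length \<open>w \<le> \<delta>\<close> a common chart, a rough bound on the position
  of \<open>E\<^sup>u q\<close>, and the Lipschitz estimate for the derivative of \<open>f\<close>.\<close>

definition controlled :: "real => ('m, 'b) chart => ('m, 'b) chart => 'm => bool" where
  "controlled \<delta> c c' p \<longleftrightarrow>
     (\<forall>\<xi>\<in>S. \<forall>\<eta>\<in>S. nrm c' (f p) (D2 f c c' p \<xi> \<eta>) \<le> 1 / \<delta> * nrm c p \<xi> * nrm c p \<eta>) \<and>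
     (\<forall>w q. cpath w p q --> w \<le> \<delta> --> q \<in> fst c \<and> f q \<in> fst c' \<and> cone 1 c p q \<and>
       (\<forall>\<omega>\<in>S. nrm c' (f p) ((D f c c' q - D f c c' p) \<omega>) \<le> w / \<delta> * nrm c p \<omega>))"

lemma controlled_local:
  assumes c: "c \<in> atlas M" "c' \<in> atlas M" "p0 \<in> fst c" "f p0 \<in> fst c'"
  shows "\<exists>\<delta>>0. \<forall>\<^sub>F p in nh p0. controlled \<delta> c c' p"
proof -
  have p0: "p0 \<in> points M" using c mem_points by blast
  obtain C r where C: "C > 0" "r > 0" "\<forall>\<^sub>F p in nh p0. \<forall>q\<in>fst c. dist (snd c q) (snd c p0) < r --> f q \<in> fst c' -->
    (\<forall>\<omega>\<in>S. nrm c' (f p) ((D f c c' q - D f c c' p) \<omega>) \<le> C * norm (snd c q - snd c p) * nrm c p \<omega>)"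
    using D_lipschitz_nrm[OF c] by blast
  obtain B where B: "B > 0" "\<forall>\<^sub>F p in nh p0. \<forall>\<xi>\<in>S. \<forall>\<eta>\<in>S.
    nrm c' (f p) (D2 f c c' p \<xi> \<eta>) \<le> B * nrm c p \<xi> * nrm c p \<eta>"
    using D2_bound_nrm[OF c] by blast
  obtain Q1 Q2 where Q: "eventually Q1 (nh p0)" "eventually Q2 (nh p0)"
    "\<And>p q. Q1 p ==> Q2 q ==> cone 1 c p q"
    using cone_nearby[OF c(1,3)] unfolding eventually_prod_filter by auto
  have "\<forall>\<^sub>F q in nh p0. Q2 q \<and> f q \<in> fst c' \<and> dist (snd c q) (snd c p0) < r"
    using Q(2) eventually_g_chart[OF C2_f c] eventually_chart_ball[OF c(1,3) C(2)]
    by eventually_elim blast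
  from cpath_confined[OF c(1,3) this] obtain \<epsilon> where \<epsilon>: "\<epsilon> > 0"
    "\<forall>\<^sub>F p in nh p0. \<forall>w \<gamma> \<gamma>'. is_cpath \<gamma> \<gamma>' w --> w \<le> \<epsilon> --> \<gamma> 0 = p -->
    (\<forall>t\<in>{0..1}. (Q2 (\<gamma> t) \<and> f (\<gamma> t) \<in> fst c' \<and> dist (snd c (\<gamma> t)) (snd c p0) < r) \<and> \<gamma> t \<in> fst c \<and>
      norm (snd c (\<gamma> t) - snd c p) \<le> w / \<epsilon>)" by blast
  define \<delta> where "\<delta> = min (1 / B) (min \<epsilon> (\<epsilon> / C))"
  have \<delta>: "\<delta> > 0" "\<delta> \<le> \<epsilon>" "B \<le> 1 / \<delta>" "C / \<epsilon> \<le> 1 / \<delta>"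
  proof -
    show d: "\<delta> > 0" "\<delta> \<le> \<epsilon>" unfolding \<delta>_def using B(1) \<epsilon>(1) C(1) by auto
    have "\<delta> \<le> 1 / B" "\<delta> \<le> \<epsilon> / C" unfolding \<delta>_def by auto
    then show "B \<le> 1 / \<delta>" "C / \<epsilon> \<le> 1 / \<delta>" using d B(1) \<epsilon>(1) C(1) by (auto simp: field_simps)
  qed
  have "\<forall>\<^sub>F p in nh p0. controlled \<delta> c c' p"
    using C(3) B(2) Q(1) \<epsilon>(2) eventually_g_chart[OF C2_f c] eventually_chart[OF c(1,3)]
  proof eventually_elim
    case (elim p)
    note cp = c(1) elim(6)
    show ?case
      unfolding controlled_def
    proof (intro conjI ballI allI impI)
      fix \<xi> \<eta> assume S: "\<xi> \<in> S" "\<eta> \<in> S"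
      have "nrm c' (f p) (D2 f c c' p \<xi> \<eta>) \<le> B * (nrm c p \<xi> * nrm c p \<eta>)"
        using elim(2) S by (simp add: mult.assoc)
      also have "\<dots> \<le> 1 / \<delta> * (nrm c p \<xi> * nrm c p \<eta>)"
        by (intro mult_right_mono \<delta>(3) mult_nonneg_nonneg nrm_nonneg cp)
      finally show "nrm c' (f p) (D2 f c c' p \<xi> \<eta>) \<le> 1 / \<delta> * nrm c p \<xi> * nrm c p \<eta>" by (simp add: mult.assoc)
    next
      fix w q assume w: "cpath w p q" "w \<le> \<delta>"
      obtain \<gamma> \<gamma>' where \<gamma>: "is_cpath \<gamma> \<gamma>' w" "\<gamma> 0 = p" "\<gamma> 1 = q" using w(1) unfolding cpath_def by blast
      have "w \<le> \<epsilon>" using w(2) \<delta>(2) by linarith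
      with elim(4) \<gamma> have q: "Q2 q" "f q \<in> fst c'" "dist (snd c q) (snd c p0) < r" "q \<in> fst c"
        "norm (snd c q - snd c p) \<le> w / \<epsilon>" by (metis atLeastAtMost_iff order_refl zero_le_one)+
      show "q \<in> fst c" "f q \<in> fst c'" "cone 1 c p q" using q Q(3) elim(3) by blast+
      fix \<omega> assume \<omega>: "\<omega> \<in> S"
      have "nrm c' (f p) ((D f c c' q - D f c c' p) \<omega>) \<le> C * norm (snd c q - snd c p) * nrm c p \<omega>"
        using elim(1) q \<omega> by blast
      also have "\<dots> \<le> C * (w / \<epsilon>) * nrm c p \<omega>"
        using C(1) q(5) by (intro mult_right_mono mult_left_mono nrm_nonneg cp) auto
      also have "\<dots> \<le> w / \<delta> * nrm c p \<omega>"
      proof -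
        have "C / \<epsilon> * w \<le> 1 / \<delta> * w" by (intro mult_right_mono \<delta>(4) cpath_nonneg(1)[OF w(1)])
        then have "C * (w / \<epsilon>) \<le> w / \<delta>" by simp
        then show ?thesis by (intro mult_right_mono nrm_nonneg cp)
      qed
      finally show "nrm c' (f p) ((D f c c' q - D f c c' p) \<omega>) \<le> w / \<delta> * nrm c p \<omega>" .
    qed
  qed
  then show ?thesis using \<delta>(1) by blast
qed

lemma controlled_mono:
  assumes "controlled \<delta> c c' p" "0 < \<delta>'" "\<delta>' \<le> \<delta>" and c: "c \<in> atlas M" "p \<in> fst c"
  shows "controlled \<delta>' c c' p"
  unfolding controlled_def
proof (intro conjI ballI allI impI)
  have d: "1 / \<delta> \<le> 1 / \<delta>'" using assms(2,3) by (simp add: field_simps)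
  fix \<xi> \<eta> assume S: "\<xi> \<in> S" "\<eta> \<in> S"
  have "nrm c' (f p) (D2 f c c' p \<xi> \<eta>) \<le> 1 / \<delta> * (nrm c p \<xi> * nrm c p \<eta>)"
    using assms(1) S unfolding controlled_def by (simp add: mult.assoc)
  also have "\<dots> \<le> 1 / \<delta>' * (nrm c p \<xi> * nrm c p \<eta>)"
    by (intro mult_right_mono d mult_nonneg_nonneg nrm_nonneg c)
  finally show "nrm c' (f p) (D2 f c c' p \<xi> \<eta>) \<le> 1 / \<delta>' * nrm c p \<xi> * nrm c p \<eta>" by (simp add: mult.assoc)
next
  fix w q assume w: "cpath w p q" "w \<le> \<delta>'"
  then have "w \<le> \<delta>" using assms(3) by linarith
  with w(1) assms(1) have q: "q \<in> fst c" "f q \<in> fst c'" "cone 1 c p q"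
    "\<And>\<omega>. \<omega> \<in> S ==> nrm c' (f p) ((D f c c' q - D f c c' p) \<omega>) \<le> w / \<delta> * nrm c p \<omega>"
    unfolding controlled_def by blast+
  then show "q \<in> fst c" "f q \<in> fst c'" "cone 1 c p q" by blast+
  fix \<omega> assume "\<omega> \<in> S"
  have "w / \<delta> \<le> w / \<delta>'"
    using assms(2,3) cpath_nonneg(1)[OF w(1)] by (intro divide_left_mono) auto
  then have "w / \<delta> * nrm c p \<omega> \<le> w / \<delta>' * nrm c p \<omega>" by (intro mult_right_mono nrm_nonneg c)
  then show "nrm c' (f p) ((D f c c' q - D f c c' p) \<omega>) \<le> w / \<delta>' * nrm c p \<omega>"
    using q(4)[OF \<open>\<omega> \<in> S\<close>] by linarith
qed

text \<open>A center path from \<open>f p\<close> pulls back to one from \<open>p\<close>; the lower rate at all of its points is the one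
  that holds near \<open>p0\<close>, because the path is short.\<close>

lemma rates_along_paths:
  assumes p0: "p0 \<in> points M" and r: "\<forall>\<^sub>F q in nh p0. rate q \<alpha> \<mu> m" and m: "0 < m"
  shows "\<exists>\<delta>>0. \<forall>\<^sub>F p in nh p0. rate p \<alpha> \<mu> m \<and>
    (\<forall>w q. w \<le> \<delta> --> cpath w (f p) q --> cpath (w / m) p (finv q))"
proof -
  note fp = f_points[OF p0]
  have "\<forall>\<^sub>F q in nh (f p0). rate (finv q) \<alpha> \<mu> m"
    using eventually_compose_filterlim[OF r, of finv "nh (f p0)"] filterlim_C2[OF C2_finv fp] p0 by simp
  from cpath_confined[OF chart_at[OF fp] this] obtain \<delta> where \<delta>: "\<delta> > 0"
    "\<forall>\<^sub>F p in nh (f p0). \<forall>w \<gamma> \<gamma>'. is_cpath \<gamma> \<gamma>' w --> w \<le> \<delta> --> \<gamma> 0 = p -->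
    (\<forall>t\<in>{0..1}. rate (finv (\<gamma> t)) \<alpha> \<mu> m \<and> \<gamma> t \<in> fst (chart_at M (f p0)) \<and>
      norm (snd (chart_at M (f p0)) (\<gamma> t) - snd (chart_at M (f p0)) p) \<le> w / \<delta>)" by blast
  have "\<forall>\<^sub>F p in nh p0. p \<in> points M"
    by (rule eventually_nhI[OF openin_topspace]) (use p0 topspace_M in auto)
  then have "\<forall>\<^sub>F p in nh p0. rate p \<alpha> \<mu> m \<and>
    (\<forall>w q. w \<le> \<delta> --> cpath w (f p) q --> cpath (w / m) p (finv q))"
    using r eventually_compose_filterlim[OF \<delta>(2) filterlim_C2[OF C2_f p0]]
  proof eventually_elim
    case (elim p)
    have "cpath (w / m) p (finv q)" if "w \<le> \<delta>" "cpath w (f p) q" for w q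
    proof -
      obtain \<gamma> \<gamma>' where \<gamma>: "is_cpath \<gamma> \<gamma>' w" "\<gamma> 0 = f p" "\<gamma> 1 = q"
        using \<open>cpath w (f p) q\<close> unfolding cpath_def by blast
      have "cpath (w / m) (finv (\<gamma> 0)) (finv (\<gamma> 1))"
        using elim(3) \<gamma> that(1) by (intro cpath_finv[OF \<gamma>(1) m]) blast
      then show ?thesis using \<gamma> elim(1) by simp
    qed
    then show ?case using elim(2) by blast
  qed
  then show ?thesis using \<delta>(1) by blast
qed

end

text \<open>Uniform constants. At \<open>p\<close> the tangent map expands \<open>E\<^sup>u\<close> at least by \<open>mu p\<close>, expands \<open>E\<^sup>c \<oplus> E\<^sup>s\<close> at
  most by \<open>al p\<close> and expands \<open>E\<^sup>c\<close> at least by \<open>mm p\<close>, all in the adapted norm. The contraction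
  rate \<open>kk p\<close> of the graph transform exceeds \<open>al p / mu p\<close> by a fixed factor, and the bunching
  condition is \<open>kk p \<le> \<theta> * mm p\<close>.\<close>

locale uniformly_bunched = center_bunched M N f Eu Ec Es
  for M :: "('m, 'b::euclidean_space) manifold" and N f Eu Ec Es +
  fixes \<kappa> \<theta> s \<delta> :: real and al mu mm kk :: "'m => real"
  assumes constants: "0 < \<kappa>" "\<kappa> < 1" "0 < \<theta>" "\<theta> < 1" "1 < s" "0 < \<delta>"
    and al: "p \<in> points M ==> 0 < al p" and mu: "p \<in> points M ==> \<delta> \<le> mu p"
    and mm: "p \<in> points M ==> \<delta> \<le> mm p"
    and kk: "p \<in> points M ==> kk p * mu p = s * al p" "p \<in> points M ==> kk p \<le> \<kappa>"
      "p \<in> points M ==> kk p \<le> \<theta> * mm p"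
    and rate: "p \<in> points M ==> rate p (al p) (mu p) (mm p)"
    and cpath_back: "p \<in> points M ==> w \<le> \<delta> ==> cpath w (f p) q ==> cpath (w / mm p) p (finv q)"
    and control: "i \<in> I0 ==> j \<in> I0 ==> p \<in> core i ==> f p \<in> core j ==>
      controlled \<delta> (chart_at M i) (chart_at M j) p"

context center_bunched
begin

text \<open>By compactness one \<open>\<delta>\<close> serves all points. The rates remain functions of the point, since bunching is a
  pointwise condition.\<close>

lemma uniform_constants:
  "\<exists>\<kappa> \<theta> s \<delta> al mu mm kk. uniformly_bunched M N f Eu Ec Es \<kappa> \<theta> s \<delta> al mu mm kk"
proof -
  obtain \<kappa>0 \<theta>0 :: real where k: "0 < \<kappa>0" "\<kappa>0 < 1" "0 < \<theta>0" "\<theta>0 < 1"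
    "\<And>p. p \<in> points M ==> \<exists>\<alpha> \<mu> m. 0 < \<alpha> \<and> 0 < \<mu> \<and> 0 < m \<and> \<alpha> \<le> \<kappa>0 * \<mu> \<and> \<alpha> \<le> \<theta>0 * \<mu> * m \<and>
       (\<forall>\<^sub>F q in nh p. rate q \<alpha> \<mu> m)"
    using rates by blast
  define s where "s = min ((1 + 1 / \<kappa>0) / 2) ((1 + 1 / \<theta>0) / 2)"
  have s: "1 < s" "s * \<kappa>0 < 1" "s * \<theta>0 < 1"
  proof -
    show "1 < s" unfolding s_def using k by (auto simp: field_simps)
    have "s \<le> (1 + 1 / \<kappa>0) / 2" "s \<le> (1 + 1 / \<theta>0) / 2"
      unfolding s_def by (rule min.cobounded1 min.cobounded2)+
    then have "s * \<kappa>0 \<le> (1 + 1 / \<kappa>0) / 2 * \<kappa>0" "s * \<theta>0 \<le> (1 + 1 / \<theta>0) / 2 * \<theta>0"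
      using k by (auto intro: mult_right_mono)
    moreover have "(1 + 1 / x) / 2 * x = (x + 1) / 2" if "0 < x" for x :: real
      using that by (simp add: field_simps)
    ultimately have sk: "s * \<kappa>0 \<le> (\<kappa>0 + 1) / 2" "s * \<theta>0 \<le> (\<theta>0 + 1) / 2" using k(1,3) by metis+
    have "(\<kappa>0 + 1) / 2 < 1" "(\<theta>0 + 1) / 2 < 1" using k(2,4) by simp_all
    then show "s * \<kappa>0 < 1" "s * \<theta>0 < 1" using sk by (meson le_less_trans)+
  qed
  define Q where "Q \<delta> p \<longleftrightarrow> (\<exists>\<alpha> \<mu> m. 0 < \<alpha> \<and> \<delta> \<le> \<mu> \<and> \<delta> \<le> m \<and> \<alpha> \<le> \<kappa>0 * \<mu> \<and> \<alpha> \<le> \<theta>0 * \<mu> * m \<and>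
     rate p \<alpha> \<mu> m \<and> (\<forall>w q. w \<le> \<delta> --> cpath w (f p) q --> cpath (w / m) p (finv q)))" for \<delta> p
  have "\<exists>\<delta>>0. \<forall>p\<in>points M. Q \<delta> p"
  proof (rule uniform_on_M)
    fix p assume p: "p \<in> points M"
    obtain \<alpha> \<mu> m where r: "0 < \<alpha>" "0 < \<mu>" "0 < m" "\<alpha> \<le> \<kappa>0 * \<mu>" "\<alpha> \<le> \<theta>0 * \<mu> * m"
      "\<forall>\<^sub>F q in nh p. rate q \<alpha> \<mu> m" using k(5)[OF p] by blast
    obtain \<delta> where \<delta>: "\<delta> > 0" "\<forall>\<^sub>F p in nh p. rate p \<alpha> \<mu> m \<and>
      (\<forall>w q. w \<le> \<delta> --> cpath w (f p) q --> cpath (w / m) p (finv q))"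
      using rates_along_paths[OF p r(6,3)] by blast
    let ?\<delta> = "min \<delta> (min \<mu> m)"
    have "\<forall>\<^sub>F q in nh p. Q ?\<delta> q"
      using \<delta>(2)
    proof eventually_elim
      case (elim q)
      then show ?case unfolding Q_def using r by (intro exI[of _ \<alpha>] exI[of _ \<mu>] exI[of _ m]) auto
    qed
    then show "\<exists>\<delta>>0. \<forall>\<^sub>F q in nh p. Q \<delta> q" using \<delta>(1) r by (intro exI[of _ ?\<delta>]) auto
  next
    fix \<delta> \<delta>' :: real and p assume "Q \<delta> p" "0 < \<delta>'" "\<delta>' \<le> \<delta>"
    then show "Q \<delta>' p" unfolding Q_def by (meson order_trans)
  qed
  then obtain \<delta>1 where \<delta>1: "\<delta>1 > 0" "\<And>p. p \<in> points M ==> Q \<delta>1 p" by blast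
  define Q2 where "Q2 \<delta> c c' p \<longleftrightarrow> c \<in> atlas M \<and> p \<in> fst c \<and> controlled \<delta> c c' p" for \<delta> c c' p
  have "\<exists>\<delta>>0. \<forall>i\<in>I0. \<forall>j\<in>I0. \<forall>p\<in>core i. f p \<in> core j --> Q2 \<delta> (chart_at M i) (chart_at M j) p"
  proof (rule uniform_on_cores)
    fix p c c' assume "p \<in> points M" and c: "c \<in> atlas M" "c' \<in> atlas M" "p \<in> fst c" "f p \<in> fst c'"
    obtain \<delta> where \<delta>: "\<delta> > 0" "\<forall>\<^sub>F q in nh p. controlled \<delta> c c' q" using controlled_local[OF c] by blast
    have "\<forall>\<^sub>F q in nh p. Q2 \<delta> c c' q"
      using \<delta>(2) eventually_chart[OF c(1,3)] by eventually_elim (simp add: Q2_def c)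
    then show "\<exists>\<delta>>0. \<forall>\<^sub>F q in nh p. Q2 \<delta> c c' q" using \<delta>(1) by blast
  qed (use controlled_mono in \<open>auto simp: Q2_def\<close>)
  then obtain \<delta>2 where \<delta>2: "\<delta>2 > 0"
    "\<And>i j p. i \<in> I0 ==> j \<in> I0 ==> p \<in> core i ==> f p \<in> core j ==> Q2 \<delta>2 (chart_at M i) (chart_at M j) p"
    by blast
  define \<delta> where "\<delta> = min \<delta>1 \<delta>2"
  have \<delta>: "\<delta> > 0" "\<delta> \<le> \<delta>1" "\<delta> \<le> \<delta>2" unfolding \<delta>_def using \<delta>1 \<delta>2 by auto
  have "\<exists>\<alpha> \<mu> m. 0 < \<alpha> \<and> \<delta> \<le> \<mu> \<and> \<delta> \<le> m \<and> \<alpha> \<le> \<kappa>0 * \<mu> \<and> \<alpha> \<le> \<theta>0 * \<mu> * m \<and>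
     rate p \<alpha> \<mu> m \<and> (\<forall>w q. w \<le> \<delta> --> cpath w (f p) q --> cpath (w / m) p (finv q))" if "p \<in> points M" for p
    using \<delta>1(2)[OF that] \<delta>(2) unfolding Q_def by (meson order_trans)
  then obtain al mu mm where r: "\<And>p. p \<in> points M ==> 0 < al p \<and> \<delta> \<le> mu p \<and> \<delta> \<le> mm p \<and>
     al p \<le> \<kappa>0 * mu p \<and> al p \<le> \<theta>0 * mu p * mm p \<and> rate p (al p) (mu p) (mm p) \<and>
     (\<forall>w q. w \<le> \<delta> --> cpath w (f p) q --> cpath (w / mm p) p (finv q))" by metis
  have "uniformly_bunched M N f Eu Ec Es (s * \<kappa>0) (s * \<theta>0) s \<delta> al mu mm (\<lambda>p. s * al p / mu p)"
  proof
    fix p assume p: "p \<in> points M"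
    have mp: "mu p > 0" using r[OF p] \<delta>(1) by linarith
    show "s * al p / mu p * mu p = s * al p" using mp by simp
    have "s * al p \<le> s * (\<kappa>0 * mu p)" "s * al p \<le> s * (\<theta>0 * mu p * mm p)" using r[OF p] s(1) by auto
    then show "s * al p / mu p \<le> s * \<kappa>0" "s * al p / mu p \<le> s * \<theta>0 * mm p" using mp by (auto simp: field_simps)
  next
    fix i j p assume "i \<in> I0" "j \<in> I0" "p \<in> core i" "f p \<in> core j"
    from \<delta>2(2)[OF this] show "controlled \<delta> (chart_at M i) (chart_at M j) p"
      using \<delta>(1,3) controlled_mono unfolding Q2_def by blast
  qed (use r \<delta>(1) s k in auto)
  then show ?thesis by blast
qed

end

context uniformly_bunched
begin

lemma mm_pos: "p \<in> points M ==> 0 < mm p" and mu_pos: "p \<in> points M ==> 0 < mu p"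
  and kk_pos: "p \<in> points M ==> 0 < kk p"
proof -
  assume p: "p \<in> points M"
  show m: "0 < mm p" "0 < mu p" using mm[OF p] mu[OF p] constants(6) by linarith+
  have "0 < kk p * mu p" using kk(1)[OF p] al[OF p] constants(5) by simp
  then show "0 < kk p" using m(2) zero_less_mult_pos2 by blast
qed

lemma cs_charts:
  assumes "p \<in> points M"
  shows "cs p \<in> atlas M" "cs (f p) \<in> atlas M" "p \<in> fst (cs p)" "f p \<in> fst (cs (f p))"
  using cover_facts(8,9) assms by simp_all

lemma control_cs: "p \<in> points M ==> controlled \<delta> (cs p) (cs (f p)) p"
  unfolding cs_def using control cover_facts(5,7) by simp

text \<open>A vector of \<open>E\<^sup>u (f q)\<close> is the image of a vector \<open>\<omega>\<close> of \<open>E\<^sup>u q\<close> under the derivative at \<open>q\<close>. Replacing that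
  derivative by the one at \<open>p\<close> costs an error of order \<open>w\<close> relative to \<open>\<omega>\<close>, and the derivative at \<open>p\<close>
  contracts the cone. The factor \<open>s\<close> in \<open>kk\<close> absorbs the error in the denominator.\<close>

lemma cone_step:
  assumes p: "p \<in> points M" and w: "cpath w p q" "w \<le> \<delta>" "w \<le> (1 - 1 / s) * \<delta> * \<delta>"
    and \<sigma>: "cone \<sigma> (cs p) p q" "0 \<le> \<sigma>" "\<sigma> \<le> 1"
  shows "cone (kk p * \<sigma> + s / (\<delta> * \<delta>) * w) (cs (f p)) (f p) (f q)"
  unfolding cone_def
proof
  let ?c = "cs p" and ?c' = "cs (f p)"
  note c = cs_charts[OF p]
  note cp = c(1,3) and cfp = c(2,4)
  have w0: "0 \<le> w" and q: "q \<in> points M" using cpath_nonneg[OF w(1)] by blast+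
  have ct: "q \<in> fst ?c" "f q \<in> fst ?c'" "\<And>\<omega>. \<omega> \<in> S ==>
      nrm ?c' (f p) ((D f ?c ?c' q - D f ?c ?c' p) \<omega>) \<le> w / \<delta> * nrm ?c p \<omega>"
    using control_cs[OF p] w unfolding controlled_def by blast+
  fix \<omega>' assume "\<omega>' \<in> EE Eu ?c' (f q)"
  then obtain \<omega> where \<omega>: "\<omega> \<in> EE Eu ?c q" "\<omega>' = D f ?c ?c' q \<omega>"
    using D_f_EE[OF c(1,2) ct(1,2) invariant(1) subbs(1)] by blast
  have \<omega>S: "\<omega> \<in> S" using \<omega>(1) subb_EE[OF subbs(1) c(1) ct(1)] by blast
  define \<zeta> where "\<zeta> = (D f ?c ?c' q - D f ?c ?c' p) \<omega>"
  define a where "a = nrm ?c p (Pu ?c p \<omega>)"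
  have a0: "0 \<le> a" unfolding a_def by (rule nrm_nonneg[OF cp])
  have cs_le: "nrm ?c p (Pcs ?c p \<omega>) \<le> \<sigma> * a" using \<sigma>(1) \<omega>(1) unfolding cone_def a_def by blast
  also have "\<dots> \<le> a" using \<sigma> a0 by (simp add: mult_left_le_one_le)
  finally have "nrm ?c p \<omega> \<le> a" using nrm_max[OF cp, of \<omega>] unfolding a_def by simp
  then have \<zeta>: "nrm ?c' (f p) \<zeta> \<le> w / \<delta> * a"
    using ct(3)[OF \<omega>S] w0 constants(6) mult_left_mono[of "nrm ?c p \<omega>" a "w / \<delta>"] unfolding \<zeta>_def by simp
  have dec: "\<omega>' = D f ?c ?c' p \<omega> + \<zeta>" unfolding \<omega>(2) \<zeta>_def by (simp add: blinfun.diff_left)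
  note rc = rate_chart[OF c rate[OF p] al[OF p], of \<omega>]
  have "nrm ?c' (f p) (Pcs ?c' (f p) \<omega>') \<le> nrm ?c' (f p) (D f ?c ?c' p (Pcs ?c p \<omega>)) + nrm ?c' (f p) (Pcs ?c' (f p) \<zeta>)"
    unfolding dec blinfun.add_right P_f(3)[OF c] by (rule nrm_triangle[OF cfp])
  also have "\<dots> \<le> al p * (\<sigma> * a) + w / \<delta> * a"
    using rc(2) cs_le al[OF p] mult_left_mono[OF cs_le, of "al p"] nrm_P_le(2)[OF cfp, of \<zeta>] \<zeta> by linarith
  finally have up: "nrm ?c' (f p) (Pcs ?c' (f p) \<omega>') \<le> (al p * \<sigma> + w / \<delta>) * a" by (simp add: algebra_simps)
  have "D f ?c ?c' p (Pu ?c p \<omega>) = Pu ?c' (f p) \<omega>' - Pu ?c' (f p) \<zeta>"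
    unfolding dec blinfun.add_right P_f(1)[OF c] by simp
  then have "nrm ?c' (f p) (D f ?c ?c' p (Pu ?c p \<omega>)) \<le> nrm ?c' (f p) (Pu ?c' (f p) \<omega>') + nrm ?c' (f p) (Pu ?c' (f p) \<zeta>)"
    using nrm_diff[OF cfp] by simp
  then have lowb: "(mu p - w / \<delta>) * a \<le> nrm ?c' (f p) (Pu ?c' (f p) \<omega>')"
    using rc(1) nrm_P_le(1)[OF cfp, of \<zeta>] \<zeta> unfolding a_def[symmetric] by (simp add: algebra_simps)
  have "w / \<delta> \<le> (1 - 1 / s) * \<delta>" using w(3) constants(6) by (simp add: field_simps)
  also have "\<dots> \<le> (1 - 1 / s) * mu p" using mu[OF p] constants(5) by (intro mult_left_mono) auto
  finally have mus: "mu p / s \<le> mu p - w / \<delta>" by (simp add: algebra_simps)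
  have mus': "\<delta> / s \<le> mu p / s" using mu[OF p] constants(5) by (simp add: divide_right_mono)
  have "al p * \<sigma> + w / \<delta> \<le> (kk p * \<sigma> + s / (\<delta> * \<delta>) * w) * (mu p / s)"
  proof -
    have "kk p * mu p / s = al p" using kk(1)[OF p] constants(5) by simp
    then have 1: "kk p * \<sigma> * (mu p / s) = al p * \<sigma>" by (metis mult.commute mult.left_commute times_divide_eq_right)
    have "w / \<delta> = s / (\<delta> * \<delta>) * w * (\<delta> / s)" using constants(5,6) by simp
    also have "\<dots> \<le> s / (\<delta> * \<delta>) * w * (mu p / s)"
      by (rule mult_left_mono[OF mus']) (use w0 constants(5,6) in auto)
    finally have "al p * \<sigma> + w / \<delta> \<le> kk p * \<sigma> * (mu p / s) + s / (\<delta> * \<delta>) * w * (mu p / s)"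
      using 1 by linarith
    also have "\<dots> = (kk p * \<sigma> + s / (\<delta> * \<delta>) * w) * (mu p / s)" by (rule distrib_right[symmetric])
    finally show ?thesis .
  qed
  also have "\<dots> \<le> (kk p * \<sigma> + s / (\<delta> * \<delta>) * w) * (mu p - w / \<delta>)"
    using mus w0 \<sigma>(2) kk_pos[OF p] constants(5,6) by (intro mult_left_mono) auto
  finally have "(al p * \<sigma> + w / \<delta>) * a \<le> (kk p * \<sigma> + s / (\<delta> * \<delta>) * w) * ((mu p - w / \<delta>) * a)"
    using a0 mult_right_mono[of _ _ a] by (simp add: mult.assoc[symmetric])
  also have "\<dots> \<le> (kk p * \<sigma> + s / (\<delta> * \<delta>) * w) * nrm ?c' (f p) (Pu ?c' (f p) \<omega>')"
    using lowb w0 \<sigma>(2) kk_pos[OF p] constants(5,6) by (intro mult_left_mono) auto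
  finally show "nrm ?c' (f p) (Pcs ?c' (f p) \<omega>') \<le>
      (kk p * \<sigma> + s / (\<delta> * \<delta>) * w) * nrm ?c' (f p) (Pu ?c' (f p) \<omega>')" using up by linarith
qed

text \<open>The path lengths for which \<open>cone_step\<close> applies, and the Lipschitz constant. The first term of \<open>CL\<close> is
  preserved by the recursion of \<open>cone_step\<close>; the second makes \<open>CL * w\<close> exceed one when \<open>w / mm\<close> exceeds
  \<open>\<epsilon>0\<close>.\<close>

definition \<epsilon>0 :: real where "\<epsilon>0 = min \<delta> ((1 - 1 / s) * \<delta> * \<delta>)"

definition CL :: real where "CL = max (s / (\<delta> * \<delta> * \<delta>) / (1 - \<theta>)) (1 / (\<epsilon>0 * \<delta>))"

lemma \<epsilon>0_pos: "0 < \<epsilon>0" "\<epsilon>0 \<le> \<delta>"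
  unfolding \<epsilon>0_def using constants by (auto simp: field_simps)

lemma cone_mono: "cone \<sigma> c p q ==> \<sigma> \<le> \<sigma>' ==> c \<in> atlas M ==> p \<in> fst c ==> cone \<sigma>' c p q"
  unfolding cone_def using mult_right_mono[OF _ nrm_nonneg] order_trans by blast

lemma cone_one:
  assumes "cpath w p q" "w \<le> \<delta>" shows "cone 1 (cs p) p q" "q \<in> fst (cs p)"
  using control_cs[OF cpath_nonneg(2)[OF assms(1)]] assms unfolding controlled_def by blast+

lemma CL_pos: "0 < CL"
  unfolding CL_def using \<epsilon>0_pos constants(6) by (simp add: less_max_iff_disj)

text \<open>Induction over the backward orbit: the path from \<open>p\<close> to \<open>q\<close> is pulled back, which lengthens it at most
  by the factor \<open>1 / mm\<close>, and bunching makes up for this factor in the following cone step. When the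
  pulled back path is too long for the estimates, \<open>CL * w\<close> exceeds one and \<open>cone_one\<close> suffices.\<close>

lemma cone_power:
  assumes "cpath w p q" "w \<le> \<epsilon>0"
  shows "cone (\<kappa> ^ n + CL * w) (cs p) p q"
  using assms
proof (induction n arbitrary: p q w)
  case 0
  note n = cpath_nonneg[OF 0(1)]
  have "w \<le> \<delta>" using 0(2) \<epsilon>0_pos by linarith
  from cone_one(1)[OF 0(1) this] show ?case
    by (rule cone_mono) (use CL_pos n(1) cover_facts(8,9)[OF n(2)] in simp_all)
next
  case (Suc n)
  have w0: "0 \<le> w" and pq: "p \<in> points M" "q \<in> points M" using cpath_nonneg[OF Suc.prems(1)] by blast+
  define p1 where "p1 = finv p"
  define q1 where "q1 = finv q"
  have p1: "p1 \<in> points M" "f p1 = p" "f q1 = q" unfolding p1_def q1_def using pq by simp_all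
  have w\<delta>: "w \<le> \<delta>" using Suc.prems(2) \<epsilon>0_pos by linarith
  have path: "cpath (w / mm p1) p1 q1"
    using cpath_back[OF p1(1) w\<delta>, of q] Suc.prems(1) p1(2) unfolding q1_def by simp
  note mp = mm_pos[OF p1(1)] and mm1 = mm[OF p1(1)]
  show ?case
  proof (cases "w / mm p1 \<le> \<epsilon>0")
    case False
    then have "\<epsilon>0 * mm p1 < w" using mp by (simp add: field_simps)
    moreover have "\<epsilon>0 * \<delta> \<le> \<epsilon>0 * mm p1" using mm1 \<epsilon>0_pos by simp
    ultimately have "\<epsilon>0 * \<delta> < w" by linarith
    then have "1 \<le> 1 / (\<epsilon>0 * \<delta>) * w" using \<epsilon>0_pos constants(6) by (simp add: field_simps)
    also have "\<dots> \<le> CL * w" unfolding CL_def using w0 by (intro mult_right_mono) auto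
    finally have "1 \<le> \<kappa> ^ Suc n + CL * w" using constants(1) by (simp add: add_increasing)
    from cone_mono[OF cone_one(1)[OF Suc.prems(1) w\<delta>] this cover_facts(8,9)[OF pq(1)]]
    show ?thesis .
  next
    case True
    let ?w = "w / mm p1"
    define \<sigma> where "\<sigma> = min 1 (\<kappa> ^ n + CL * ?w)"
    have w1: "0 \<le> ?w" using w0 mp by simp
    have w1\<delta>: "?w \<le> \<delta>" using True \<epsilon>0_pos by linarith
    have "cone \<sigma> (cs p1) p1 q1"
      unfolding \<sigma>_def min_def using Suc.IH[OF path True] cone_one(1)[OF path w1\<delta>] by simp
    moreover have \<sigma>: "0 \<le> \<sigma>" "\<sigma> \<le> 1" proof -
      have "0 \<le> \<kappa> ^ n + CL * ?w"
        by (intro add_nonneg_nonneg mult_nonneg_nonneg) (use constants(1) CL_pos w1 in auto)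
      then show "0 \<le> \<sigma>" "\<sigma> \<le> 1" unfolding \<sigma>_def by simp_all
    qed
    ultimately have "cone (kk p1 * \<sigma> + s / (\<delta> * \<delta>) * ?w) (cs (f p1)) (f p1) (f q1)"
      using True unfolding \<epsilon>0_def by (intro cone_step[OF p1(1) path]) simp_all
    then have c: "cone (kk p1 * \<sigma> + s / (\<delta> * \<delta>) * ?w) (cs p) p q" unfolding p1 .
    have "kk p1 * \<sigma> \<le> kk p1 * (\<kappa> ^ n + CL * ?w)"
      unfolding \<sigma>_def using kk_pos[OF p1(1)] by (intro mult_left_mono) auto
    also have "\<dots> = kk p1 * \<kappa> ^ n + CL * (kk p1 * ?w)" by (simp add: algebra_simps)
    also have "\<dots> \<le> \<kappa> * \<kappa> ^ n + CL * (\<theta> * w)"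
    proof (rule add_mono)
      show "kk p1 * \<kappa> ^ n \<le> \<kappa> * \<kappa> ^ n" using kk(2)[OF p1(1)] constants(1) by (intro mult_right_mono) auto
      have "kk p1 * ?w \<le> (\<theta> * mm p1) * ?w" using kk(3)[OF p1(1)] w1 by (intro mult_right_mono)
      also have "(\<theta> * mm p1) * ?w = \<theta> * w" using mp by simp
      finally show "CL * (kk p1 * ?w) \<le> CL * (\<theta> * w)" using CL_pos by (intro mult_left_mono) auto
    qed
    finally have 1: "kk p1 * \<sigma> \<le> \<kappa> ^ Suc n + CL * \<theta> * w" by simp
    have "s / (\<delta> * \<delta>) * ?w \<le> s / (\<delta> * \<delta>) * (w / \<delta>)"
      using w0 mm1 mp constants(5,6) by (intro mult_left_mono divide_left_mono) auto
    also have "\<dots> = s / (\<delta> * \<delta> * \<delta>) * w" by simp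
    also have "\<dots> \<le> (CL * (1 - \<theta>)) * w"
    proof (rule mult_right_mono[OF _ w0])
      have "s / (\<delta> * \<delta> * \<delta>) / (1 - \<theta>) \<le> CL" unfolding CL_def by simp
      then show "s / (\<delta> * \<delta> * \<delta>) \<le> CL * (1 - \<theta>)" using pos_divide_le_eq[of "1 - \<theta>" "s / (\<delta> * \<delta> * \<delta>)" CL] constants(4) by linarith
    qed
    finally have "kk p1 * \<sigma> + s / (\<delta> * \<delta>) * ?w \<le> \<kappa> ^ Suc n + CL * w" using 1 by (simp add: algebra_simps)
    from cone_mono[OF c this cover_facts(8,9)[OF pq(1)]] show ?thesis .
  qed
qed

text \<open>Letting \<open>n\<close> tend to infinity: \<open>E\<^sup>u\<close> is Lipschitz along center paths.\<close>

theorem Eu_lipschitz_along_center: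
  assumes "cpath w p q" "w \<le> \<epsilon>0"
  shows "cone (CL * w) (cs p) p q"
  unfolding cone_def
proof
  fix \<omega> assume \<omega>: "\<omega> \<in> EE Eu (cs p) q"
  let ?a = "nrm (cs p) p (Pu (cs p) p \<omega>)"
  have "(\<lambda>n. (\<kappa> ^ n + CL * w) * ?a) \<longlonglongrightarrow> (0 + CL * w) * ?a"
    by (intro tendsto_intros LIMSEQ_power_zero) (use constants in auto)
  then show "nrm (cs p) p (Pcs (cs p) p \<omega>) \<le> CL * w * ?a"
    using cone_power[OF assms] \<omega> unfolding cone_def
    by (intro LIMSEQ_le_const[of "\<lambda>n. (\<kappa> ^ n + CL * w) * ?a"]) auto
qed

end

section \<open>The candidate for the derivative of the unstable bundle\<close>

context center_bunched
begin

text \<open>The action of \<open>f\<close> on derivatives of \<open>E\<^sup>u\<close> along \<open>E\<^sup>c\<close>. Such a derivative at \<open>p\<close>, in a chart, is a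
  bilinear map \<open>E\<^sup>c \<times> E\<^sup>u \<rightarrow> E\<^sup>c \<oplus> E\<^sup>s\<close>; it is precomposed with the projections in order to be defined
  on the whole model space.\<close>

definition push :: "('m, 'b) chart => ('m, 'b) chart => ('b => 'b => 'b) => 'm => 'b => 'b => 'b" where
  "push c c' X p \<xi> \<eta> =
     (let p1 = finv p; \<xi>1 = D finv c' c p (Pc c' p \<xi>); \<eta>1 = D finv c' c p (Pu c' p \<eta>)
      in D f c c' p1 (X \<xi>1 \<eta>1) + Pcs c' p (D2 f c c' p1 \<xi>1 \<eta>1))"

text \<open>The change of charts for such derivatives; it is not tensorial, since \<open>E\<^sup>u\<close> is differentiated in
  coordinates.\<close>

definition trans :: "('m, 'b) chart => ('m, 'b) chart => ('b => 'b => 'b) => 'm => 'b => 'b => 'b" where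
  "trans c d X p \<xi> \<eta> = D id c d p (X (D id d c p \<xi>) (D id d c p \<eta>))
     + Pcs d p (D2 id c d p (D id d c p (Pc d p \<xi>)) (D id d c p (Pu d p \<eta>)))"

text \<open>A bilinear map on the coordinate space that stands for one from \<open>E\<^sup>c \<times> E\<^sup>u\<close> to \<open>E\<^sup>c \<oplus> E\<^sup>s\<close>.\<close>

definition tensor :: "('m, 'b) chart => 'm => ('b => 'b => 'b) => bool" where
  "tensor c p X \<longleftrightarrow> bilinear X \<and> (\<forall>\<xi> \<eta>. Pcs c p (X \<xi> \<eta>) = X \<xi> \<eta> \<and> X (Pc c p \<xi>) (Pu c p \<eta>) = X \<xi> \<eta>)"

context
  fixes p c c'
  assumes p: "p \<in> points M" and c: "c \<in> atlas M" "c' \<in> atlas M" "finv p \<in> fst c" "p \<in> fst c'"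
begin

lemma c_f: "f (finv p) \<in> fst c'" using c p by simp

lemma back_f: "v \<in> S ==> D f c c' (finv p) (D finv c' c p v) = v"
  using D_f_finv[OF c(1-3) c_f] p by simp

lemma back_S: "D finv c' c p v \<in> S"
  using D_S[OF C2_finv c(2,1,4,3)] .

lemma back_EE: "invariant_bundle M f E ==> subb E ==> \<xi> \<in> EE E c' p ==> D finv c' c p \<xi> \<in> EE E c (finv p)"
  using D_finv_EE[OF c(1-3) c_f] p by simp

lemma back_P:
  "Pc c (finv p) (D finv c' c p (Pc c' p \<xi>)) = D finv c' c p (Pc c' p \<xi>)"
  "Pu c (finv p) (D finv c' c p (Pu c' p \<xi>)) = D finv c' c p (Pu c' p \<xi>)"
  using P_Ec(2)[OF c(1,3) back_EE[OF invariant(2) subbs(2) Pc_mem[OF c(2,4)]]]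
    P_Eu(1)[OF c(1,3) back_EE[OF invariant(1) subbs(1) Pu_mem[OF c(2,4)]]] by simp_all

lemma tensor_push:
  assumes "tensor c (finv p) X"
  shows "tensor c' p (push c c' X p)"
proof -
  have X: "bilinear X" "Pcs c (finv p) (X \<xi> \<eta>) = X \<xi> \<eta>" for \<xi> \<eta>
    using assms unfolding tensor_def by blast+
  have lin: "linear (\<lambda>\<eta>. X \<xi> \<eta>)" "linear (\<lambda>\<xi>. X \<xi> \<eta>)" for \<xi> \<eta>
    using X(1) unfolding bilinear_def by blast+
  have "bilinear (push c c' X p)"
    unfolding bilinear_def push_def Let_def
    by (auto intro!: linearI simp: blinfun.bilinear_simps linear_add[OF lin(1)] linear_add[OF lin(2)]
        linear_scale[OF lin(1)] linear_scale[OF lin(2)] scaleR_add_right)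
  moreover have "Pcs c' p (push c c' X p \<xi> \<eta>) = push c c' X p \<xi> \<eta>" for \<xi> \<eta>
  proof -
    have "Pcs c' p (D f c c' (finv p) z) = D f c c' (finv p) (Pcs c (finv p) z)" for z
      using P_f(3)[OF c(1-3) c_f] p by simp
    then show ?thesis unfolding push_def Let_def by (simp add: blinfun.add_right P_comp[OF c(2,4)] X(2))
  qed
  moreover have "push c c' X p (Pc c' p \<xi>) (Pu c' p \<eta>) = push c c' X p \<xi> \<eta>" for \<xi> \<eta>
    unfolding push_def Let_def by (simp add: P_comp[OF c(2,4)])
  ultimately show ?thesis unfolding tensor_def by blast
qed

end

text \<open>The action of \<open>f\<close> is compatible with changes of charts, by the chain rule for the second derivative.\<close>

lemma push_target_change:
  assumes p: "p \<in> points M" and c: "c \<in> atlas M" "finv p \<in> fst c" "c' \<in> atlas M" "p \<in> fst c'"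
    "d' \<in> atlas M" "p \<in> fst d'"
  shows "push c d' X p = trans c' d' (push c c' X p) p"
proof (intro ext)
  fix \<xi> \<eta>
  let ?p = "finv p"
  define \<xi>1 where "\<xi>1 = D finv d' c p (Pc d' p \<xi>)"
  define \<eta>1 where "\<eta>1 = D finv d' c p (Pu d' p \<eta>)"
  have ff: "f ?p = p" using p by simp
  have fp: "f ?p \<in> fst c'" "f ?p \<in> fst d'" using c p by simp_all
  have chain1: "D finv c' c p (D id d' c' p v) = D finv d' c p v" for v
    using D_chain[OF C2_id C2_finv C2_finv _ c(5,3,1,6), of] c by simp
  have chain2: "D f c c' ?p (D finv d' c p v) = D id d' c' p v" for v
    using D_chain[OF C2_finv C2_f C2_id _ c(5,1,3,6,2) fp(1)] by simp
  have x: "D finv c' c p (Pc c' p (D id d' c' p \<xi>)) = \<xi>1" "D finv c' c p (Pu c' p (D id d' c' p \<eta>)) = \<eta>1"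
    using P_id[OF c(5,3,6,4)] chain1 unfolding \<xi>1_def \<eta>1_def by simp_all
  have y: "D id d' c' p (Pc d' p \<xi>) = D f c c' ?p \<xi>1" "D id d' c' p (Pu d' p \<eta>) = D f c c' ?p \<eta>1"
    unfolding \<xi>1_def \<eta>1_def chain2 by simp_all
  have d1: "D f c d' ?p v = D id c' d' p (D f c c' ?p v)" for v
    using D_chain[OF C2_f C2_id C2_f _ c(1,3,5,2) fp(1)] fp ff by simp
  have d2: "D2 f c d' ?p \<xi>1 \<eta>1 = D2 id c' d' p (D f c c' ?p \<xi>1) (D f c c' ?p \<eta>1) + D id c' d' p (D2 f c c' ?p \<xi>1 \<eta>1)"
    using D2_chain[OF C2_f C2_id C2_f _ c(1,3,5,2) fp(1), of \<xi>1] fp ff by (simp add: blinfun.add_left)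
  show "push c d' X p \<xi> \<eta> = trans c' d' (push c c' X p) p \<xi> \<eta>"
    unfolding trans_def y unfolding push_def Let_def x \<xi>1_def[symmetric] \<eta>1_def[symmetric] d1 d2
    using P_id(2)[OF c(3,5,4,6)] by (simp add: blinfun.add_right)
qed

lemma push_source_change:
  assumes p: "p \<in> points M" and c: "c \<in> atlas M" "finv p \<in> fst c" "d \<in> atlas M" "finv p \<in> fst d"
    "c' \<in> atlas M" "p \<in> fst c'"
  shows "push d c' (trans c d X (finv p)) p = push c c' X p"
proof (intro ext)
  fix \<xi> \<eta>
  let ?p = "finv p"
  define \<xi>1 where "\<xi>1 = D finv c' d p (Pc c' p \<xi>)"
  define \<eta>1 where "\<eta>1 = D finv c' d p (Pu c' p \<eta>)"
  define \<xi>2 where "\<xi>2 = D finv c' c p (Pc c' p \<xi>)"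
  define \<eta>2 where "\<eta>2 = D finv c' c p (Pu c' p \<eta>)"
  have ff: "f ?p = p" using p by simp
  have fp: "f ?p \<in> fst c'" using c p by simp
  have "D id d c ?p (D finv c' d p v) = D finv c' c p v" for v
    using D_chain[OF C2_finv C2_id C2_finv _ c(5,3,1,6,4)] c by simp
  then have x: "D id d c ?p \<xi>1 = \<xi>2" "D id d c ?p \<eta>1 = \<eta>2"
    unfolding \<xi>1_def \<eta>1_def \<xi>2_def \<eta>2_def by simp_all
  have "D id c d ?p (D finv c' c p v) = D finv c' d p v" for v
    using D_chain[OF C2_finv C2_id C2_finv _ c(5,1,3,6,2)] c by simp
  then have x': "D id c d ?p \<xi>2 = \<xi>1" "D id c d ?p \<eta>2 = \<eta>1"
    unfolding \<xi>1_def \<eta>1_def \<xi>2_def \<eta>2_def by simp_all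
  have P: "Pc d ?p \<xi>1 = \<xi>1" "Pu d ?p \<eta>1 = \<eta>1"
    unfolding \<xi>1_def \<eta>1_def using back_P[OF p c(3,5,4,6)] by simp_all
  have d1: "D f d c' ?p (D id c d ?p v) = D f c c' ?p v" for v
    using D_chain[OF C2_id C2_f C2_f _ c(1,3,5,2)] c fp by simp
  have d2: "D2 f c c' ?p \<xi>2 \<eta>2 = D2 f d c' ?p \<xi>1 \<eta>1 + D f d c' ?p (D2 id c d ?p \<xi>2 \<eta>2)"
    using D2_chain[OF C2_id C2_f C2_f _ c(1,3,5,2), of \<xi>2] c fp x' by (simp add: blinfun.add_left)
  have Pf: "D f d c' ?p (Pcs d ?p z) = Pcs c' p (D f d c' ?p z)" for z
    using P_f(3)[OF c(3,5,4) fp] ff by simp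
  show "push d c' (trans c d X (finv p)) p \<xi> \<eta> = push c c' X p \<xi> \<eta>"
    unfolding push_def Let_def \<xi>1_def[symmetric] \<eta>1_def[symmetric] \<xi>2_def[symmetric] \<eta>2_def[symmetric]
      trans_def P x d2
    by (simp add: blinfun.add_right d1 Pf)
qed

lemma nrm_id:
  assumes c: "c \<in> atlas M" "c' \<in> atlas M" "p \<in> fst c" "p \<in> fst c'"
  shows "nrm c' p (D id c c' p \<xi>) = nrm c p \<xi>"
proof -
  have p: "p \<in> points M" using c mem_points by blast
  have N: "Nc c' p (D id c c' p \<eta>) = Nc c p \<eta>" for \<eta>
    unfolding Nc_def using D_chain[OF C2_id C2_id C2_id _ c(1,2) chart_at(1)[OF p] c(3)] c chart_at(2)[OF p] by simp
  have "Ps c' p (D id c c' p \<xi>) = D id c c' p (Ps c p \<xi>)"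
    using P_id[OF c, of \<xi>] P_decomp(2)[OF c(2,4), of "D id c c' p \<xi>"] P_decomp(2)[OF c(1,3), of \<xi>]
    by (metis add_left_cancel blinfun.add_right)
  then show ?thesis unfolding nrm_def using P_id[OF c] N by simp
qed

definition jointly_continuous :: "'m => ('m => 'b => 'b => 'b) => bool" where
  "jointly_continuous q \<Phi> \<longleftrightarrow> (\<forall>\<xi> \<eta>.
     ((\<lambda>z. \<Phi> (fst z) (fst (snd z)) (snd (snd z))) \<longlongrightarrow> \<Phi> q \<xi> \<eta>) (nh q \<times>\<^sub>F (nhds \<xi> \<times>\<^sub>F nhds \<eta>)))"

lemma jointly_continuousD:
  assumes "jointly_continuous q \<Phi>" "filterlim P (nh q) F" "(X \<longlongrightarrow> \<xi>) F" "(Y \<longlongrightarrow> \<eta>) F"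
  shows "((\<lambda>x. \<Phi> (P x) (X x) (Y x)) \<longlongrightarrow> \<Phi> q \<xi> \<eta>) F"
proof -
  have "filterlim (\<lambda>x. (P x, X x, Y x)) (nh q \<times>\<^sub>F (nhds \<xi> \<times>\<^sub>F nhds \<eta>)) F"
    by (intro filterlim_Pair assms)
  from filterlim_compose[OF assms(1)[unfolded jointly_continuous_def, rule_format] this] show ?thesis by simp
qed

lemma joint_lims:
  "filterlim fst (nh q) (nh q \<times>\<^sub>F (nhds \<xi> \<times>\<^sub>F nhds \<eta>))"
  "((\<lambda>z. fst (snd z)) \<longlongrightarrow> \<xi>) (nh q \<times>\<^sub>F (nhds \<xi> \<times>\<^sub>F nhds \<eta>))"
  "((\<lambda>z. snd (snd z)) \<longlongrightarrow> \<eta>) (nh q \<times>\<^sub>F (nhds \<xi> \<times>\<^sub>F nhds \<eta>))"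
  using filterlim_fst filterlim_compose[OF filterlim_fst filterlim_snd]
    filterlim_compose[OF filterlim_snd filterlim_snd] by blast+

lemma push_continuous:
  assumes q: "q \<in> points M" and c: "c \<in> atlas M" "finv q \<in> fst c" "c' \<in> atlas M" "q \<in> fst c'"
    and \<Phi>: "jointly_continuous (finv q) \<Phi>"
  shows "jointly_continuous q (\<lambda>p. push c c' (\<Phi> (finv p)) p)"
  unfolding jointly_continuous_def
proof (intro allI)
  fix \<xi> \<eta> :: 'b
  let ?F = "nh q \<times>\<^sub>F (nhds \<xi> \<times>\<^sub>F nhds \<eta>)"
  note j = joint_lims[where q = q and \<xi> = \<xi> and \<eta> = \<eta>]
  have fl: "filterlim (\<lambda>z. finv (fst z)) (nh (finv q)) ?F"
    using filterlim_compose[OF filterlim_C2[OF C2_finv q] j(1)] .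
  have fq: "f (finv q) \<in> fst c'" using q c by simp
  have DB: "((\<lambda>z. D finv c' c (fst z)) \<longlongrightarrow> D finv c' c q) ?F"
    using filterlim_compose[OF D_tendsto[OF C2_finv c(3,1,4,2)] j(1)] .
  have DF: "((\<lambda>z. D f c c' (finv (fst z))) \<longlongrightarrow> D f c c' (finv q)) ?F"
    using filterlim_compose[OF D_tendsto[OF C2_f c(1,3,2) fq] fl] .
  have D2F: "((\<lambda>z. D2 f c c' (finv (fst z))) \<longlongrightarrow> D2 f c c' (finv q)) ?F"
    using filterlim_compose[OF D2_tendsto[OF C2_f c(1,3,2) fq] fl] .
  note P = filterlim_compose[OF P_tendsto(1)[OF c(3,4)] j(1)] filterlim_compose[OF P_tendsto(3)[OF c(3,4)] j(1)]
    filterlim_compose[OF P_tendsto(4)[OF c(3,4)] j(1)]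
  have t1: "((\<lambda>z. D finv c' c (fst z) (Pc c' (fst z) (fst (snd z)))) \<longlongrightarrow> D finv c' c q (Pc c' q \<xi>)) ?F"
    by (intro blinfun.tendsto DB P j)
  have t2: "((\<lambda>z. D finv c' c (fst z) (Pu c' (fst z) (snd (snd z)))) \<longlongrightarrow> D finv c' c q (Pu c' q \<eta>)) ?F"
    by (intro blinfun.tendsto DB P j)
  show "((\<lambda>z. push c c' (\<Phi> (finv (fst z))) (fst z) (fst (snd z)) (snd (snd z)))
      \<longlongrightarrow> push c c' (\<Phi> (finv q)) q \<xi> \<eta>) ?F"
    unfolding push_def Let_def
    by (intro tendsto_add blinfun.tendsto DF D2F P t1 t2 jointly_continuousD[OF \<Phi> fl])
qed

lemma trans_zero_continuous:
  assumes c: "c \<in> atlas M" "d \<in> atlas M" "q \<in> fst c" "q \<in> fst d"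
  shows "jointly_continuous q (\<lambda>p. trans c d (\<lambda>_ _. 0) p)"
  unfolding jointly_continuous_def
proof (intro allI)
  fix \<xi> \<eta> :: 'b
  let ?F = "nh q \<times>\<^sub>F (nhds \<xi> \<times>\<^sub>F nhds \<eta>)"
  note j = joint_lims[where q = q and \<xi> = \<xi> and \<eta> = \<eta>]
  have iq: "id q \<in> fst c" "id q \<in> fst d" using c by simp_all
  note t = filterlim_compose[OF D_tendsto[OF C2_id c(2,1,4) iq(1)] j(1)]
    filterlim_compose[OF D_tendsto[OF C2_id c(1,2,3) iq(2)] j(1)]
    filterlim_compose[OF D2_tendsto[OF C2_id c(1,2,3) iq(2)] j(1)]
    filterlim_compose[OF P_tendsto(1)[OF c(2,4)] j(1)] filterlim_compose[OF P_tendsto(3)[OF c(2,4)] j(1)]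
    filterlim_compose[OF P_tendsto(4)[OF c(2,4)] j(1)]
  show "((\<lambda>z. trans c d (\<lambda>_ _. 0) (fst z) (fst (snd z)) (snd (snd z))) \<longlongrightarrow> trans c d (\<lambda>_ _. 0) q \<xi> \<eta>) ?F"
    unfolding trans_def by (intro tendsto_add blinfun.tendsto t j tendsto_const)
qed

end

context uniformly_bunched
begin

lemma back_bounds:
  assumes p: "p \<in> points M" and c: "c \<in> atlas M" "c' \<in> atlas M" "finv p \<in> fst c" "p \<in> fst c'"
  shows "mm (finv p) * nrm c (finv p) (D finv c' c p (Pc c' p \<xi>)) \<le> nrm c' p \<xi>"
    and "mu (finv p) * nrm c (finv p) (D finv c' c p (Pu c' p \<xi>)) \<le> nrm c' p \<xi>"
proof -
  note p1 = finv_points[OF p]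
  have ff: "f (finv p) = p" using p by simp
  note rc = rate_chart[OF c(1,2,3) c_f[OF p c] rate[OF p1] al[OF p1]]
  show "mm (finv p) * nrm c (finv p) (D finv c' c p (Pc c' p \<xi>)) \<le> nrm c' p \<xi>"
    using rc(3)[of "D finv c' c p (Pc c' p \<xi>)"] nrm_P_le(3)[OF c(2,4), of \<xi>]
    by (simp add: back_P[OF p c] back_f[OF p c] P_S[OF c(2,4)] ff)
  show "mu (finv p) * nrm c (finv p) (D finv c' c p (Pu c' p \<xi>)) \<le> nrm c' p \<xi>"
    using rc(1)[of "D finv c' c p (Pu c' p \<xi>)"] nrm_P_le(1)[OF c(2,4), of \<xi>]
    by (simp add: back_P[OF p c] back_f[OF p c] P_S[OF c(2,4)] ff)
qed

text \<open>The linear part of the action contracts by the factor \<open>\<theta>\<close>. This is where the bunching condition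
  enters.\<close>

lemma push_contracts:
  assumes p: "p \<in> points M" and c: "c \<in> atlas M" "c' \<in> atlas M" "finv p \<in> fst c" "p \<in> fst c'"
    and X: "\<And>\<xi> \<eta>. Pcs c (finv p) (X \<xi> \<eta>) = X \<xi> \<eta>" "\<And>\<xi> \<eta>. Pcs c (finv p) (Y \<xi> \<eta>) = Y \<xi> \<eta>"
    and a: "0 \<le> a" "\<And>\<xi> \<eta>. nrm c (finv p) (X \<xi> \<eta> - Y \<xi> \<eta>) \<le> a * nrm c (finv p) \<xi> * nrm c (finv p) \<eta>"
  shows "nrm c' p (push c c' X p \<xi> \<eta> - push c c' Y p \<xi> \<eta>) \<le> \<theta> * a * nrm c' p \<xi> * nrm c' p \<eta>"
proof -
  note p1 = finv_points[OF p]
  have ff: "f (finv p) = p" using p by simp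
  define \<xi>1 where "\<xi>1 = D finv c' c p (Pc c' p \<xi>)"
  define \<eta>1 where "\<eta>1 = D finv c' c p (Pu c' p \<eta>)"
  note b = back_bounds(1)[OF p c, of \<xi>, folded \<xi>1_def] back_bounds(2)[OF p c, of \<eta>, folded \<eta>1_def]
  note n = nrm_nonneg[OF c(1,3)] and n' = nrm_nonneg[OF c(2,4)]
  let ?Z = "X \<xi>1 \<eta>1 - Y \<xi>1 \<eta>1"
  have Z: "Pcs c (finv p) ?Z = ?Z" using X by (simp add: blinfun.diff_right)
  have "nrm c' p (push c c' X p \<xi> \<eta> - push c c' Y p \<xi> \<eta>) = nrm c' p (D f c c' (finv p) ?Z)"
    unfolding push_def Let_def \<xi>1_def[symmetric] \<eta>1_def[symmetric] by (simp add: blinfun.diff_right)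
  also have "\<dots> \<le> al (finv p) * nrm c (finv p) ?Z"
    using rate_chart(2)[OF c(1,2,3) c_f[OF p c] rate[OF p1] al[OF p1], of ?Z] Z ff by simp
  also have "al (finv p) * nrm c (finv p) ?Z \<le> al (finv p) * (a * nrm c (finv p) \<xi>1 * nrm c (finv p) \<eta>1)"
    using a(2) al[OF p1] by (intro mult_left_mono) auto
  also have "al (finv p) * (a * nrm c (finv p) \<xi>1 * nrm c (finv p) \<eta>1) \<le>
      (\<theta> * mm (finv p) * mu (finv p)) * (a * nrm c (finv p) \<xi>1 * nrm c (finv p) \<eta>1)"
  proof (rule mult_right_mono)
    have "al (finv p) \<le> s * al (finv p)" using al[OF p1] constants(5) by simp
    also have "\<dots> = kk (finv p) * mu (finv p)" using kk(1)[OF p1] by simp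
    also have "\<dots> \<le> \<theta> * mm (finv p) * mu (finv p)"
      using kk(3)[OF p1] mu_pos[OF p1] by (intro mult_right_mono) auto
    finally show "al (finv p) \<le> \<theta> * mm (finv p) * mu (finv p)" .
    show "0 \<le> a * nrm c (finv p) \<xi>1 * nrm c (finv p) \<eta>1" using a(1) n by simp
  qed
  also have "(\<theta> * mm (finv p) * mu (finv p)) * (a * nrm c (finv p) \<xi>1 * nrm c (finv p) \<eta>1) =
      \<theta> * a * ((mm (finv p) * nrm c (finv p) \<xi>1) * (mu (finv p) * nrm c (finv p) \<eta>1))" by (simp add: mult_ac)
  also have "\<theta> * a * ((mm (finv p) * nrm c (finv p) \<xi>1) * (mu (finv p) * nrm c (finv p) \<eta>1)) \<le>
      \<theta> * a * (nrm c' p \<xi> * nrm c' p \<eta>)"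
    by (intro mult_left_mono mult_mono b mult_nonneg_nonneg n n')
      (use constants a mu_pos[OF p1] in auto)
  finally show ?thesis by (simp add: mult.assoc)
qed

lemma push_zero_bound:
  assumes p: "p \<in> points M" and ij: "i \<in> I0" "j \<in> I0" "finv p \<in> core i" "p \<in> core j"
  shows "nrm (chart_at M j) p (push (chart_at M i) (chart_at M j) (\<lambda>_ _. 0) p \<xi> \<eta>)
    \<le> 1 / (\<delta> * \<delta> * \<delta>) * nrm (chart_at M j) p \<xi> * nrm (chart_at M j) p \<eta>"
proof -
  let ?c = "chart_at M i" and ?c' = "chart_at M j"
  have c: "?c \<in> atlas M" "?c' \<in> atlas M" "finv p \<in> fst ?c" "p \<in> fst ?c'"
    using cover_facts(2,4) chart_at(1) ij by blast+
  note p1 = finv_points[OF p]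
  have ff: "f (finv p) = p" using p by simp
  define \<xi>1 where "\<xi>1 = D finv ?c' ?c p (Pc ?c' p \<xi>)"
  define \<eta>1 where "\<eta>1 = D finv ?c' ?c p (Pu ?c' p \<eta>)"
  note b = back_bounds(1)[OF p c, of \<xi>, folded \<xi>1_def] back_bounds(2)[OF p c, of \<eta>, folded \<eta>1_def]
  note n = nrm_nonneg[OF c(1,3)] and n' = nrm_nonneg[OF c(2,4)]
  have b1: "nrm ?c (finv p) \<xi>1 \<le> nrm ?c' p \<xi> / \<delta>" "nrm ?c (finv p) \<eta>1 \<le> nrm ?c' p \<eta> / \<delta>"
  proof -
    have "\<delta> * nrm ?c (finv p) \<xi>1 \<le> nrm ?c' p \<xi>"
      using b(1) mult_right_mono[OF mm[OF p1] n[of \<xi>1]] by linarith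
    moreover have "\<delta> * nrm ?c (finv p) \<eta>1 \<le> nrm ?c' p \<eta>"
      using b(2) mult_right_mono[OF mu[OF p1] n[of \<eta>1]] by linarith
    ultimately show "nrm ?c (finv p) \<xi>1 \<le> nrm ?c' p \<xi> / \<delta>" "nrm ?c (finv p) \<eta>1 \<le> nrm ?c' p \<eta> / \<delta>"
      using constants(6) by (simp_all add: field_simps)
  qed
  have S: "\<xi>1 \<in> S" "\<eta>1 \<in> S" unfolding \<xi>1_def \<eta>1_def using back_S[OF p c] by blast+
  have "controlled \<delta> ?c ?c' (finv p)" using control[OF ij(1,2,3)] ij(4) ff by simp
  then have D2: "nrm ?c' p (D2 f ?c ?c' (finv p) \<xi>1 \<eta>1) \<le> 1 / \<delta> * nrm ?c (finv p) \<xi>1 * nrm ?c (finv p) \<eta>1"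
    using S ff unfolding controlled_def by simp
  have "nrm ?c' p (push ?c ?c' (\<lambda>_ _. 0) p \<xi> \<eta>) \<le> nrm ?c' p (D2 f ?c ?c' (finv p) \<xi>1 \<eta>1)"
    unfolding push_def Let_def \<xi>1_def[symmetric] \<eta>1_def[symmetric]
    using nrm_P_le(2)[OF c(2,4)] by simp
  also note D2
  also have "1 / \<delta> * nrm ?c (finv p) \<xi>1 * nrm ?c (finv p) \<eta>1 \<le> 1 / \<delta> * (nrm ?c' p \<xi> / \<delta>) * (nrm ?c' p \<eta> / \<delta>)"
    by (intro mult_mono mult_left_mono b1 mult_nonneg_nonneg n) (use constants(6) n' in auto)
  finally show ?thesis by simp
qed

text \<open>The iterates of zero under the action of \<open>f\<close>, read in the selected charts.\<close>

primrec Kn :: "nat => 'm => 'b => 'b => 'b" where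
  "Kn 0 p = (\<lambda>_ _. 0)"
| "Kn (Suc n) p = push (cs (finv p)) (cs p) (Kn n (finv p)) p"

text \<open>The sum of the geometric series with ratio \<open>\<theta>\<close> that bounds the iterates.\<close>

definition BK :: real where "BK = 1 / (\<delta> * \<delta> * \<delta>) / (1 - \<theta>)"

lemma BK_pos: "0 < BK" unfolding BK_def using constants by simp

lemma back_charts:
  assumes "p \<in> points M"
  shows "cs (finv p) \<in> atlas M" "cs p \<in> atlas M" "finv p \<in> fst (cs (finv p))" "p \<in> fst (cs p)"
  using cover_facts(8,9) assms by simp_all

lemma tensor_zero: "tensor c p (\<lambda>_ _. 0)"
  unfolding tensor_def bilinear_def by (simp add: linear_zero)

lemma tensor_Kn: "p \<in> points M ==> tensor (cs p) p (Kn n p)"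
  by (induction n arbitrary: p) (simp_all add: tensor_zero tensor_push back_charts)

lemma tensor_Pcs: "tensor c p X ==> Pcs c p (X \<xi> \<eta>) = X \<xi> \<eta>"
  unfolding tensor_def by blast

lemma Kn_diff:
  "p \<in> points M ==> nrm (cs p) p (Kn (Suc n) p \<xi> \<eta> - Kn n p \<xi> \<eta>)
    \<le> \<theta> ^ n * (1 / (\<delta> * \<delta> * \<delta>)) * nrm (cs p) p \<xi> * nrm (cs p) p \<eta>"
proof (induction n arbitrary: p \<xi> \<eta>)
  case 0
  then show ?case
    using push_zero_bound[OF 0, of "idx (finv p)" "idx p"] cover_facts(5,7)[of p] cover_facts(5,7)[of "finv p"]
    by (simp add: cs_def)
next
  case (Suc n)
  note c = back_charts[OF Suc.prems] and p1 = finv_points[OF Suc.prems]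
  have "nrm (cs p) p (push (cs (finv p)) (cs p) (Kn (Suc n) (finv p)) p \<xi> \<eta> - push (cs (finv p)) (cs p) (Kn n (finv p)) p \<xi> \<eta>)
      \<le> \<theta> * (\<theta> ^ n * (1 / (\<delta> * \<delta> * \<delta>))) * nrm (cs p) p \<xi> * nrm (cs p) p \<eta>"
  proof (rule push_contracts[OF Suc.prems c])
    show "0 \<le> \<theta> ^ n * (1 / (\<delta> * \<delta> * \<delta>))" using constants by simp
  qed (use tensor_Pcs[OF tensor_Kn[OF p1]] Suc.IH[OF p1] in \<open>auto simp del: Kn.simps\<close>)
  then show ?case by (simp only: Kn.simps(2)[of _ p] power_Suc mult.assoc)
qed

lemma push_bound:
  assumes p: "p \<in> points M" and ij: "i \<in> I0" "j \<in> I0" "finv p \<in> core i" "p \<in> core j"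
    and X: "tensor (chart_at M i) (finv p) X"
      "\<And>\<xi> \<eta>. nrm (chart_at M i) (finv p) (X \<xi> \<eta>) \<le> BK * nrm (chart_at M i) (finv p) \<xi> * nrm (chart_at M i) (finv p) \<eta>"
  shows "nrm (chart_at M j) p (push (chart_at M i) (chart_at M j) X p \<xi> \<eta>)
    \<le> BK * nrm (chart_at M j) p \<xi> * nrm (chart_at M j) p \<eta>"
proof -
  let ?c = "chart_at M i" and ?c' = "chart_at M j"
  have c: "?c \<in> atlas M" "?c' \<in> atlas M" "finv p \<in> fst ?c" "p \<in> fst ?c'"
    using cover_facts(2,4) chart_at(1) ij by blast+
  let ?n = "nrm ?c' p \<xi> * nrm ?c' p \<eta>"
  have "nrm ?c' p (push ?c ?c' X p \<xi> \<eta> - push ?c ?c' (\<lambda>_ _. 0) p \<xi> \<eta>) \<le> \<theta> * BK * nrm ?c' p \<xi> * nrm ?c' p \<eta>"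
    by (rule push_contracts[OF p c]) (use tensor_Pcs[OF X(1)] X(2) BK_pos in auto)
  moreover have "nrm ?c' p (push ?c ?c' X p \<xi> \<eta>) \<le> nrm ?c' p (push ?c ?c' (\<lambda>_ _. 0) p \<xi> \<eta>)
      + nrm ?c' p (push ?c ?c' X p \<xi> \<eta> - push ?c ?c' (\<lambda>_ _. 0) p \<xi> \<eta>)"
    by (rule nrm_triangle_diff[OF c(2,4)])
  ultimately have "nrm ?c' p (push ?c ?c' X p \<xi> \<eta>) \<le> 1 / (\<delta> * \<delta> * \<delta>) * ?n + \<theta> * BK * ?n"
    using push_zero_bound[OF p ij, of \<xi> \<eta>] by (simp add: mult.assoc)
  also have "\<dots> = (1 / (\<delta> * \<delta> * \<delta>) + \<theta> * BK) * ?n" by (simp add: distrib_right)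
  also have "1 / (\<delta> * \<delta> * \<delta>) + \<theta> * BK = BK" unfolding BK_def using constants by (simp add: field_simps)
  finally show ?thesis by (simp add: mult.assoc)
qed

lemma Kn_bound:
  "p \<in> points M ==> nrm (cs p) p (Kn n p \<xi> \<eta>) \<le> BK * nrm (cs p) p \<xi> * nrm (cs p) p \<eta>"
proof (induction n arbitrary: p \<xi> \<eta>)
  case 0
  then show ?case using BK_pos back_charts[OF 0] by simp
next
  case (Suc n)
  note p1 = finv_points[OF Suc.prems]
  show ?case
    using push_bound[OF Suc.prems cover_facts(5)[OF p1] cover_facts(5)[OF Suc.prems]
        cover_facts(7)[OF p1] cover_facts(7)[OF Suc.prems], of "Kn n (finv p)" \<xi> \<eta>]
      tensor_Kn[OF p1] Suc.IH[OF p1] by (simp add: cs_def)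
qed

definition K :: "'m => 'b => 'b => 'b" where
  "K p \<xi> \<eta> = lim (\<lambda>n. Kn n p \<xi> \<eta>)"

lemma Kn_limit:
  assumes p: "p \<in> points M"
  shows "(\<lambda>n. Kn n p \<xi> \<eta>) \<longlonglongrightarrow> K p \<xi> \<eta>"
proof -
  note c = back_charts[OF p]
  obtain C where C: "C > 0" "\<forall>\<xi>\<in>S. norm \<xi> \<le> C * nrm (cs p) p \<xi> \<and> nrm (cs p) p \<xi> \<le> C * norm \<xi>"
    using nrm_equiv[OF c(2,4)] eventually_nh_self[OF _ p] by blast
  let ?d = "\<lambda>n. Kn (Suc n) p \<xi> \<eta> - Kn n p \<xi> \<eta>"
  let ?A = "C * (1 / (\<delta> * \<delta> * \<delta>) * nrm (cs p) p \<xi> * nrm (cs p) p \<eta>)"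
  have KS: "Kn n p \<xi> \<eta> \<in> S" for n
    using tensor_Pcs[OF tensor_Kn[OF p]] P_S(4)[OF c(2,4)] by metis
  have "norm (?d n) \<le> ?A * \<theta> ^ n" for n
  proof -
    have "?d n \<in> S" using KS S_closed_under(5) by blast
    then have "norm (?d n) \<le> C * nrm (cs p) p (?d n)" using C(2) by blast
    also have "\<dots> \<le> C * (\<theta> ^ n * (1 / (\<delta> * \<delta> * \<delta>)) * nrm (cs p) p \<xi> * nrm (cs p) p \<eta>)"
      using Kn_diff[OF p] C(1) by (intro mult_left_mono) auto
    finally show ?thesis by (simp add: mult_ac)
  qed
  moreover have "summable (\<lambda>n. ?A * \<theta> ^ n)"
    using constants by (intro summable_mult summable_geometric) simp
  ultimately have "summable ?d" by (rule summable_comparison_test'[of _ 0, rotated])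
  then have "convergent (\<lambda>n. \<Sum>k<n. ?d k)" by (simp add: summable_iff_convergent)
  moreover have "(\<Sum>k<n. ?d k) = Kn n p \<xi> \<eta>" for n
    by (subst sum_lessThan_telescope) simp
  ultimately have "convergent (\<lambda>n. Kn n p \<xi> \<eta>)" by simp
  then show ?thesis unfolding K_def by (rule convergent_LIMSEQ_iff[THEN iffD1])
qed

lemma bilinear_limit:
  assumes "\<And>n. bilinear (X n)" "\<And>\<xi> \<eta>. (\<lambda>n. X n \<xi> \<eta>) \<longlonglongrightarrow> (Y \<xi> \<eta> :: 'b)"
  shows "bilinear (Y :: 'b => 'b => 'b)"
proof -
  have lin: "linear (\<lambda>\<eta>. X n \<xi> \<eta>)" "linear (\<lambda>\<xi>. X n \<xi> \<eta>)" for n \<xi> \<eta>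
    using assms(1) unfolding bilinear_def by blast+
  show ?thesis
    unfolding bilinear_def
  proof (intro conjI allI)
    fix \<xi>
    show "linear (\<lambda>\<eta>. Y \<xi> \<eta>)"
    proof (rule linearI)
      fix x y and r :: real
      have "(\<lambda>n. X n \<xi> (x + y)) \<longlonglongrightarrow> Y \<xi> x + Y \<xi> y"
        using tendsto_add[OF assms(2)[of \<xi> x] assms(2)[of \<xi> y]] by (simp add: linear_add[OF lin(1)])
      then show "Y \<xi> (x + y) = Y \<xi> x + Y \<xi> y" by (rule LIMSEQ_unique[OF assms(2)])
      have "(\<lambda>n. X n \<xi> (r *\<^sub>R x)) \<longlonglongrightarrow> r *\<^sub>R Y \<xi> x"
        using tendsto_scaleR[OF tendsto_const assms(2)[of \<xi> x], of r] by (simp add: linear_scale[OF lin(1)])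
      then show "Y \<xi> (r *\<^sub>R x) = r *\<^sub>R Y \<xi> x" by (rule LIMSEQ_unique[OF assms(2)])
    qed
    show "linear (\<lambda>\<eta>. Y \<eta> \<xi>)"
    proof (rule linearI)
      fix x y and r :: real
      have "(\<lambda>n. X n (x + y) \<xi>) \<longlonglongrightarrow> Y x \<xi> + Y y \<xi>"
        using tendsto_add[OF assms(2)[of x \<xi>] assms(2)[of y \<xi>]] by (simp add: linear_add[OF lin(2)])
      then show "Y (x + y) \<xi> = Y x \<xi> + Y y \<xi>" by (rule LIMSEQ_unique[OF assms(2)])
      have "(\<lambda>n. X n (r *\<^sub>R x) \<xi>) \<longlonglongrightarrow> r *\<^sub>R Y x \<xi>"
        using tendsto_scaleR[OF tendsto_const assms(2)[of x \<xi>], of r] by (simp add: linear_scale[OF lin(2)])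
      then show "Y (r *\<^sub>R x) \<xi> = r *\<^sub>R Y x \<xi>" by (rule LIMSEQ_unique[OF assms(2)])
    qed
  qed
qed

lemma K_facts:
  assumes p: "p \<in> points M"
  shows "tensor (cs p) p (K p)"
    and "nrm (cs p) p (K p \<xi> \<eta>) \<le> BK * nrm (cs p) p \<xi> * nrm (cs p) p \<eta>"
    and "K p = push (cs (finv p)) (cs p) (K (finv p)) p"
proof -
  note c = back_charts[OF p] and L = Kn_limit[OF p] and p1 = finv_points[OF p]
  note t = tensor_Kn[OF p, unfolded tensor_def]
  have "bilinear (K p)" by (rule bilinear_limit[OF _ L]) (use t in blast)
  moreover have "Pcs (cs p) p (K p \<xi> \<eta>) = K p \<xi> \<eta>" for \<xi> \<eta>
  proof -
    have "(\<lambda>n. Pcs (cs p) p (Kn n p \<xi> \<eta>)) \<longlonglongrightarrow> Pcs (cs p) p (K p \<xi> \<eta>)"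
      by (intro blinfun.tendsto tendsto_const L)
    moreover have "Pcs (cs p) p (Kn n p \<xi> \<eta>) = Kn n p \<xi> \<eta>" for n using t by blast
    ultimately have "(\<lambda>n. Kn n p \<xi> \<eta>) \<longlonglongrightarrow> Pcs (cs p) p (K p \<xi> \<eta>)" by simp
    then show ?thesis by (rule LIMSEQ_unique[OF _ L])
  qed
  moreover have "K p (Pc (cs p) p \<xi>) (Pu (cs p) p \<eta>) = K p \<xi> \<eta>" for \<xi> \<eta>
  proof -
    have "Kn n p (Pc (cs p) p \<xi>) (Pu (cs p) p \<eta>) = Kn n p \<xi> \<eta>" for n using t by blast
    then have "(\<lambda>n. Kn n p \<xi> \<eta>) \<longlonglongrightarrow> K p (Pc (cs p) p \<xi>) (Pu (cs p) p \<eta>)"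
      using L[of "Pc (cs p) p \<xi>" "Pu (cs p) p \<eta>"] by simp
    then show ?thesis by (rule LIMSEQ_unique[OF _ L])
  qed
  ultimately show "tensor (cs p) p (K p)" unfolding tensor_def by blast
  have "filterlim (\<lambda>_. p) (nh p) sequentially"
    unfolding filterlim_iff using eventually_nh_self[OF _ p] by (auto intro: always_eventually)
  from nrm_tendsto[OF c(2,4) this L]
  show "nrm (cs p) p (K p \<xi> \<eta>) \<le> BK * nrm (cs p) p \<xi> * nrm (cs p) p \<eta>"
    by (rule LIMSEQ_le_const2) (use Kn_bound[OF p] in blast)
  show "K p = push (cs (finv p)) (cs p) (K (finv p)) p"
  proof (intro ext)
    fix \<xi> \<eta>
    have "(\<lambda>n. push (cs (finv p)) (cs p) (Kn n (finv p)) p \<xi> \<eta>) \<longlonglongrightarrow> push (cs (finv p)) (cs p) (K (finv p)) p \<xi> \<eta>"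
      unfolding push_def Let_def by (intro tendsto_intros blinfun.tendsto Kn_limit[OF p1])
    then have "(\<lambda>n. Kn (Suc n) p \<xi> \<eta>) \<longlonglongrightarrow> push (cs (finv p)) (cs p) (K (finv p)) p \<xi> \<eta>" by simp
    then show "K p \<xi> \<eta> = push (cs (finv p)) (cs p) (K (finv p)) p \<xi> \<eta>"
      using LIMSEQ_unique LIMSEQ_Suc[OF L[of \<xi> \<eta>]] by blast
  qed
qed

text \<open>The candidate for the derivative of \<open>E\<^sup>u\<close> in an arbitrary chart: by the invariance of \<open>K\<close>, one more
  iterate of \<open>f\<close> with values in that chart.\<close>

definition KK :: "('m, 'b) chart => 'm => 'b => 'b => 'b" where
  "KK c p = push (cs (finv p)) c (K (finv p)) p"

lemma KK_cs: "p \<in> points M ==> KK (cs p) p = K p"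
  unfolding KK_def using K_facts(3) by metis

context
  fixes p c
  assumes c: "c \<in> atlas M" "p \<in> fst c"
begin

lemma KK_point: "p \<in> points M" using mem_points[OF c] .

lemma KK_tensor: "tensor c p (KK c p)"
  unfolding KK_def
  using back_charts[OF KK_point] c K_facts(1)[OF finv_points[OF KK_point]]
  by (intro tensor_push[OF KK_point]) auto

lemma KK_chart:
  assumes "d \<in> atlas M" "p \<in> fst d"
  shows "KK d p = trans c d (KK c p) p"
  unfolding KK_def using back_charts[OF KK_point] c assms by (intro push_target_change[OF KK_point]) auto

end

lemma KK_push:
  assumes p: "p \<in> points M" and c: "c \<in> atlas M" "finv p \<in> fst c" "c' \<in> atlas M" "p \<in> fst c'"
  shows "KK c' p = push c c' (KK c (finv p)) p"
proof -
  note p1 = finv_points[OF p]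
  have "KK c (finv p) = trans (cs (finv p)) c (K (finv p)) (finv p)"
    using KK_chart[OF cover_facts(8,9)[OF p1] c(1,2)] KK_cs[OF p1] by simp
  then have "push c c' (KK c (finv p)) p = push (cs (finv p)) c' (K (finv p)) p"
    using push_source_change[OF p cover_facts(8,9)[OF p1] c] by simp
  then show ?thesis unfolding KK_def by simp
qed

text \<open>The equation obtained by differentiating the invariance of \<open>E\<^sup>u\<close>.\<close>

lemma KK_f:
  assumes c: "c \<in> atlas M" "c' \<in> atlas M" "p \<in> fst c" "f p \<in> fst c'"
  shows "KK c' (f p) (D f c c' p (Pc c p \<xi>)) (D f c c' p (Pu c p \<eta>)) =
    D f c c' p (KK c p \<xi> \<eta>) + Pcs c' (f p) (D2 f c c' p (Pc c p \<xi>) (Pu c p \<eta>))"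
proof -
  have p: "p \<in> points M" using mem_points c by blast
  note fp = f_points[OF p]
  have "D finv c' c (f p) (Pc c' (f p) (D f c c' p (Pc c p \<xi>))) = Pc c p \<xi>"
    "D finv c' c (f p) (Pu c' (f p) (D f c c' p (Pu c p \<eta>))) = Pu c p \<eta>"
    using P_f[OF c] D_finv_f[OF c] P_comp[OF c(1,3)] P_S[OF c(1,3)] by simp_all
  moreover have "KK c p (Pc c p \<xi>) (Pu c p \<eta>) = KK c p \<xi> \<eta>"
    using KK_tensor[OF c(1,3)] unfolding tensor_def by blast
  ultimately show ?thesis
    using KK_push[OF fp c(1) _ c(2,4)] p c unfolding push_def Let_def by simp
qed

text \<open>Continuity: up to an error that is as small as one likes, \<open>KK\<close> is the image of a continuous
  function under an iterate of the contraction.\<close>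

definition approximable :: "real => bool" where
  "approximable a \<longleftrightarrow> (\<forall>q\<in>points M. \<forall>c\<in>atlas M. q \<in> fst c -->
     (\<exists>\<Phi>. jointly_continuous q \<Phi> \<and>
       (\<forall>\<^sub>F p in nh q. (\<forall>\<xi> \<eta>. Pcs c p (\<Phi> p \<xi> \<eta>) = \<Phi> p \<xi> \<eta>) \<and>
         (\<forall>\<xi> \<eta>. nrm c p (KK c p \<xi> \<eta> - \<Phi> p \<xi> \<eta>) \<le> a * nrm c p \<xi> * nrm c p \<eta>))))"

lemma approximable_start: "approximable BK"
  unfolding approximable_def
proof (intro ballI impI)
  fix q c assume q: "q \<in> points M" and c: "c \<in> atlas M" "q \<in> fst c"
  note c0 = cover_facts(8,9)[OF q]
  let ?\<Phi> = "\<lambda>p. trans (cs q) c (\<lambda>_ _. 0) p"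
  have "\<forall>\<^sub>F p in nh q. (\<forall>\<xi> \<eta>. Pcs c p (?\<Phi> p \<xi> \<eta>) = ?\<Phi> p \<xi> \<eta>) \<and>
         (\<forall>\<xi> \<eta>. nrm c p (KK c p \<xi> \<eta> - ?\<Phi> p \<xi> \<eta>) \<le> BK * nrm c p \<xi> * nrm c p \<eta>)"
    using cover_facts(6)[OF q] eventually_chart[OF c] eventually_chart[OF c0]
  proof eventually_elim
    case (elim p)
    note cp = c(1) elim(2) and c0p = c0(1) elim(3)
    have p: "p \<in> points M" using mem_points[OF cp] .
    note p1 = finv_points[OF p]
    have b: "nrm (cs q) p (KK (cs q) p \<xi> \<eta>) \<le> BK * nrm (cs q) p \<xi> * nrm (cs q) p \<eta>" for \<xi> \<eta>
      using push_bound[OF p cover_facts(5)[OF p1] cover_facts(5)[OF q] cover_facts(7)[OF p1] elim(1),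
          of "K (finv p)"] K_facts(1,2)[OF p1] unfolding KK_def cs_def by simp
    show ?case
    proof (intro conjI allI)
      fix \<xi> \<eta>
      show "Pcs c p (?\<Phi> p \<xi> \<eta>) = ?\<Phi> p \<xi> \<eta>" unfolding trans_def by (simp add: P_comp[OF cp])
      have "KK c p \<xi> \<eta> - ?\<Phi> p \<xi> \<eta> = D id (cs q) c p (KK (cs q) p (D id c (cs q) p \<xi>) (D id c (cs q) p \<eta>))"
        using KK_chart[OF c0p cp] unfolding trans_def by simp
      then have "nrm c p (KK c p \<xi> \<eta> - ?\<Phi> p \<xi> \<eta>) = nrm (cs q) p (KK (cs q) p (D id c (cs q) p \<xi>) (D id c (cs q) p \<eta>))"
        using nrm_id[OF c0(1) c(1) elim(3,2)] by simp
      also have "\<dots> \<le> BK * nrm (cs q) p (D id c (cs q) p \<xi>) * nrm (cs q) p (D id c (cs q) p \<eta>)" by (rule b)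
      also have "\<dots> = BK * nrm c p \<xi> * nrm c p \<eta>" using nrm_id[OF c(1) c0(1) elim(2,3)] by simp
      finally show "nrm c p (KK c p \<xi> \<eta> - ?\<Phi> p \<xi> \<eta>) \<le> BK * nrm c p \<xi> * nrm c p \<eta>" .
    qed
  qed
  then show "\<exists>\<Phi>. jointly_continuous q \<Phi> \<and>
       (\<forall>\<^sub>F p in nh q. (\<forall>\<xi> \<eta>. Pcs c p (\<Phi> p \<xi> \<eta>) = \<Phi> p \<xi> \<eta>) \<and>
         (\<forall>\<xi> \<eta>. nrm c p (KK c p \<xi> \<eta> - \<Phi> p \<xi> \<eta>) \<le> BK * nrm c p \<xi> * nrm c p \<eta>))"
    using trans_zero_continuous[OF c0(1) c(1) c0(2) c(2)] by (intro exI[of _ ?\<Phi>]) blast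
qed

text \<open>The action of \<open>f\<close> takes continuous approximations to continuous ones and contracts their error.\<close>

lemma approximable_step:
  assumes "approximable a" "0 \<le> a"
  shows "approximable (\<theta> * a)"
  unfolding approximable_def
proof (intro ballI impI)
  fix q c assume q: "q \<in> points M" and c: "c \<in> atlas M" "q \<in> fst c"
  note q1 = finv_points[OF q]
  note c1 = chart_at[OF q1]
  let ?c1 = "chart_at M (finv q)"
  obtain \<Phi> where \<Phi>: "jointly_continuous (finv q) \<Phi>"
    "\<forall>\<^sub>F p in nh (finv q). (\<forall>\<xi> \<eta>. Pcs ?c1 p (\<Phi> p \<xi> \<eta>) = \<Phi> p \<xi> \<eta>) \<and>
         (\<forall>\<xi> \<eta>. nrm ?c1 p (KK ?c1 p \<xi> \<eta> - \<Phi> p \<xi> \<eta>) \<le> a * nrm ?c1 p \<xi> * nrm ?c1 p \<eta>)"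
    using assms(1) q1 c1 unfolding approximable_def by meson
  let ?\<Psi> = "\<lambda>p. push ?c1 c (\<Phi> (finv p)) p"
  have "\<forall>\<^sub>F p in nh q. (\<forall>\<xi> \<eta>. Pcs c p (?\<Psi> p \<xi> \<eta>) = ?\<Psi> p \<xi> \<eta>) \<and>
         (\<forall>\<xi> \<eta>. nrm c p (KK c p \<xi> \<eta> - ?\<Psi> p \<xi> \<eta>) \<le> \<theta> * a * nrm c p \<xi> * nrm c p \<eta>)"
    using eventually_compose_filterlim[OF \<Phi>(2) filterlim_C2[OF C2_finv q]]
      eventually_compose_filterlim[OF eventually_chart[OF c1] filterlim_C2[OF C2_finv q]] eventually_chart[OF c]
  proof eventually_elim
    case (elim p)
    have p: "p \<in> points M" using mem_points[OF c(1) elim(3)] .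
    have ff: "f (finv p) = p" using p by simp
    note cc = c1(1) c(1) elim(2,3)
    show ?case
    proof (intro conjI allI)
      fix \<xi> \<eta>
      have "Pcs c p (D f ?c1 c (finv p) z) = D f ?c1 c (finv p) (Pcs ?c1 (finv p) z)" for z
        using P_f(3)[OF cc(1-3) c_f[OF p cc]] ff by simp
      then show "Pcs c p (?\<Psi> p \<xi> \<eta>) = ?\<Psi> p \<xi> \<eta>"
        unfolding push_def Let_def using elim(1) by (simp add: blinfun.add_right P_comp[OF c(1) elim(3)])
      show "nrm c p (KK c p \<xi> \<eta> - ?\<Psi> p \<xi> \<eta>) \<le> \<theta> * a * nrm c p \<xi> * nrm c p \<eta>"
        unfolding KK_push[OF p c1(1) elim(2) c(1) elim(3)]
        by (rule push_contracts[OF p cc tensor_Pcs[OF KK_tensor[OF c1(1) elim(2)]]]) (use elim(1) assms(2) in auto)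
    qed
  qed
  then show "\<exists>\<Phi>. jointly_continuous q \<Phi> \<and>
       (\<forall>\<^sub>F p in nh q. (\<forall>\<xi> \<eta>. Pcs c p (\<Phi> p \<xi> \<eta>) = \<Phi> p \<xi> \<eta>) \<and>
         (\<forall>\<xi> \<eta>. nrm c p (KK c p \<xi> \<eta> - \<Phi> p \<xi> \<eta>) \<le> \<theta> * a * nrm c p \<xi> * nrm c p \<eta>))"
    using push_continuous[OF q c1 c \<Phi>(1)] by (intro exI[of _ ?\<Psi>]) blast
qed

lemma approximable_power: "approximable (\<theta> ^ n * BK)"
proof (induction n)
  case (Suc n)
  have "0 \<le> \<theta> ^ n * BK" using constants BK_pos by simp
  from approximable_step[OF Suc this] show ?case by (simp add: mult.assoc)
qed (simp add: approximable_start)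

theorem KK_continuous:
  assumes c: "c \<in> atlas M" "q \<in> fst c"
  shows "jointly_continuous q (KK c)"
  unfolding jointly_continuous_def
proof (intro allI tendstoI)
  fix \<xi> \<eta> :: 'b and e :: real assume e: "e > 0"
  have q: "q \<in> points M" using mem_points[OF c] .
  let ?F = "nh q \<times>\<^sub>F (nhds \<xi> \<times>\<^sub>F nhds \<eta>)"
  note j = joint_lims[where q = q and \<xi> = \<xi> and \<eta> = \<eta>]
  obtain C where C: "C > 0" "\<forall>\<^sub>F p in nh q. \<forall>\<xi>\<in>S. norm \<xi> \<le> C * nrm c p \<xi> \<and> nrm c p \<xi> \<le> C * norm \<xi>"
    using nrm_equiv[OF c] by blast
  define R where "R = (nrm c q \<xi> + 1) * (nrm c q \<eta> + 1)"
  have R: "R > 0" unfolding R_def using nrm_nonneg[OF c] by (intro mult_pos_pos add_nonneg_pos) auto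
  have "(\<lambda>n. C * (\<theta> ^ n * BK * R)) \<longlonglongrightarrow> C * (0 * BK * R)"
    by (intro tendsto_intros LIMSEQ_power_zero) (use constants in auto)
  then have "\<forall>\<^sub>F n in sequentially. C * (\<theta> ^ n * BK * R) < e / 3"
    using e by (intro order_tendstoD(2)) auto
  then obtain n where n: "C * (\<theta> ^ n * BK * R) < e / 3" using eventually_happens by force
  define a where "a = \<theta> ^ n * BK"
  have a: "0 \<le> a" unfolding a_def using constants BK_pos by simp
  obtain \<Phi> where \<Phi>: "jointly_continuous q \<Phi>"
    "\<forall>\<^sub>F p in nh q. (\<forall>\<xi> \<eta>. Pcs c p (\<Phi> p \<xi> \<eta>) = \<Phi> p \<xi> \<eta>) \<and>
         (\<forall>\<xi> \<eta>. nrm c p (KK c p \<xi> \<eta> - \<Phi> p \<xi> \<eta>) \<le> a * nrm c p \<xi> * nrm c p \<eta>)"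
    using approximable_power[of n] q c unfolding approximable_def a_def by meson
  have key: "\<forall>\<^sub>F p in nh q. \<forall>x y. nrm c p x < nrm c q \<xi> + 1 --> nrm c p y < nrm c q \<eta> + 1 -->
      norm (KK c p x y - \<Phi> p x y) < e / 3"
    using \<Phi>(2) C(2) eventually_chart[OF c]
  proof eventually_elim
    case (elim p)
    note cp = c(1) elim(3)
    show ?case
    proof (intro allI impI)
      fix x y assume xy: "nrm c p x < nrm c q \<xi> + 1" "nrm c p y < nrm c q \<eta> + 1"
      let ?z = "KK c p x y - \<Phi> p x y"
      have "KK c p x y \<in> S" "\<Phi> p x y \<in> S"
        using tensor_Pcs[OF KK_tensor[OF cp]] elim(1) P_S(4)[OF cp] by metis+
      then have "norm ?z \<le> C * nrm c p ?z" using elim(2) by simp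
      also have "\<dots> \<le> C * (a * (nrm c p x * nrm c p y))"
        using elim(1) C(1) by (simp add: mult.assoc)
      also have "\<dots> \<le> C * (a * R)"
      proof -
        have "nrm c p x * nrm c p y \<le> R"
          unfolding R_def using xy nrm_nonneg[OF cp] by (intro mult_mono) (auto intro: less_imp_le order_trans)
        then show ?thesis using C(1) a by (intro mult_left_mono) auto
      qed
      also have "\<dots> < e / 3" using n unfolding a_def by (simp add: mult.assoc)
      finally show "norm ?z < e / 3" .
    qed
  qed
  have kq: "norm (KK c q \<xi> \<eta> - \<Phi> q \<xi> \<eta>) < e / 3"
    using eventually_nh_self[OF key q] by simp
  have "\<forall>\<^sub>F z in ?F. nrm c (fst z) (fst (snd z)) < nrm c q \<xi> + 1"
    by (intro order_tendstoD(2)[OF nrm_tendsto[OF c j(1,2)]]) simp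
  moreover have "\<forall>\<^sub>F z in ?F. nrm c (fst z) (snd (snd z)) < nrm c q \<eta> + 1"
    by (intro order_tendstoD(2)[OF nrm_tendsto[OF c j(1,3)]]) simp
  moreover have "\<forall>\<^sub>F z in ?F. dist (\<Phi> (fst z) (fst (snd z)) (snd (snd z))) (\<Phi> q \<xi> \<eta>) < e / 3"
    using tendstoD[OF \<Phi>(1)[unfolded jointly_continuous_def, rule_format], of "e / 3"] e by simp
  ultimately show "\<forall>\<^sub>F z in ?F. dist (KK c (fst z) (fst (snd z)) (snd (snd z))) (KK c q \<xi> \<eta>) < e"
    using eventually_compose_filterlim[OF key j(1)]
  proof eventually_elim
    case (elim z)
    let ?k = "KK c (fst z) (fst (snd z)) (snd (snd z))" and ?f = "\<Phi> (fst z) (fst (snd z)) (snd (snd z))"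
    have "norm (?k - ?f) < e / 3" using elim by blast
    then have "dist ?k ?f < e / 3" by (simp add: dist_norm)
    moreover have "dist (\<Phi> q \<xi> \<eta>) (KK c q \<xi> \<eta>) < e / 3" using kq by (simp add: dist_norm norm_minus_commute)
    ultimately show ?case
      using elim(3) dist_triangle[of ?k "KK c q \<xi> \<eta>" ?f] dist_triangle[of ?f "KK c q \<xi> \<eta>" "\<Phi> q \<xi> \<eta>"] by linarith
  qed
qed

end

section \<open>Differentiability of the unstable bundle along center arcs\<close>

context uniformly_bunched
begin

lemma operator_nrm_bound:
  assumes "c \<in> atlas M" "p \<in> fst c" "c' \<in> atlas M" "q \<in> fst c'"
  shows "\<exists>C>0. \<forall>X :: 'b \<Rightarrow>\<^sub>L 'b. \<forall>x\<in>S. nrm c' q (blinfun_apply X x) \<le> C * norm X * nrm c p x"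
proof -
  obtain C1 where C1: "C1 > 0" "\<forall>x\<in>S. norm x \<le> C1 * nrm c p x" using nrm_norm_constant[OF assms(1,2)] by blast
  obtain C2 where C2: "C2 > 0" "\<forall>x. nrm c' q x \<le> C2 * norm x" using nrm_norm_constant[OF assms(3,4)] by blast
  have "nrm c' q (blinfun_apply X x) \<le> C2 * C1 * norm X * nrm c p x" if "x \<in> S" for X :: "'b \<Rightarrow>\<^sub>L 'b" and x
  proof -
    have "nrm c' q (blinfun_apply X x) \<le> C2 * (norm X * norm x)"
      using order_trans[OF spec[OF C2(2)] mult_left_mono[OF norm_blinfun less_imp_le[OF C2(1)]]] .
    also have "\<dots> \<le> C2 * (norm X * (C1 * nrm c p x))" using C1(2) C2(1) that by (intro mult_left_mono) auto
    finally show ?thesis by (simp add: mult_ac)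
  qed
  then show ?thesis using C1(1) C2(1) by (intro exI[of _ "C2 * C1"]) simp
qed

lemma tensor_nrm_bound:
  assumes c: "c \<in> atlas M" "p \<in> fst c" and X: "tensor c p X"
  shows "\<exists>k\<ge>0. \<forall>y\<in>S. nrm c p (X x y) \<le> k * nrm c p y"
proof -
  obtain C where C: "C > 0" "\<forall>X :: 'b \<Rightarrow>\<^sub>L 'b. \<forall>x\<in>S. nrm c p (blinfun_apply X x) \<le> C * norm X * nrm c p x"
    using operator_nrm_bound[OF c c] by blast
  have "linear (X x)" using X unfolding tensor_def bilinear_def by blast
  then have "blinfun_apply (Blinfun (X x)) = X x"
    by (intro bounded_linear_Blinfun_apply linear_conv_bounded_linear[THEN iffD1])
  then show ?thesis using C by (intro exI[of _ "C * norm (Blinfun (X x))"]) (metis less_imp_le mult_nonneg_nonneg norm_ge_zero)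
qed

text \<open>One step of the dynamics. The plane \<open>E\<^sup>u\<close> at a nearby point of an arc, at the parameter
  distance \<open>h\<close>, is described by vectors \<open>\<omega>\<close>, and \<open>b\<close> bounds by how much it deviates, relative to \<open>h\<close>,
  from what the derivative \<open>KK\<close> predicts. After one step the bound becomes \<open>al p / mu p * b\<close>, up to
  errors of higher order; the second derivative of \<open>f\<close> cancels by the invariance of \<open>KK\<close>.\<close>

lemma deviation_estimate:
  assumes c: "c \<in> atlas M" "c' \<in> atlas M" "p \<in> fst c" "f p \<in> fst c'"
    and \<xi>: "\<xi> \<in> EE Ec c p" and b: "0 \<le> b"
  defines "L \<equiv> D f c c' p" and "Q \<equiv> D2 f c c' p \<xi>"
  shows "\<exists>G>0. \<forall>h T \<omega> \<epsilon>. \<epsilon> \<le> 1 --> \<bar>h\<bar> \<le> \<epsilon> --> norm (T - L - h *\<^sub>R Q) \<le> \<epsilon> * \<bar>h\<bar> --> \<omega> \<in> S -->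
    nrm c p (Pcs c p \<omega> - h *\<^sub>R KK c p \<xi> (Pu c p \<omega>)) \<le> b * \<bar>h\<bar> * nrm c p (Pu c p \<omega>) -->
    nrm c' (f p) (Pcs c' (f p) (blinfun_apply T \<omega>) - h *\<^sub>R KK c' (f p) (L \<xi>) (Pu c' (f p) (T \<omega>)))
      \<le> (al p * b + G * \<epsilon>) * \<bar>h\<bar> * nrm c p (Pu c p \<omega>) \<and>
    mu p * nrm c p (Pu c p \<omega>) \<le> nrm c' (f p) (Pu c' (f p) (T \<omega>)) + G * \<epsilon> * nrm c p (Pu c p \<omega>)"
proof -
  have p: "p \<in> points M" using mem_points c by blast
  note cp = c(1,3) and cfp = c(2,4)
  note rc = rate_chart[OF c rate[OF p] al[OF p]]
  obtain C where C: "C > 0" "\<And>X x. x \<in> S ==> nrm c' (f p) (blinfun_apply X x) \<le> C * norm X * nrm c p x"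
    using operator_nrm_bound[OF cp cfp] by blast
  obtain k where k: "k \<ge> 0" "\<And>y. y \<in> S ==> nrm c p (KK c p \<xi> y) \<le> k * nrm c p y"
    using tensor_nrm_bound[OF cp KK_tensor[OF cp]] by blast
  obtain k1 where k1: "k1 \<ge> 0" "\<And>y. y \<in> S ==> nrm c' (f p) (KK c' (f p) (L \<xi>) y) \<le> k1 * nrm c' (f p) y"
    using tensor_nrm_bound[OF cfp KK_tensor[OF cfp]] by blast
  have linK: "linear (KK c' (f p) (L \<xi>))"
    using KK_tensor[OF cfp] unfolding tensor_def bilinear_def by blast
  define w where "w = 1 + b + k"
  define Cy where "Cy = C * (norm Q + 1) * w"
  define G0 where "G0 = C * norm Q * (b + k) + C * w + k1 * Cy"
  define G where "G = G0 + Cy + 1"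
  have w: "w \<ge> 0" unfolding w_def using b k(1) by simp
  have Cy: "Cy \<ge> 0" unfolding Cy_def using w C(1) by simp
  have "G0 \<ge> 0" unfolding G0_def using k(1) b C(1) w k1(1) Cy by simp
  then have G: "G > 0" "Cy \<le> G" "G0 \<le> G" unfolding G_def using Cy by linarith+
  show ?thesis
  proof (intro exI[of _ G] conjI G(1) allI impI)
    fix h \<epsilon> :: real and T :: "'b \<Rightarrow>\<^sub>L 'b" and \<omega> :: 'b
    assume e: "\<epsilon> \<le> 1" "\<bar>h\<bar> \<le> \<epsilon>" and T: "norm (T - L - h *\<^sub>R Q) \<le> \<epsilon> * \<bar>h\<bar>" and \<omega>: "\<omega> \<in> S"
      and dev: "nrm c p (Pcs c p \<omega> - h *\<^sub>R KK c p \<xi> (Pu c p \<omega>)) \<le> b * \<bar>h\<bar> * nrm c p (Pu c p \<omega>)"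
    define u where "u = Pu c p \<omega>"
    define z where "z = Pcs c p \<omega>"
    define n where "n = nrm c p u"
    define r where "r = T - L - h *\<^sub>R Q"
    define q where "q = h *\<^sub>R Q \<omega> + r \<omega>"
    define y where "y = Pu c' (f p) q"
    have e0: "0 \<le> \<epsilon>" using e(2) by linarith
    have n0: "0 \<le> n" unfolding n_def by (rule nrm_nonneg[OF cp])
    have S: "u \<in> S" "z \<in> S" "y \<in> S" unfolding u_def z_def y_def using P_S[OF cp] P_S[OF cfp] by blast+
    have \<omega>uz: "\<omega> = u + z" unfolding u_def z_def using P_decomp(1)[OF cp \<omega>] by simp
    have "nrm c p (h *\<^sub>R KK c p \<xi> u) \<le> k * \<bar>h\<bar> * n"
      unfolding nrm_scale[OF cp] n_def using mult_left_mono[OF k(2)[OF S(1)], of "\<bar>h\<bar>"] by (simp add: mult_ac)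
    then have nz: "nrm c p z \<le> (b + k) * \<bar>h\<bar> * n"
      using nrm_triangle_diff[OF cp, of z "h *\<^sub>R KK c p \<xi> u"] dev
      unfolding u_def[symmetric] z_def[symmetric] n_def[symmetric] by (simp add: algebra_simps)
    have "nrm c p \<omega> \<le> n + nrm c p z" unfolding \<omega>uz n_def by (rule nrm_triangle[OF cp])
    also have "\<dots> \<le> n + (b + k) * 1 * n"
      using order_trans[OF nz mult_right_mono[OF mult_left_mono[of "\<bar>h\<bar>" 1 "b + k"] n0]] e b k(1) by simp
    finally have n\<omega>: "nrm c p \<omega> \<le> w * n" unfolding w_def by (simp add: algebra_simps)
    have nr: "nrm c' (f p) (r \<omega>) \<le> C * w * (\<epsilon> * \<bar>h\<bar> * n)"
    proof -
      have "nrm c' (f p) (r \<omega>) \<le> C * (\<epsilon> * \<bar>h\<bar>) * (w * n)"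
        using C(1) T e0 by (intro order_trans[OF C(2)[OF \<omega>]] mult_mono n\<omega>) (auto simp: r_def nrm_nonneg[OF cp])
      then show ?thesis by (simp add: mult_ac)
    qed
    have ny: "nrm c' (f p) y \<le> Cy * (\<bar>h\<bar> * n)"
    proof -
      have "norm (h *\<^sub>R Q + r) \<le> \<bar>h\<bar> * norm Q + 1 * \<bar>h\<bar>"
        using norm_triangle_ineq[of "h *\<^sub>R Q" r] T mult_right_mono[OF e(1), of "\<bar>h\<bar>"] unfolding r_def by simp
      then have "C * norm (h *\<^sub>R Q + r) * nrm c p \<omega> \<le> C * (\<bar>h\<bar> * norm Q + 1 * \<bar>h\<bar>) * (w * n)"
        using C(1) by (intro mult_mono n\<omega>) (auto simp: nrm_nonneg[OF cp])
      moreover have "q = (h *\<^sub>R Q + r) \<omega>" unfolding q_def by (simp add: blinfun.add_left blinfun.scaleR_left)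
      ultimately show ?thesis
        unfolding y_def Cy_def using order_trans[OF nrm_P_le(1)[OF cfp] order_trans[OF C(2)[OF \<omega>]]] by (simp add: algebra_simps)
    qed
    have T\<omega>: "T \<omega> = L \<omega> + q" unfolding q_def r_def by (simp add: blinfun.diff_left blinfun.scaleR_left)
    have Pu': "Pu c' (f p) (T \<omega>) = L u + y"
      unfolding T\<omega> blinfun.add_right y_def u_def L_def using P_f(1)[OF c] by simp
    have Pcs': "Pcs c' (f p) (T \<omega>) = L z + h *\<^sub>R Pcs c' (f p) (Q \<omega>) + Pcs c' (f p) (r \<omega>)"
      unfolding T\<omega> q_def z_def L_def using P_f(3)[OF c] by (simp add: blinfun.add_right blinfun.scaleR_right)
    have K': "KK c' (f p) (L \<xi>) (L u) = L (KK c p \<xi> u) + Pcs c' (f p) (Q u)"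
    proof -
      have "Pc c p \<xi> = \<xi>" "Pu c p u = u" unfolding u_def using P_Ec(2)[OF cp \<xi>] P_comp[OF cp] by simp_all
      then show ?thesis using KK_f[OF c, of \<xi> u] unfolding L_def Q_def by simp
    qed
    define R where "R = h *\<^sub>R Pcs c' (f p) (Q z) + Pcs c' (f p) (r \<omega>) - h *\<^sub>R KK c' (f p) (L \<xi>) y"
    have Q\<omega>: "Q \<omega> = Q u + Q z" by (simp add: \<omega>uz blinfun.add_right)
    have Diff: "Pcs c' (f p) (T \<omega>) - h *\<^sub>R KK c' (f p) (L \<xi>) (Pu c' (f p) (T \<omega>)) = L (z - h *\<^sub>R KK c p \<xi> u) + R"
      unfolding Pu' Pcs' linear_add[OF linK] K' R_def Q\<omega>
      by (simp add: blinfun.add_right blinfun.diff_right blinfun.scaleR_right algebra_simps)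
    have nR: "nrm c' (f p) R \<le> G * (\<epsilon> * \<bar>h\<bar> * n)"
    proof -
      have hh: "\<bar>h\<bar> * (\<bar>h\<bar> * n) \<le> \<epsilon> * \<bar>h\<bar> * n" using mult_right_mono[OF e(2), of "\<bar>h\<bar> * n"] n0 by simp
      have "nrm c' (f p) (Pcs c' (f p) (Q z)) \<le> C * norm Q * ((b + k) * \<bar>h\<bar> * n)"
        using C(1) by (intro order_trans[OF nrm_P_le(2)[OF cfp]] order_trans[OF C(2)[OF S(2)]] mult_left_mono nz) auto
      from mult_left_mono[OF this abs_ge_zero[of h]]
      have "\<bar>h\<bar> * nrm c' (f p) (Pcs c' (f p) (Q z)) \<le> C * norm Q * (b + k) * (\<bar>h\<bar> * (\<bar>h\<bar> * n))"
        by (simp only: mult_ac)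
      also have "\<dots> \<le> C * norm Q * (b + k) * (\<epsilon> * \<bar>h\<bar> * n)" using hh C(1) b k(1) by (intro mult_left_mono) auto
      finally have 1: "nrm c' (f p) (h *\<^sub>R Pcs c' (f p) (Q z)) \<le> C * norm Q * (b + k) * (\<epsilon> * \<bar>h\<bar> * n)"
        unfolding nrm_scale[OF cfp] .
      have 2: "nrm c' (f p) (Pcs c' (f p) (r \<omega>)) \<le> C * w * (\<epsilon> * \<bar>h\<bar> * n)" by (rule order_trans[OF nrm_P_le(2)[OF cfp] nr])
      have "\<bar>h\<bar> * nrm c' (f p) (KK c' (f p) (L \<xi>) y) \<le> \<bar>h\<bar> * (k1 * (Cy * (\<bar>h\<bar> * n)))"
        using order_trans[OF k1(2)[OF S(3)] mult_left_mono[OF ny k1(1)]] by (intro mult_left_mono) auto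
      also have "\<dots> = k1 * Cy * (\<bar>h\<bar> * (\<bar>h\<bar> * n))" by (simp add: mult_ac)
      also have "\<dots> \<le> k1 * Cy * (\<epsilon> * \<bar>h\<bar> * n)" using hh k1(1) Cy by (intro mult_left_mono) auto
      finally have 3: "nrm c' (f p) (h *\<^sub>R KK c' (f p) (L \<xi>) y) \<le> k1 * Cy * (\<epsilon> * \<bar>h\<bar> * n)"
        unfolding nrm_scale[OF cfp] .
      have "nrm c' (f p) R \<le> G0 * (\<epsilon> * \<bar>h\<bar> * n)"
        unfolding R_def G0_def distrib_right
        by (rule order_trans[OF nrm_diff[OF cfp] add_mono[OF order_trans[OF nrm_triangle[OF cfp] add_mono[OF 1 2]] 3]])
      also have "\<dots> \<le> G * (\<epsilon> * \<bar>h\<bar> * n)" using G(3) e0 n0 by (intro mult_right_mono) auto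
      finally show ?thesis .
    qed
    have "Pcs c p (z - h *\<^sub>R KK c p \<xi> u) = z - h *\<^sub>R KK c p \<xi> u"
      using tensor_Pcs[OF KK_tensor[OF cp]] P_comp(4)[OF cp] unfolding z_def by (simp add: blinfun.diff_right blinfun.scaleR_right)
    then have "nrm c' (f p) (L (z - h *\<^sub>R KK c p \<xi> u)) \<le> al p * nrm c p (z - h *\<^sub>R KK c p \<xi> u)"
      using rc(2)[of "z - h *\<^sub>R KK c p \<xi> u"] unfolding L_def by simp
    also have "\<dots> \<le> al p * (b * \<bar>h\<bar> * n)"
      using dev al[OF p] unfolding z_def u_def n_def by (intro mult_left_mono) auto
    finally have main: "nrm c' (f p) (L (z - h *\<^sub>R KK c p \<xi> u)) \<le> al p * (b * \<bar>h\<bar> * n)" .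
    from main nR show "nrm c' (f p) (Pcs c' (f p) (T \<omega>) - h *\<^sub>R KK c' (f p) (L \<xi>) (Pu c' (f p) (T \<omega>)))
        \<le> (al p * b + G * \<epsilon>) * \<bar>h\<bar> * nrm c p (Pu c p \<omega>)"
      unfolding Diff using nrm_triangle[OF cfp, of "L (z - h *\<^sub>R KK c p \<xi> u)" R]
      unfolding n_def u_def by (simp add: algebra_simps)
    have "Cy * (\<bar>h\<bar> * n) \<le> G * (\<epsilon> * n)" using Cy G e(2) n0 e0 by (intro mult_mono mult_right_mono) auto
    then have y2: "nrm c' (f p) y \<le> G * \<epsilon> * n" using ny by (simp add: mult.assoc)
    have "mu p * n \<le> nrm c' (f p) (L u)"
      using rc(1)[of \<omega>] unfolding n_def u_def L_def .
    also have "L u = Pu c' (f p) (T \<omega>) - y" using Pu' by simp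
    also have "nrm c' (f p) (Pu c' (f p) (T \<omega>) - y) \<le> nrm c' (f p) (Pu c' (f p) (T \<omega>)) + nrm c' (f p) y"
      by (rule nrm_diff[OF cfp])
    finally show "mu p * nrm c p (Pu c p \<omega>) \<le> nrm c' (f p) (Pu c' (f p) (T \<omega>)) + G * \<epsilon> * nrm c p (Pu c p \<omega>)"
      using y2 unfolding n_def u_def by linarith
  qed
qed

text \<open>Near the parameter \<open>t\<close> of the arc, the plane \<open>E\<^sup>u\<close> differs from the prediction by \<open>KK\<close> by at most \<open>b\<close>
  relative to the parameter distance.\<close>

definition deviates_at_most ::
  "('m, 'b) chart => (real => 'm) => 'b => real => real set => real => bool" where
  "deviates_at_most c \<gamma> v t I b \<longleftrightarrow> (\<forall>\<^sub>F s in at t within I. \<forall>\<omega>\<in>EE Eu c (\<gamma> s).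
     nrm c (\<gamma> t) (Pcs c (\<gamma> t) \<omega> - (s - t) *\<^sub>R KK c (\<gamma> t) (chart_diff M c (\<gamma> t) v) (Pu c (\<gamma> t) \<omega>))
       \<le> b * \<bar>s - t\<bar> * nrm c (\<gamma> t) (Pu c (\<gamma> t) \<omega>))"

text \<open>The component of \<open>\<omega>\<close> in \<open>E\<^sup>u\<close> grows at least by the factor \<open>mu\<close>, which turns \<open>al\<close> into \<open>al / mu \<le> kk\<close>; the
  errors of higher order are absorbed by \<open>e\<close>.\<close>

lemma deviation_step:
  assumes \<gamma>: "has_velocity M \<gamma> v t I" "t \<in> I" "v \<in> Ec (\<gamma> t)"
    and c: "c \<in> atlas M" "c' \<in> atlas M" "\<gamma> t \<in> fst c" "f (\<gamma> t) \<in> fst c'"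
    and b: "0 \<le> b" "deviates_at_most c \<gamma> v t I b" and e: "0 < e"
  shows "deviates_at_most c' (\<lambda>s. f (\<gamma> s)) (Tf (\<gamma> t) v) t I (kk (\<gamma> t) * b + e)"
proof -
  let ?p = "\<gamma> t"
  define \<xi> where "\<xi> = chart_diff M c ?p v"
  have p: "?p \<in> points M" using mem_points c by blast
  have vS: "v \<in> S" using subb_fibre[OF subbs(2) p] \<gamma>(3) by blast
  have \<xi>: "\<xi> \<in> EE Ec c ?p" unfolding \<xi>_def EE_def using \<gamma>(3) by blast
  have \<xi>': "chart_diff M c' (f ?p) (Tf ?p v) = D f c c' ?p \<xi>"
    unfolding \<xi>_def using D_chart_diff[OF C2_f c vS] by simp
  obtain G where G: "G > 0" "\<And>h T \<omega> \<epsilon>. \<epsilon> \<le> 1 ==> \<bar>h\<bar> \<le> \<epsilon> ==> norm (T - D f c c' ?p - h *\<^sub>R D2 f c c' ?p \<xi>) \<le> \<epsilon> * \<bar>h\<bar> ==> \<omega> \<in> S ==>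
    nrm c ?p (Pcs c ?p \<omega> - h *\<^sub>R KK c ?p \<xi> (Pu c ?p \<omega>)) \<le> b * \<bar>h\<bar> * nrm c ?p (Pu c ?p \<omega>) ==>
    nrm c' (f ?p) (Pcs c' (f ?p) (blinfun_apply T \<omega>) - h *\<^sub>R KK c' (f ?p) (D f c c' ?p \<xi>) (Pu c' (f ?p) (T \<omega>)))
      \<le> (al ?p * b + G * \<epsilon>) * \<bar>h\<bar> * nrm c ?p (Pu c ?p \<omega>) \<and>
    mu ?p * nrm c ?p (Pu c ?p \<omega>) \<le> nrm c' (f ?p) (Pu c' (f ?p) (T \<omega>)) + G * \<epsilon> * nrm c ?p (Pu c ?p \<omega>)"
    using deviation_estimate[OF c \<xi> b(1)] by blast
  define H where "H = kk ?p * b + e"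
  have H: "H > 0" unfolding H_def using kk_pos[OF p] b(1) e by (simp add: add_nonneg_pos)
  define \<epsilon> where "\<epsilon> = min 1 (min (mu ?p / (2 * G)) (e * mu ?p / (G * (1 + H))))"
  have \<epsilon>: "0 < \<epsilon>" "\<epsilon> \<le> 1" "G * \<epsilon> < mu ?p" "G * \<epsilon> * (1 + H) \<le> e * mu ?p"
  proof -
    show "0 < \<epsilon>" unfolding \<epsilon>_def using mu_pos[OF p] G(1) H e by simp
    show "\<epsilon> \<le> 1" unfolding \<epsilon>_def by (rule min.cobounded1)
    have "\<epsilon> \<le> mu ?p / (2 * G)" "\<epsilon> \<le> e * mu ?p / (G * (1 + H))" unfolding \<epsilon>_def by auto
    then have "\<epsilon> * (2 * G) \<le> mu ?p" "\<epsilon> * (G * (1 + H)) \<le> e * mu ?p" using G(1) H by (simp_all add: pos_le_divide_eq)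
    moreover have "G * \<epsilon> < \<epsilon> * (2 * G)" using G(1) \<open>0 < \<epsilon>\<close> by simp
    ultimately show "G * \<epsilon> < mu ?p" "G * \<epsilon> * (1 + H) \<le> e * mu ?p" by (linarith, simp add: mult_ac)
  qed
  note lim = velocity_lim[OF \<gamma>(1,2) vS]
  have ev: "\<forall>\<^sub>F s in at t within I. \<gamma> s \<in> fst c" using lim filterlim_nh_iff[OF c(1,3)] by blast
  have ev': "\<forall>\<^sub>F s in at t within I. f (\<gamma> s) \<in> fst c'"
    using eventually_compose_filterlim[OF eventually_g_chart[OF C2_f c] lim] .
  have "((\<lambda>s. D f c c' (\<gamma> s)) has_vector_derivative D2 f c c' ?p \<xi>) (at t within I)"
    unfolding \<xi>_def by (rule curve_D[OF C2_f c \<gamma>(2) ev velocity_chart[OF \<gamma>(1,2) vS c(1,3)]])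
  then have "((\<lambda>s. (D f c c' (\<gamma> s) - D f c c' ?p - (s - t) *\<^sub>R D2 f c c' ?p \<xi>) /\<^sub>R norm (s - t)) \<longlongrightarrow> 0) (at t within I)"
    unfolding has_vector_derivative_def has_derivative_at_within by blast
  from tendstoD[OF this \<epsilon>(1)]
  have "\<forall>\<^sub>F s in at t within I. norm (D f c c' (\<gamma> s) - D f c c' ?p - (s - t) *\<^sub>R D2 f c c' ?p \<xi>) / \<bar>s - t\<bar> < \<epsilon>"
    by (simp add: divide_inverse mult.commute)
  moreover have "\<forall>\<^sub>F s in at t within I. s \<noteq> t \<and> \<bar>s - t\<bar> \<le> \<epsilon>"
    unfolding eventually_at using \<epsilon>(1) by (intro exI[of _ \<epsilon>]) (auto simp: dist_real_def)
  ultimately have "\<forall>\<^sub>F s in at t within I. \<forall>\<omega>\<in>EE Eu c' (f (\<gamma> s)).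
     nrm c' (f ?p) (Pcs c' (f ?p) \<omega> - (s - t) *\<^sub>R KK c' (f ?p) (D f c c' ?p \<xi>) (Pu c' (f ?p) \<omega>))
       \<le> H * \<bar>s - t\<bar> * nrm c' (f ?p) (Pu c' (f ?p) \<omega>)"
    using b(2)[unfolded deviates_at_most_def, folded \<xi>_def] ev ev'
  proof eventually_elim
    case (elim s)
    let ?h = "s - t" and ?T = "D f c c' (\<gamma> s)"
    have nT: "norm (?T - D f c c' ?p - ?h *\<^sub>R D2 f c c' ?p \<xi>) \<le> \<epsilon> * \<bar>?h\<bar>"
      using elim(1,2) by (simp add: divide_less_eq)
    show ?case
    proof
      fix \<omega>' assume "\<omega>' \<in> EE Eu c' (f (\<gamma> s))"
      then obtain \<omega> where \<omega>: "\<omega> \<in> EE Eu c (\<gamma> s)" "\<omega>' = ?T \<omega>"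
        using D_f_EE[OF c(1,2) elim(4,5) invariant(1) subbs(1)] by blast
      have \<omega>S: "\<omega> \<in> S" using \<omega>(1) subb_EE[OF subbs(1) c(1) elim(4)] by blast
      let ?n = "nrm c ?p (Pu c ?p \<omega>)" and ?n' = "nrm c' (f ?p) (Pu c' (f ?p) \<omega>')"
      have dev: "nrm c ?p (Pcs c ?p \<omega> - ?h *\<^sub>R KK c ?p \<xi> (Pu c ?p \<omega>)) \<le> b * \<bar>?h\<bar> * ?n"
        using elim(3) \<omega>(1) by blast
      from G(2)[OF \<epsilon>(2) conjunct2[OF elim(2)] nT \<omega>S dev]
      have 1: "nrm c' (f ?p) (Pcs c' (f ?p) \<omega>' - ?h *\<^sub>R KK c' (f ?p) (D f c c' ?p \<xi>) (Pu c' (f ?p) \<omega>'))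
          \<le> (al ?p * b + G * \<epsilon>) * \<bar>?h\<bar> * ?n"
        and 2: "(mu ?p - G * \<epsilon>) * ?n \<le> ?n'"
        unfolding \<omega>(2) by (simp_all add: algebra_simps)
      have n0: "0 \<le> ?n" by (rule nrm_nonneg[OF c(1,3)])
      have ak: "al ?p \<le> kk ?p * mu ?p"
        unfolding kk(1)[OF p] using mult_right_mono[of 1 _ "al ?p"] al[OF p] constants(5) by simp
      from mult_right_mono[OF ak b(1)] have "al ?p * b \<le> (kk ?p * b) * mu ?p" by (simp add: mult_ac)
      then have "al ?p * b + G * \<epsilon> \<le> H * (mu ?p - G * \<epsilon>)"
        using \<epsilon>(4) unfolding H_def by (simp add: algebra_simps)
      then have "(al ?p * b + G * \<epsilon>) * ?n \<le> H * (mu ?p - G * \<epsilon>) * ?n" using n0 by (rule mult_right_mono)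
      also have "\<dots> \<le> H * ?n'" using mult_left_mono[OF 2, of H] H by (simp add: mult.assoc)
      finally have "\<bar>?h\<bar> * ((al ?p * b + G * \<epsilon>) * ?n) \<le> \<bar>?h\<bar> * (H * ?n')" by (intro mult_left_mono) auto
      then show "nrm c' (f ?p) (Pcs c' (f ?p) \<omega>' - ?h *\<^sub>R KK c' (f ?p) (D f c c' ?p \<xi>) (Pu c' (f ?p) \<omega>'))
          \<le> H * \<bar>?h\<bar> * ?n'"
        using 1 by (simp add: mult_ac)
    qed
  qed
  then show ?thesis unfolding deviates_at_most_def \<xi>' H_def .
qed

text \<open>An arc near the parameter \<open>t\<close>. Tangency to \<open>E\<^sup>c\<close> away from \<open>t\<close> enters through the center paths
  that join \<open>\<gamma> t\<close> to \<open>\<gamma> s\<close>; this property passes to the images under the inverse of \<open>f\<close>.\<close>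

definition germ :: "(real => 'm) => 'b => real => real set => real => bool" where
  "germ \<gamma> v t I A \<longleftrightarrow> t \<in> I \<and> has_velocity M \<gamma> v t I \<and> v \<in> Ec (\<gamma> t) \<and> N (\<gamma> t) v \<le> A \<and>
     (\<forall>\<^sub>F s in at t within I. cpath (A * \<bar>s - t\<bar>) (\<gamma> t) (\<gamma> s))"

lemma germD:
  assumes "germ \<gamma> v t I A"
  shows "\<gamma> t \<in> points M" "v \<in> S" "0 \<le> A"
    and "c \<in> atlas M ==> \<gamma> t \<in> fst c ==> nrm c (\<gamma> t) (chart_diff M c (\<gamma> t) v) \<le> A"
proof -
  show p: "\<gamma> t \<in> points M" using assms unfolding germ_def has_velocity_def by blast
  then show v: "v \<in> S" using subb_fibre[OF subbs(2)] assms unfolding germ_def by blast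
  show "0 \<le> A" using N_facts(1)[OF p v v] assms unfolding germ_def by linarith
  show "nrm c (\<gamma> t) (chart_diff M c (\<gamma> t) v) \<le> A" if c: "c \<in> atlas M" "\<gamma> t \<in> fst c"
  proof -
    have "chart_diff M c (\<gamma> t) v \<in> EE Ec c (\<gamma> t)" using assms unfolding EE_def germ_def by blast
    then show ?thesis using nrm_Ec[OF c] Nc_chart_diff[OF c v] assms unfolding germ_def by simp
  qed
qed

lemma small_parameter:
  assumes "0 < (e::real)" "0 \<le> A"
  shows "\<forall>\<^sub>F s in at t within I. A * \<bar>s - t\<bar> \<le> e"
proof -
  have "((\<lambda>s. A * \<bar>s - t\<bar>) \<longlongrightarrow> A * \<bar>t - t\<bar>) (at t within I)" by (intro tendsto_intros)
  then show ?thesis using assms(1) by (auto dest!: order_tendstoD(2)[of _ _ _ e] elim: eventually_mono)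
qed

text \<open>Pulling back by \<open>f\<close> increases the speed of the arc at most by the factor \<open>1 / mm\<close>.\<close>

lemma germ_back:
  assumes g: "germ \<gamma> v t I A"
  shows "germ (\<lambda>s. finv (\<gamma> s)) (Tfinv (\<gamma> t) v) t I (A / mm (finv (\<gamma> t)))"
    and "Tf (finv (\<gamma> t)) (Tfinv (\<gamma> t) v) = v"
proof -
  note d = germD[OF g] and p1 = finv_points[OF germD(1)[OF g]]
  have ff: "f (finv (\<gamma> t)) = \<gamma> t" using d(1) by simp
  have g': "t \<in> I" "has_velocity M \<gamma> v t I" "v \<in> Ec (\<gamma> t)" "N (\<gamma> t) v \<le> A"
    "\<forall>\<^sub>F s in at t within I. cpath (A * \<bar>s - t\<bar>) (\<gamma> t) (\<gamma> s)"
    using g unfolding germ_def by blast+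
  note tf = tangent_finv[OF p1 invariant(2) subbs(2), of v, unfolded ff, OF g'(3)]
  show "Tf (finv (\<gamma> t)) (Tfinv (\<gamma> t) v) = v" by (rule tf(2))
  have "mm (finv (\<gamma> t)) * N (finv (\<gamma> t)) (Tfinv (\<gamma> t) v) \<le> N (\<gamma> t) v"
    using rate[OF p1] tf ff unfolding rate_def by metis
  then have N: "N (finv (\<gamma> t)) (Tfinv (\<gamma> t) v) \<le> A / mm (finv (\<gamma> t))"
    using g'(4) mm_pos[OF p1] by (simp add: field_simps)
  have "\<forall>\<^sub>F s in at t within I. cpath (A / mm (finv (\<gamma> t)) * \<bar>s - t\<bar>) (finv (\<gamma> t)) (finv (\<gamma> s))"
    using g'(5) small_parameter[OF constants(6) d(3)]
  proof eventually_elim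
    case (elim s)
    from cpath_back[OF p1 elim(2), unfolded ff, OF elim(1)] show ?case by simp
  qed
  then show "germ (\<lambda>s. finv (\<gamma> s)) (Tfinv (\<gamma> t) v) t I (A / mm (finv (\<gamma> t)))"
    unfolding germ_def using g'(1) velocity_image[OF C2_finv g'(2,1) d(2)] tf(1) N by blast
qed

lemma deviation_from_past:
  assumes g: "germ \<gamma> v t I A" and c: "c \<in> atlas M" "finv (\<gamma> t) \<in> fst c" "c' \<in> atlas M" "\<gamma> t \<in> fst c'"
    and dev: "deviates_at_most c (\<lambda>s. finv (\<gamma> s)) (Tfinv (\<gamma> t) v) t I b" "0 \<le> b" and e: "0 < e"
  shows "deviates_at_most c' \<gamma> v t I (kk (finv (\<gamma> t)) * b + e)"
proof -
  note gb = germ_back[OF g] and d = germD[OF g]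
  have ff: "f (finv (\<gamma> t)) = \<gamma> t" using d(1) by simp
  have "deviates_at_most c' (\<lambda>s. f (finv (\<gamma> s))) v t I (kk (finv (\<gamma> t)) * b + e)"
    using deviation_step[of "\<lambda>s. finv (\<gamma> s)" "Tfinv (\<gamma> t) v" t I c c' b e] gb c dev e ff
    unfolding germ_def by simp
  moreover have "\<forall>\<^sub>F s in at t within I. \<gamma> s \<in> fst c'"
    using velocity_lim[of \<gamma> v t I] filterlim_nh_iff[OF c(3,4)] g d unfolding germ_def by blast
  ultimately show ?thesis
    unfolding deviates_at_most_def ff
  proof eventually_elim
    case (elim s)
    have "f (finv (\<gamma> s)) = \<gamma> s" using mem_points[OF c(3) elim(2)] by simp
    then show ?case using elim(1) by simp
  qed
qed

text \<open>An a priori bound, proportional to the speed: the planes are Lipschitz, and \<open>KK\<close> is bounded.\<close>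

lemma deviation_start:
  assumes g: "germ \<gamma> v t I A"
  shows "deviates_at_most (cs (\<gamma> t)) \<gamma> v t I ((CL + BK) * A)"
proof -
  let ?p = "\<gamma> t" and ?c = "cs (\<gamma> t)"
  note d = germD[OF g]
  note c = cover_facts(8,9)[OF d(1)]
  let ?\<xi> = "chart_diff M ?c ?p v"
  note n\<xi> = d(4)[OF c]
  have "\<forall>\<^sub>F s in at t within I. cpath (A * \<bar>s - t\<bar>) ?p (\<gamma> s)" using g unfolding germ_def by blast
  then show ?thesis
    unfolding deviates_at_most_def
    using small_parameter[OF \<epsilon>0_pos(1) d(3)]
  proof eventually_elim
    case (elim s)
    note L = Eu_lipschitz_along_center[OF elim]
    show ?case
    proof
      fix \<omega> assume \<omega>: "\<omega> \<in> EE Eu ?c (\<gamma> s)"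
      let ?n = "nrm ?c ?p (Pu ?c ?p \<omega>)"
      have n0: "0 \<le> ?n" by (rule nrm_nonneg[OF c])
      have "nrm ?c ?p (Pcs ?c ?p \<omega>) \<le> CL * (A * \<bar>s - t\<bar>) * ?n" using L \<omega> unfolding cone_def by blast
      moreover have "nrm ?c ?p ((s - t) *\<^sub>R KK ?c ?p ?\<xi> (Pu ?c ?p \<omega>)) \<le> BK * (A * \<bar>s - t\<bar>) * ?n"
      proof -
        have "nrm ?c ?p (KK ?c ?p ?\<xi> (Pu ?c ?p \<omega>)) \<le> BK * nrm ?c ?p ?\<xi> * ?n"
          using K_facts(2)[OF d(1)] KK_cs[OF d(1)] by simp
        also have "\<dots> \<le> BK * A * ?n" using n\<xi> BK_pos n0 by (intro mult_right_mono mult_left_mono) auto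
        finally have "\<bar>s - t\<bar> * nrm ?c ?p (KK ?c ?p ?\<xi> (Pu ?c ?p \<omega>)) \<le> \<bar>s - t\<bar> * (BK * A * ?n)"
          by (intro mult_left_mono) auto
        then show ?thesis unfolding nrm_scale[OF c] by (simp add: mult_ac)
      qed
      ultimately show "nrm ?c ?p (Pcs ?c ?p \<omega> - (s - t) *\<^sub>R KK ?c ?p ?\<xi> (Pu ?c ?p \<omega>))
          \<le> (CL + BK) * A * \<bar>s - t\<bar> * ?n"
        using nrm_diff[OF c, of "Pcs ?c ?p \<omega>" "(s - t) *\<^sub>R KK ?c ?p ?\<xi> (Pu ?c ?p \<omega>)"] by (simp add: algebra_simps)
    qed
  qed
qed

lemma deviates_mono:
  assumes "deviates_at_most c \<gamma> v t I b" "b \<le> b'" "c \<in> atlas M" "\<gamma> t \<in> fst c"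
  shows "deviates_at_most c \<gamma> v t I b'"
  using assms(1) unfolding deviates_at_most_def
proof eventually_elim
  case (elim s)
  show ?case
  proof
    fix \<omega> assume "\<omega> \<in> EE Eu c (\<gamma> s)"
    moreover have "b * \<bar>s - t\<bar> * nrm c (\<gamma> t) (Pu c (\<gamma> t) \<omega>) \<le> b' * \<bar>s - t\<bar> * nrm c (\<gamma> t) (Pu c (\<gamma> t) \<omega>)"
      by (intro mult_right_mono assms nrm_nonneg) auto
    ultimately show "nrm c (\<gamma> t) (Pcs c (\<gamma> t) \<omega> - (s - t) *\<^sub>R KK c (\<gamma> t) (chart_diff M c (\<gamma> t) v) (Pu c (\<gamma> t) \<omega>))
        \<le> b' * \<bar>s - t\<bar> * nrm c (\<gamma> t) (Pu c (\<gamma> t) \<omega>)" using elim by force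
  qed
qed

text \<open>Along the backward orbit the a priori bound grows with the speed of the pulled back arcs, by
  \<open>1 / mm\<close> in every step, whereas coming forward again each step contracts by \<open>kk \<le> \<theta> * mm\<close>.\<close>

lemma deviation_power:
  assumes "germ \<gamma> v t I A" "0 < e"
  shows "deviates_at_most (cs (\<gamma> t)) \<gamma> v t I (\<theta> ^ n * (CL + BK) * A + e)"
  using assms
proof (induction n arbitrary: \<gamma> v A e)
  case 0
  have c: "cs (\<gamma> t) \<in> atlas M" "\<gamma> t \<in> fst (cs (\<gamma> t))" using cover_facts(8,9) germD(1)[OF 0(1)] by blast+
  show ?case by (rule deviates_mono[OF deviation_start[OF 0(1)] _ c]) (use 0(2) in simp)
next
  case (Suc n)
  note d = germD[OF Suc.prems(1)] and gb = germ_back[OF Suc.prems(1)]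
  let ?p1 = "finv (\<gamma> t)"
  note p1 = finv_points[OF d(1)]
  note c = cover_facts(8,9)[OF d(1)] and c1 = cover_facts(8,9)[OF p1]
  let ?b = "\<theta> ^ n * (CL + BK) * (A / mm ?p1) + e / 2"
  have CB: "0 \<le> \<theta> ^ n * (CL + BK)" using constants CL_pos BK_pos by simp
  have b0: "0 \<le> ?b" using CB d(3) mm_pos[OF p1] Suc.prems(2) by simp
  have "deviates_at_most (cs (\<gamma> t)) \<gamma> v t I (kk ?p1 * ?b + e / 2)"
    using deviation_from_past[OF Suc.prems(1) c1 c Suc.IH[OF gb(1), of "e / 2"] b0, of "e / 2"] Suc.prems(2) by simp
  then show ?case
  proof (rule deviates_mono[where \<gamma> = \<gamma> and t = t, OF _ _ c])
    have "kk ?p1 * (\<theta> ^ n * (CL + BK) * (A / mm ?p1)) \<le> (\<theta> * mm ?p1) * (\<theta> ^ n * (CL + BK) * (A / mm ?p1))"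
      using kk(3)[OF p1] CB d(3) mm_pos[OF p1] by (intro mult_right_mono mult_nonneg_nonneg[OF CB]) auto
    also have "\<dots> = \<theta> ^ Suc n * (CL + BK) * A" using mm_pos[OF p1] by simp
    finally have 1: "kk ?p1 * (\<theta> ^ n * (CL + BK) * (A / mm ?p1)) \<le> \<theta> ^ Suc n * (CL + BK) * A" .
    have "kk ?p1 \<le> 1" using kk(2)[OF p1] constants(2) by linarith
    then have 2: "kk ?p1 * (e / 2) \<le> e / 2" using Suc.prems(2) kk_pos[OF p1] by simp
    show "kk ?p1 * ?b + e / 2 \<le> \<theta> ^ Suc n * (CL + BK) * A + e"
      using 1 2 unfolding distrib_left by linarith
  qed
qed

lemma contract_budget:
  fixes x y e :: real
  assumes "y \<le> x + e / 4" "x < e / 4"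
  shows "y + e / 2 \<le> e"
  using assms by linarith

theorem Eu_differentiable_along_center:
  assumes g: "germ \<gamma> v t I A" and c: "c \<in> atlas M" "\<gamma> t \<in> fst c" and e: "0 < e"
  shows "deviates_at_most c \<gamma> v t I e"
proof -
  note d = germD[OF g] and gb = germ_back[OF g]
  let ?p1 = "finv (\<gamma> t)"
  note p1 = finv_points[OF d(1)]
  note c1 = cover_facts(8,9)[OF p1]
  let ?A = "A / mm ?p1"
  have "(\<lambda>n. \<theta> ^ n * (CL + BK) * ?A) \<longlonglongrightarrow> 0 * (CL + BK) * ?A"
    by (intro tendsto_intros LIMSEQ_power_zero) (use constants in auto)
  then have "\<forall>\<^sub>F n in sequentially. \<theta> ^ n * (CL + BK) * ?A < e / 4"
    using e by (intro order_tendstoD(2)) auto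
  then obtain n where n: "\<theta> ^ n * (CL + BK) * ?A < e / 4" using eventually_happens by force
  have A0: "0 \<le> ?A" using germD(3)[OF gb(1)] .
  have b: "0 \<le> \<theta> ^ n * (CL + BK) * ?A + e / 4"
    using constants CL_pos BK_pos A0 e by (intro add_nonneg_nonneg mult_nonneg_nonneg) auto
  have "deviates_at_most c \<gamma> v t I (kk ?p1 * (\<theta> ^ n * (CL + BK) * ?A + e / 4) + e / 2)"
    using deviation_from_past[OF g c1 c deviation_power[OF gb(1), of "e / 4" n] b, of "e / 2"] e by simp
  then show ?thesis
  proof (rule deviates_mono[where \<gamma> = \<gamma> and t = t, OF _ _ c])
    have "kk ?p1 \<le> 1" using kk(2)[OF p1] constants(2) by linarith
    then have "kk ?p1 * x \<le> x" if "0 \<le> x" for x using mult_right_mono[of "kk ?p1" 1 x] that by simp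
    from this[OF b] n
    show "kk ?p1 * (\<theta> ^ n * (CL + BK) * ?A + e / 4) + e / 2 \<le> e"
      by (rule contract_budget)
  qed
qed

end

section \<open>Calculus in the Grassmann bundle\<close>

text \<open>The derivative of a quotient of operator-valued functions: \<open>F\<close> is only known through the
  equation \<open>(F y - F y0) \<circ> Z y = Q y\<close>. Solving it at \<open>y0\<close> bounds \<open>F y - F y0\<close> by a multiple of
  \<open>\<parallel>y - y0\<parallel>\<close>, after which replacing \<open>Z y\<close> by \<open>Z y0\<close> costs only a term of higher order.\<close>

lemma quotient_has_derivative:
  fixes F Q :: "'a::real_normed_vector => 'e::real_normed_vector \<Rightarrow>\<^sub>L 'c::real_normed_vector"
    and Z :: "'a => 'e \<Rightarrow>\<^sub>L 'e"
  assumes Q: "(Q has_derivative Q') (at y0 within X)" and y0: "y0 \<in> X"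
    and Z: "(Z \<longlongrightarrow> Z y0) (at y0 within X)" and W: "Z y0 o\<^sub>L W = id_blinfun"
    and eq: "\<And>y. y \<in> X ==> (F y - F y0) o\<^sub>L Z y = Q y"
  shows "(F has_derivative (\<lambda>h. Q' h o\<^sub>L W)) (at y0 within X)"
  unfolding has_derivative_within_alt2
proof (intro conjI allI impI)
  have Q0: "Q y0 = 0" using eq[OF y0] by simp
  have bl: "bounded_linear Q'" using Q has_derivative_bounded_linear by blast
  then obtain k where k: "k > 0" "\<And>h. norm (Q' h) \<le> norm h * k"
    using bounded_linear.pos_bounded by blast
  show "bounded_linear (\<lambda>h. Q' h o\<^sub>L W)"
    by (rule bounded_linear_compose[OF bounded_bilinear.bounded_linear_left[OF bounded_bilinear_blinfun_compose] bl])
  fix e :: real assume e: "e > 0"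
  define w where "w = norm W + 1"
  have w: "w \<ge> 1" "norm W \<le> w" unfolding w_def by simp_all
  define e1 where "e1 = min 1 (e / (2 * w))"
  define e2 where "e2 = min (1 / (2 * w)) (e / (4 * w * w * (k + 1)))"
  have e12: "e1 > 0" "e2 > 0" unfolding e1_def e2_def using e w k(1) by simp_all
  have e1: "e1 * w \<le> e / 2" "e1 \<le> 1"
    unfolding e1_def using w e by (simp_all add: min_def field_simps)
  have "e2 \<le> e / (4 * w * w * (k + 1))" "e2 \<le> 1 / (2 * w)" unfolding e2_def by simp_all
  moreover have "0 < 4 * w * w * (k + 1)" using w k by simp
  ultimately have e2: "e2 * (4 * w * w * (k + 1)) \<le> e" "e2 * w \<le> 1 / 2"
    using w by (simp_all add: pos_le_divide_eq mult_ac)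
  have "\<forall>\<^sub>F y in at y0 within X. norm (Q y - Q y0 - Q' (y - y0)) \<le> e1 * norm (y - y0)"
    using Q e12(1) unfolding has_derivative_within_alt2 by blast
  moreover have "\<forall>\<^sub>F y in at y0 within X. dist (Z y) (Z y0) < e2" using tendstoD[OF Z e12(2)] .
  moreover have "\<forall>\<^sub>F y in at y0 within X. y \<in> X" unfolding eventually_at_filter by simp
  ultimately show "\<forall>\<^sub>F y in at y0 within X. norm (F y - F y0 - (Q' (y - y0) o\<^sub>L W)) \<le> e * norm (y - y0)"
  proof eventually_elim
    case (elim y)
    define h where "h = y - y0"
    define \<Delta> where "\<Delta> = F y - F y0"
    have nQ: "norm (Q y - Q' h) \<le> e1 * norm h" using elim(1) Q0 unfolding h_def by simp
    have nZ: "norm (Z y - Z y0) \<le> e2" using elim(2) by (simp add: dist_norm)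
    have "norm (Q y) \<le> norm (Q y - Q' h) + norm (Q' h)" using norm_triangle_ineq[of "Q y - Q' h" "Q' h"] by simp
    also have "\<dots> \<le> 1 * norm h + norm h * k"
      using order_trans[OF nQ mult_right_mono[OF e1(2) norm_ge_zero]] k(2)[of h] by linarith
    finally have Qy: "norm (Q y) \<le> (k + 1) * norm h" by (simp add: algebra_simps)
    have D: "\<Delta> = (Q y - (\<Delta> o\<^sub>L (Z y - Z y0))) o\<^sub>L W"
    proof (rule blinfun_eqI)
      fix v
      have 1: "\<Delta> (Z y u) = Q y u" for u using eq[OF elim(3)] unfolding \<Delta>_def by (metis blinfun_apply_blinfun_compose)
      have 2: "Z y0 (W v) = v" using W by (metis blinfun_apply_blinfun_compose blinfun_apply_id_blinfun id_apply)
      show "\<Delta> v = ((Q y - (\<Delta> o\<^sub>L (Z y - Z y0))) o\<^sub>L W) v"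
        by (simp add: blinfun.diff_left blinfun.diff_right 1 2)
    qed
    have nc: "norm (U o\<^sub>L W) \<le> norm U * w" for U :: "'e \<Rightarrow>\<^sub>L 'c"
      using order_trans[OF norm_blinfun_compose mult_left_mono[OF w(2) norm_ge_zero]] .
    have nD: "norm (\<Delta> o\<^sub>L (Z y - Z y0)) \<le> norm \<Delta> * e2"
      using order_trans[OF norm_blinfun_compose mult_left_mono[OF nZ norm_ge_zero]] .
    have "norm \<Delta> \<le> norm (Q y - (\<Delta> o\<^sub>L (Z y - Z y0))) * w" using nc D by metis
    also have "\<dots> \<le> (norm (Q y) + norm \<Delta> * e2) * w"
      using norm_triangle_ineq4[of "Q y" "\<Delta> o\<^sub>L (Z y - Z y0)"] nD w by (intro mult_right_mono) linarith+
    also have "\<dots> = norm (Q y) * w + norm \<Delta> * (e2 * w)" by (simp add: algebra_simps)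
    also have "\<dots> \<le> norm (Q y) * w + norm \<Delta> * (1 / 2)" using e2(2) by (intro add_left_mono mult_left_mono) auto
    finally have "norm \<Delta> \<le> 2 * (norm (Q y) * w)" by simp
    also have "\<dots> \<le> 2 * ((k + 1) * norm h * w)" using Qy w by (intro mult_left_mono mult_right_mono) auto
    finally have n\<Delta>: "norm \<Delta> \<le> 2 * ((k + 1) * norm h * w)" .
    have "\<Delta> - (Q' h o\<^sub>L W) = ((Q y - Q' h) - (\<Delta> o\<^sub>L (Z y - Z y0))) o\<^sub>L W"
      by (subst (1) D) (auto intro!: blinfun_eqI simp: blinfun.diff_left)
    then have "norm (\<Delta> - (Q' h o\<^sub>L W)) \<le> norm ((Q y - Q' h) - (\<Delta> o\<^sub>L (Z y - Z y0))) * w" using nc by metis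
    also have "\<dots> \<le> (e1 * norm h + norm \<Delta> * e2) * w"
      using norm_triangle_ineq4[of "Q y - Q' h" "\<Delta> o\<^sub>L (Z y - Z y0)"] nD nQ w by (intro mult_right_mono) linarith+
    also have "\<dots> \<le> (e1 * norm h + 2 * ((k + 1) * norm h * w) * e2) * w"
      using n\<Delta> e12 w by (intro mult_right_mono add_left_mono) auto
    also have "\<dots> = (e1 * w) * norm h + (e2 * (4 * w * w * (k + 1))) * norm h / 2" by (simp add: algebra_simps)
    also have "\<dots> \<le> e / 2 * norm h + e * norm h / 2"
      using mult_right_mono[OF e1(1) norm_ge_zero[of h]] mult_right_mono[OF e2(1) norm_ge_zero[of h]] by linarith
    finally show ?case unfolding \<Delta>_def h_def by simp
  qed
qed

text \<open>An operator closer to an injective one than the inverse norm of a left inverse of the latter is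
  injective.\<close>

lemma open_injective_blinfun: "open {Z :: 'e::euclidean_space \<Rightarrow>\<^sub>L 'e. inj (blinfun_apply Z)}"
  unfolding open_dist
proof
  fix Z0 :: "'e \<Rightarrow>\<^sub>L 'e" assume "Z0 \<in> {Z. inj (blinfun_apply Z)}"
  then obtain g where g: "linear g" "g \<circ> blinfun_apply Z0 = id"
    using linear_injective_left_inverse[OF bounded_linear.linear[OF blinfun.bounded_linear_right]] by blast
  then obtain k where k: "k > 0" "\<And>x. norm (g x) \<le> norm x * k"
    using linear_conv_bounded_linear bounded_linear.pos_bounded by blast
  show "\<exists>e>0. \<forall>Z. dist Z Z0 < e --> Z \<in> {Z. inj (blinfun_apply Z)}"
  proof (intro exI[of _ "1 / k"] conjI allI impI)
    show "1 / k > 0" using k by simp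
    fix Z :: "'e \<Rightarrow>\<^sub>L 'e" assume Z: "dist Z Z0 < 1 / k"
    have "x = 0" if x: "Z x = 0" for x
    proof (rule ccontr)
      assume "x \<noteq> 0"
      have "norm x = norm (g (Z0 x))" using fun_cong[OF g(2), of x] by simp
      also have "\<dots> \<le> norm (Z0 x) * k" by (rule k(2))
      also have "norm (Z0 x) = norm ((Z - Z0) x)" using x by (simp add: blinfun.diff_left)
      also have "norm ((Z - Z0) x) * k \<le> norm (Z - Z0) * norm x * k"
        using k(1) by (intro mult_right_mono norm_blinfun) simp
      also have "\<dots> = (norm (Z - Z0) * k) * norm x" by simp
      also have "\<dots> < 1 * norm x"
        using Z k(1) \<open>x \<noteq> 0\<close> by (intro mult_strict_right_mono) (simp_all add: dist_norm field_simps)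
      finally show False by simp
    qed
    then show "Z \<in> {Z. inj (blinfun_apply Z)}"
      using linear_injective_0[OF bounded_linear.linear[OF blinfun.bounded_linear_right]] by blast
  qed
qed

context
  fixes d :: nat and S :: "'b::euclidean_space set"
  assumes S: "subspace S" and ne: "planes d S \<noteq> {}"
begin

text \<open>For an operator \<open>Y\<close> that vanishes on the complement of the reference plane, its range is the
  graph of a slope iff \<open>tilt Y\<close>, the operator \<open>\<pi> \<circ> Y\<close> completed by the identity on that complement,
  is invertible.\<close>

definition tilt :: "'b \<Rightarrow>\<^sub>L 'b => 'b \<Rightarrow>\<^sub>L 'b" where
  "tilt Y = (oproj (ref_plane d S) o\<^sub>L Y) + (id_blinfun - oproj (ref_plane d S))"

lemma ref_oproj: "oproj (ref_plane d S) (oproj (ref_plane d S) x) = oproj (ref_plane d S) x"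
  "oproj (ref_plane d S) x \<in> S"
  using oproj_id[OF ref_plane(1)[OF S ne] oproj_mem[OF ref_plane(1)[OF S ne]]]
    oproj_mem[OF ref_plane(1)[OF S ne], of x] ref_plane(2)[OF S ne] by auto

lemma tilt_apply: "tilt Y x = oproj (ref_plane d S) (Y x) + (x - oproj (ref_plane d S) x)"
  unfolding tilt_def by (simp add: blinfun.add_left blinfun.diff_left)

lemma tilt_proj: "oproj (ref_plane d S) (tilt Y x) = oproj (ref_plane d S) (Y x)"
  unfolding tilt_apply by (simp add: blinfun.add_right blinfun.diff_right ref_oproj)

lemma slope_of_range:
  fixes Y :: "'b \<Rightarrow>\<^sub>L 'b"
  assumes Y: "\<And>x. Y x = 0 ==> oproj (ref_plane d S) x = 0"
    and A: "A \<in> slopes d S" "range (blinfun_apply Y) = slope_graph d S A"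
  shows "inj (blinfun_apply (tilt Y))" "A o\<^sub>L tilt Y = Y - (oproj (ref_plane d S) o\<^sub>L Y)"
proof -
  let ?P = "oproj (ref_plane d S)"
  have AP: "A (?P x) = A x" for x using A(1) unfolding slopes_iff[OF S ne] by blast
  have Yg: "Y x - ?P (Y x) = A (?P (Y x))" for x
    using slope_graph_iff[OF S ne A(1)] A(2) by blast
  show "A o\<^sub>L tilt Y = Y - (?P o\<^sub>L Y)"
  proof (rule blinfun_eqI)
    fix x
    have "A (tilt Y x) = A (?P (tilt Y x))" using AP by simp
    then show "(A o\<^sub>L tilt Y) x = (Y - (?P o\<^sub>L Y)) x" unfolding tilt_proj by (simp add: blinfun.diff_left Yg)
  qed
  have "x = 0" if x: "tilt Y x = 0" for x
  proof -
    have 1: "?P (Y x) = 0" using tilt_proj[of Y x] x by simp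
    then have "Y x = 0" using Yg[of x] by simp
    then have "?P x = 0" by (rule Y)
    then show ?thesis using x 1 unfolding tilt_apply by simp
  qed
  then show "inj (blinfun_apply (tilt Y))"
    using linear_injective_0[OF bounded_linear.linear[OF blinfun.bounded_linear_right]] by blast
qed

lemma exists_slope_of_range:
  fixes Y :: "'b \<Rightarrow>\<^sub>L 'b"
  assumes Y: "\<And>x. Y (oproj (ref_plane d S) x) = Y x" "\<And>x. Y x \<in> S" and inj: "inj (blinfun_apply (tilt Y))"
  shows "\<exists>A\<in>slopes d S. range (blinfun_apply Y) = slope_graph d S A"
proof -
  let ?P = "oproj (ref_plane d S)"
  obtain g where g: "linear g" "\<And>x. g (tilt Y x) = x" "\<And>x. tilt Y (g x) = x"
    using linear_injective_isomorphism[OF bounded_linear.linear[OF blinfun.bounded_linear_right] inj] by blast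
  define W where "W = Blinfun g"
  have "blinfun_apply W = g"
    unfolding W_def by (rule bounded_linear_Blinfun_apply[OF linear_conv_bounded_linear[THEN iffD1, OF g(1)]])
  then have W: "W (tilt Y x) = x" "tilt Y (W x) = x" for x using g by simp_all
  define A where "A = (Y - (?P o\<^sub>L Y)) o\<^sub>L W"
  have Aa: "A x = Y (W x) - ?P (Y (W x))" for x unfolding A_def by (simp add: blinfun.diff_left)
  have "W (?P (Y x)) = ?P x" for x
  proof -
    have "tilt Y (?P x) = ?P (Y x)" unfolding tilt_apply by (simp add: ref_oproj Y)
    then show ?thesis using W(1)[of "?P x"] by simp
  qed
  then have AY: "A (?P (Y x)) = Y x - ?P (Y x)" for x unfolding Aa by (simp add: Y)
  have "A (?P x) = A x" for x
  proof -
    have "Y (x - ?P x) = 0" by (simp add: blinfun.diff_right Y)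
    then have "tilt Y (x - ?P x) = x - ?P x" unfolding tilt_apply by (simp add: blinfun.diff_right ref_oproj)
    then have "W (x - ?P x) = x - ?P x" using W(1)[of "x - ?P x"] by simp
    then have "A (x - ?P x) = 0" unfolding Aa by (simp add: blinfun.diff_right Y)
    then show ?thesis by (simp add: blinfun.diff_right)
  qed
  moreover have "A x \<in> S \<and> ?P (A x) = 0" for x
    unfolding Aa using Y(2) ref_oproj S by (simp add: blinfun.diff_right subspace_diff)
  ultimately have A: "A \<in> slopes d S" unfolding slopes_iff[OF S ne] by blast
  have "range (blinfun_apply Y) = slope_graph d S A"
  proof
    show "range (blinfun_apply Y) \<subseteq> slope_graph d S A"
      using slope_graph_iff[OF S ne A] AY by auto
    show "slope_graph d S A \<subseteq> range (blinfun_apply Y)"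
    proof
      fix w assume "w \<in> slope_graph d S A"
      then obtain x where x: "x \<in> ref_plane d S" "w = x + A x" unfolding slope_graph_def by blast
      have "?P (Y (W x)) = ?P x" using tilt_proj[of Y "W x"] W(2) by simp
      then have "w = Y (W x)" using x oproj_id[OF ref_plane(1)[OF S ne] x(1)] unfolding Aa by simp
      then show "w \<in> range (blinfun_apply Y)" by blast
    qed
  qed
  then show ?thesis using A by blast
qed

lemma dim_slope_graph:
  assumes "A \<in> slopes d S"
  shows "subspace (slope_graph d S A)" "dim (slope_graph d S A) = d"
proof -
  have l: "linear (\<lambda>x. x + A x)"
    by (intro linear_compose_add linear_ident bounded_linear.linear[OF blinfun.bounded_linear_right])
  have "inj_on (\<lambda>x. x + A x) (ref_plane d S)"
  proof (rule inj_on_inverseI[where g = "blinfun_apply (oproj (ref_plane d S))"])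
    fix x assume "x \<in> ref_plane d S"
    then show "oproj (ref_plane d S) (x + A x) = x"
      using assms oproj_id[OF ref_plane(1)[OF S ne]] unfolding slopes_iff[OF S ne] by (simp add: blinfun.add_right)
  qed
  then show "dim (slope_graph d S A) = d"
    unfolding slope_graph_def
    using dim_image_eq[OF l, of "ref_plane d S"] ref_plane[OF S ne] span_eq_iff by metis
  show "subspace (slope_graph d S A)"
    unfolding slope_graph_def by (rule linear_subspace_image[OF l ref_plane(1)[OF S ne]])
qed

end

context smooth_mfd
begin

definition binv :: "('b => 'b) => 'b \<Rightarrow>\<^sub>L 'b" where
  "binv B = Blinfun (\<lambda>x. inv_into S B (oproj S x))"

lemma automorphism:
  assumes B: "linear B" "bij_betw B S S"
  shows "blinfun_apply (Blinfun B) = B" "x \<in> S ==> B x \<in> S"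
    and "x \<in> S ==> binv B (B x) = x" "x \<in> S ==> B (binv B x) = x" "binv B y \<in> S"
    and "binv B (oproj S y) = binv B y"
proof -
  let ?i = "inv_into S B"
  show "blinfun_apply (Blinfun B) = B"
    by (rule bounded_linear_Blinfun_apply[OF linear_conv_bounded_linear[THEN iffD1, OF B(1)]])
  have BS: "B x \<in> S" if "x \<in> S" for x using B(2) that unfolding bij_betw_def by blast
  then show "x \<in> S ==> B x \<in> S" .
  have i: "?i x \<in> S" "B (?i x) = x" if "x \<in> S" for x
    using B(2) that bij_betw_inv_into_right inv_into_into[of x B S] unfolding bij_betw_def by fastforce+
  have iB: "?i (B x) = x" if "x \<in> S" for x using B(2) that bij_betw_inv_into_left by fastforce
  have "linear (\<lambda>x. ?i (oproj S x))"
  proof (rule linearI)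
    fix x y :: 'b and r :: real
    have "oproj S (x + y) = B (?i (oproj S x) + ?i (oproj S y))"
      using i by (simp add: linear_add[OF B(1)] blinfun.add_right)
    then show "?i (oproj S (x + y)) = ?i (oproj S x) + ?i (oproj S y)" using iB i by simp
    have "oproj S (r *\<^sub>R x) = B (r *\<^sub>R ?i (oproj S x))"
      using i by (simp add: linear_scale[OF B(1)] blinfun.scaleR_right)
    then show "?i (oproj S (r *\<^sub>R x)) = r *\<^sub>R ?i (oproj S x)" using iB i by simp
  qed
  then have b: "binv B x = ?i (oproj S x)" for x
    unfolding binv_def by (subst bounded_linear_Blinfun_apply[OF linear_conv_bounded_linear[THEN iffD1]]) auto
  show "x \<in> S ==> binv B (B x) = x" "x \<in> S ==> B (binv B x) = x" "binv B y \<in> S"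
    "binv B (oproj S y) = binv B y"
    unfolding b using i iB BS by simp_all
qed

lemma mem_grassmann_chart:
  "(q, V) \<in> fst (gchart d c B) \<longleftrightarrow>
     q \<in> fst c \<and> V \<in> planes d S \<and> (\<exists>A\<in>slopes d S. chart_diff M c q ` V = B ` slope_graph d S A)"
  unfolding grassmann_chart_def by simp

lemma grassmann_coordinate:
  assumes B: "bij_betw B S S" and x: "(q, V) \<in> fst (gchart d c B)"
  obtains A where "A \<in> slopes d S" "chart_diff M c q ` V = B ` slope_graph d S A"
    "snd (gchart d c B) (q, V) = (snd c q, A)"
proof -
  obtain A where A: "A \<in> slopes d S" "chart_diff M c q ` V = B ` slope_graph d S A" "V \<in> planes d S"
    using x unfolding mem_grassmann_chart by blast
  then have "planes d S \<noteq> {}" by blast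
  from that[OF A(1,2) grassmann_chart_value[OF this B A(1,2)]] show ?thesis .
qed

lemma exists_plane:
  assumes ne: "planes d S \<noteq> {}" and c: "c \<in> atlas M" "q \<in> fst c" and B: "linear B" "bij_betw B S S"
    and A: "A \<in> slopes d S"
  obtains V where "(q, V) \<in> fst (gchart d c B)" "chart_diff M c q ` V = B ` slope_graph d S A"
    "snd (gchart d c B) (q, V) = (snd c q, A)"
proof -
  let ?D = "D id c (chart_at M q) q" and ?g = "slope_graph d S A"
  define V where "V = ?D ` B ` ?g"
  have q: "q \<in> points M" using c mem_points by blast
  note cq = chart_at[OF q]
  note g = slope_graph_subset[OF sub ne A] dim_slope_graph[OF sub ne A]
  have BgS: "B ` ?g \<subseteq> S" using g(1) B(2) unfolding bij_betw_def by blast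
  have Bg: "subspace (B ` ?g)" "dim (B ` ?g) = d"
    using linear_subspace_image[OF B(1) g(2)] dim_image_eq[OF B(1), of ?g] g B(2)
      inj_on_subset[of B S ?g] span_eq_iff[THEN iffD2, OF g(2)] unfolding bij_betw_def by simp_all
  have l: "linear ?D" by (simp add: blinfun.bounded_linear_right bounded_linear.linear)
  have DD: "chart_diff M c q (?D y) = y" if "y \<in> B ` ?g" for y using chart_diff_inverse(2)[OF c] BgS that by blast
  have inj: "inj_on ?D (B ` ?g)" by (rule inj_on_inverseI[where g = "chart_diff M c q"]) (rule DD)
  have VS: "V \<subseteq> S" unfolding V_def using D_S[OF C2_id c(1) cq(1) c(2)] cq by auto
  have Vp: "V \<in> planes d S"
    unfolding planes_def V_def mem_Collect_eq
    using linear_subspace_image[OF l Bg(1)] dim_image_eq[OF l, of "B ` ?g"] inj Bg VS[unfolded V_def]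
      span_eq_iff[THEN iffD2, OF Bg(1)] by simp
  have im: "chart_diff M c q ` V = B ` ?g" unfolding V_def image_image[of _ ?D] using DD by force
  have "(q, V) \<in> fst (gchart d c B)" unfolding mem_grassmann_chart using c(2) Vp A im by blast
  from that[OF this im grassmann_chart_value[OF ne B(2) A im]] show ?thesis .
qed

lemma grassmann_chart_inj:
  assumes c: "c \<in> atlas M" and B: "bij_betw B S S"
  shows "inj_on (snd (gchart d c B)) (fst (gchart d c B))"
proof (rule inj_onI, clarify)
  fix q V q' V'
  assume x: "(q, V) \<in> fst (gchart d c B)" "(q', V') \<in> fst (gchart d c B)"
    and e: "snd (gchart d c B) (q, V) = snd (gchart d c B) (q', V')"
  obtain A where A: "chart_diff M c q ` V = B ` slope_graph d S A"
    "snd (gchart d c B) (q, V) = (snd c q, A)" using grassmann_coordinate[OF B x(1)] by metis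
  obtain A' where A': "chart_diff M c q' ` V' = B ` slope_graph d S A'"
    "snd (gchart d c B) (q', V') = (snd c q', A')" using grassmann_coordinate[OF B x(2)] by metis
  have m: "q \<in> fst c" "q' \<in> fst c" "V \<subseteq> S" "V' \<subseteq> S" using x unfolding mem_grassmann_chart planes_def by blast+
  have qq: "q = q'" using e A(2) A'(2) inj_chart[OF c] m by (auto dest: inj_onD)
  have "D id c (chart_at M q) q ` chart_diff M c q ` U = U" if "U \<subseteq> S" for U
    unfolding image_image using chart_diff_inverse(1)[OF c m(1)] that by force
  then have "V = V'" using m A A' e qq by (metis Pair_inject)
  with qq show "q = q' \<and> V = V'" by blast
qed

lemma grassmann_local_rep:
  assumes c: "c \<in> atlas M" and B: "bij_betw B S S" and x: "x \<in> fst (gchart d c B)"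
  shows "local_rep (gchart d c B) C g (snd (gchart d c B) x) = snd C (g x)"
  unfolding local_rep_def chart_inv_def using inv_into_f_f[OF grassmann_chart_inj[OF c B] x] by simp

text \<open>In a chart of the Grassmann bundle the projection to \<open>M\<close> forgets the slope.\<close>

lemma grassmann_projection_derivative:
  assumes ne: "planes d S \<noteq> {}" and c: "c \<in> atlas M" and B: "linear B" "bij_betw B S S"
    and x: "(p, V) \<in> fst (gchart d c B)" and w: "\<xi> \<in> S" "\<alpha> \<in> slopes d S"
    and chart: "chart_at (Gr d) (p, V) = gchart d c B"
  shows "tangent_map (Gr d) M fst (p, V) (\<xi>, \<alpha>) = D id c (chart_at M p) p \<xi>"
proof -
  let ?C = "gchart d c B" and ?c = "chart_at M p" and ?T = "S \<times> slopes d S"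
  have pc: "p \<in> fst c" using x unfolding mem_grassmann_chart by blast
  note cp = chart_at[OF mem_points[OF c pc]]
  obtain A where A: "A \<in> slopes d S" "snd ?C (p, V) = (snd c p, A)" using grassmann_coordinate[OF B(2) x] by metis
  let ?X = "local_dom c ?c id \<times> slopes d S"
  have dom: "local_dom ?C ?c fst = ?X"
  proof (intro equalityI subsetI)
    fix y assume "y \<in> local_dom ?C ?c fst"
    then obtain q U where q: "(q, U) \<in> fst ?C" "q \<in> fst ?c" "y = snd ?C (q, U)" unfolding local_dom_def by auto
    obtain A' where "A' \<in> slopes d S" "snd ?C (q, U) = (snd c q, A')" using grassmann_coordinate[OF B(2) q(1)] by metis
    moreover have "q \<in> fst c" using q(1) unfolding mem_grassmann_chart by blast
    ultimately show "y \<in> ?X" using q(2,3) by (simp add: local_domI)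
  next
    fix y assume "y \<in> ?X"
    then obtain q A' where q: "q \<in> fst c" "q \<in> fst ?c" "A' \<in> slopes d S" "y = (snd c q, A')"
      unfolding local_dom_def by auto
    obtain U where "(q, U) \<in> fst ?C" "snd ?C (q, U) = (snd c q, A')"
      using exists_plane[OF ne c q(1) B q(3)] by metis
    then show "y \<in> local_dom ?C ?c fst" unfolding local_dom_def using q by force
  qed
  have X: "openin (top_of_set ?T) ?X" by (intro openin_Times openin_local_dom[OF C2_id c cp(1)] openin_subtopology_self)
  have y0: "(snd c p, A) \<in> ?X" using A(1) pc cp(2) by (simp add: local_domI)
  have "(local_rep c ?c id has_derivative D id c ?c p) (at (snd c p) within S)"
    unfolding D_def by (rule has_derivative_der[OF local_rep_diff(1)[OF C2_id c cp(1) pc] _ sub]) (use c pc cp in auto)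
  then have "(local_rep c ?c id has_derivative D id c ?c p) (at (fst (snd c p, A)) within fst ` ?X)"
    unfolding fst_conv by (rule has_derivative_subset) (use openin_imp_subset[OF openin_local_dom[OF C2_id c cp(1)]] in auto)
  from has_derivative_in_compose[OF has_derivative_fst[OF has_derivative_ident] this]
  have "((\<lambda>y. local_rep c ?c id (fst y)) has_derivative (\<lambda>h. D id c ?c p (fst h))) (at (snd c p, A) within ?X)" by simp
  then have der: "(local_rep ?C ?c fst has_derivative (\<lambda>h. D id c ?c p (fst h))) (at (snd c p, A) within ?X)"
  proof (rule has_derivative_transform[rotated 2])
    show "(snd c p, A) \<in> ?X" by (rule y0)
    fix y assume y: "y \<in> ?X"
    then have "y \<in> local_dom ?C ?c fst" unfolding dom .
    then obtain x where "x \<in> fst ?C" "y = snd ?C x" unfolding local_dom_def by blast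
    then obtain q U where q: "(q, U) \<in> fst ?C" "y = snd ?C (q, U)" by (metis surj_pair)
    obtain A' where A': "snd ?C (q, U) = (snd c q, A')" using grassmann_coordinate[OF B(2) q(1)] by metis
    have "q \<in> fst c" using q(1) unfolding mem_grassmann_chart by blast
    then show "local_rep ?C ?c fst y = local_rep c ?c id (fst y)"
      unfolding q(2) using grassmann_local_rep[OF c B(2) q(1), of ?c fst] A' local_rep_at[OF c, of q ?c id] by simp
  qed
  have "subspace ?T" by (intro subspace_Times sub subspace_slopes[OF sub ne])
  from frechet_derivative_relatively_open[OF this X y0 _ der, of "(\<xi>, \<alpha>)"] w
  show ?thesis unfolding tangent_map_def chart A(2) using dom by simp
qed

text \<open>In the chart \<open>(c, B)\<close>, the plane with base coordinate \<open>fst y\<close> and slope \<open>snd y\<close> in the chart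
  \<open>(c0, B0)\<close> is the range of \<open>plane_map c0 B0 c B y\<close>.\<close>

definition plane_map where
  "plane_map d c0 B0 c B y = (binv B o\<^sub>L der S (local_rep c0 c id) (fst y)) o\<^sub>L
     (Blinfun B0 o\<^sub>L ((id_blinfun + snd y) o\<^sub>L oproj (ref_plane d S)))"

context
  fixes d :: nat and c0 c :: "('m, 'b) chart" and B0 B :: "'b => 'b"
  assumes ne: "planes d S \<noteq> {}"
    and c0: "c0 \<in> atlas M" "linear B0" "bij_betw B0 S S" and c: "c \<in> atlas M" "linear B" "bij_betw B S S"
begin

private abbreviation "ppi \<equiv> oproj (ref_plane d S)"
private abbreviation "C0 \<equiv> gchart d c0 B0"
private abbreviation "C1 \<equiv> gchart d c B"
private abbreviation "Y \<equiv> plane_map d c0 B0 c B"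
private abbreviation "T \<equiv> S \<times> slopes d S"

lemma plane_map_apply:
  assumes "q \<in> fst c0"
  shows "Y (snd c0 q, A) x = binv B (D id c0 c q (B0 (ppi x + A (ppi x))))"
  unfolding plane_map_def D_def using automorphism(1)[OF c0(2,3)]
  by (simp add: blinfun.add_left)

lemma plane_map_facts:
  assumes q: "q \<in> fst c0" "q \<in> fst c" and A: "A \<in> slopes d S"
  shows "Y (snd c0 q, A) x = 0 ==> ppi x = 0"
    and "Y (snd c0 q, A) (ppi x) = Y (snd c0 q, A) x" and "Y (snd c0 q, A) x \<in> S"
    and "chart_diff M c0 q ` V = B0 ` slope_graph d S A ==> V \<subseteq> S ==>
      chart_diff M c q ` V = B ` range (blinfun_apply (Y (snd c0 q, A)))"
proof -
  note rp = ref_oproj[OF sub ne] and Ya = plane_map_apply[OF q(1)]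
  note au0 = automorphism[OF c0(2,3)] and au = automorphism[OF c(2,3)]
  have AS: "A x \<in> S" "ppi (A x) = 0" for x using A unfolding slopes_iff[OF sub ne] by blast+
  let ?w = "\<lambda>x. ppi x + A (ppi x)"
  have w: "?w x \<in> S" "ppi (?w x) = ppi x" for x using rp AS by (simp_all add: blinfun.add_right)
  have DS: "D id c0 c q y \<in> S" for y using D_S[OF C2_id c0(1) c(1)] q by simp
  show "Y (snd c0 q, A) (ppi x) = Y (snd c0 q, A) x" unfolding Ya rp ..
  show "Y (snd c0 q, A) x \<in> S" unfolding Ya by (rule au(5))
  show "ppi x = 0" if "Y (snd c0 q, A) x = 0"
  proof -
    have "D id c0 c q (B0 (?w x)) = B (binv B (D id c0 c q (B0 (?w x))))" using au(4) DS by simp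
    then have "D id c0 c q (B0 (?w x)) = 0" using that unfolding Ya by (simp add: linear_0[OF c(2)])
    then have "B0 (?w x) = 0"
      using D_id_inverse[OF c0(1) c(1) q au0(2)[OF w(1)]] by (metis blinfun.zero_right)
    then have "?w x = 0" using au0(3)[OF w(1)] by (metis blinfun.zero_right)
    then show ?thesis using w(2)[of x] by simp
  qed
  assume V: "chart_diff M c0 q ` V = B0 ` slope_graph d S A" "V \<subseteq> S"
  have "chart_diff M c q ` V = D id c0 c q ` chart_diff M c0 q ` V"
    unfolding image_image using V(2) by (intro image_cong refl chart_diff_trans[OF c0(1) c(1) q]) auto
  also have "\<dots> = B ` binv B ` D id c0 c q ` B0 ` slope_graph d S A"
    unfolding V(1) image_image using au(4) DS by simp
  also have "binv B ` D id c0 c q ` B0 ` slope_graph d S A = range (blinfun_apply (Y (snd c0 q, A)))"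
  proof -
    have "slope_graph d S A = range ?w"
    proof -
      have "ref_plane d S = range ppi"
        using oproj_mem[OF ref_plane(1)[OF sub ne]] oproj_id[OF ref_plane(1)[OF sub ne]] by (metis image_subset_iff rangeI subsetI subset_antisym)
      from arg_cong[OF this, of "image (\<lambda>x. x + A x)"] show ?thesis unfolding slope_graph_def image_image .
    qed
    then show ?thesis by (simp add: image_image Ya)
  qed
  finally show "chart_diff M c q ` V = B ` range (blinfun_apply (Y (snd c0 q, A)))" .
qed

text \<open>The slope in the new chart solves a linear equation whose coefficients depend differentiably on the
  old coordinates.\<close>

lemma transition_slope:
  assumes q: "(q, V) \<in> fst C0" "q \<in> fst c" and A: "A \<in> slopes d S" "chart_diff M c0 q ` V = B0 ` slope_graph d S A"
    and A': "A' \<in> slopes d S" "chart_diff M c q ` V = B ` slope_graph d S A'"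
  shows "range (blinfun_apply (Y (snd c0 q, A))) = slope_graph d S A'"
    and "inj (blinfun_apply (tilt d S (Y (snd c0 q, A))))"
    and "A' o\<^sub>L tilt d S (Y (snd c0 q, A)) = Y (snd c0 q, A) - (ppi o\<^sub>L Y (snd c0 q, A))"
proof -
  have q0: "q \<in> fst c0" "V \<subseteq> S" using q unfolding mem_grassmann_chart planes_def by blast+
  note pm = plane_map_facts[OF q0(1) q(2) A(1)]
  have "B ` range (blinfun_apply (Y (snd c0 q, A))) = B ` slope_graph d S A'"
    using pm(4)[OF A(2) q0(2)] A'(2) by simp
  moreover have "range (blinfun_apply (Y (snd c0 q, A))) \<subseteq> S" by (rule image_subsetI) (rule pm(3))
  ultimately show r: "range (blinfun_apply (Y (snd c0 q, A))) = slope_graph d S A'"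
    using inj_on_image_eq_iff[OF bij_betw_imp_inj_on[OF c(3)] _ slope_graph_subset[OF sub ne A'(1)]] by metis
  show "inj (blinfun_apply (tilt d S (Y (snd c0 q, A))))"
    by (rule slope_of_range(1)[OF sub ne pm(1) A'(1) r])
  show "A' o\<^sub>L tilt d S (Y (snd c0 q, A)) = Y (snd c0 q, A) - (ppi o\<^sub>L Y (snd c0 q, A))"
    by (rule slope_of_range(2)[OF sub ne pm(1) A'(1) r])
qed

lemma transition_domain:
  "local_dom C0 C1 id = {y \<in> local_dom c0 c id \<times> slopes d S. inj (blinfun_apply (tilt d S (Y y)))}" (is "?l = ?r")
proof (intro equalityI subsetI)
  fix y assume "y \<in> ?l"
  then obtain x where x: "x \<in> fst C0" "x \<in> fst C1" "y = snd C0 x" unfolding local_dom_def by auto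
  obtain q V where xq: "x = (q, V)" by fastforce
  have q: "(q, V) \<in> fst C0" "(q, V) \<in> fst C1" using x xq by simp_all
  obtain A where A: "A \<in> slopes d S" "chart_diff M c0 q ` V = B0 ` slope_graph d S A" "snd C0 (q, V) = (snd c0 q, A)"
    using grassmann_coordinate[OF c0(3) q(1)] by metis
  have qc: "q \<in> fst c" "q \<in> fst c0" using q unfolding mem_grassmann_chart by blast+
  obtain A' where A': "A' \<in> slopes d S" "chart_diff M c q ` V = B ` slope_graph d S A'"
    using q(2) unfolding mem_grassmann_chart by blast
  show "y \<in> ?r" unfolding x(3) xq A(3) using transition_slope(2)[OF q(1) qc(1) A(1,2) A'] A(1) qc by (simp add: local_domI)
next
  fix y assume y: "y \<in> ?r"
  then obtain q A where q: "q \<in> fst c0" "q \<in> fst c" "A \<in> slopes d S" "y = (snd c0 q, A)"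
    "inj (blinfun_apply (tilt d S (Y y)))"
    unfolding local_dom_def by auto
  obtain V where V: "(q, V) \<in> fst C0" "chart_diff M c0 q ` V = B0 ` slope_graph d S A" "snd C0 (q, V) = (snd c0 q, A)"
    using exists_plane[OF ne c0(1) q(1) c0(2,3) q(3)] by metis
  have V': "V \<in> planes d S" "V \<subseteq> S" using V(1) unfolding mem_grassmann_chart planes_def by blast+
  note pm = plane_map_facts[OF q(1-3)]
  obtain A' where "A' \<in> slopes d S" "range (blinfun_apply (Y (snd c0 q, A))) = slope_graph d S A'"
    using exists_slope_of_range[OF sub ne pm(2,3) q(5)[unfolded q(4)]] by blast
  then have "(q, V) \<in> fst C1" unfolding mem_grassmann_chart using q(2) V'(1) pm(4)[OF V(2) V'(2)] by auto
  then show "y \<in> ?l" unfolding local_dom_def q(4) using V(1,3) by force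
qed

context
  fixes p V A0 A1
  assumes p: "(p, V) \<in> fst C0" "(p, V) \<in> fst C1" and A0: "snd C0 (p, V) = (snd c0 p, A0)"
    and A1: "snd C1 (p, V) = (snd c p, A1)"
begin

lemma base_facts: "p \<in> fst c0" "p \<in> fst c" "A0 \<in> slopes d S" "A1 \<in> slopes d S"
    "chart_diff M c0 p ` V = B0 ` slope_graph d S A0" "chart_diff M c p ` V = B ` slope_graph d S A1"
  using p grassmann_coordinate[OF c0(3) p(1)] grassmann_coordinate[OF c(3) p(2)] A0 A1
  unfolding mem_grassmann_chart by (metis prod.inject)+

text \<open>The derivative of \<open>plane_map\<close>: the second term comes from the base point, the first from the slope.\<close>

definition "dplane_map h =
  ((binv B o\<^sub>L D id c0 c p) o\<^sub>L (Blinfun B0 o\<^sub>L (snd h o\<^sub>L ppi))) +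
  ((binv B o\<^sub>L D2 id c0 c p (fst h)) o\<^sub>L (Blinfun B0 o\<^sub>L ((id_blinfun + A0) o\<^sub>L ppi)))"

lemma plane_map_derivative: "(Y has_derivative dplane_map) (at (snd c0 p, A0) within T)"
proof -
  note bf = base_facts
  let ?y = "(snd c0 p, A0)"
  have "(der S (local_rep c0 c id) has_derivative D2 id c0 c p) (at (snd c0 p) within S)"
    unfolding D2_def by (rule has_derivative_der[OF local_rep_diff(2)[OF C2_id c0(1) c(1) bf(1)] _ sub]) (use bf c0 in auto)
  then have "(der S (local_rep c0 c id) has_derivative D2 id c0 c p) (at (fst ?y) within fst ` T)"
    unfolding fst_conv by (rule has_derivative_subset) auto
  from has_derivative_in_compose[OF has_derivative_fst[OF has_derivative_ident] this]
  have 1: "((\<lambda>y. der S (local_rep c0 c id) (fst y)) has_derivative (\<lambda>h. D2 id c0 c p (fst h))) (at ?y within T)" by simp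
  have U: "((\<lambda>y. binv B o\<^sub>L der S (local_rep c0 c id) (fst y)) has_derivative (\<lambda>h. binv B o\<^sub>L D2 id c0 c p (fst h))) (at ?y within T)"
    by (rule bounded_linear.has_derivative[OF bounded_bilinear.bounded_linear_right[OF bounded_bilinear_blinfun_compose] 1])
  have "((\<lambda>y :: 'b \<times> ('b \<Rightarrow>\<^sub>L 'b). id_blinfun + snd y) has_derivative (\<lambda>h. snd h)) (at ?y within T)"
    by (auto intro!: derivative_eq_intros)
  then have "((\<lambda>y :: 'b \<times> ('b \<Rightarrow>\<^sub>L 'b). (id_blinfun + snd y) o\<^sub>L ppi) has_derivative (\<lambda>h. snd h o\<^sub>L ppi)) (at ?y within T)"
    by (rule bounded_linear.has_derivative[OF bounded_bilinear.bounded_linear_left[OF bounded_bilinear_blinfun_compose]])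
  then have "((\<lambda>y :: 'b \<times> ('b \<Rightarrow>\<^sub>L 'b). Blinfun B0 o\<^sub>L ((id_blinfun + snd y) o\<^sub>L ppi)) has_derivative
      (\<lambda>h. Blinfun B0 o\<^sub>L (snd h o\<^sub>L ppi))) (at ?y within T)"
    by (rule bounded_linear.has_derivative[OF bounded_bilinear.bounded_linear_right[OF bounded_bilinear_blinfun_compose]])
  from bounded_bilinear.FDERIV[OF bounded_bilinear_blinfun_compose U this]
  show ?thesis unfolding plane_map_def dplane_map_def D_def by simp
qed

lemma transition_domain_open: "openin (top_of_set T) (local_dom C0 C1 id)"
proof -
  let ?O = "local_dom c0 c id \<times> slopes d S"
  have O: "openin (top_of_set T) ?O"
    by (intro openin_Times openin_local_dom[OF C2_id c0(1) c(1)] openin_subtopology_self)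
  have "continuous_on (local_dom c0 c id) (der S (local_rep c0 c id))"
    using twice_diff_continuous_der(2)[OF twice_diff_local_rep[OF C2_id c0(1) c(1)]] .
  then have "continuous_on ?O (\<lambda>y. der S (local_rep c0 c id) (fst y))"
    by (rule continuous_on_compose2) (auto intro: continuous_intros)
  then have "continuous_on ?O (\<lambda>y. tilt d S (Y y))"
    unfolding tilt_def[OF sub ne] plane_map_def
    by (intro continuous_intros bounded_bilinear.continuous_on[OF bounded_bilinear_blinfun_compose])
  then have "openin (top_of_set ?O) (?O \<inter> (\<lambda>y. tilt d S (Y y)) -` {Z. inj (blinfun_apply Z)})"
    by (rule continuous_openin_preimage_gen[OF _ open_injective_blinfun])
  moreover have "?O \<inter> (\<lambda>y. tilt d S (Y y)) -` {Z. inj (blinfun_apply Z)} = local_dom C0 C1 id"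
    unfolding transition_domain by blast
  ultimately show ?thesis using openin_trans[OF _ O] by simp
qed

text \<open>The transition map between two charts of the Grassmann bundle is differentiable, with the
  slope component given by \<open>quotient_has_derivative\<close>: project \<open>dplane_map\<close> along the plane of slope \<open>A1\<close>
  and divide by \<open>tilt\<close>.\<close>

lemma grassmann_chart_diff:
  assumes chart: "chart_at (Gr d) (p, V) = C0" and h: "h \<in> T"
  obtains W where "tilt d S (Y (snd c0 p, A0)) o\<^sub>L W = id_blinfun"
    "chart_diff (Gr d) C1 (p, V) h =
      (D id c0 c p (fst h), ((id_blinfun - ppi - (A1 o\<^sub>L ppi)) o\<^sub>L dplane_map h) o\<^sub>L W)"
proof -
  note bf = base_facts
  let ?X = "local_dom C0 C1 id" and ?y = "(snd c0 p, A0)" and ?\<Psi> = "id_blinfun - ppi - (A1 o\<^sub>L ppi)"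
  let ?F = "local_rep C0 C1 id"
  note rp = ref_oproj[OF sub ne]
  note X = transition_domain_open
  have y0: "?y \<in> ?X" using p A0 unfolding local_dom_def by (intro image_eqI[of _ _ "(p, V)"]) auto
  have point: "\<exists>q V A A'. y = (snd c0 q, A) \<and> ?F y = (snd c q, A') \<and> (q, V) \<in> fst C0 \<and> q \<in> fst c \<and> A' \<in> slopes d S
     \<and> A \<in> slopes d S \<and> chart_diff M c0 q ` V = B0 ` slope_graph d S A \<and> chart_diff M c q ` V = B ` slope_graph d S A'"
    if "y \<in> ?X" for y
  proof -
    from that obtain x where x: "x \<in> fst C0" "x \<in> fst C1" "y = snd C0 x" unfolding local_dom_def by auto
    obtain q V where xq: "x = (q, V)" by fastforce
    have q: "(q, V) \<in> fst C0" "(q, V) \<in> fst C1" using x xq by simp_all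
    obtain A where A: "A \<in> slopes d S" "chart_diff M c0 q ` V = B0 ` slope_graph d S A" "snd C0 (q, V) = (snd c0 q, A)"
      using grassmann_coordinate[OF c0(3) q(1)] by metis
    obtain A' where A': "A' \<in> slopes d S" "chart_diff M c q ` V = B ` slope_graph d S A'" "snd C1 (q, V) = (snd c q, A')"
      using grassmann_coordinate[OF c(3) q(2)] by metis
    have "?F y = (snd c q, A')" using grassmann_local_rep[OF c0(1,3) q(1), of C1 id] A'(3) unfolding x(3) xq by simp
    moreover have "q \<in> fst c" using q(2) unfolding mem_grassmann_chart by blast
    ultimately show ?thesis using A A' q(1) unfolding x(3) xq A(3) by blast
  qed
  have F0: "snd (?F ?y) = A1"
    using grassmann_local_rep[OF c0(1,3) p(1), of C1 id] A1 unfolding A0 by simp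
  have rel: "(snd (?F y) - snd (?F ?y)) o\<^sub>L tilt d S (Y y) = ?\<Psi> o\<^sub>L Y y" if "y \<in> ?X" for y
  proof -
    obtain q V A A' where q: "y = (snd c0 q, A)" "?F y = (snd c q, A')" "(q, V) \<in> fst C0" "q \<in> fst c" "A' \<in> slopes d S"
      "A \<in> slopes d S" "chart_diff M c0 q ` V = B0 ` slope_graph d S A" "chart_diff M c q ` V = B ` slope_graph d S A'"
      using point[OF \<open>y \<in> ?X\<close>] by (elim exE conjE) (rule that)
    note ts = transition_slope(3)[OF q(3,4,6,7,5,8)]
    have "A' (tilt d S (Y y) x) = Y y x - ppi (Y y x)" for x
      using arg_cong[OF ts, of "\<lambda>Z. blinfun_apply Z x"] unfolding q(1) by (simp add: blinfun.diff_left)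
    moreover have "A1 (tilt d S (Y y) x) = A1 (ppi (Y y x))" for x
      using bf(4) tilt_proj[OF sub ne, of "Y y" x] unfolding slopes_iff[OF sub ne] by metis
    ultimately show ?thesis
      unfolding F0 q(2) snd_conv by (auto intro!: blinfun_eqI simp: blinfun.diff_left)
  qed
  have X': "at ?y within ?X = at ?y within T" by (rule at_within_openin[OF X y0])
  have "inj (blinfun_apply (tilt d S (Y ?y)))" using y0 unfolding transition_domain by blast
  then obtain g where g: "linear g" "\<And>x. tilt d S (Y ?y) (g x) = x"
    using linear_injective_isomorphism[OF bounded_linear.linear[OF blinfun.bounded_linear_right]] by metis
  define W where "W = Blinfun g"
  have "blinfun_apply W = g"
    unfolding W_def by (rule bounded_linear_Blinfun_apply[OF linear_conv_bounded_linear[THEN iffD1, OF g(1)]])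
  then have W: "tilt d S (Y ?y) o\<^sub>L W = id_blinfun" using g(2) by (auto intro!: blinfun_eqI)
  have Q: "((\<lambda>y. ?\<Psi> o\<^sub>L Y y) has_derivative (\<lambda>h. ?\<Psi> o\<^sub>L dplane_map h)) (at ?y within ?X)"
    unfolding X'
    by (rule bounded_linear.has_derivative[OF bounded_bilinear.bounded_linear_right[OF bounded_bilinear_blinfun_compose] plane_map_derivative])
  have "(Y \<longlongrightarrow> Y ?y) (at ?y within ?X)"
    unfolding X' using has_derivative_continuous[OF plane_map_derivative] by (simp add: continuous_within)
  then have Z: "((\<lambda>y. tilt d S (Y y)) \<longlongrightarrow> tilt d S (Y ?y)) (at ?y within ?X)"
    unfolding tilt_def[OF sub ne] by (intro tendsto_intros bounded_bilinear.tendsto[OF bounded_bilinear_blinfun_compose])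
  have 2: "((\<lambda>y. snd (?F y)) has_derivative (\<lambda>h. (?\<Psi> o\<^sub>L dplane_map h) o\<^sub>L W)) (at ?y within ?X)"
    by (rule quotient_has_derivative[OF Q y0 Z W rel])
  have "(local_rep c0 c id has_derivative D id c0 c p) (at (snd c0 p) within S)"
    unfolding D_def by (rule has_derivative_der[OF local_rep_diff(1)[OF C2_id c0(1) c(1) bf(1)] _ sub]) (use bf c0 in auto)
  then have "(local_rep c0 c id has_derivative D id c0 c p) (at (fst ?y) within fst ` ?X)"
    unfolding fst_conv by (rule has_derivative_subset) (use openin_imp_subset[OF X] in auto)
  from has_derivative_in_compose[OF has_derivative_fst[OF has_derivative_ident] this]
  have "((\<lambda>y. local_rep c0 c id (fst y)) has_derivative (\<lambda>h. D id c0 c p (fst h))) (at ?y within ?X)" by simp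
  then have 1: "((\<lambda>y. fst (?F y)) has_derivative (\<lambda>h. D id c0 c p (fst h))) (at ?y within ?X)"
  proof (rule has_derivative_transform[rotated 2])
    show "?y \<in> ?X" by (rule y0)
    fix y assume y: "y \<in> ?X"
    obtain q V A A' where q: "y = (snd c0 q, A)" "?F y = (snd c q, A')" "(q, V) \<in> fst C0"
      using point[OF y] by (elim exE conjE) (rule that)
    then show "fst (?F y) = local_rep c0 c id (fst y)"
      unfolding mem_grassmann_chart using local_rep_at[OF c0(1), of q c id] by simp
  qed
  have der: "(?F has_derivative (\<lambda>h. (D id c0 c p (fst h), (?\<Psi> o\<^sub>L dplane_map h) o\<^sub>L W))) (at ?y within ?X)"
    using has_derivative_Pair[OF 1 2] by simp
  have "subspace T" by (intro subspace_Times sub subspace_slopes[OF sub ne])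
  from frechet_derivative_relatively_open[OF this X y0 h der]
  have "chart_diff (Gr d) C1 (p, V) h = (D id c0 c p (fst h), (?\<Psi> o\<^sub>L dplane_map h) o\<^sub>L W)"
    unfolding chart_diff_def chart A0 .
  with W show ?thesis using that by blast
qed

end

end

end

section \<open>The derivative as a map into the tangent bundle of the Grassmann bundle\<close>

context smooth_mfd
begin

lemma grassmann_atlasE:
  assumes "C \<in> atlas (Gr d)"
  obtains c B where "C = gchart d c B" "c \<in> atlas M" "linear B" "bij_betw B S S"
proof -
  have "\<exists>c B. C = gchart d c B \<and> c \<in> atlas M \<and> linear B \<and> bij_betw B S S"
    using assms unfolding grassmann_bundle_def by (simp del: split_paired_Ex)
  then show ?thesis using that by blast
qed

end

context uniformly_bunched
begin

text \<open>Reparametrisation by an affine map; it turns pieces of an arc into paths over the unit interval.\<close>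

lemma velocity_affine:
  assumes \<gamma>: "has_velocity M \<gamma> v (t + \<tau> * r) I" and r: "r \<noteq> 0"
    and J: "\<And>\<tau>'. \<tau>' \<in> J ==> t + \<tau>' * r \<in> I" "\<tau> \<in> J"
  shows "has_velocity M (\<lambda>\<tau>'. \<gamma> (t + \<tau>' * r)) (r *\<^sub>R v) \<tau> J"
proof -
  let ?c = "chart_at M (\<gamma> (t + \<tau> * r))" and ?l = "\<lambda>\<tau>'. t + \<tau>' * r"
  have \<gamma>': "\<gamma> (?l \<tau>) \<in> points M" "\<forall>\<^sub>F s in at (?l \<tau>) within I. \<gamma> s \<in> fst ?c"
    "((snd ?c \<circ> \<gamma>) has_vector_derivative v) (at (?l \<tau>) within I)"
    using \<gamma> unfolding has_velocity_def by blast+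
  have l: "(?l has_vector_derivative r) (at \<tau> within J)"
    by (auto intro!: derivative_eq_intros simp: has_vector_derivative_def)
  have "(?l \<longlongrightarrow> ?l \<tau>) (at \<tau> within J)" by (intro tendsto_intros)
  moreover have "\<forall>\<^sub>F \<tau>' in at \<tau> within J. ?l \<tau>' \<in> I \<and> ?l \<tau>' \<noteq> ?l \<tau>"
    unfolding eventually_at_filter using J r by (auto intro!: always_eventually)
  ultimately have fl: "filterlim ?l (at (?l \<tau>) within I) (at \<tau> within J)"
    unfolding filterlim_at by blast
  have "((snd ?c \<circ> \<gamma>) has_vector_derivative v) (at (?l \<tau>) within ?l ` J)"
    by (rule has_vector_derivative_within_subset[OF \<gamma>'(3)]) (use J in blast)
  from vector_diff_chain_within[OF l this]
  show ?thesis
    unfolding has_velocity_def using \<gamma>'(1) eventually_compose_filterlim[OF \<gamma>'(2) fl] by (simp add: o_def)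
qed

text \<open>The speed of a \<open>C\<^sup>1\<close> arc is continuous, so that near \<open>t\<close> it exceeds its value at \<open>t\<close> by less than one.\<close>

lemma C1_arc_germ:
  assumes \<gamma>: "C1_arc M \<gamma> \<gamma>' a b" "\<And>t. t \<in> {a..b} ==> \<gamma>' t \<in> Ec (\<gamma> t)" and t: "t \<in> {a..b}"
  shows "\<exists>A. germ \<gamma> (\<gamma>' t) t {a..b} A"
proof -
  have vel: "has_velocity M \<gamma> (\<gamma>' s) s {a..b}" if "s \<in> {a..b}" for s using \<gamma>(1) that unfolding C1_arc_def by blast
  have cm: "continuous_map (top_of_set {a..b}) TMtop (\<lambda>t. (\<gamma> t, \<gamma>' t))"
    using \<gamma>(1) unfolding C1_arc_def by blast
  have "continuous_map TMtop euclideanreal (\<lambda>(p, v). N p v)"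
    using finsler unfolding finsler_metric_def by blast
  from continuous_map_compose[OF cm this]
  have co: "continuous_on {a..b} (\<lambda>t. N (\<gamma> t) (\<gamma>' t))" by (simp add: o_def)
  define A where "A = N (\<gamma> t) (\<gamma>' t) + 1"
  obtain r where r: "r > 0" "\<And>s. s \<in> {a..b} ==> dist s t < r ==> dist (N (\<gamma> s) (\<gamma>' s)) (N (\<gamma> t) (\<gamma>' t)) < 1"
    using co t unfolding continuous_on_iff by (metis zero_less_one)
  have NA: "N (\<gamma> s) (\<gamma>' s) \<le> A" if "s \<in> {a..b}" "\<bar>s - t\<bar> < r" for s
    using r(2)[OF that(1)] that(2) unfolding A_def dist_real_def by linarith
  have "\<forall>\<^sub>F s in at t within {a..b}. cpath (A * \<bar>s - t\<bar>) (\<gamma> t) (\<gamma> s)"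
    unfolding eventually_at
  proof (intro exI[of _ r] conjI r(1) ballI impI)
    fix s assume s: "s \<in> {a..b}" "s \<noteq> t \<and> dist s t < r"
    let ?l = "\<lambda>\<tau>. t + \<tau> * (s - t)"
    have l: "?l \<tau> \<in> {a..b}" "\<bar>?l \<tau> - t\<bar> < r" if "\<tau> \<in> {0..1}" for \<tau>
    proof -
      have "(1 - \<tau>) *\<^sub>R t + \<tau> *\<^sub>R s \<in> {a..b}"
        by (rule convexD[OF convex_real_interval(5)]) (use s t that in auto)
      then show "?l \<tau> \<in> {a..b}" by (simp add: algebra_simps)
      have "\<bar>?l \<tau> - t\<bar> = \<tau> * \<bar>s - t\<bar>" using that by (simp add: abs_mult)
      also have "\<dots> \<le> 1 * \<bar>s - t\<bar>" using that by (intro mult_right_mono) auto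
      finally show "\<bar>?l \<tau> - t\<bar> < r" using s by (simp add: dist_real_def)
    qed
    have "is_cpath (\<lambda>\<tau>. \<gamma> (?l \<tau>)) (\<lambda>\<tau>. (s - t) *\<^sub>R \<gamma>' (?l \<tau>)) (A * \<bar>s - t\<bar>)"
      unfolding is_cpath_def
    proof (intro ballI conjI)
      fix \<tau> :: real assume \<tau>: "\<tau> \<in> {0..1}"
      have p: "\<gamma> (?l \<tau>) \<in> points M" using vel[OF l(1)[OF \<tau>]] unfolding has_velocity_def by blast
      note fib = subb_fibre[OF subbs(2) p]
      note E = \<gamma>(2)[OF l(1)[OF \<tau>]]
      show "has_velocity M (\<lambda>\<tau>. \<gamma> (?l \<tau>)) ((s - t) *\<^sub>R \<gamma>' (?l \<tau>)) \<tau> {0..1}"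
        by (rule velocity_affine[OF vel[OF l(1)[OF \<tau>]]]) (use s \<tau> l(1) in auto)
      show "(s - t) *\<^sub>R \<gamma>' (?l \<tau>) \<in> Ec (\<gamma> (?l \<tau>))" using fib E by (simp add: subspace_scale)
      have "N (\<gamma> (?l \<tau>)) ((s - t) *\<^sub>R \<gamma>' (?l \<tau>)) = \<bar>s - t\<bar> * N (\<gamma> (?l \<tau>)) (\<gamma>' (?l \<tau>))"
        using finsler p fib E unfolding finsler_metric_def by blast
      also have "\<dots> \<le> \<bar>s - t\<bar> * A" using NA[OF l[OF \<tau>]] by (intro mult_left_mono) auto
      finally show "N (\<gamma> (?l \<tau>)) ((s - t) *\<^sub>R \<gamma>' (?l \<tau>)) \<le> A * \<bar>s - t\<bar>" by (simp add: mult.commute)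
    qed
    then show "cpath (A * \<bar>s - t\<bar>) (\<gamma> t) (\<gamma> s)"
      unfolding cpath_def by (intro exI[of _ "\<lambda>\<tau>. \<gamma> (?l \<tau>)"] exI conjI) auto
  qed
  then have "germ \<gamma> (\<gamma>' t) t {a..b} A" unfolding germ_def using t vel[OF t] \<gamma>(2)[OF t] unfolding A_def by simp
  then show ?thesis ..
qed

text \<open>In the affine chart \<open>(c, B)\<close>: \<open>vert\<close> is the vertical coordinate of a vector relative to the plane \<open>E\<^sup>u p\<close>,
  which it kills, and \<open>lift\<close> parametrises \<open>E\<^sup>u p\<close> by the reference plane.\<close>

definition vert :: "nat => ('m, 'b) chart => ('b => 'b) => 'm => 'b \<Rightarrow>\<^sub>L 'b" where
  "vert d c B p = (id_blinfun - oproj (ref_plane d S) - (slope d Eu c B p o\<^sub>L oproj (ref_plane d S))) o\<^sub>L binv B"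

definition lift :: "nat => ('m, 'b) chart => ('b => 'b) => 'm => 'b \<Rightarrow>\<^sub>L 'b" where
  "lift d c B p = Blinfun B o\<^sub>L ((id_blinfun + slope d Eu c B p) o\<^sub>L oproj (ref_plane d S))"

text \<open>The derivative of the slope of \<open>E\<^sup>u\<close> in the direction \<open>\<xi>\<close> of \<open>E\<^sup>c\<close>: the tensor \<open>KK\<close>, seen in the
  affine coordinate of the Grassmannian.\<close>

definition dslope :: "nat => ('m, 'b) chart => ('b => 'b) => 'm => 'b => 'b \<Rightarrow>\<^sub>L 'b" where
  "dslope d c B p \<xi> = vert d c B p o\<^sub>L (Blinfun (KK c p \<xi>) o\<^sub>L lift d c B p)"

context
  fixes d assumes dEu: "continuous_subbundle M d Eu"
begin

private abbreviation "ppv \<equiv> oproj (ref_plane d S)"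

lemma ne_planes: "p \<in> points M ==> planes d S \<noteq> {}"
  using subbundle_planes[OF dEu] by blast

context
  fixes c B p
  assumes c: "c \<in> atlas M" and B: "linear B" "bij_betw B S S" and p: "(p, Eu p) \<in> fst (gchart d c B)"
begin

lemma base_point: "p \<in> fst c" "p \<in> points M"
  using p mem_points[OF c] unfolding mem_grassmann_chart by blast+

lemma vert_apply: "vert d c B p x = binv B x - ppv (binv B x) - slope d Eu c B p (ppv (binv B x))"
  unfolding vert_def by (simp add: blinfun.diff_left)

lemma lift_apply: "lift d c B p x = B (ppv x + slope d Eu c B p (ppv x))"
  unfolding lift_def by (simp add: blinfun.add_left automorphism(1)[OF B])

lemma dslope_apply: "dslope d c B p \<xi> x = vert d c B p (KK c p \<xi> (lift d c B p x))"
proof -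
  have "linear (KK c p \<xi>)" using KK_tensor[OF c base_point(1)] unfolding tensor_def bilinear_def by blast
  then have "blinfun_apply (Blinfun (KK c p \<xi>)) = KK c p \<xi>"
    by (rule bounded_linear_Blinfun_apply[OF linear_conv_bounded_linear[THEN iffD1]])
  then show ?thesis unfolding dslope_def by simp
qed

lemma slope_p: "slope d Eu c B p \<in> slopes d S" "EE Eu c p = B ` slope_graph d S (slope d Eu c B p)"
  using slope_local(2,3)[OF dEu c B base_point(2) p] by blast+

lemma vert_Eu: "u \<in> EE Eu c p ==> vert d c B p u = 0"
proof -
  assume "u \<in> EE Eu c p"
  then obtain w where w: "w \<in> slope_graph d S (slope d Eu c B p)" "u = B w" using slope_p(2) by blast
  have "binv B u = w" using w slope_graph_subset[OF sub ne_planes[OF base_point(2)] slope_p(1)] automorphism(3)[OF B] by blast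
  then show ?thesis
    unfolding vert_apply using w(1) slope_graph_iff[OF sub ne_planes[OF base_point(2)] slope_p(1)] by simp
qed

lemma lift_Eu: "lift d c B p x \<in> EE Eu c p"
  unfolding lift_apply slope_p(2) slope_graph_def
  using oproj_mem[OF ref_plane(1)[OF sub ne_planes[OF base_point(2)]]] by blast

lemma dslope_slopes: "dslope d c B p \<xi> \<in> slopes d S"
proof -
  note ne = ne_planes[OF base_point(2)]
  note rp = ref_oproj[OF sub ne]
  have A: "slope d Eu c B p x \<in> S" "ppv (slope d Eu c B p x) = 0" for x
    using slope_p(1) unfolding slopes_iff[OF sub ne] by blast+
  have "vert d c B p x \<in> S \<and> ppv (vert d c B p x) = 0" for x
    unfolding vert_apply using automorphism(5)[OF B] rp A by (simp add: blinfun.diff_right)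
  moreover have "lift d c B p (ppv x) = lift d c B p x" for x unfolding lift_apply rp ..
  ultimately show ?thesis unfolding slopes_iff[OF sub ne] dslope_apply by simp
qed

lemma dslope_linear: "dslope d c B p (r *\<^sub>R \<xi> + r' *\<^sub>R \<eta>) = r *\<^sub>R dslope d c B p \<xi> + r' *\<^sub>R dslope d c B p \<eta>"
proof (rule blinfun_eqI)
  fix x
  let ?y = "lift d c B p x"
  have l: "linear (\<lambda>\<xi>. KK c p \<xi> ?y)" using KK_tensor[OF c base_point(1)] unfolding tensor_def bilinear_def by blast
  have "KK c p (r *\<^sub>R \<xi> + r' *\<^sub>R \<eta>) ?y = r *\<^sub>R KK c p \<xi> ?y + r' *\<^sub>R KK c p \<eta> ?y"
    using linear_add[OF l, of "r *\<^sub>R \<xi>" "r' *\<^sub>R \<eta>"] linear_scale[OF l, of r \<xi>] linear_scale[OF l, of r' \<eta>] by simp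
  then show "dslope d c B p (r *\<^sub>R \<xi> + r' *\<^sub>R \<eta>) x = (r *\<^sub>R dslope d c B p \<xi> + r' *\<^sub>R dslope d c B p \<eta>) x"
    unfolding blinfun.add_left blinfun.scaleR_left dslope_apply
    by (simp add: blinfun.add_right blinfun.scaleR_right)
qed

lemma vert_lift_tendsto:
  "(vert d c B \<longlongrightarrow> vert d c B p) (nh p)" "(lift d c B \<longlongrightarrow> lift d c B p) (nh p)"
  unfolding vert_def[abs_def] lift_def[abs_def]
  by (intro tendsto_intros bounded_bilinear.tendsto[OF bounded_bilinear_blinfun_compose] slope_local(5)[OF dEu c B base_point(2) p])+

end

lemma dslope_tendsto:
  assumes c: "c \<in> atlas M" and B: "linear B" "bij_betw B S S" and p: "(p, Eu p) \<in> fst (gchart d c B)"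
    and P: "filterlim P (nh p) F" "(X \<longlongrightarrow> \<xi>) F"
  shows "((\<lambda>x. dslope d c B (P x) (X x)) \<longlongrightarrow> dslope d c B p \<xi>) F"
proof (rule tendsto_componentwise1)
  fix j :: 'b
  note pc = base_point[OF c B p]
  note vl = vert_lift_tendsto[OF c B p]
  have "((\<lambda>x. vert d c B (P x) (KK c (P x) (X x) (lift d c B (P x) j))) \<longlongrightarrow> vert d c B p (KK c p \<xi> (lift d c B p j))) F"
    by (intro blinfun.tendsto filterlim_compose[OF vl(1) P(1)] tendsto_intros
        jointly_continuousD[OF KK_continuous[OF c pc(1)] P] filterlim_compose[OF vl(2) P(1)])
  then show "((\<lambda>x. dslope d c B (P x) (X x) j) \<longlongrightarrow> dslope d c B p \<xi> j) F"
    unfolding dslope_apply[OF c B p]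
  proof (rule Lim_transform_eventually)
    show "\<forall>\<^sub>F x in F. vert d c B (P x) (KK c (P x) (X x) (lift d c B (P x) j)) = dslope d c B (P x) (X x) j"
      using eventually_compose_filterlim[OF slope_local(4)[OF dEu c B pc(2) p] P(1)]
    proof eventually_elim
      case (elim x)
      show ?case by (rule dslope_apply[OF c B elim, symmetric])
    qed
  qed
qed

text \<open>Apply \<open>vert\<close> at \<open>\<gamma> t\<close> to the vector of \<open>E\<^sup>u (\<gamma> s)\<close> over \<open>x\<close>. The result is the difference of the two slopes at
  \<open>x\<close>, and the differentiability estimate predicts it by \<open>KK\<close>.\<close>

lemma slope_velocity:
  assumes g: "germ \<gamma> v t I A" and c: "c \<in> atlas M" and B: "linear B" "bij_betw B S S"
    and p: "(\<gamma> t, Eu (\<gamma> t)) \<in> fst (gchart d c B)"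
  shows "((\<lambda>s. slope d Eu c B (\<gamma> s)) has_vector_derivative
    dslope d c B (\<gamma> t) (chart_diff M c (\<gamma> t) v)) (at t within I)"
proof -
  let ?p = "\<gamma> t" and ?\<xi> = "chart_diff M c (\<gamma> t) v" and ?A = "\<lambda>s. slope d Eu c B (\<gamma> s)"
  note pc = base_point[OF c B p]
  note ne = ne_planes[OF pc(2)]
  note rp = ref_oproj[OF sub ne]
  have gt: "t \<in> I" "has_velocity M \<gamma> v t I" using g unfolding germ_def by blast+
  have fl: "filterlim \<gamma> (nh ?p) (at t within I)" by (rule velocity_lim[OF gt(2,1) germD(2)[OF g]])
  have ev: "\<forall>\<^sub>F s in at t within I. (\<gamma> s, Eu (\<gamma> s)) \<in> fst (gchart d c B)"
    by (rule eventually_compose_filterlim[OF slope_local(4)[OF dEu c B pc(2) p] fl])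
  obtain C where C: "C > 0" "\<And>\<xi>. \<xi> \<in> S ==> norm \<xi> \<le> C * nrm c ?p \<xi>" "\<And>\<xi>. nrm c ?p \<xi> \<le> C * norm \<xi>"
    using nrm_norm_constant[OF c pc(1)] by blast
  have linK: "linear (KK c ?p ?\<xi>)" using KK_tensor[OF c pc(1)] unfolding tensor_def bilinear_def by blast
  have comp: "((\<lambda>s. ?A s x) has_vector_derivative dslope d c B ?p ?\<xi> x) (at t within I)" for x
    unfolding has_vector_derivative_def has_derivative_within_alt2
  proof (intro conjI allI impI)
    show "bounded_linear (\<lambda>r. r *\<^sub>R dslope d c B ?p ?\<xi> x)" by (rule bounded_linear_scaleR_left)
    fix e :: real assume e: "e > 0"
    let ?w = "\<lambda>s. lift d c B (\<gamma> s) x" and ?vn = "norm (vert d c B ?p)"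
    have wl: "(?w \<longlongrightarrow> ?w t) (at t within I)"
      using blinfun.tendsto[OF filterlim_compose[OF vert_lift_tendsto(2)[OF c B p] fl] tendsto_const] .
    have Pw: "((\<lambda>s. Pu c ?p (?w s)) \<longlongrightarrow> Pu c ?p (?w t)) (at t within I)"
      by (intro blinfun.tendsto tendsto_const wl)
    have PuL: "Pu c ?p (?w t) = ?w t" by (rule P_Eu(1)[OF c pc(1) lift_Eu[OF c B p]])
    have blK: "bounded_linear (KK c ?p ?\<xi>)" using linK linear_conv_bounded_linear by blast
    have "((\<lambda>s. vert d c B ?p (KK c ?p ?\<xi> (Pu c ?p (?w s)))) \<longlongrightarrow> vert d c B ?p (KK c ?p ?\<xi> (Pu c ?p (?w t)))) (at t within I)"
      by (intro blinfun.tendsto tendsto_const bounded_linear.tendsto[OF blK Pw])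
    then have "((\<lambda>s. vert d c B ?p (KK c ?p ?\<xi> (Pu c ?p (?w s)))) \<longlongrightarrow> dslope d c B ?p ?\<xi> x) (at t within I)"
      unfolding PuL dslope_apply[OF c B p] .
    then have e1: "\<forall>\<^sub>F s in at t within I. dist (vert d c B ?p (KK c ?p ?\<xi> (Pu c ?p (?w s)))) (dslope d c B ?p ?\<xi> x) < e / 2"
      using tendstoD e half_gt_zero by blast
    have "((\<lambda>s. norm (Pu c ?p (?w s))) \<longlongrightarrow> norm (Pu c ?p (?w t))) (at t within I)" by (intro tendsto_norm Pw)
    then have e2: "\<forall>\<^sub>F s in at t within I. norm (Pu c ?p (?w s)) < norm (Pu c ?p (?w t)) + 1"
      by (rule order_tendstoD(2)) simp
    define m where "m = norm (Pu c ?p (?w t)) + 1"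
    have m: "m > 0" unfolding m_def using norm_ge_zero[of "Pu c ?p (?w t)"] by linarith
    define b where "b = e / (2 * ((?vn + 1) * C * C * m))"
    have V: "0 < (?vn + 1) * C * C * m" using C(1) m norm_ge_zero[of "vert d c B ?p"] by (intro mult_pos_pos) linarith+
    have b: "0 < b" unfolding b_def using e V by simp
    have bb: "(?vn + 1) * C * C * m * b = e / 2" unfolding b_def using V by (simp add: field_simps)
    from Eu_differentiable_along_center[OF g c pc(1) b]
    have e3: "\<forall>\<^sub>F s in at t within I. \<forall>\<omega>\<in>EE Eu c (\<gamma> s).
      nrm c ?p (Pcs c ?p \<omega> - (s - t) *\<^sub>R KK c ?p ?\<xi> (Pu c ?p \<omega>)) \<le> b * \<bar>s - t\<bar> * nrm c ?p (Pu c ?p \<omega>)"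
      unfolding deviates_at_most_def .
    show "\<forall>\<^sub>F s in at t within I. norm (?A s x - ?A t x - (s - t) *\<^sub>R dslope d c B ?p ?\<xi> x) \<le> e * norm (s - t)"
      using ev e1 e2 e3
    proof eventually_elim
      case (elim s)
      let ?V = "vert d c B ?p" and ?u = "Pu c ?p (?w s)" and ?z = "Pcs c ?p (?w s)"
      have wE: "?w s \<in> EE Eu c (\<gamma> s)" by (rule lift_Eu[OF c B elim(1)])
      note pcs = base_point[OF c B elim(1)]
      have wS: "?w s \<in> S" using wE subb_EE[OF subbs(1) c pcs(1)] by blast
      have As: "?A s y \<in> S" "ppv (?A s y) = 0" "?A s (ppv y) = ?A s y" for y
        using slope_p(1)[OF c B elim(1)] unfolding slopes_iff[OF sub ne] by blast+
      have At: "?A t (ppv y) = ?A t y" for y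
        using slope_p(1)[OF c B p] unfolding slopes_iff[OF sub ne] by blast
      have "binv B (?w s) = ppv x + ?A s (ppv x)"
        unfolding lift_apply[OF c B elim(1)] by (rule automorphism(3)[OF B]) (use rp As in simp)
      then have "?V (?w s) = ?A s x - ?A t x"
        unfolding vert_apply[OF c B p] using As At rp by (simp add: blinfun.add_right)
      moreover have "?V (?w s) = ?V (?u + ?z)" using P_decomp(1)[OF c pc(1) wS] by simp
      ultimately have Az: "?A s x - ?A t x = ?V ?z"
        using vert_Eu[OF c B p Pu_mem[OF c pc(1)]] by (simp add: blinfun.add_right)
      let ?k = "KK c ?p ?\<xi> ?u"
      have kS: "?k \<in> S" using tensor_Pcs[OF KK_tensor[OF c pc(1)]] P_S(4)[OF c pc(1)] by metis
      have zS: "?z \<in> S" by (rule P_S(4)[OF c pc(1)])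
      have "nrm c ?p (?z - (s - t) *\<^sub>R ?k) \<le> b * \<bar>s - t\<bar> * nrm c ?p ?u" using elim(4) wE by blast
      also have "\<dots> \<le> b * \<bar>s - t\<bar> * (C * m)"
        using b order_trans[OF C(3) mult_left_mono[OF less_imp_le[OF elim(3)[folded m_def]] less_imp_le[OF C(1)]]]
        by (intro mult_left_mono) auto
      finally have n1: "norm (?z - (s - t) *\<^sub>R ?k) \<le> C * (b * \<bar>s - t\<bar> * (C * m))"
        using order_trans[OF C(2) mult_left_mono[OF _ less_imp_le[OF C(1)]]] kS zS by simp
      have "norm (?V (?z - (s - t) *\<^sub>R ?k)) \<le> (?vn + 1) * (C * (b * \<bar>s - t\<bar> * (C * m)))"
        by (intro order_trans[OF norm_blinfun] mult_mono n1) auto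
      also have "\<dots> = ((?vn + 1) * C * C * m * b) * \<bar>s - t\<bar>" by (simp add: mult_ac)
      finally have n2: "norm (?V (?z - (s - t) *\<^sub>R ?k)) \<le> e / 2 * \<bar>s - t\<bar>" unfolding bb .
      have n3: "norm ((s - t) *\<^sub>R (?V ?k - dslope d c B ?p ?\<xi> x)) \<le> e / 2 * \<bar>s - t\<bar>"
        using mult_left_mono[OF less_imp_le[OF elim(2)[unfolded dist_norm]], of "\<bar>s - t\<bar>"] by (simp add: mult.commute)
      have "?A s x - ?A t x - (s - t) *\<^sub>R dslope d c B ?p ?\<xi> x
          = ?V (?z - (s - t) *\<^sub>R ?k) + (s - t) *\<^sub>R (?V ?k - dslope d c B ?p ?\<xi> x)"
        unfolding Az by (simp add: blinfun.diff_right blinfun.scaleR_right scaleR_diff_right)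
      then show ?case using norm_triangle_ineq[of "?V (?z - (s - t) *\<^sub>R ?k)" "(s - t) *\<^sub>R (?V ?k - dslope d c B ?p ?\<xi> x)"] n2 n3
        by simp
    qed
  qed
  have "((\<lambda>s. \<Sum>i\<in>Basis. elementary i (?A s i)) has_vector_derivative
      (\<Sum>i\<in>Basis. elementary i (dslope d c B ?p ?\<xi> i))) (at t within I)"
    by (intro has_vector_derivative_sum bounded_linear.has_vector_derivative[OF blinfun.bounded_linear_right] comp)
  then show ?thesis unfolding blinfun_elementary_sum[symmetric] .
qed

text \<open>The derivative of the transition map takes \<open>dslope\<close> in one chart to \<open>dslope\<close> in the other. The second
  derivative of the change of charts enters on both sides: in the derivative of the transition map, and
  in the transformation rule of \<open>KK\<close>. Whatever lies in \<open>E\<^sup>u\<close> is killed by \<open>vert\<close>.\<close>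

lemma dslope_transition:
  assumes c0: "c0 \<in> atlas M" "linear B0" "bij_betw B0 S S" and p0: "(p, Eu p) \<in> fst (gchart d c0 B0)"
    and c: "c \<in> atlas M" "linear B" "bij_betw B S S" and p: "(p, Eu p) \<in> fst (gchart d c B)"
    and chart: "chart_at (Gr d) (p, Eu p) = gchart d c0 B0"
    and v: "v \<in> Ec p"
  shows "chart_diff (Gr d) (gchart d c B) (p, Eu p)
      (chart_diff M c0 p v, dslope d c0 B0 p (chart_diff M c0 p v)) =
    (chart_diff M c p v, dslope d c B p (chart_diff M c p v))"
proof -
  note pc0 = base_point[OF c0 p0] and pc = base_point[OF c p]
  note ne = ne_planes[OF pc(2)]
  note rp = ref_oproj[OF sub ne]
  define \<xi> where "\<xi> = chart_diff M c0 p v"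
  define L where "L = D id c0 c p"
  have vS: "v \<in> S" using v subb_fibre[OF subbs(2) pc(2)] by blast
  have L\<xi>: "chart_diff M c p v = L \<xi>" unfolding L_def \<xi>_def by (rule chart_diff_trans[OF c0(1) c(1) pc0(1) pc(1) vS])
  have \<xi>E: "\<xi> \<in> EE Ec c0 p" unfolding \<xi>_def EE_def using v by blast
  have \<xi>S: "\<xi> \<in> S" using subb_EE(1)[OF subbs(2) c0(1) pc0(1)] \<xi>E by blast
  define A0 where "A0 = slope d Eu c0 B0 p"
  define A1 where "A1 = slope d Eu c B p"
  define h where "h = (\<xi>, dslope d c0 B0 p \<xi>)"
  have A0': "snd (gchart d c0 B0) (p, Eu p) = (snd c0 p, A0)" and A1': "snd (gchart d c B) (p, Eu p) = (snd c p, A1)"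
    unfolding A0_def A1_def slope_def by (simp_all add: grassmann_chart_def)
  have h: "h \<in> S \<times> slopes d S" unfolding h_def using \<xi>S dslope_slopes[OF c0 p0] by simp
  let ?Y0 = "plane_map d c0 B0 c B (snd c0 p, A0)"
  let ?\<Psi> = "id_blinfun - ppv - (A1 o\<^sub>L ppv)"
  obtain W where W: "tilt d S ?Y0 o\<^sub>L W = id_blinfun"
    and cd: "chart_diff (Gr d) (gchart d c B) (p, Eu p) h =
      (D id c0 c p (fst h), (?\<Psi> o\<^sub>L dplane_map d c0 c B0 B p A0 h) o\<^sub>L W)"
    using grassmann_chart_diff[OF ne c0 c p0 p A0' A1' chart h] by blast
  note dpm = dplane_map_def[OF ne c0 c p0 p A0' A1']
  note bf = base_facts[OF ne c0 c p0 p A0' A1']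
  note ts = transition_slope(1)[OF ne c0 c p0 pc(1) bf(3,5,4,6)]
  have \<Psi>v: "?\<Psi> (binv B x) = vert d c B p x" for x
    unfolding vert_apply[OF c p] A1_def by (simp add: blinfun.diff_left)
  have "((?\<Psi> o\<^sub>L dplane_map d c0 c B0 B p A0 h) o\<^sub>L W) = dslope d c B p (L \<xi>)"
  proof (rule blinfun_eqI)
    fix x
    define \<eta> where "\<eta> = lift d c0 B0 p (W x)"
    have \<eta>: "\<eta> \<in> EE Eu c0 p" unfolding \<eta>_def by (rule lift_Eu[OF c0 p0])
    have Y\<eta>: "?Y0 (W x) = binv B (L \<eta>)"
      unfolding plane_map_apply[OF ne c0 c pc0(1)] L_def \<eta>_def lift_apply[OF c0 p0] A0_def ..
    have LS: "L y \<in> S" for y unfolding L_def using D_S[OF C2_id c0(1) c(1) pc0(1)] pc(1) by simp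
    have "ppv (?Y0 (W x)) = ppv x"
    proof -
      have "tilt d S ?Y0 (W x) = x" using arg_cong[OF W, of "\<lambda>Z. blinfun_apply Z x"] by simp
      then show ?thesis using tilt_proj[OF sub ne, of ?Y0 "W x"] by simp
    qed
    moreover have "?Y0 (W x) - ppv (?Y0 (W x)) = A1 (ppv (?Y0 (W x)))"
      using slope_graph_iff[OF sub ne bf(4)] ts by blast
    ultimately have "?Y0 (W x) = ppv x + A1 (ppv x)" by (metis add.commute diff_add_cancel)
    then have "L \<eta> = B (ppv x + A1 (ppv x))" using automorphism(4)[OF c(2,3) LS] Y\<eta> by metis
    then have L\<eta>: "L \<eta> = lift d c B p x" unfolding lift_apply[OF c p] A1_def .
    have PP: "Pc c0 p \<xi> = \<xi>" "Pu c0 p \<eta> = \<eta>" using P_Ec(2)[OF c0(1) pc0(1) \<xi>E] P_Eu(1)[OF c0(1) pc0(1) \<eta>] by simp_all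
    have \<eta>S: "\<eta> \<in> S" using subb_EE(1)[OF subbs(1) c0(1) pc0(1)] \<eta> by blast
    have inv: "D id c c0 p (L y) = y" if "y \<in> S" for y
      unfolding L_def by (rule D_id_inverse[OF c0(1) c(1) pc0(1) pc(1) that])
    have PL: "Pc c p (L \<xi>) = L \<xi>" "Pu c p (L \<eta>) = L \<eta>"
      unfolding L_def P_id[OF c0(1) c(1) pc0(1) pc(1)] PP by simp_all
    have KL: "KK c p (L \<xi>) (L \<eta>) = L (KK c0 p \<xi> \<eta>) + Pcs c p (D2 id c0 c p \<xi> \<eta>)"
      unfolding KK_chart[OF c0(1) pc0(1) c(1) pc(1)] trans_def L_def[symmetric]
      by (simp only: PL inv[OF \<xi>S] inv[OF \<eta>S])
    have vEu: "vert d c B p u = 0" if "u \<in> EE Eu c p" for u using vert_Eu[OF c p that] .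
    have "vert d c B p \<zeta> = vert d c B p (Pcs c p \<zeta>)" for \<zeta>
    proof -
      have "vert d c B p \<zeta> = vert d c B p (oproj S \<zeta>)" unfolding vert_apply[OF c p] automorphism(6)[OF c(2,3)] ..
      also have "oproj S \<zeta> = Pu c p \<zeta> + Pcs c p \<zeta>"
        using P_decomp(1)[OF c(1) pc(1) oproj_S(1), of \<zeta>] unfolding P_oproj[OF c(1) pc(1)] by simp
      finally show ?thesis using vEu[OF Pu_mem[OF c(1) pc(1)]] by (simp add: blinfun.add_right)
    qed
    moreover have "vert d c B p (L (B0 (dslope d c0 B0 p \<xi> (ppv (W x))))) = vert d c B p (L (KK c0 p \<xi> \<eta>))"
    proof -
      let ?u = "KK c0 p \<xi> \<eta>"
      have uS: "?u \<in> S" using tensor_Pcs[OF KK_tensor[OF c0(1) pc0(1)]] P_S(4)[OF c0(1) pc0(1)] by metis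
      have "lift d c0 B0 p (ppv (W x)) = \<eta>" unfolding \<eta>_def lift_apply[OF c0 p0] rp ..
      then have "dslope d c0 B0 p \<xi> (ppv (W x)) = vert d c0 B0 p ?u" unfolding dslope_apply[OF c0 p0] by simp
      also have "\<dots> = binv B0 ?u - (ppv (binv B0 ?u) + A0 (ppv (binv B0 ?u)))"
        unfolding vert_apply[OF c0 p0] A0_def by simp
      finally have "B0 (dslope d c0 B0 p \<xi> (ppv (W x))) = ?u - lift d c0 B0 p (binv B0 ?u)"
        unfolding lift_apply[OF c0 p0] A0_def by (simp add: linear_diff[OF c0(2)] automorphism(4)[OF c0(2,3) uS])
      moreover have "vert d c B p (L (lift d c0 B0 p (binv B0 ?u))) = 0"
      proof (rule vEu)
        let ?e = "lift d c0 B0 p (binv B0 ?u)"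
        have "Pu c p (L ?e) = L ?e"
          unfolding L_def P_id[OF c0(1) c(1) pc0(1) pc(1)] P_Eu(1)[OF c0(1) pc0(1) lift_Eu[OF c0 p0]] ..
        then show "L ?e \<in> EE Eu c p" using Pu_mem[OF c(1) pc(1)] by metis
      qed
      ultimately show ?thesis by (simp add: blinfun.diff_right)
    qed
    moreover have "((?\<Psi> o\<^sub>L dplane_map d c0 c B0 B p A0 h) o\<^sub>L W) x
        = vert d c B p (L (B0 (dslope d c0 B0 p \<xi> (ppv (W x))))) + vert d c B p (D2 id c0 c p \<xi> \<eta>)"
    proof -
      have "dplane_map d c0 c B0 B p A0 h (W x) = binv B (L (B0 (dslope d c0 B0 p \<xi> (ppv (W x))))) + binv B (D2 id c0 c p \<xi> \<eta>)"
        unfolding dpm unfolding h_def L_def \<eta>_def lift_apply[OF c0 p0] A0_def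
        by (simp add: blinfun.add_left automorphism(1)[OF c0(2,3)])
      then show ?thesis unfolding \<Psi>v[symmetric] by (simp only: blinfun_apply_blinfun_compose blinfun.add_right)
    qed
    ultimately show "((?\<Psi> o\<^sub>L dplane_map d c0 c B0 B p A0 h) o\<^sub>L W) x = dslope d c B p (L \<xi>) x"
      unfolding dslope_apply[OF c p] L\<eta>[symmetric] KL by (simp add: blinfun.add_right)
  qed
  then show ?thesis using cd unfolding L\<xi> h_def \<xi>_def[symmetric] L_def by simp
qed

text \<open>The map \<open>H\<close> of the definition of differentiability. A tangent vector of the Grassmann bundle is recorded
  in the preferred chart of its base point, which \<open>hc\<close> and \<open>hB\<close> describe.\<close>

definition differential ::
  "('m => ('m, 'b) chart) => ('m => 'b => 'b) => 'm \<times> 'b => ('m \<times> 'b set) \<times> ('b \<times> ('b \<Rightarrow>\<^sub>L 'b))" where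
  "differential hc hB z = (let p = fst z; \<xi> = chart_diff M (hc p) p (snd z)
     in (plane_section Eu p, (\<xi>, dslope d (hc p) (hB p) p \<xi>)))"

lemma preferred_chart:
  assumes p: "p \<in> points M"
  shows "\<exists>c B. c \<in> atlas M \<and> linear B \<and> bij_betw B S S \<and> (p, Eu p) \<in> fst (gchart d c B) \<and>
    chart_at (Gr d) (p, Eu p) = gchart d c B"
proof -
  let ?G = "Gr d"
  note cp = chart_at[OF p]
  obtain B where B: "linear B" "bij_betw B S S" "(p, Eu p) \<in> fst (gchart d (chart_at M p) B)"
    by (rule exists_grassmann_chart[OF dEu cp]) (rule that)
  have "gchart d (chart_at M p) B \<in> atlas ?G \<and> (p, Eu p) \<in> fst (gchart d (chart_at M p) B)"
    using grassmann_atlas[OF cp(1) B(1,2)] B(3) by blast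
  then have C: "chart_at ?G (p, Eu p) \<in> atlas ?G \<and> (p, Eu p) \<in> fst (chart_at ?G (p, Eu p))"
    unfolding chart_at_def[of ?G] by (rule someI[where P = "\<lambda>C. C \<in> atlas ?G \<and> (p, Eu p) \<in> fst C"])
  obtain c B' where "chart_at ?G (p, Eu p) = gchart d c B'" "c \<in> atlas M" "linear B'" "bij_betw B' S S"
    by (rule grassmann_atlasE[OF conjunct1[OF C]])
  with conjunct2[OF C] show ?thesis by (intro exI[of _ c] exI[of _ B'] conjI) simp_all
qed

context
  fixes hc hB
  assumes hcB: "\<And>p. p \<in> points M ==> hc p \<in> atlas M \<and> linear (hB p) \<and> bij_betw (hB p) S S \<and>
      (p, Eu p) \<in> fst (gchart d (hc p) (hB p)) \<and>
      chart_at (Gr d) (p, Eu p) = gchart d (hc p) (hB p)"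
begin

abbreviation "TG \<equiv> tangent_bundle (Gr d)"
abbreviation "H \<equiv> differential hc hB"

lemma preferred:
  assumes "p \<in> points M"
  shows "hc p \<in> atlas M" "linear (hB p)" "bij_betw (hB p) S S" "(p, Eu p) \<in> fst (gchart d (hc p) (hB p))"
    "chart_at (Gr d) (p, Eu p) = gchart d (hc p) (hB p)" "p \<in> fst (hc p)"
  using hcB[OF assms] unfolding mem_grassmann_chart by blast+

lemma Ec_S: "p \<in> points M ==> v \<in> Ec p ==> v \<in> S"
  using subb_fibre[OF subbs(2)] by blast

lemma snd_H: "snd (H (p, v)) = (chart_diff M (hc p) p v, dslope d (hc p) (hB p) p (chart_diff M (hc p) p v))"
  and fst_H: "fst (H (p, v)) = (p, Eu p)"
  unfolding differential_def plane_section_def by (simp_all add: Let_def)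

lemma H_model:
  assumes "p \<in> points M" "v \<in> Ec p"
  shows "snd (H (p, v)) \<in> S \<times> slopes d S"
  unfolding snd_H
  using chart_diff_S[OF preferred(1,6)[OF assms(1)] Ec_S[OF assms]] dslope_slopes[OF preferred(1-4)[OF assms(1)]] by simp

lemma H_chart:
  assumes "p \<in> points M" "v \<in> Ec p" and c: "c \<in> atlas M" "linear B" "bij_betw B S S" "(p, Eu p) \<in> fst (gchart d c B)"
  shows "chart_diff (Gr d) (gchart d c B) (p, Eu p) (snd (H (p, v)))
    = (chart_diff M c p v, dslope d c B p (chart_diff M c p v))"
  unfolding snd_H by (rule dslope_transition[OF preferred(1-4)[OF assms(1)] c preferred(5)[OF assms(1)] assms(2)])

lemma H_linear:
  assumes p: "p \<in> points M" "v \<in> Ec p" "w \<in> Ec p"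
  shows "snd (H (p, a *\<^sub>R v + b *\<^sub>R w)) = a *\<^sub>R snd (H (p, v)) + b *\<^sub>R snd (H (p, w))"
proof -
  note pr = preferred[OF p(1)]
  have S: "v \<in> S" "w \<in> S" "a *\<^sub>R v + b *\<^sub>R w \<in> S" using Ec_S[OF p(1)] p by simp_all
  have "chart_diff M (hc p) p (a *\<^sub>R v + b *\<^sub>R w) = a *\<^sub>R chart_diff M (hc p) p v + b *\<^sub>R chart_diff M (hc p) p w"
    unfolding chart_diff_eq[OF pr(1,6) S(1)] chart_diff_eq[OF pr(1,6) S(2)] chart_diff_eq[OF pr(1,6) S(3)]
    by (simp add: blinfun.add_right blinfun.scaleR_right)
  then show ?thesis unfolding snd_H using dslope_linear[OF pr(1-4)] by simp
qed

lemma H_projection: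
  assumes p: "p \<in> points M" "v \<in> Ec p"
  shows "tangent_map (Gr d) M fst (fst (H (p, v))) (snd (H (p, v))) = v"
proof -
  note pr = preferred[OF p(1)]
  have h: "chart_diff M (hc p) p v \<in> S" "dslope d (hc p) (hB p) p (chart_diff M (hc p) p v) \<in> slopes d S"
    using H_model[OF p] unfolding snd_H by simp_all
  show ?thesis
    unfolding fst_H snd_H grassmann_projection_derivative[OF ne_planes[OF p(1)] pr(1-4) h pr(5)]
    by (rule chart_diff_inverse(1)[OF pr(1,6) Ec_S[OF p]])
qed

lemma H_velocity:
  assumes \<gamma>: "C1_arc M \<gamma> \<gamma>' a b" "\<forall>t\<in>{a..b}. \<gamma>' t \<in> Ec (\<gamma> t)" and t: "t \<in> {a..b}"
  shows "has_velocity (Gr d) (plane_section Eu \<circ> \<gamma>) (snd (H (\<gamma> t, \<gamma>' t))) t {a..b}"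
proof -
  obtain A where g: "germ \<gamma> (\<gamma>' t) t {a..b} A" using C1_arc_germ[OF \<gamma>(1) _ t] \<gamma>(2) by blast
  have v: "has_velocity M \<gamma> (\<gamma>' t) t {a..b}" using g unfolding germ_def by blast
  note p = germD(1)[OF g] and vS = germD(2)[OF g]
  note pr = preferred[OF p]
  let ?c = "hc (\<gamma> t)" and ?B = "hB (\<gamma> t)"
  let ?C = "gchart d ?c ?B"
  have C: "chart_at (Gr d) ((plane_section Eu \<circ> \<gamma>) t) = ?C"
    using pr(5) unfolding plane_section_def by simp
  have "?C \<in> atlas (Gr d)" by (rule grassmann_atlas[OF pr(1-3)])
  then have 1: "(plane_section Eu \<circ> \<gamma>) t \<in> points (Gr d)"
    using pr(4) unfolding points_def plane_section_def comp_def by blast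
  have 2: "\<forall>\<^sub>F s in at t within {a..b}. (plane_section Eu \<circ> \<gamma>) s \<in> fst ?C"
    using eventually_compose_filterlim[OF slope_local(4)[OF dEu pr(1-3) p pr(4)] velocity_lim[OF v t vS]]
    unfolding plane_section_def comp_def .
  have "snd ?C \<circ> (plane_section Eu \<circ> \<gamma>) = (\<lambda>s. (snd ?c (\<gamma> s), slope d Eu ?c ?B (\<gamma> s)))"
    unfolding slope_def plane_section_def comp_def grassmann_chart_def by simp
  then have 3: "((snd ?C \<circ> (plane_section Eu \<circ> \<gamma>)) has_vector_derivative snd (H (\<gamma> t, \<gamma>' t))) (at t within {a..b})"
    unfolding snd_H
    using has_vector_derivative_Pair[OF velocity_chart[OF v t vS pr(1,6)] slope_velocity[OF g pr(1-4)]] by simp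
  show ?thesis unfolding has_velocity_def C using 1 2 3 by blast
qed

text \<open>Read in a bundle chart, \<open>H\<close> consists of the coordinate, the slope, the vector in coordinates, and \<open>dslope\<close>,
  all of which are continuous; the charts \<open>hc\<close> and \<open>hB\<close>, which may jump, have disappeared.\<close>

lemma H_continuous:
  "continuous_map (subtopology TMtop (total_space M Ec)) (mtopology TG) H"
proof -
  let ?G = "Gr d" and ?X = "subtopology TMtop (total_space M Ec)"
  let ?T = "S \<times> slopes d S"
  let ?\<U> = "{{x \<in> fst c. snd c x \<in> W} | c W. c \<in> atlas TG \<and> openin (top_of_set (model TG)) W}"
  have modelTG: "model TG = ?T \<times> ?T" unfolding tangent_bundle_def grassmann_bundle_def by simp
  have atlasTG: "\<exists>c B. C' = (fst (gchart d c B) \<times> ?T,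
        \<lambda>(x, h). (snd (gchart d c B) x, chart_diff ?G (gchart d c B) x h))
      \<and> c \<in> atlas M \<and> linear B \<and> bij_betw B S S" if "C' \<in> atlas TG" for C'
  proof -
    obtain C where C: "C \<in> atlas ?G" "C' = (fst C \<times> model ?G, \<lambda>(x, h). (snd C x, chart_diff ?G C x h))"
      using \<open>C' \<in> atlas TG\<close> unfolding tangent_bundle_def by auto
    have G: "model ?G = ?T" by (simp add: grassmann_bundle_def)
    obtain c B where cB: "C = gchart d c B" "c \<in> atlas M" "linear B" "bij_betw B S S"
      by (rule grassmann_atlasE[OF C(1)])
    show ?thesis using C(2) cB(2-4) unfolding G cB(1) by (intro exI[of _ c] exI[of _ B] conjI)
  qed
  have atlasTG': "(fst C \<times> ?T, \<lambda>(x, h). (snd C x, chart_diff ?G C x h)) \<in> atlas TG" if "C \<in> atlas ?G" for C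
    using that unfolding tangent_bundle_def by (simp add: grassmann_bundle_def)
  \<comment> \<open>the expression of \<open>H\<close> in the bundle chart given by \<open>(c, B)\<close>\<close>
  define \<Phi> where "\<Phi> c B q w = ((snd c q, slope d Eu c B q), (chart_diff M c q w, dslope d c B q (chart_diff M c q w)))" for c B q w
  have H\<Phi>: "H (q, w) \<in> fst (gchart d c B) \<times> ?T"
      "(\<lambda>(x, h). (snd (gchart d c B) x, chart_diff ?G (gchart d c B) x h)) (H (q, w)) = \<Phi> c B q w"
      "\<Phi> c B q w \<in> ?T \<times> ?T"
    if q: "q \<in> points M" "w \<in> Ec q" and c: "c \<in> atlas M" "linear B" "bij_betw B S S"
      "(q, Eu q) \<in> fst (gchart d c B)" for c B q w
  proof -
    have e: "H (q, w) = ((q, Eu q), snd (H (q, w)))" using fst_H[of q w] by (metis prod.collapse)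
    show "H (q, w) \<in> fst (gchart d c B) \<times> ?T" using e c(4) H_model[OF q] by (metis mem_Sigma_iff)
    have "snd (gchart d c B) (q, Eu q) = (snd c q, slope d Eu c B q)"
      unfolding slope_def grassmann_chart_def by simp
    then show "(\<lambda>(x, h). (snd (gchart d c B) x, chart_diff ?G (gchart d c B) x h)) (H (q, w)) = \<Phi> c B q w"
      using H_chart[OF q c] unfolding \<Phi>_def by (subst e) simp
    note qc = base_point(1)[OF c]
    show "\<Phi> c B q w \<in> ?T \<times> ?T"
      unfolding \<Phi>_def using chart_S[OF c(1) qc] slope_p(1)[OF c] chart_diff_S[OF c(1) qc Ec_S[OF q]] dslope_slopes[OF c] by simp
  qed
  have tot: "\<exists>q w. x = (q, w) \<and> q \<in> points M \<and> w \<in> Ec q" if "x \<in> topspace ?X" for x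
    using that unfolding total_space_def topspace_subtopology by blast
  have "openin ?X (H -` U \<inter> topspace ?X)" if U: "U \<in> ?\<U>" for U
  proof (subst openin_subopen, intro ballI)
    fix x assume x: "x \<in> H -` U \<inter> topspace ?X"
    obtain C' W where CW: "U = {x \<in> fst C'. snd C' x \<in> W}" "C' \<in> atlas TG" "openin (top_of_set (?T \<times> ?T)) W"
      using U unfolding modelTG by blast
    obtain c B where C': "C' = (fst (gchart d c B) \<times> ?T,
        \<lambda>(x, h). (snd (gchart d c B) x, chart_diff ?G (gchart d c B) x h))"
      and c: "c \<in> atlas M" "linear B" "bij_betw B S S" using atlasTG[OF CW(2)] by blast
    obtain O1 where O1: "open O1" "W = (?T \<times> ?T) \<inter> O1" using CW(3) unfolding openin_open by blast
    obtain p v where pv: "x = (p, v)" "p \<in> points M" "v \<in> Ec p" using tot x by blast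
    have "H x \<in> U" using x by blast
    then have pC: "(p, Eu p) \<in> fst (gchart d c B)"
    proof -
      have "H (p, v) \<in> fst C'" using \<open>H x \<in> U\<close> unfolding CW(1) pv(1) by blast
      then have "fst (H (p, v)) \<in> fst (gchart d c B)" unfolding C' fst_conv mem_Times_iff by blast
      then show ?thesis unfolding fst_H .
    qed
    note H0 = H\<Phi>[OF pv(2,3) c pC]
    have "\<Phi> c B p v \<in> O1" using \<open>H x \<in> U\<close> O1(2) H0(2) unfolding CW(1) C' pv(1) by simp
    note pc = base_point(1)[OF c pC]
    note vS = Ec_S[OF pv(2,3)]
    let ?F = "nhdsin TMtop (p, v)"
    note tl = tangent_bundle_lims[OF c(1) pc vS]
    have l2: "((\<lambda>z. chart_diff M c (fst z) (snd z)) \<longlongrightarrow> chart_diff M c p v) ?F"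
      using tl(2) by (simp add: case_prod_beta')
    have "((\<lambda>z. \<Phi> c B (fst z) (snd z)) \<longlongrightarrow> \<Phi> c B p v) ?F"
      unfolding \<Phi>_def
      by (intro tendsto_Pair filterlim_compose[OF tendsto_chart[OF c(1) pc] tl(1)]
          filterlim_compose[OF slope_local(5)[OF dEu c pv(2) pC] tl(1)] l2 dslope_tendsto[OF c pC tl(1) l2])
    then have "\<forall>\<^sub>F z in ?F. \<Phi> c B (fst z) (snd z) \<in> O1"
      using topological_tendstoD O1(1) \<open>\<Phi> c B p v \<in> O1\<close> by blast
    moreover have "\<forall>\<^sub>F z in ?F. (fst z, Eu (fst z)) \<in> fst (gchart d c B)"
      by (rule eventually_compose_filterlim[OF slope_local(4)[OF dEu c pv(2) pC] tl(1)])
    ultimately have ev: "\<forall>\<^sub>F z in ?F. \<Phi> c B (fst z) (snd z) \<in> O1 \<and> (fst z, Eu (fst z)) \<in> fst (gchart d c B)"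
      by (rule eventually_conj)
    have "(p, v) \<in> topspace TMtop" using x pv(1) by simp
    then obtain Q where Q: "openin TMtop Q" "(p, v) \<in> Q"
      "\<And>z. z \<in> Q ==> \<Phi> c B (fst z) (snd z) \<in> O1 \<and> (fst z, Eu (fst z)) \<in> fst (gchart d c B)"
      using ev unfolding eventually_nhdsin by blast
    have "Q \<inter> total_space M Ec \<subseteq> H -` U \<inter> topspace ?X"
    proof
      fix z assume z: "z \<in> Q \<inter> total_space M Ec"
      obtain q w where qw: "z = (q, w)" "q \<in> points M" "w \<in> Ec q" using z unfolding total_space_def by blast
      have Qz: "\<Phi> c B q w \<in> O1" "(q, Eu q) \<in> fst (gchart d c B)" using Q(3)[of z] z qw(1) by simp_all
      note Hz = H\<Phi>[OF qw(2,3) c Qz(2)]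
      have "H (q, w) \<in> U" unfolding CW(1) C' O1(2) using Hz Qz(1) by simp
      moreover have "z \<in> topspace ?X" using z openin_subset[OF Q(1)] by auto
      ultimately show "z \<in> H -` U \<inter> topspace ?X" using qw(1) by simp
    qed
    moreover have "openin ?X (Q \<inter> total_space M Ec)" using Q(1) unfolding openin_subtopology by blast
    moreover have "x \<in> Q \<inter> total_space M Ec" using Q(2) pv unfolding total_space_def by simp
    ultimately show "\<exists>V. openin ?X V \<and> x \<in> V \<and> V \<subseteq> H -` U \<inter> topspace ?X" by blast
  qed
  moreover have "H ` topspace ?X \<subseteq> \<Union>?\<U>"
  proof (rule image_subsetI)
    fix x assume "x \<in> topspace ?X"
    then obtain p v where pv: "x = (p, v)" "p \<in> points M" "v \<in> Ec p" using tot by blast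
    note pr = preferred[OF pv(2)]
    let ?C = "gchart d (hc p) (hB p)"
    let ?C' = "(fst ?C \<times> ?T, \<lambda>(x, h). (snd ?C x, chart_diff ?G ?C x h))"
    note H0 = H\<Phi>[OF pv(2,3) pr(1-4)]
    have 1: "?C' \<in> atlas TG" by (rule atlasTG'[OF grassmann_atlas[OF pr(1-3)]])
    have 2: "openin (top_of_set (model TG)) (?T \<times> ?T)" unfolding modelTG by simp
    have 3: "H x \<in> {x \<in> fst ?C'. snd ?C' x \<in> ?T \<times> ?T}" unfolding pv(1) using H0 by (simp del: mem_Sigma_iff)
    show "H x \<in> \<Union>?\<U>"
      by (rule UnionI[OF CollectI 3], intro exI[of _ ?C'] exI[of _ "?T \<times> ?T"] conjI refl 1 2)
  qed
  ultimately show ?thesis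
    unfolding mtopology_def[of TG] continuous_on_generated_topo_iff by blast
qed

end

end

theorem Eu_continuously_differentiable: "continuously_differentiable_wrt M Eu Ec"
proof -
  obtain d where d: "continuous_subbundle M d Eu" using subbs(1) unfolding subb_def by blast
  have "\<forall>p\<in>points M. \<exists>z. fst z \<in> atlas M \<and> linear (snd z) \<and> bij_betw (snd z) S S \<and>
      (p, Eu p) \<in> fst (gchart d (fst z) (snd z)) \<and>
      chart_at (Gr d) (p, Eu p) = gchart d (fst z) (snd z)"
    using preferred_chart[OF d] by simp
  from bchoice[OF this] obtain z where z: "\<And>p. p \<in> points M ==> fst (z p) \<in> atlas M \<and> linear (snd (z p)) \<and>
      bij_betw (snd (z p)) S S \<and> (p, Eu p) \<in> fst (gchart d (fst (z p)) (snd (z p))) \<and>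
      chart_at (Gr d) (p, Eu p) = gchart d (fst (z p)) (snd (z p))" by blast
  define H where "H = differential d (\<lambda>p. fst (z p)) (\<lambda>p. snd (z p))"
  note facts = H_continuous[OF d z, folded H_def] H_linear[OF d z, folded H_def] H_projection[OF d z, folded H_def]
    H_velocity[OF d z, folded H_def] fst_H[OF d z, folded H_def]
  have Ec: "\<exists>e. continuous_subbundle M e Ec" using subbs(2) unfolding subb_def .
  have lin: "\<forall>p\<in>points M. (\<forall>v\<in>Ec p. fst (H (p, v)) = plane_section Eu p) \<and>
      (\<forall>v\<in>Ec p. \<forall>w\<in>Ec p. \<forall>a b :: real. snd (H (p, a *\<^sub>R v + b *\<^sub>R w)) = a *\<^sub>R snd (H (p, v)) + b *\<^sub>R snd (H (p, w)))"
    using facts(2,5) unfolding plane_section_def by simp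
  show ?thesis
    unfolding continuously_differentiable_wrt_def
  proof (rule conjI[OF Ec], rule exI[of _ d], intro conjI[OF d] exI[of _ H] conjI[OF facts(1)] conjI[OF lin] conjI)
    show "\<forall>p\<in>points M. \<forall>v\<in>Ec p. tangent_map (Gr d) M fst (fst (H (p, v))) (snd (H (p, v))) = v"
      by (intro ballI facts(3))
    show "\<forall>\<gamma> \<gamma>' a b. C1_arc M \<gamma> \<gamma>' a b \<and> (\<forall>t\<in>{a..b}. \<gamma>' t \<in> Ec (\<gamma> t)) -->
        (\<forall>t\<in>{a..b}. has_velocity (Gr d) (plane_section Eu \<circ> \<gamma>) (snd (H (\<gamma> t, \<gamma>' t))) t {a..b})"
      by (intro allI impI ballI, elim conjE) (rule facts(4))
  qed
qed

end

theorem theoremA: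
  fixes M :: "('m, 'b::euclidean_space) manifold"
    and N :: "'m \<Rightarrow> 'b \<Rightarrow> real"
    and f :: "'m \<Rightarrow> 'm"
    and Eu Ec Es :: "('m, 'b) subbundle"
  assumes "smooth_manifold M" and "compact_space (mtopology M)"
    and "finsler_metric M N"
    and "Ck_diffeo 2 M f"
    and "partially_hyperbolic M N f Eu Ec Es"
    and "(SUP p\<in>points M.
            norm_on M N f Ec p / (conorm_on M N f Eu p * conorm_on M N f Ec p)) < 1"
  shows "continuously_differentiable_wrt M Eu Ec"
proof -
  interpret center_bunched M N f Eu Ec Es by unfold_locales (use assms in auto)
  from uniform_constants obtain \<kappa> \<theta> s \<delta> al mu mm kk
    where "uniformly_bunched M N f Eu Ec Es \<kappa> \<theta> s \<delta> al mu mm kk" by blast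
  then show ?thesis by (rule uniformly_bunched.Eu_continuously_differentiable)
qed

end
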